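(* Let $n\ge 1$, let $M$ be a compact smooth $n$-dimensional submanifold (without boundary) of $\mathbb{R}^d$, and let $u\in M$. Then the function $B_M^u$, defined for $\operatorname{Re} s>-n$ by $B_M^u(s)=\int_M \|v-u\|^s\,dA(v)$, can be analytically continued to a meromorphic function on $\mathbb{C}$ whose only possible poles are at the points $s=-n-j$, $j=0,2,4,\dots$, each such pole being (at most) simple. Moreover, if $M$ is a hypersurface (i.e. $d=n+1$), the residues of $B_M^u$ at these points are polynomials in complete contractions, evaluated at $u$, of the covariant derivatives of the second fundamental form of $M$; that is, for each $n$ and each $j\in\{0,2,4,\dots\}$ there is a universal polynomial expression in finitely many such complete contractions, depending only on $n$ and $j$, which equals $\operatorname{Res}_{s=-n-j}B_M^u$ for every compact smooth hypersurface $M\subset\mathbb{R}^{n+1}$ and every $u\in M$.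
   Context: $\|\cdot\|$ is the Euclidean norm on $\mathbb{R}^d$ and $dA$ is the $n$-dimensional area element of $M$ induced from $\mathbb{R}^d$. The integral defining $B_M^u(s)$ converges and is analytic for $\operatorname{Re} s>-n$. For a hypersurface $M\subset\mathbb{R}^{n+1}$, $\mathrm{I}$ denotes the first fundamental form (induced Riemannian metric) and $\mathrm{II}$ the second fundamental form with respect to a local choice of unit normal near $u$. The covariant derivatives of $\mathrm{II}$ are the tensors $\mathrm{II}_{ij;k_1\cdots k_m}$, $m\ge 0$ (with $m=0$ giving $\mathrm{II}$ itself), obtained by iterated covariant differentiation with the Levi-Civita connection of $\mathrm{I}$. A complete contraction of the covariant derivatives of $\mathrm{II}$ is a scalar obtained by taking a tensor product of finitely many tensors of the form $\mathrm{II}_{ij;k_1\cdots k_m}$ having an even total number of indices, and contracting all indices in pairs using $\mathrm{I}$. *)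

theory Defs
  imports "HOL-Complex_Analysis.Complex_Analysis"
begin

text \<open>\<^term>\<open>S\<close> is meant to be open. All iterated directional derivatives up to order
  \<^term>\<open>k\<close> exist, those of order \<open>< k\<close> are (Frechet) differentiable and those of
  order \<^term>\<open>k\<close> are continuous.\<close>

fun times_cont_diff_on ::
    "nat \<Rightarrow> 'a::real_normed_vector set \<Rightarrow> ('a \<Rightarrow> 'b::real_normed_vector) \<Rightarrow> bool" where
  "times_cont_diff_on 0 S f \<longleftrightarrow> continuous_on S f"
| "times_cont_diff_on (Suc k) S f \<longleftrightarrow> f differentiable_on S \<and>
     (\<forall>v. times_cont_diff_on k S (\<lambda>x. frechet_derivative f (at x) v))"

definition smooth_on :: "'a::real_normed_vector set \<Rightarrow> ('a \<Rightarrow> 'b::real_normed_vector) \<Rightarrow> bool" where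
  "smooth_on S f \<longleftrightarrow> (\<forall>k. times_cont_diff_on k S f)"

text \<open>A local parametrization of \<^term>\<open>M\<close>: a smooth immersion of an open set \<^term>\<open>W\<close>
  that is a homeomorphism onto a relatively open subset of \<^term>\<open>M\<close>.\<close>

definition local_param :: "(real^'d) set \<Rightarrow> (real^'n) set \<Rightarrow> (real^'n \<Rightarrow> real^'d) \<Rightarrow> bool" where
  "local_param M W f \<longleftrightarrow> open W \<and> smooth_on W f \<and>
     (\<forall>x\<in>W. inj (frechet_derivative f (at x))) \<and>
     openin (top_of_set M) (f ` W) \<and> (\<exists>g. homeomorphism W (f ` W) f g)"

text \<open>The dimension of the (embedded, boundaryless) submanifold is \<open>CARD('n)\<close>.\<close>

definition submanifold :: "'n::finite itself \<Rightarrow> (real^'d) set \<Rightarrow> bool" where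
  "submanifold _ M \<longleftrightarrow>
     (\<forall>p\<in>M. \<exists>W (f :: real^'n \<Rightarrow> real^'d). local_param M W f \<and> p \<in> f ` W)"

definition partial :: "'n::finite \<Rightarrow> (real^'n \<Rightarrow> 'b::real_normed_vector) \<Rightarrow> real^'n \<Rightarrow> 'b" where
  "partial k F x = frechet_derivative F (at x) (axis k 1)"

definition first_form :: "(real^'n \<Rightarrow> real^'d) \<Rightarrow> real^'n \<Rightarrow> real^'n^'n" where
  "first_form f x = (\<chi> i j. partial i f x \<bullet> partial j f x)"

text \<open>The area measure induced from the ambient space is the Borel measure on \<^term>\<open>M\<close> given in
  every local parametrization by the density \<open>sqrt (det g)\<close>.\<close>

definition is_area_measure :: "'n::finite itself \<Rightarrow> (real^'d) set \<Rightarrow> (real^'d) measure \<Rightarrow> bool" where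
  "is_area_measure _ M \<mu> \<longleftrightarrow> sets \<mu> = sets (restrict_space borel M) \<and>
     (\<forall>W (f :: real^'n \<Rightarrow> real^'d) A.
        local_param M W f \<and> A \<in> sets borel \<and> A \<subseteq> f ` W \<longrightarrow>
        emeasure \<mu> A = (\<integral>\<^sup>+x\<in>W \<inter> f -` A. ennreal (sqrt (det (first_form f x))) \<partial>lborel))"

definition area_measure :: "'n::finite itself \<Rightarrow> (real^'d) set \<Rightarrow> (real^'d) measure" where
  "area_measure n M = (THE \<mu>. is_area_measure n M \<mu>)"

text \<open>At \<open>v = u\<close> the integrand takes the junk value \<open>0 powr s = 0\<close>; a point is a null set.\<close>

definition B_fun :: "'n::finite itself \<Rightarrow> (real^'d) set \<Rightarrow> real^'d \<Rightarrow> complex \<Rightarrow> complex" where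
  "B_fun n M u s = (LINT v | area_measure n M. complex_of_real (norm (v - u)) powr s)"

definition unit_normal ::
    "(real^'n) set \<Rightarrow> (real^'n \<Rightarrow> real^'d) \<Rightarrow> (real^'n \<Rightarrow> real^'d) \<Rightarrow> bool" where
  "unit_normal W f \<nu> \<longleftrightarrow> smooth_on W \<nu> \<and>
     (\<forall>x\<in>W. norm (\<nu> x) = 1 \<and> (\<forall>i. \<nu> x \<bullet> partial i f x = 0))"

definition inv_form :: "(real^'n \<Rightarrow> real^'d) \<Rightarrow> real^'n \<Rightarrow> real^'n^'n" where
  "inv_form f x = matrix_inv (first_form f x)"

definition christoffel ::
    "(real^'n \<Rightarrow> real^'d) \<Rightarrow> 'n \<Rightarrow> 'n \<Rightarrow> 'n \<Rightarrow> real^'n \<Rightarrow> real" where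
  "christoffel f l i j x = (\<Sum>k\<in>UNIV. inv_form f x $ l $ k *
     (partial i (\<lambda>y. first_form f y $ j $ k) x
      + partial j (\<lambda>y. first_form f y $ i $ k) x
      - partial k (\<lambda>y. first_form f y $ i $ j) x)) / 2"

text \<open>A covariant tensor field of rank \<open>r\<close> is given by its components, indexed by lists of
  length \<open>r\<close>. Covariant differentiation appends the new index at the end.\<close>

definition cov_deriv :: "(real^'n \<Rightarrow> real^'d) \<Rightarrow>
    ('n list \<Rightarrow> real^'n \<Rightarrow> real) \<Rightarrow> 'n list \<Rightarrow> real^'n \<Rightarrow> real" where
  "cov_deriv f T js x = (let is = butlast js; k = last js in
     partial k (T is) x
     - (\<Sum>a<length is. \<Sum>l\<in>UNIV. christoffel f l k (is ! a) x * T (is[a := l]) x))"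

definition second_form ::
    "(real^'n \<Rightarrow> real^'d) \<Rightarrow> (real^'n \<Rightarrow> real^'d) \<Rightarrow> 'n list \<Rightarrow> real^'n \<Rightarrow> real" where
  "second_form f \<nu> is x = partial (is ! 0) (partial (is ! 1) f) x \<bullet> \<nu> x"

definition cov_second_form :: "(real^'n \<Rightarrow> real^'d) \<Rightarrow> (real^'n \<Rightarrow> real^'d) \<Rightarrow>
    nat \<Rightarrow> 'n list \<Rightarrow> real^'n \<Rightarrow> real" where
  "cov_second_form f \<nu> m = (cov_deriv f ^^ m) (second_form f \<nu>)"

text \<open>The pair \<open>(ms, ps)\<close> stands for the tensor product of the \<open>m\<close>-th covariant derivatives of
  the second fundamental form, \<open>m\<close> running through \<open>ms\<close>, whose index positions are numbered
  consecutively from 0 and contracted in the pairs listed in \<open>ps\<close>.\<close>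

type_synonym contraction = "nat list \<times> (nat \<times> nat) list"

definition num_indices :: "nat list \<Rightarrow> nat" where
  "num_indices ms = (\<Sum>m\<leftarrow>ms. m + 2)"

definition complete_contraction :: "contraction \<Rightarrow> bool" where
  "complete_contraction c \<longleftrightarrow> (case c of (ms, ps) \<Rightarrow>
     distinct (map fst ps @ map snd ps) \<and>
     set (map fst ps @ map snd ps) = {..<num_indices ms})"

fun tensor_prod ::
    "(nat \<Rightarrow> 'n list \<Rightarrow> real^'n \<Rightarrow> real) \<Rightarrow> nat list \<Rightarrow> 'n list \<Rightarrow> real^'n \<Rightarrow> real" where
  "tensor_prod T [] is x = 1"
| "tensor_prod T (m # ms) is x =
     T m (take (m + 2) is) x * tensor_prod T ms (drop (m + 2) is) x"

definition contraction_value ::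
    "(real^'n \<Rightarrow> real^'d) \<Rightarrow> (real^'n \<Rightarrow> real^'d) \<Rightarrow> real^'n \<Rightarrow> contraction \<Rightarrow> real" where
  "contraction_value f \<nu> x c = (case c of (ms, ps) \<Rightarrow>
     \<Sum>is | length is = num_indices ms.
       (\<Prod>(a, b)\<leftarrow>ps. inv_form f x $ (is ! a) $ (is ! b)) *
       tensor_prod (cov_second_form f \<nu>) ms is x)"

datatype (vars: 'v) poly_expr =
    Const real
  | Var 'v
  | Add "'v poly_expr" "'v poly_expr"
  | Mult "'v poly_expr" "'v poly_expr"

primrec eval_poly :: "('v \<Rightarrow> real) \<Rightarrow> 'v poly_expr \<Rightarrow> real" where
  "eval_poly \<rho> (Const c) = c"
| "eval_poly \<rho> (Var v) = \<rho> v"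
| "eval_poly \<rho> (Add p q) = eval_poly \<rho> p + eval_poly \<rho> q"
| "eval_poly \<rho> (Mult p q) = eval_poly \<rho> p * eval_poly \<rho> q"

end

theory Submission
  imports Defs
begin

text \<open>Over the tangent space at \<open>u\<close>, \<open>M\<close> is a graph with \<open>\<parallel>v - u\<parallel>\<^sup>2 = \<parallel>y\<parallel>\<^sup>2 + q y\<close>, where \<open>q\<close> vanishes to
  fourth order. Expanding \<open>(\<parallel>y\<parallel>\<^sup>2 + q)\<close> to the power \<open>s / 2\<close> by the binomial series and the coefficient
  functions \<open>q\<^sup>l sqrt (det g)\<close> by Taylor's formula leaves integrals of \<open>\<parallel>y\<parallel>\<close> to the power \<open>s - 2l\<close> times
  homogeneous polynomials over a ball, which are explicit meromorphic functions of \<open>s\<close>, and a remainder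
  that is holomorphic on a larger half plane. The polynomials of odd degree integrate to zero; by
  Pizzetti's formula those of even degree integrate to iterated Laplacians at \<open>0\<close>.

  For a hypersurface \<open>q\<close> is the square of the function \<open>\<phi>\<close> whose graph is \<open>M\<close>, and these Laplacians are
  complete contractions of derivatives of \<open>\<phi>\<close>. The \<open>m\<close>-th covariant derivative of the second fundamental
  form at \<open>u\<close> is the derivative of \<open>\<phi>\<close> of order \<open>m + 2\<close> plus contractions of derivatives of lower order,
  so the derivatives of \<open>\<phi>\<close> can be eliminated recursively. As the first fundamental form is the identity
  at \<open>0\<close> and complete contractions do not depend on the parametrization, the result holds in any chart.\<close>

text \<open>The order four in \<open>q\<close> is what keeps everything finite: the
  \<open>l\<close>-th binomial term loses \<open>2 * l\<close> powers of the norm, but the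
  \<open>l\<close>-th power of \<open>q\<close> brings at least \<open>4 * l\<close>. A homogeneous
  term of degree \<open>j + 2 * l\<close> can therefore reach the pole at \<open>-n - j\<close> only
  when \<open>2 * l \<le> j\<close>, and the residue is an explicit finite sum at one value of
  \<open>s\<close>. The real obstacle is universality: one polynomial has to be produced before any
  hypersurface is given. Index notation is therefore formalized as a class of functionals
  (\<open>index_expr\<close>) evaluated on tensors, and every step from Laplacians to contractions
  yields one functional valid for all graphs at once. To keep these functionals polynomial, the
  normal component \<open>\<omega>\<close>, equal to 1 / sqrt (1 + |grad \<phi>|^2), is carried as
  an additional scalar: the area density, the Christoffel symbols and the derivatives of
  \<open>\<omega>\<close> itself are polynomials in \<open>\<omega>\<close> and the derivatives of
  \<open>\<phi>\<close>, and \<open>\<omega>\<close> is 1 at the origin. Since \<open>\<phi>\<close>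
  is measured along the prescribed normal, no sign is left to choose.\<close>

no_notation fps_nth (infixl \<open>$\<close> 75)

section \<open>Calculus of smooth functions on open sets\<close>

named_theorems smooth_intros

lemma times_cont_diff_on_SucD:
  assumes "open S" "times_cont_diff_on (Suc k) S f" "x \<in> S"
  shows "(f has_derivative frechet_derivative f (at x)) (at x)"
proof -
  have "f differentiable_on S" using assms(2) by simp
  then show ?thesis
    using assms(1,3) differentiable_on_eq_differentiable_at frechet_derivative_works by blast
qed

lemma times_cont_diff_on_cong:
  assumes "open S"
  shows "(\<And>x. x \<in> S \<Longrightarrow> f x = g x) \<Longrightarrow> times_cont_diff_on k S f \<Longrightarrow> times_cont_diff_on k S g"
proof (induction k arbitrary: f g)
  case 0
  then show ?case using continuous_on_cong[of S S f g] by simp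
next
  case (Suc k)
  have g: "(g has_derivative frechet_derivative f (at x)) (at x)" if "x \<in> S" for x
    by (rule has_derivative_transform_within_open[OF times_cont_diff_on_SucD[OF assms Suc.prems(2) that] assms that])
      (rule Suc.prems(1))
  have eq: "frechet_derivative f (at x) v = frechet_derivative g (at x) v" if "x \<in> S" for x v
    using frechet_derivative_at[OF g[OF that]] by (rule fun_cong)
  have "times_cont_diff_on k S (\<lambda>x. frechet_derivative g (at x) v)" for v
    by (rule Suc.IH[where f = "\<lambda>x. frechet_derivative f (at x) v"]) (use eq Suc.prems(2) in auto)
  moreover have "g differentiable_on S"
    using g differentiable_at_imp_differentiable_on differentiable_def by blast
  ultimately show ?case by simp
qed

text \<open>The definition refers to \<open>frechet_derivative\<close>; this rule lets an explicitly
  computed derivative stand in for it. A derivative at a point is unique, so the two agree on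
  \<open>S\<close>, and \<open>times_cont_diff_on_cong\<close> carries the regularity over.\<close>

lemma times_cont_diff_on_SucI:
  assumes "open S" and d: "\<And>x. x \<in> S \<Longrightarrow> (f has_derivative f' x) (at x)"
    and "\<And>v. times_cont_diff_on k S (\<lambda>x. f' x v)"
  shows "times_cont_diff_on (Suc k) S f"
proof -
  have "f differentiable_on S"
    using d differentiable_at_imp_differentiable_on differentiable_def by blast
  moreover have eq: "f' x v = frechet_derivative f (at x) v" if "x \<in> S" for x v
    using frechet_derivative_at[OF d[OF that]] by (rule fun_cong)
  have "times_cont_diff_on k S (\<lambda>x. frechet_derivative f (at x) v)" for v
    by (rule times_cont_diff_on_cong[OF assms(1) eq assms(3)])
  ultimately show ?thesis by simp
qed

lemma times_cont_diff_on_continuous: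
  "open S \<Longrightarrow> times_cont_diff_on k S f \<Longrightarrow> continuous_on S f"
  by (cases k) (auto intro: differentiable_imp_continuous_on)

lemma times_cont_diff_on_Suc_imp:
  assumes "open S"
  shows "times_cont_diff_on (Suc k) S f \<Longrightarrow> times_cont_diff_on k S f"
proof (induction k arbitrary: f)
  case 0
  then show ?case using times_cont_diff_on_continuous[OF assms, of "Suc 0"]
    by (simp only: times_cont_diff_on.simps(1))
next
  case (Suc k)
  have "times_cont_diff_on (Suc k) S (\<lambda>x. frechet_derivative f (at x) v)" for v
    using Suc.prems by (simp only: times_cont_diff_on.simps(2)[of "Suc k"])
  then have "times_cont_diff_on k S (\<lambda>x. frechet_derivative f (at x) v)" for v
    by (rule Suc.IH)
  then show ?case using Suc.prems by simp
qed

lemma times_cont_diff_on_subset: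
  "open S \<Longrightarrow> open T \<Longrightarrow> T \<subseteq> S \<Longrightarrow> times_cont_diff_on k S f \<Longrightarrow> times_cont_diff_on k T f"
proof (induction k arbitrary: f)
  case 0
  then show ?case using continuous_on_subset by auto
next
  case (Suc k)
  then show ?case using differentiable_on_subset by auto
qed

lemma times_cont_diff_on_const: "open S \<Longrightarrow> times_cont_diff_on k S (\<lambda>_. c)"
  by (induction k arbitrary: c) (auto intro!: times_cont_diff_on_SucI derivative_eq_intros
      simp del: times_cont_diff_on.simps(2))

lemma times_cont_diff_on_linear_comp:
  assumes "bounded_linear L" "open S"
  shows "times_cont_diff_on k S f \<Longrightarrow> times_cont_diff_on k S (\<lambda>x. L (f x))"
proof (induction k arbitrary: f)
  case 0
  then show ?case using bounded_linear.continuous_on[OF assms(1)] by simp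
next
  case (Suc k)
  show ?case
    by (rule times_cont_diff_on_SucI[OF \<open>open S\<close>, where f' = "\<lambda>x v. L (frechet_derivative f (at x) v)"])
      (use Suc in \<open>auto intro!: bounded_linear.has_derivative[OF assms(1) times_cont_diff_on_SucD[OF \<open>open S\<close> Suc.prems]]\<close>)
qed

lemma times_cont_diff_on_add:
  assumes "open S"
  shows "times_cont_diff_on k S f \<Longrightarrow> times_cont_diff_on k S g \<Longrightarrow> times_cont_diff_on k S (\<lambda>x. f x + g x)"
proof (induction k arbitrary: f g)
  case 0
  then show ?case by (simp add: continuous_on_add)
next
  case (Suc k)
  show ?case
    by (rule times_cont_diff_on_SucI[OF \<open>open S\<close>, where
          f' = "\<lambda>x v. frechet_derivative f (at x) v + frechet_derivative g (at x) v"])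
      (use Suc in \<open>auto intro!: has_derivative_add times_cont_diff_on_SucD[OF \<open>open S\<close> Suc.prems(1)]
        times_cont_diff_on_SucD[OF \<open>open S\<close> Suc.prems(2)]\<close>)
qed

lemma times_cont_diff_on_sum:
  assumes "open S" "\<And>i. i \<in> I \<Longrightarrow> times_cont_diff_on k S (f i)"
  shows "times_cont_diff_on k S (\<lambda>x. \<Sum>i\<in>I. f i x)"
  using assms(2)
  by (induction I rule: infinite_finite_induct)
    (auto intro!: times_cont_diff_on_const times_cont_diff_on_add assms(1) simp del: times_cont_diff_on.simps)

lemma times_cont_diff_on_bilinear:
  assumes "bounded_bilinear B" "open S"
  shows "times_cont_diff_on k S f \<Longrightarrow> times_cont_diff_on k S g \<Longrightarrow> times_cont_diff_on k S (\<lambda>x. B (f x) (g x))"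
proof (induction k arbitrary: f g)
  case 0
  then show ?case using bounded_bilinear.continuous_on[OF assms(1)] by simp
next
  case (Suc k)
  show ?case
  proof (rule times_cont_diff_on_SucI[OF \<open>open S\<close>])
    show "((\<lambda>x. B (f x) (g x)) has_derivative
        (\<lambda>v. B (f x) (frechet_derivative g (at x) v) + B (frechet_derivative f (at x) v) (g x))) (at x)"
      if "x \<in> S" for x
      by (rule bounded_bilinear.FDERIV[OF assms(1) times_cont_diff_on_SucD[OF \<open>open S\<close> Suc.prems(1) that]
          times_cont_diff_on_SucD[OF \<open>open S\<close> Suc.prems(2) that]])
    show "times_cont_diff_on k S
        (\<lambda>x. B (f x) (frechet_derivative g (at x) v) + B (frechet_derivative f (at x) v) (g x))" for v
      by (intro times_cont_diff_on_add[OF \<open>open S\<close>] Suc.IH times_cont_diff_on_Suc_imp[OF \<open>open S\<close> Suc.prems(1)]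
          times_cont_diff_on_Suc_imp[OF \<open>open S\<close> Suc.prems(2)]) (use Suc.prems in auto)
  qed
qed

text \<open>The chain rule evaluates the derivative of \<open>g\<close> in a direction that moves
  with \<open>x\<close>, whereas the definition only controls fixed directions. Expanding the
  direction in the finite basis of the intermediate space reduces the derivative to sums of
  products, whose factors are covered by the induction hypothesis.\<close>

lemma times_cont_diff_on_compose:
  fixes g :: "'b::euclidean_space \<Rightarrow> 'c::real_normed_vector"
  assumes "open S" "open T"
  shows "times_cont_diff_on k S f \<Longrightarrow> f ` S \<subseteq> T \<Longrightarrow> times_cont_diff_on k T g \<Longrightarrow> times_cont_diff_on k S (\<lambda>x. g (f x))"
proof (induction k arbitrary: g)
  case 0
  then show ?case by (auto intro: continuous_on_compose2)
next
  case (Suc k)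
  show ?case
  proof (rule times_cont_diff_on_SucI[OF \<open>open S\<close>, where
          f' = "\<lambda>x v. \<Sum>b\<in>Basis. (frechet_derivative f (at x) v \<bullet> b) *\<^sub>R frechet_derivative g (at (f x)) b"])
    fix x assume x: "x \<in> S"
    have g: "(g has_derivative frechet_derivative g (at (f x))) (at (f x))"
      using x Suc.prems(2) by (intro times_cont_diff_on_SucD[OF \<open>open T\<close> Suc.prems(3)]) auto
    note lin = has_derivative_linear[OF g]
    have "frechet_derivative g (at (f x)) (\<Sum>b\<in>Basis. (w \<bullet> b) *\<^sub>R b)
        = (\<Sum>b\<in>Basis. (w \<bullet> b) *\<^sub>R frechet_derivative g (at (f x)) b)" for w
      by (simp only: linear_sum[OF lin] linear_cmul[OF lin])
    note this[unfolded euclidean_representation]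
    then have "(\<lambda>v. frechet_derivative g (at (f x)) (frechet_derivative f (at x) v)) =
      (\<lambda>v. \<Sum>b\<in>Basis. (frechet_derivative f (at x) v \<bullet> b) *\<^sub>R frechet_derivative g (at (f x)) b)"
      by (rule ext)
    from has_derivative_eq_rhs[OF has_derivative_compose[OF times_cont_diff_on_SucD[OF \<open>open S\<close> Suc.prems(1) x] g] this]
    show "((\<lambda>x. g (f x)) has_derivative (\<lambda>v. \<Sum>b\<in>Basis. (frechet_derivative f (at x) v \<bullet> b) *\<^sub>R frechet_derivative g (at (f x)) b)) (at x)" .
  next
    fix v
    have "times_cont_diff_on k S (\<lambda>x. frechet_derivative g (at (f x)) b)" for b
      by (rule Suc.IH[OF times_cont_diff_on_Suc_imp[OF \<open>open S\<close> Suc.prems(1)] Suc.prems(2)])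
        (use Suc.prems(3) in simp)
    moreover have "times_cont_diff_on k S (\<lambda>x. frechet_derivative f (at x) v \<bullet> b)" for b
      by (rule times_cont_diff_on_linear_comp[OF bounded_linear_inner_left \<open>open S\<close>]) (use Suc.prems(1) in simp)
    ultimately show "times_cont_diff_on k S (\<lambda>x. \<Sum>b\<in>Basis. (frechet_derivative f (at x) v \<bullet> b) *\<^sub>R frechet_derivative g (at (f x)) b)"
      by (intro times_cont_diff_on_sum \<open>open S\<close> times_cont_diff_on_bilinear[OF bounded_bilinear_scaleR])
  qed
qed

lemma smooth_on_cong:
  "open S \<Longrightarrow> (\<And>x. x \<in> S \<Longrightarrow> f x = g x) \<Longrightarrow> smooth_on S f \<Longrightarrow> smooth_on S g"
  unfolding smooth_on_def using times_cont_diff_on_cong by blast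

lemma smooth_on_subset: "open S \<Longrightarrow> open T \<Longrightarrow> T \<subseteq> S \<Longrightarrow> smooth_on S f \<Longrightarrow> smooth_on T f"
  unfolding smooth_on_def using times_cont_diff_on_subset by blast

lemma smooth_on_continuous: "smooth_on S f \<Longrightarrow> continuous_on S f"
  unfolding smooth_on_def by (drule spec[of _ 0]) simp

lemma smooth_on_has_derivative:
  "open S \<Longrightarrow> smooth_on S f \<Longrightarrow> x \<in> S \<Longrightarrow> (f has_derivative frechet_derivative f (at x)) (at x)"
  unfolding smooth_on_def using times_cont_diff_on_SucD by blast

lemma smooth_on_derivative: "smooth_on S f \<Longrightarrow> smooth_on S (\<lambda>x. frechet_derivative f (at x) v)"
  unfolding smooth_on_def by (rule allI, drule_tac x = "Suc k" in spec) simp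

lemma smooth_on_const [smooth_intros]: "open S \<Longrightarrow> smooth_on S (\<lambda>_. c)"
  unfolding smooth_on_def using times_cont_diff_on_const by blast

lemma smooth_on_linear_comp:
  "bounded_linear L \<Longrightarrow> open S \<Longrightarrow> smooth_on S f \<Longrightarrow> smooth_on S (\<lambda>x. L (f x))"
  unfolding smooth_on_def using times_cont_diff_on_linear_comp by blast

lemma smooth_on_ident [smooth_intros]: "open S \<Longrightarrow> smooth_on S (\<lambda>x. x)"
  unfolding smooth_on_def
proof
  fix k assume S: "open S"
  show "times_cont_diff_on k S (\<lambda>x. x)"
  proof (cases k)
    case (Suc j)
    show ?thesis unfolding Suc
      by (rule times_cont_diff_on_SucI[OF S has_derivative_ident times_cont_diff_on_const[OF S]])
  qed simp
qed

lemma smooth_on_add [smooth_intros]: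
  "open S \<Longrightarrow> smooth_on S f \<Longrightarrow> smooth_on S g \<Longrightarrow> smooth_on S (\<lambda>x. f x + g x)"
  unfolding smooth_on_def using times_cont_diff_on_add by blast

lemma smooth_on_minus [smooth_intros]:
  "open S \<Longrightarrow> smooth_on S f \<Longrightarrow> smooth_on S (\<lambda>x. - f x)"
  using smooth_on_linear_comp[OF bounded_linear_minus[OF bounded_linear_ident]] by blast

lemma smooth_on_diff [smooth_intros]:
  "open S \<Longrightarrow> smooth_on S f \<Longrightarrow> smooth_on S g \<Longrightarrow> smooth_on S (\<lambda>x. f x - g x)"
  using smooth_on_add[of S f "\<lambda>x. - g x"] smooth_on_minus by auto

lemma smooth_on_sum [smooth_intros]:
  "open S \<Longrightarrow> (\<And>i. i \<in> I \<Longrightarrow> smooth_on S (f i)) \<Longrightarrow> smooth_on S (\<lambda>x. \<Sum>i\<in>I. f i x)"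
  unfolding smooth_on_def by (rule allI, rule times_cont_diff_on_sum) blast+

lemma smooth_on_bilinear:
  "bounded_bilinear B \<Longrightarrow> open S \<Longrightarrow> smooth_on S f \<Longrightarrow> smooth_on S g \<Longrightarrow> smooth_on S (\<lambda>x. B (f x) (g x))"
  unfolding smooth_on_def by (rule allI, rule times_cont_diff_on_bilinear) blast+

lemmas smooth_on_mult [smooth_intros] = smooth_on_bilinear[OF bounded_bilinear_mult]
lemmas smooth_on_scaleR [smooth_intros] = smooth_on_bilinear[OF bounded_bilinear_scaleR]
lemmas smooth_on_inner [smooth_intros] = smooth_on_bilinear[OF bounded_bilinear_inner]

lemma smooth_on_prod [smooth_intros]:
  fixes f :: "'i \<Rightarrow> 'a::real_normed_vector \<Rightarrow> real"
  shows "open S \<Longrightarrow> (\<And>i. i \<in> I \<Longrightarrow> smooth_on S (f i)) \<Longrightarrow> smooth_on S (\<lambda>x. \<Prod>i\<in>I. f i x)"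
  by (induction I rule: infinite_finite_induct) (auto intro!: smooth_intros)

lemma smooth_on_power [smooth_intros]:
  fixes f :: "'a::real_normed_vector \<Rightarrow> real"
  shows "open S \<Longrightarrow> smooth_on S f \<Longrightarrow> smooth_on S (\<lambda>x. f x ^ k)"
  by (induction k) (auto intro!: smooth_intros)

lemma smooth_on_compose:
  fixes g :: "'b::euclidean_space \<Rightarrow> 'c::real_normed_vector"
  assumes "open S" "open T" "smooth_on S f" "f ` S \<subseteq> T" "smooth_on T g"
  shows "smooth_on S (\<lambda>x. g (f x))"
  unfolding smooth_on_def
  by (rule allI, rule times_cont_diff_on_compose[OF assms(1,2) _ assms(4)])
    (use assms(3,5) in \<open>auto simp: smooth_on_def\<close>)

lemma smooth_on_powr: "smooth_on {0<..} (\<lambda>x::real. x powr a)"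
  unfolding smooth_on_def
proof
  fix k show "times_cont_diff_on k {0<..} (\<lambda>x::real. x powr a)"
  proof (induction k arbitrary: a)
    case 0
    then show ?case by (auto intro!: continuous_intros)
  next
    case (Suc k)
    show ?case
    proof (rule times_cont_diff_on_SucI[where f' = "\<lambda>x v. v * (a * x powr (a - 1))"])
      show "((\<lambda>x. x powr a) has_derivative (\<lambda>v. v * (a * x powr (a - 1)))) (at x)" if "x \<in> {0<..}" for x
        using has_real_derivative_powr[of x a] that by (simp add: has_field_derivative_def mult_commute_abs)
      show "times_cont_diff_on k {0<..} (\<lambda>x. v * (a * x powr (a - 1)))" for v
        by (intro times_cont_diff_on_linear_comp[OF bounded_linear_mult_right] Suc) auto
    qed auto
  qed
qed

lemma smooth_on_powr_comp [smooth_intros]: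
  "open S \<Longrightarrow> smooth_on S f \<Longrightarrow> (\<And>x. x \<in> S \<Longrightarrow> f x > 0) \<Longrightarrow> smooth_on S (\<lambda>x. f x powr a :: real)"
  by (rule smooth_on_compose[where T = "{0<..}" and g = "\<lambda>t. t powr a"]) (auto intro: smooth_on_powr)

lemma smooth_on_sqrt [smooth_intros]:
  "open S \<Longrightarrow> smooth_on S f \<Longrightarrow> (\<And>x. x \<in> S \<Longrightarrow> f x > 0) \<Longrightarrow> smooth_on S (\<lambda>x. sqrt (f x))"
  by (rule smooth_on_cong[OF _ _ smooth_on_powr_comp[where a = "1/2"]]) (auto simp: powr_half_sqrt less_imp_le)

lemma smooth_on_vec_nth [smooth_intros]:
  fixes f :: "'a::real_normed_vector \<Rightarrow> real^'m"
  shows "open S \<Longrightarrow> smooth_on S f \<Longrightarrow> smooth_on S (\<lambda>x. f x $ i)"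
  using smooth_on_linear_comp[OF bounded_linear_vec_nth] by blast

lemma smooth_on_vec [smooth_intros]:
  fixes f :: "'m::finite \<Rightarrow> 'a::real_normed_vector \<Rightarrow> real"
  assumes "open S" "\<And>i. smooth_on S (f i)"
  shows "smooth_on S (\<lambda>x. \<chi> i. f i x)"
proof -
  have "smooth_on S (\<lambda>x. \<Sum>i\<in>UNIV. f i x *\<^sub>R axis i (1::real))"
    by (intro smooth_intros assms)
  also have "(\<lambda>x. \<Sum>i\<in>UNIV. f i x *\<^sub>R axis i (1::real)) = (\<lambda>x. \<chi> i. f i x)"
    by (simp add: fun_eq_iff vec_eq_iff sum.delta axis_def if_distrib cong: if_cong)
  finally show ?thesis .
qed

lemma smooth_on_det [smooth_intros]:
  fixes A :: "'a::real_normed_vector \<Rightarrow> real^'m^'m"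
  assumes "open S" "\<And>i j. smooth_on S (\<lambda>x. A x $ i $ j)"
  shows "smooth_on S (\<lambda>x. det (A x))"
  unfolding det_def by (intro smooth_intros assms)

text \<open>Only positive bases are allowed in \<open>smooth_on_powr_comp\<close>, while
  \<open>g\<close> may be negative; hence the quotient is written as
  \<open>f * g * (g\<^sup>2) powr (-1)\<close>.\<close>

lemma smooth_on_divide [smooth_intros]:
  fixes f g :: "'a::real_normed_vector \<Rightarrow> real"
  assumes "open S" "smooth_on S f" "smooth_on S g" "\<And>x. x \<in> S \<Longrightarrow> g x \<noteq> 0"
  shows "smooth_on S (\<lambda>x. f x / g x)"
proof (rule smooth_on_cong[OF assms(1)])
  have "(g x)\<^sup>2 > 0" if "x \<in> S" for x
    using assms(4)[OF that] by simp
  then show "smooth_on S (\<lambda>x. f x * g x * ((g x)\<^sup>2) powr (-1))"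
    by (intro smooth_on_mult smooth_on_powr_comp smooth_on_power assms(1-3)) auto
  show "f x * g x * ((g x)\<^sup>2) powr (-1) = f x / g x" if "x \<in> S" for x
    using assms(4)[OF that] by (simp add: powr_minus_divide power2_eq_square)
qed

text \<open>Cramer's rule presents the solution as a quotient of determinants, hence as a smooth
  function. It later gives smoothness of the inverse metric and of the derivative of a local
  inverse.\<close>

lemma smooth_on_cramer:
  fixes A :: "'a::real_normed_vector \<Rightarrow> real^'m^'m"
  assumes "open S" "\<And>i j. smooth_on S (\<lambda>x. A x $ i $ j)" "\<And>i. smooth_on S (\<lambda>x. b x $ i)"
    and "\<And>x. x \<in> S \<Longrightarrow> det (A x) \<noteq> 0" "\<And>x. x \<in> S \<Longrightarrow> A x *v y x = b x"
  shows "smooth_on S y"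
proof (rule smooth_on_cong[OF \<open>open S\<close>])
  show "smooth_on S (\<lambda>x. \<chi> k. det (\<chi> i j. if j = k then b x $ i else A x $ i $ j) / det (A x))"
  proof (intro smooth_on_vec smooth_on_divide smooth_on_det assms(1,2,4))
    fix i j k show "smooth_on S (\<lambda>x. (\<chi> i j. if j = k then b x $ i else A x $ i $ j) $ i $ j)"
      by (cases "j = k") (simp_all add: assms(2,3))
  qed
  show "(\<chi> k. det (\<chi> i j. if j = k then b x $ i else A x $ i $ j) / det (A x)) = y x" if "x \<in> S" for x
    using cramer[of "A x" "y x" "b x"] assms(4,5) that by simp
qed

subsection \<open>Partial derivatives\<close>

lemma partial_eqI: "(f has_derivative f') (at x) \<Longrightarrow> partial i f x = f' (axis i 1)"
  unfolding partial_def using frechet_derivative_at by metis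

lemma has_derivative_partials:
  fixes f :: "real^'n \<Rightarrow> 'b::real_normed_vector"
  assumes "f differentiable (at x)"
  shows "(f has_derivative (\<lambda>h. \<Sum>i\<in>UNIV. h $ i *\<^sub>R partial i f x)) (at x)"
proof -
  have d: "(f has_derivative frechet_derivative f (at x)) (at x)"
    using assms frechet_derivative_works by blast
  have "frechet_derivative f (at x) = (\<lambda>h. \<Sum>i\<in>UNIV. h $ i *\<^sub>R partial i f x)"
  proof
    fix h
    have "frechet_derivative f (at x) (\<Sum>i\<in>UNIV. h $ i *\<^sub>R axis i 1) = (\<Sum>i\<in>UNIV. h $ i *\<^sub>R partial i f x)"
      unfolding partial_def by (simp add: linear_sum[OF has_derivative_linear[OF d]] linear_cmul[OF has_derivative_linear[OF d]])
    then show "frechet_derivative f (at x) h = (\<Sum>i\<in>UNIV. h $ i *\<^sub>R partial i f x)"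
      using basis_expansion[of h] by (simp add: scalar_mult_eq_scaleR)
  qed
  then show ?thesis using d by simp
qed

lemma smooth_on_has_derivative_partials:
  fixes f :: "real^'n \<Rightarrow> 'b::real_normed_vector"
  assumes "open S" "smooth_on S f" "x \<in> S"
  shows "(f has_derivative (\<lambda>h. \<Sum>i\<in>UNIV. h $ i *\<^sub>R partial i f x)) (at x)"
  using has_derivative_partials smooth_on_has_derivative[OF assms] differentiable_def by blast

lemma smooth_on_partial [smooth_intros]: "smooth_on S f \<Longrightarrow> smooth_on S (partial i f)"
  unfolding partial_def[abs_def] by (rule smooth_on_derivative)

lemma partial_cong:
  assumes "open S" "x \<in> S" "\<And>y. y \<in> S \<Longrightarrow> f y = g y"
  shows "partial i f x = partial i g x"
proof (cases "f differentiable (at x)")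
  case True
  then show ?thesis unfolding partial_def
    using frechet_derivative_transform_within_open assms by metis
next
  case False
  \<comment> \<open>\<open>frechet_derivative\<close> is a choice operator, so without
    differentiability the two sides agree because the predicates they choose from are equal.\<close>
  have "(f has_derivative f') (at x) = (g has_derivative f') (at x)" for f'
    using has_derivative_transform_within_open[OF _ assms(1,2), of f f' UNIV g]
      has_derivative_transform_within_open[OF _ assms(1,2), of g f' UNIV f] assms(3) by auto
  then show ?thesis unfolding partial_def frechet_derivative_def by simp
qed

lemma partial_compose:
  fixes f :: "real^'m \<Rightarrow> 'b::real_normed_vector" and g :: "real^'n \<Rightarrow> real^'m"
  assumes "f differentiable (at (g x))" "g differentiable (at x)"
  shows "partial i (\<lambda>x. f (g x)) x = (\<Sum>a\<in>UNIV. partial i g x $ a *\<^sub>R partial a f (g x))"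
proof -
  have "((\<lambda>x. f (g x)) has_derivative (\<lambda>h. \<Sum>a\<in>UNIV. (frechet_derivative g (at x) h) $ a *\<^sub>R partial a f (g x))) (at x)"
    using has_derivative_compose[OF assms(2)[unfolded frechet_derivative_works] has_derivative_partials[OF assms(1)]] .
  from partial_eqI[OF this, of i] show ?thesis by (simp add: partial_def)
qed

lemma partial_bilinear:
  assumes "bounded_bilinear B" "f differentiable (at x)" "g differentiable (at x)"
  shows "partial i (\<lambda>x. B (f x) (g x)) x = B (f x) (partial i g x) + B (partial i f x) (g x)"
  using partial_eqI[OF bounded_bilinear.FDERIV[OF assms(1) assms(2,3)[unfolded frechet_derivative_works]]]
  by (simp add: partial_def)

lemmas partial_inner = partial_bilinear[OF bounded_bilinear_inner]
lemmas partial_mult = partial_bilinear[OF bounded_bilinear_mult]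
lemmas partial_scaleR = partial_bilinear[OF bounded_bilinear_scaleR]

lemma partial_linear:
  assumes "bounded_linear L" "f differentiable (at x)"
  shows "partial i (\<lambda>x. L (f x)) x = L (partial i f x)"
  using partial_eqI[OF bounded_linear.has_derivative[OF assms(1) assms(2)[unfolded frechet_derivative_works]]]
  by (simp add: partial_def)

lemma partial_const [simp]: "partial i (\<lambda>_. c) x = 0"
  by (simp add: partial_def)

lemma partial_add:
  "f differentiable (at x) \<Longrightarrow> g differentiable (at x) \<Longrightarrow>
   partial i (\<lambda>x. f x + g x) x = partial i f x + partial i g x"
  unfolding frechet_derivative_works by (drule (1) has_derivative_add, drule partial_eqI) (simp add: partial_def)

lemma partial_sum:
  "(\<And>j. j \<in> I \<Longrightarrow> f j differentiable (at x)) \<Longrightarrow>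
   partial i (\<lambda>x. \<Sum>j\<in>I. f j x) x = (\<Sum>j\<in>I. partial i (f j) x)"
  unfolding frechet_derivative_works by (drule has_derivative_sum, drule partial_eqI) (simp add: partial_def)

lemma smooth_on_differentiable: "open S \<Longrightarrow> smooth_on S f \<Longrightarrow> x \<in> S \<Longrightarrow> f differentiable (at x)"
  using smooth_on_has_derivative differentiable_def by blast

text \<open>The mixed second difference is an iterated mean value of either mixed derivative, so a strict
  inequality between the two at one point would contradict continuity.\<close>

lemma second_difference_mvt:
  fixes F :: "real^'n \<Rightarrow> real"
  assumes "open S" "smooth_on S F" "cball x \<delta> \<subseteq> S" "s > 0" "2 * s \<le> \<delta>"
  shows "\<exists>y\<in>cball x \<delta>. F (x + s *\<^sub>R axis i 1 + s *\<^sub>R axis j 1) - F (x + s *\<^sub>R axis i 1) - F (x + s *\<^sub>R axis j 1) + F x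
            = s\<^sup>2 * partial j (partial i F) y"
proof -
  let ?ei = "axis i 1 :: real^'n" and ?ej = "axis j 1 :: real^'n"
  have nb: "x + a *\<^sub>R ?ei + b *\<^sub>R ?ej \<in> cball x \<delta>" if "0 \<le> a" "a \<le> s" "0 \<le> b" "b \<le> s" for a b
  proof -
    have "norm (a *\<^sub>R ?ei + b *\<^sub>R ?ej) \<le> norm (a *\<^sub>R ?ei) + norm (b *\<^sub>R ?ej)" by (rule norm_triangle_ineq)
    also have "\<dots> \<le> \<delta>" using that assms by (simp add: norm_axis_1)
    moreover have "dist x (x + a *\<^sub>R ?ei + b *\<^sub>R ?ej) = norm (a *\<^sub>R ?ei + b *\<^sub>R ?ej)"
      by (metis add.assoc add_diff_cancel_left' dist_commute dist_norm)
    ultimately show ?thesis by simp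
  qed
  have d: "((\<lambda>t. G (p + t *\<^sub>R axis k 1)) has_real_derivative partial k G (p + t *\<^sub>R axis k 1)) (at t)"
    if "smooth_on S G" "p + t *\<^sub>R axis k 1 \<in> S" for G and p :: "real^'n" and t k
  proof -
    have "((\<lambda>t. G (p + t *\<^sub>R axis k 1)) has_derivative (\<lambda>h. frechet_derivative G (at (p + t *\<^sub>R axis k 1)) (h *\<^sub>R axis k 1))) (at t)"
      by (rule has_derivative_compose[where f = "\<lambda>t. p + t *\<^sub>R axis k 1" and g = G, OF _ smooth_on_has_derivative[OF \<open>open S\<close> that]])
        (auto intro!: derivative_eq_intros)
    moreover have "frechet_derivative G (at (p + t *\<^sub>R axis k 1)) (h *\<^sub>R axis k 1) =
        partial k G (p + t *\<^sub>R axis k 1) * h" for h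
      using linear_cmul[OF has_derivative_linear[OF smooth_on_has_derivative[OF \<open>open S\<close> that]]]
      by (simp add: partial_def)
    ultimately show ?thesis
      by (simp add: has_field_derivative_def)
  qed
  define g where "g t = F (x + s *\<^sub>R ?ej + t *\<^sub>R ?ei) - F (x + t *\<^sub>R ?ei)" for t
  have nS: "x + a *\<^sub>R ?ei + b *\<^sub>R ?ej \<in> S" if "0 \<le> a" "a \<le> s" "0 \<le> b" "b \<le> s" for a b
    using nb that assms(3) by blast
  have "\<exists>z>0. z < s \<and> g s - g 0 = (s - 0) * (partial i F (x + s *\<^sub>R ?ej + z *\<^sub>R ?ei) - partial i F (x + z *\<^sub>R ?ei))"
  proof (rule MVT2[OF \<open>s > 0\<close>])
    fix t assume t: "0 \<le> t" "t \<le> s"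
    show "(g has_real_derivative partial i F (x + s *\<^sub>R ?ej + t *\<^sub>R ?ei) - partial i F (x + t *\<^sub>R ?ei)) (at t)"
      unfolding g_def
      by (rule DERIV_diff; rule d[OF assms(2)])
        (use nS[OF t, of s] nS[OF t, of 0] \<open>s > 0\<close> in \<open>auto simp: algebra_simps\<close>)
  qed
  then obtain z where z: "0 < z" "z < s"
    and gz: "g s - g 0 = s * (partial i F (x + s *\<^sub>R ?ej + z *\<^sub>R ?ei) - partial i F (x + z *\<^sub>R ?ei))" by auto
  have "\<exists>w>0. w < s \<and> partial i F (x + z *\<^sub>R ?ei + s *\<^sub>R ?ej) - partial i F (x + z *\<^sub>R ?ei + 0 *\<^sub>R ?ej)
      = (s - 0) * partial j (partial i F) (x + z *\<^sub>R ?ei + w *\<^sub>R ?ej)"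
  proof (rule MVT2[OF \<open>s > 0\<close>])
    fix t assume t: "0 \<le> t" "t \<le> s"
    show "((\<lambda>t. partial i F (x + z *\<^sub>R ?ei + t *\<^sub>R ?ej)) has_real_derivative
          partial j (partial i F) (x + z *\<^sub>R ?ei + t *\<^sub>R ?ej)) (at t)"
      by (rule d[OF smooth_on_partial[OF assms(2)]]) (use nS[of z t] z t in auto)
  qed
  then obtain w where w: "0 < w" "w < s" "partial i F (x + z *\<^sub>R ?ei + s *\<^sub>R ?ej) - partial i F (x + z *\<^sub>R ?ei)
      = s * partial j (partial i F) (x + z *\<^sub>R ?ei + w *\<^sub>R ?ej)" by auto
  show ?thesis
  proof (rule bexI)
    have "g s - g 0 = s * (s * partial j (partial i F) (x + z *\<^sub>R ?ei + w *\<^sub>R ?ej))"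
      using gz w(3) by (simp add: algebra_simps)
    then show "F (x + s *\<^sub>R ?ei + s *\<^sub>R ?ej) - F (x + s *\<^sub>R ?ei) - F (x + s *\<^sub>R ?ej) + F x
        = s\<^sup>2 * partial j (partial i F) (x + z *\<^sub>R ?ei + w *\<^sub>R ?ej)"
      unfolding g_def by (simp add: algebra_simps power2_eq_square)
  qed (use nb z w in auto)
qed

lemma partial_commute_real:
  fixes F :: "real^'n \<Rightarrow> real"
  assumes "open S" "smooth_on S F" "x \<in> S"
  shows "partial i (partial j F) x = partial j (partial i F) x"
proof (rule ccontr)
  assume ne: "partial i (partial j F) x \<noteq> partial j (partial i F) x"
  define e where "e = \<bar>partial i (partial j F) x - partial j (partial i F) x\<bar> / 2"
  have "e > 0" using ne unfolding e_def by simp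
  have "isCont (partial k (partial l F)) x" for k l
    using smooth_on_continuous[OF smooth_on_partial[OF smooth_on_partial[OF assms(2)]]] assms
      continuous_on_eq_continuous_at by blast
  then have "\<exists>d>0. \<forall>y. dist y x < d \<longrightarrow> \<bar>partial k (partial l F) y - partial k (partial l F) x\<bar> < e" for k l
    using \<open>e > 0\<close> unfolding continuous_at_eps_delta dist_real_def by blast
  then obtain d1 d2 where d: "d1 > 0" "d2 > 0"
    "\<And>y. dist y x < d1 \<Longrightarrow> \<bar>partial i (partial j F) y - partial i (partial j F) x\<bar> < e"
    "\<And>y. dist y x < d2 \<Longrightarrow> \<bar>partial j (partial i F) y - partial j (partial i F) x\<bar> < e"
    by metis
  obtain d3 where d3: "d3 > 0" "cball x d3 \<subseteq> S"
    using assms open_contains_cball by blast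
  define \<delta> where "\<delta> = min d3 (min d1 d2 / 2)"
  have \<delta>: "\<delta> > 0" "\<delta> < d1" "\<delta> < d2" "cball x \<delta> \<subseteq> S"
    using d d3 unfolding \<delta>_def by (auto simp: min_def)
  define s where "s = \<delta> / 2"
  have s: "s > 0" "2 * s \<le> \<delta>" using \<delta> s_def by auto
  obtain y where y: "y \<in> cball x \<delta>" "F (x + s *\<^sub>R axis i 1 + s *\<^sub>R axis j 1) - F (x + s *\<^sub>R axis i 1) - F (x + s *\<^sub>R axis j 1) + F x
            = s\<^sup>2 * partial j (partial i F) y"
    using second_difference_mvt[OF assms(1,2) \<delta>(4) s] by blast
  obtain z where z: "z \<in> cball x \<delta>" "F (x + s *\<^sub>R axis j 1 + s *\<^sub>R axis i 1) - F (x + s *\<^sub>R axis j 1) - F (x + s *\<^sub>R axis i 1) + F x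
            = s\<^sup>2 * partial i (partial j F) z"
    using second_difference_mvt[OF assms(1,2) \<delta>(4) s] by blast
  have "s\<^sup>2 * partial j (partial i F) y = s\<^sup>2 * partial i (partial j F) z"
    using y(2) z(2) by (simp add: algebra_simps)
  then have "partial j (partial i F) y = partial i (partial j F) z" using s by simp
  moreover have "\<bar>partial i (partial j F) z - partial i (partial j F) x\<bar> < e"
    using z \<delta> by (intro d) (auto simp: dist_commute)
  moreover have "\<bar>partial j (partial i F) y - partial j (partial i F) x\<bar> < e"
    using y \<delta> by (intro d) (auto simp: dist_commute)
  ultimately show False unfolding e_def by (simp add: field_simps abs_if split: if_splits)
qed

lemma partial_commute:
  fixes F :: "real^'n \<Rightarrow> 'b::euclidean_space"
  assumes "open S" "smooth_on S F" "x \<in> S"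
  shows "partial i (partial j F) x = partial j (partial i F) x"
proof (rule euclidean_eqI)
  fix b :: 'b assume "b \<in> Basis"
  have 1: "partial k (\<lambda>y. G y \<bullet> b) y = partial k G y \<bullet> b" if "smooth_on S G" "y \<in> S" for G k y
    using partial_linear[OF bounded_linear_inner_left smooth_on_differentiable[OF assms(1) that]] .
  have 2: "partial l (partial k (\<lambda>y. F y \<bullet> b)) x = partial l (partial k F) x \<bullet> b" for k l
    using partial_cong[OF assms(1,3), of "partial k (\<lambda>y. F y \<bullet> b)" "\<lambda>y. partial k F y \<bullet> b"]
      1[OF assms(2)] 1[OF smooth_on_partial[OF assms(2)] assms(3)] by simp
  have "smooth_on S (\<lambda>y. F y \<bullet> b)" by (intro smooth_intros assms)
  from partial_commute_real[OF assms(1) this assms(3), of i j]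
  show "partial i (partial j F) x \<bullet> b = partial j (partial i F) x \<bullet> b"
    by (simp add: 2)
qed

section \<open>Taylor expansion\<close>

text \<open>The \<open>q\<close>-th derivative at \<open>x\<close> applied to \<open>q\<close>
  copies of \<open>y\<close>. With \<open>x\<close> fixed it is a homogeneous polynomial of degree
  \<open>q\<close> in \<open>y\<close>, and divided by \<open>fact q\<close> it is the degree
  \<open>q\<close> part of the Taylor expansion. All differentiation acts on \<open>E\<close>, so
  \<open>y\<close> stays outside of the derivatives.\<close>

primrec dir_deriv :: "nat \<Rightarrow> (real^'n \<Rightarrow> real) \<Rightarrow> real^'n \<Rightarrow> real^'n \<Rightarrow> real" where
  "dir_deriv 0 E x y = E x"
| "dir_deriv (Suc q) E x y = (\<Sum>i\<in>UNIV. y $ i * dir_deriv q (partial i E) x y)"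

lemma dir_deriv_cong:
  assumes "open S" "x \<in> S"
  shows "(\<And>z. z \<in> S \<Longrightarrow> E z = F z) \<Longrightarrow> dir_deriv q E x y = dir_deriv q F x y"
proof (induction q arbitrary: E F)
  case 0
  then show ?case using assms by simp
next
  case (Suc q)
  have "dir_deriv q (partial i E) x y = dir_deriv q (partial i F) x y" for i
    by (rule Suc.IH) (rule partial_cong[OF assms(1) _ Suc.prems])
  then show ?case by simp
qed

lemma dir_deriv_sum:
  assumes "open S" "x \<in> S"
  shows "(\<And>i. i \<in> I \<Longrightarrow> smooth_on S (F i)) \<Longrightarrow>
    dir_deriv q (\<lambda>z. \<Sum>i\<in>I. F i z) x y = (\<Sum>i\<in>I. dir_deriv q (F i) x y)"
proof (induction q arbitrary: F)
  case (Suc q)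
  have "dir_deriv q (partial k (\<lambda>z. \<Sum>i\<in>I. F i z)) x y = (\<Sum>i\<in>I. dir_deriv q (partial k (F i)) x y)" for k
  proof -
    have "dir_deriv q (partial k (\<lambda>z. \<Sum>i\<in>I. F i z)) x y = dir_deriv q (\<lambda>z. \<Sum>i\<in>I. partial k (F i) z) x y"
      by (rule dir_deriv_cong[OF assms], rule partial_sum, rule smooth_on_differentiable[OF assms(1) Suc.prems])
    also have "\<dots> = (\<Sum>i\<in>I. dir_deriv q (partial k (F i)) x y)"
      by (rule Suc.IH, rule smooth_on_partial, rule Suc.prems)
    finally show ?thesis .
  qed
  then show ?case by (simp add: sum_distrib_left) (rule sum.swap)
qed simp

lemma dir_deriv_along_line:
  assumes "open S"
  shows "smooth_on S E \<Longrightarrow> x + t *\<^sub>R y \<in> S \<Longrightarrow>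
    ((\<lambda>t. dir_deriv q E (x + t *\<^sub>R y) y) has_real_derivative dir_deriv (Suc q) E (x + t *\<^sub>R y) y) (at t)"
proof (induction q arbitrary: E)
  case 0
  have "((\<lambda>t. E (x + t *\<^sub>R y)) has_derivative
      (\<lambda>h. \<Sum>i\<in>UNIV. (h *\<^sub>R y) $ i *\<^sub>R partial i E (x + t *\<^sub>R y))) (at t)"
    by (rule has_derivative_compose[where f = "\<lambda>t. x + t *\<^sub>R y" and g = E,
          OF _ smooth_on_has_derivative_partials[OF assms 0]]) (auto intro!: derivative_eq_intros)
  then show ?case
    unfolding has_field_derivative_def dir_deriv.simps
    by (rule has_derivative_eq_rhs) (auto simp: fun_eq_iff sum_distrib_left sum_distrib_right algebra_simps)
next
  case (Suc q)
  have "((\<lambda>t. \<Sum>i\<in>UNIV. y $ i * dir_deriv q (partial i E) (x + t *\<^sub>R y) y) has_real_derivative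
     (\<Sum>i\<in>UNIV. y $ i * dir_deriv (Suc q) (partial i E) (x + t *\<^sub>R y) y)) (at t)"
    by (intro DERIV_sum DERIV_cmult Suc.IH smooth_on_partial Suc.prems)
  then show ?case by simp
qed

lemma dir_deriv_bounded:
  assumes "compact K" "K \<subseteq> S"
  shows "smooth_on S E \<Longrightarrow> \<exists>C\<ge>0. \<forall>x\<in>K. \<forall>y. \<bar>dir_deriv q E x y\<bar> \<le> C * norm y ^ q"
proof (induction q arbitrary: E)
  case 0
  have "continuous_on K E" using smooth_on_continuous[OF 0] assms(2) continuous_on_subset by blast
  then have "bounded (E ` K)" using assms(1) compact_continuous_image compact_imp_bounded by blast
  then obtain C where "\<forall>x\<in>K. \<bar>E x\<bar> \<le> C" unfolding bounded_iff by auto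
  then show ?case by (intro exI[of _ "max C 0"]) (auto simp: le_max_iff_disj)
next
  case (Suc q)
  have "\<forall>i. \<exists>C\<ge>0. \<forall>x\<in>K. \<forall>y. \<bar>dir_deriv q (partial i E) x y\<bar> \<le> C * norm y ^ q"
    using Suc.IH smooth_on_partial[OF Suc.prems] by blast
  then obtain C where C: "\<And>i. C i \<ge> 0" "\<And>i x y. x \<in> K \<Longrightarrow> \<bar>dir_deriv q (partial i E) x y\<bar> \<le> C i * norm y ^ q"
    by metis
  have "\<bar>dir_deriv (Suc q) E x y\<bar> \<le> (\<Sum>i\<in>UNIV. C i) * norm y ^ Suc q" if "x \<in> K" for x y
  proof -
    have "\<bar>dir_deriv (Suc q) E x y\<bar> \<le> (\<Sum>i\<in>UNIV. \<bar>y $ i * dir_deriv q (partial i E) x y\<bar>)"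
      by simp
    also have "\<dots> \<le> (\<Sum>i\<in>UNIV. norm y * (C i * norm y ^ q))"
      by (intro sum_mono) (auto simp: abs_mult intro!: mult_mono component_le_norm_cart C that)
    finally show ?thesis by (simp add: sum_distrib_right sum_distrib_left algebra_simps)
  qed
  then show ?case using C(1) by (intro exI[of _ "\<Sum>i\<in>UNIV. C i"]) (auto intro: sum_nonneg)
qed

lemma taylor_bound:
  assumes "open S" "smooth_on S E" "cball 0 r \<subseteq> S"
  shows "\<exists>C\<ge>0. \<forall>y\<in>cball 0 r. \<bar>E y - (\<Sum>q<K. dir_deriv q E 0 y / fact q)\<bar> \<le> C * norm y ^ K"
proof (cases "K = 0")
  case True
  then show ?thesis using dir_deriv_bounded[OF compact_cball assms(3,2), of 0] by auto
next
  case False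
  obtain C where C: "C \<ge> 0" "\<And>x y. x \<in> cball 0 r \<Longrightarrow> \<bar>dir_deriv K E x y\<bar> \<le> C * norm y ^ K"
    using dir_deriv_bounded[OF compact_cball assms(3,2)] by blast
  have "\<bar>E y - (\<Sum>q<K. dir_deriv q E 0 y / fact q)\<bar> \<le> C * norm y ^ K" if y: "y \<in> cball 0 r" for y
  proof -
    have ty: "t *\<^sub>R y \<in> cball 0 r" if "0 \<le> t" "t \<le> 1" for t
    proof -
      have "norm (t *\<^sub>R y) \<le> norm y" using that by (simp add: mult_left_le_one_le)
      then show ?thesis using y by simp
    qed
    have "\<exists>t>0. t < 1 \<and> E (1 *\<^sub>R y) = (\<Sum>m<K. dir_deriv m E (0 *\<^sub>R y) y / fact m * 1 ^ m) + dir_deriv K E (t *\<^sub>R y) y / fact K * 1 ^ K"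
    proof (rule Maclaurin)
      show "\<forall>m t. m < K \<and> 0 \<le> t \<and> t \<le> 1 \<longrightarrow>
          ((\<lambda>t. dir_deriv m E (t *\<^sub>R y) y) has_real_derivative dir_deriv (Suc m) E (t *\<^sub>R y) y) (at t)"
      proof (intro allI impI)
        fix m t assume "m < K \<and> 0 \<le> t \<and> (t::real) \<le> 1"
        then have "t *\<^sub>R y \<in> S" using ty assms(3) by blast
        then show "((\<lambda>t. dir_deriv m E (t *\<^sub>R y) y) has_real_derivative dir_deriv (Suc m) E (t *\<^sub>R y) y) (at t)"
          using dir_deriv_along_line[OF assms(1,2), of 0 t y m] by simp
      qed
    qed (use False in auto)
    then obtain t where t: "0 < t" "t < 1" "E y - (\<Sum>m<K. dir_deriv m E 0 y / fact m) = dir_deriv K E (t *\<^sub>R y) y / fact K"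
      by auto
    have "\<bar>dir_deriv K E (t *\<^sub>R y) y / fact K\<bar> \<le> \<bar>dir_deriv K E (t *\<^sub>R y) y\<bar>"
      by (simp add: divide_le_eq mult_le_cancel_left1 fact_ge_1)
    also have "\<dots> \<le> C * norm y ^ K" using t by (intro C ty) auto
    finally show ?thesis using t(3) by simp
  qed
  then show ?thesis using C(1) by blast
qed

lemma dir_deriv_scale: "dir_deriv q E x (c *\<^sub>R y) = c ^ q * dir_deriv q E x y"
  by (induction q arbitrary: E) (simp_all add: sum_distrib_left algebra_simps)

lemma dir_deriv_continuous: "continuous_on UNIV (\<lambda>y. dir_deriv q E x y)"
  by (induction q arbitrary: E) (auto intro!: continuous_intros)

text \<open>This is the gradient in the variable \<open>y\<close>, not in the base point. By
  symmetry of mixed partial derivatives the \<open>q\<close> slots contribute equally, which gives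
  the factor \<open>q\<close>. For \<open>q = 0\<close> the truncated \<open>q - 1\<close> is
  harmless, since the factor is zero.\<close>

lemma dir_deriv_has_derivative:
  assumes "open S" "x \<in> S"
  shows "smooth_on S E \<Longrightarrow> ((\<lambda>y. dir_deriv q E x y) has_derivative
    (\<lambda>h. \<Sum>i\<in>UNIV. h $ i * (real q * dir_deriv (q - 1) (partial i E) x y))) (at y)"
proof (induction q arbitrary: E)
  case 0
  then show ?case by simp
next
  case (Suc q)
  have "((\<lambda>y. dir_deriv (Suc q) E x y) has_derivative (\<lambda>h. \<Sum>i\<in>UNIV.
      y $ i * (\<Sum>j\<in>UNIV. h $ j * (real q * dir_deriv (q - 1) (partial j (partial i E)) x y))
      + h $ i * dir_deriv q (partial i E) x y)) (at y)"
    unfolding dir_deriv.simps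
    by (intro has_derivative_sum has_derivative_mult Suc.IH smooth_on_partial Suc.prems
        bounded_linear.has_derivative[OF bounded_linear_vec_nth has_derivative_ident])
  moreover have "(\<Sum>i\<in>UNIV. y $ i * (\<Sum>j\<in>UNIV. h $ j * (real q * dir_deriv (q - 1) (partial j (partial i E)) x y))
      + h $ i * dir_deriv q (partial i E) x y)
      = (\<Sum>i\<in>UNIV. h $ i * (real (Suc q) * dir_deriv (Suc q - 1) (partial i E) x y))" for h
  proof -
    have *: "real q * (\<Sum>i\<in>UNIV. y $ i * dir_deriv (q - 1) (partial j (partial i E)) x y) = real q * dir_deriv q (partial j E) x y" for j
    proof (cases q)
      case (Suc p)
      have "dir_deriv p (partial j (partial i E)) x y = dir_deriv p (partial i (partial j E)) x y" for i
        by (rule dir_deriv_cong[OF assms], rule partial_commute[OF assms(1) Suc.prems])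
      then show ?thesis by (simp add: Suc)
    qed simp
    have "(\<Sum>i\<in>UNIV. y $ i * (\<Sum>j\<in>UNIV. h $ j * (real q * dir_deriv (q - 1) (partial j (partial i E)) x y)))
      = (\<Sum>j\<in>UNIV. h $ j * (real q * (\<Sum>i\<in>UNIV. y $ i * dir_deriv (q - 1) (partial j (partial i E)) x y)))"
      by (simp add: sum_distrib_left algebra_simps) (rule sum.swap)
    also have "\<dots> = (\<Sum>j\<in>UNIV. h $ j * (real q * dir_deriv q (partial j E) x y))"
      by (simp only: *)
    finally show ?thesis by (simp add: sum.distrib algebra_simps)
  qed
  ultimately show ?case by (simp only:)
qed

text \<open>Letting \<open>t\<close> tend to \<open>0\<close> kills the constant coefficient; the
  remaining sum has a factor \<open>t\<close> that can be divided out on both sides, and the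
  induction continues with the shifted coefficients.\<close>

lemma polynomial_vanishing_order:
  fixes a :: "nat \<Rightarrow> real"
  assumes "\<delta> > 0"
  shows "(\<And>t. 0 < t \<Longrightarrow> t < \<delta> \<Longrightarrow> \<bar>\<Sum>q<p. a q * t ^ q\<bar> \<le> C * t ^ p) \<Longrightarrow> q < p \<Longrightarrow> a q = 0"
proof (induction p arbitrary: a q)
  case (Suc p)
  have split: "(\<Sum>q<Suc p. a q * t ^ q) = a 0 + t * (\<Sum>q<p. a (Suc q) * t ^ q)" for t
    by (subst sum.lessThan_Suc_shift) (simp add: sum_distrib_left algebra_simps)
  have ev: "eventually (\<lambda>t. 0 < t \<and> t < \<delta>) (at_right 0)"
    using assms eventually_at_right_field by blast
  have "((\<lambda>t. \<Sum>q<Suc p. a q * t ^ q) \<longlongrightarrow> 0) (at_right 0)"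
  proof (rule Lim_null_comparison)
    show "eventually (\<lambda>t. norm (\<Sum>q<Suc p. a q * t ^ q) \<le> C * t ^ Suc p) (at_right 0)"
      using ev by eventually_elim (use Suc.prems(1) in auto)
    show "((\<lambda>t. C * t ^ Suc p) \<longlongrightarrow> 0) (at_right (0::real))"
      by (auto intro!: tendsto_eq_intros)
  qed
  moreover have "((\<lambda>t. \<Sum>q<Suc p. a q * t ^ q) \<longlongrightarrow> a 0) (at_right 0)"
    unfolding split by (auto intro!: tendsto_eq_intros)
  ultimately have a0: "a 0 = 0"
    using tendsto_unique trivial_limit_at_right_real by blast
  have "\<bar>\<Sum>q<p. a (Suc q) * t ^ q\<bar> \<le> C * t ^ p" if "0 < t" "t < \<delta>" for t
  proof -
    have "t * \<bar>\<Sum>q<p. a (Suc q) * t ^ q\<bar> \<le> t * (C * t ^ p)"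
      using Suc.prems(1)[OF that] that unfolding split a0 by (simp add: abs_mult algebra_simps)
    then show ?thesis using that by (simp only: mult_le_cancel_left_pos)
  qed
  then have "a (Suc j) = 0" if "j < p" for j
    using Suc.IH[of "\<lambda>q. a (Suc q)" j] that by blast
  then show ?case using a0 Suc.prems(2) by (cases q) auto
qed simp

lemma dir_deriv_vanishing_order:
  assumes "open S" "smooth_on S E" "cball 0 r \<subseteq> S" "r > 0"
    and "\<And>y. y \<in> cball 0 r \<Longrightarrow> \<bar>E y\<bar> \<le> C * norm y ^ p" and "q < p"
  shows "dir_deriv q E 0 y = 0"
proof -
  obtain D where D: "D \<ge> 0" "\<And>y. y \<in> cball 0 r \<Longrightarrow> \<bar>E y - (\<Sum>q<p. dir_deriv q E 0 y / fact q)\<bar> \<le> D * norm y ^ p"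
    using taylor_bound[OF assms(1-3), of p] by blast
  \<comment> \<open>The polynomial argument is run along the ray through \<open>y\<close>. Adding 1
    to the norm keeps the parameter interval meaningful when \<open>y = 0\<close>.\<close>
  have pos: "r / (norm y + 1) > 0" using \<open>r > 0\<close> by (intro divide_pos_pos) (auto simp: add_nonneg_pos)
  have "dir_deriv q E 0 y / fact q = 0"
  proof (rule polynomial_vanishing_order[OF pos _ \<open>q < p\<close>, of "\<lambda>q. dir_deriv q E 0 y / fact q" "(C + D) * norm y ^ p"])
    fix t assume t: "0 < t" "t < r / (norm y + 1)"
    have "norm (t *\<^sub>R y) \<le> t * (norm y + 1)" using t by simp
    also have "\<dots> \<le> r"
      using t(2) pos_less_divide_eq[of "norm y + 1" t r] by (simp add: add_nonneg_pos)
    finally have ty: "t *\<^sub>R y \<in> cball 0 r" by simp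
    have "\<bar>\<Sum>q<p. dir_deriv q E 0 (t *\<^sub>R y) / fact q\<bar> \<le> C * norm (t *\<^sub>R y) ^ p + D * norm (t *\<^sub>R y) ^ p"
      using D(2)[OF ty] assms(5)[OF ty] by linarith
    then show "\<bar>\<Sum>q<p. dir_deriv q E 0 y / fact q * t ^ q\<bar> \<le> (C + D) * norm y ^ p * t ^ p"
      using t by (simp add: dir_deriv_scale power_mult_distrib algebra_simps)
  qed
  then show ?thesis by simp
qed

section \<open>Integrals of homogeneous functions\<close>

text \<open>For \<open>p\<close> homogeneous of degree \<open>q\<close> this is the integral of \<open>p\<close> over the unit sphere,
  expressed through the ball to avoid surface measure.\<close>

definition sphere_integral :: "nat \<Rightarrow> (real^'n \<Rightarrow> real) \<Rightarrow> real" where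
  "sphere_integral q p = real (CARD('n) + q) * (LINT y:cball 0 1|lborel. p y)"

lemma integrable_cball_continuous:
  fixes p :: "real^'n \<Rightarrow> 'b::{banach, second_countable_topology}"
  assumes "continuous_on UNIV p"
  shows "set_integrable lborel (cball 0 R) p"
  unfolding set_integrable_def
  by (rule borel_integrable_compact[OF compact_cball continuous_on_subset[OF assms]]) simp

lemma cball_borel [measurable]: "cball (a :: 'a::euclidean_space) r \<in> sets borel"
  by simp

lemma sphere_integral_add:
  assumes "continuous_on UNIV p" "continuous_on UNIV p'"
  shows "sphere_integral q (\<lambda>y. p y + p' y) = sphere_integral q p + sphere_integral q p'"
  unfolding sphere_integral_def
  by (subst set_integral_add(2)[OF integrable_cball_continuous[OF assms(1)] integrable_cball_continuous[OF assms(2)]])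
    (simp add: algebra_simps)

lemma sphere_integral_diff:
  assumes "continuous_on UNIV p" "continuous_on UNIV p'"
  shows "sphere_integral q (\<lambda>y. p y - p' y) = sphere_integral q p - sphere_integral q p'"
  unfolding sphere_integral_def
  by (subst set_integral_diff(2)[OF integrable_cball_continuous[OF assms(1)] integrable_cball_continuous[OF assms(2)]])
    (simp add: algebra_simps)

lemma sphere_integral_cmult: "sphere_integral q (\<lambda>y. c * p y) = c * sphere_integral q p"
  unfolding sphere_integral_def by simp

lemma sphere_integral_sum:
  fixes p :: "'i \<Rightarrow> real^'n \<Rightarrow> real"
  assumes "\<And>i. i \<in> I \<Longrightarrow> continuous_on UNIV (p i)"
  shows "sphere_integral q (\<lambda>y. \<Sum>i\<in>I. p i y) = (\<Sum>i\<in>I. sphere_integral q (p i))"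
  using assms
proof (induction I rule: infinite_finite_induct)
  case (insert i I)
  have "sphere_integral q (\<lambda>y. \<Sum>i\<in>insert i I. p i y) = sphere_integral q (\<lambda>y. p i y + (\<Sum>i\<in>I. p i y))"
    using insert by simp
  also have "\<dots> = sphere_integral q (p i) + sphere_integral q (\<lambda>y. \<Sum>i\<in>I. p i y)"
    by (intro sphere_integral_add continuous_on_sum insert) auto
  finally show ?case using insert by simp
qed (simp_all add: sphere_integral_def)

lemma sphere_integral_odd:
  fixes p :: "real^'n \<Rightarrow> real"
  assumes cont: "continuous_on UNIV p" and "\<And>y. p (- y) = - p y"
  shows "sphere_integral q p = 0"
proof -
  have [measurable]: "p \<in> borel_measurable borel" using cont by (rule borel_measurable_continuous_onI)
  have "(LINT y:cball 0 1|lborel. p y) = (LINT y:cball 0 1|distr lborel borel (\<lambda>y. - y). p y)"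
    using lborel_affine[of "-1::real" "0::real^'n"] by (simp add: density_1)
  also have "\<dots> = (LINT y:cball 0 1|lborel. - p y)"
    unfolding set_lebesgue_integral_def
    by (subst integral_distr) (auto simp: assms indicator_def intro!: Bochner_Integration.integral_cong)
  also have "\<dots> = - (LINT y:cball 0 1|lborel. p y)"
    by (simp add: set_lebesgue_integral_def)
  finally show ?thesis by (simp add: sphere_integral_def)
qed

lemma nn_integral_cball_homogeneous:
  fixes p :: "real^'n \<Rightarrow> real"
  assumes [measurable]: "p \<in> borel_measurable borel" and pos: "\<And>y. p y \<ge> 0"
    and hom: "\<And>c y. c > 0 \<Longrightarrow> p (c *\<^sub>R y) = c ^ q * p y" and "a \<ge> 0"
  shows "(\<integral>\<^sup>+y. indicator (cball 0 a) y * ennreal (p y) \<partial>lborel) =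
    ennreal (a ^ (CARD('n) + q)) * (\<integral>\<^sup>+y. indicator (cball 0 1) y * ennreal (p y) \<partial>lborel)"
proof (cases "a = 0")
  case True
  have "(\<integral>\<^sup>+y. indicator (cball 0 a) y * ennreal (p y) \<partial>lborel) = (\<integral>\<^sup>+(y::real^'n). 0 \<partial>lborel)"
    by (rule nn_integral_cong_AE, use AE_lborel_singleton[of "0::real^'n"] in eventually_elim) (simp add: True)
  then show ?thesis using True by simp
next
  case False
  then have a: "a > 0" using assms by simp
  have "(\<integral>\<^sup>+y. indicator (cball 0 a) y * ennreal (p y) \<partial>lborel) =
     (\<integral>\<^sup>+y. indicator (cball 0 a) y * ennreal (p y) \<partial>density (distr lborel borel (\<lambda>x. 0 + a *\<^sub>R x)) (\<lambda>_. ennreal (\<bar>a\<bar> ^ DIM(real^'n))))"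
    using lborel_affine[of a "0::real^'n"] a by simp
  also have "\<dots> = (\<integral>\<^sup>+y. ennreal (a ^ CARD('n)) * (indicator (cball 0 a) (a *\<^sub>R y) * ennreal (p (a *\<^sub>R y))) \<partial>lborel)"
    using a by (subst nn_integral_density, measurable, subst nn_integral_distr, measurable)
  also have "\<dots> = (\<integral>\<^sup>+y. ennreal (a ^ (CARD('n) + q)) * (indicator (cball 0 1) y * ennreal (p y)) \<partial>lborel)"
  proof (rule nn_integral_cong)
    fix y :: "real^'n"
    have "(indicator (cball 0 a) (a *\<^sub>R y) :: ennreal) = indicator (cball 0 1) y"
      using a by (simp add: indicator_def mult_le_cancel_left1)
    then show "ennreal (a ^ CARD('n)) * (indicator (cball 0 a) (a *\<^sub>R y) * ennreal (p (a *\<^sub>R y))) =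
        ennreal (a ^ (CARD('n) + q)) * (indicator (cball 0 1) y * ennreal (p y))"
      using a pos[of y] by (simp add: hom ennreal_mult power_add algebra_simps)
  qed
  also have "\<dots> = ennreal (a ^ (CARD('n) + q)) * (\<integral>\<^sup>+y. indicator (cball 0 1) y * ennreal (p y) \<partial>lborel)"
    by (rule nn_integral_cmult) measurable
  finally show ?thesis .
qed

lemma nn_integral_cball_continuous:
  fixes p :: "real^'n \<Rightarrow> real"
  assumes "continuous_on UNIV p" "\<And>y. p y \<ge> 0"
  shows "(\<integral>\<^sup>+y. indicator (cball 0 a) y * ennreal (p y) \<partial>lborel) = ennreal (LINT y:cball 0 a|lborel. p y)"
proof -
  have "(\<integral>\<^sup>+y. ennreal (indicator (cball 0 a) y *\<^sub>R p y) \<partial>lborel) = ennreal (LINT y:cball 0 a|lborel. p y)"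
    unfolding set_lebesgue_integral_def
    using integrable_cball_continuous[OF assms(1)] assms(2)
    by (intro nn_integral_eq_integral) (auto simp: set_integrable_def)
  moreover have "ennreal (indicator (cball 0 a) y *\<^sub>R p y) = indicator (cball 0 a) y * ennreal (p y)" for y
    by (simp add: indicator_def)
  ultimately show ?thesis by simp
qed

text \<open>Polar coordinates for homogeneous weights: scaling gives the weighted measure of a ball
  of radius \<open>a\<close> as a constant times \<open>a ^ (CARD('n) + q)\<close>, and
  differentiating in \<open>a\<close> yields the density on the half line. Both measures are finite,
  so comparing them on the rays \<open>{x<..}\<close> is enough.\<close>

lemma distr_norm_homogeneous:
  fixes p :: "real^'n \<Rightarrow> real"
  assumes cont: "continuous_on UNIV p" and pos: "\<And>y. p y \<ge> 0"
    and hom: "\<And>c y. c > 0 \<Longrightarrow> p (c *\<^sub>R y) = c ^ q * p y" and R: "R > 0"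
  shows "distr (density lborel (\<lambda>y. ennreal (indicat_real (cball 0 R) y * p y))) borel norm =
    density lborel (\<lambda>r. ennreal (indicat_real {0..R} r * (sphere_integral q p * r ^ (CARD('n) + q - 1))))"
    (is "?M1 = ?M2")
proof -
  let ?m = "CARD('n) + q"
  define c where "c = (LINT y:cball 0 1|lborel. p y)"
  have c: "c \<ge> 0" unfolding c_def set_lebesgue_integral_def using pos by (intro integral_nonneg_AE) simp
  have mpos: "?m > 0" by simp
  have [measurable]: "p \<in> borel_measurable borel" using cont by (rule borel_measurable_continuous_onI)
  have ball: "(\<integral>\<^sup>+y. indicator (cball 0 a) y * ennreal (p y) \<partial>lborel) = ennreal (a ^ ?m * c)" if "a \<ge> 0" for a
    using nn_integral_cball_homogeneous[OF \<open>p \<in> borel_measurable borel\<close> pos hom that]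
      nn_integral_cball_continuous[OF cont pos, of 1] that c
    by (simp add: c_def ennreal_mult)
  have e1: "emeasure ?M1 A = (\<integral>\<^sup>+y. indicator A (norm y) * (indicator (cball 0 R) y * ennreal (p y)) \<partial>lborel)"
    if [measurable]: "A \<in> sets borel" for A
  proof -
    have [measurable]: "norm -` A \<in> sets (borel :: (real^'n) measure)"
      using measurable_sets[of norm borel borel A] by simp
    show ?thesis
      by (subst emeasure_distr, measurable, subst emeasure_density, measurable)
        (auto intro!: nn_integral_cong simp: indicator_def)
  qed
  have e2: "emeasure ?M2 A = (\<integral>\<^sup>+r. indicator A r * (indicator {0..R} r * ennreal (sphere_integral q p * r ^ (?m - 1))) \<partial>lborel)"
    if [measurable]: "A \<in> sets borel" for A
    by (subst emeasure_density, measurable) (auto intro!: nn_integral_cong simp: indicator_def)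
  have S: "sphere_integral q p = real ?m * c" by (simp add: sphere_integral_def c_def)
  have seg: "(\<integral>\<^sup>+r. indicator {a..R} r * ennreal (sphere_integral q p * r ^ (?m - 1)) \<partial>lborel) = ennreal (R ^ ?m * c - a ^ ?m * c)"
    if "0 \<le> a" "a \<le> R" for a
  proof -
    have "(\<integral>\<^sup>+r. ennreal (sphere_integral q p * r ^ (?m - 1)) * indicator {a..R} r \<partial>lborel) = ennreal (R ^ ?m * c - a ^ ?m * c)"
    proof (rule nn_integral_FTC_Icc[where F = "\<lambda>r. r ^ ?m * c"])
      show "((\<lambda>r. r ^ ?m * c) has_real_derivative sphere_integral q p * r ^ (?m - 1)) (at r)" for r
        unfolding S by (auto intro!: derivative_eq_intros)
      show "0 \<le> sphere_integral q p * x ^ (?m - 1)" if "x \<in> {a..R}" for x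
        unfolding S using that \<open>0 \<le> a\<close> c by simp
    qed (use that in auto)
    then show ?thesis by (simp add: mult.commute)
  qed
  have fin: "emeasure ?M1 UNIV = ennreal (R ^ ?m * c)"
    using e1[of UNIV] ball[of R] R by simp
  have main: "emeasure ?M1 {x<..} = emeasure ?M2 {x<..}" for x
  proof (cases "x < 0")
    case True
    have "emeasure ?M1 {x<..} = (\<integral>\<^sup>+y. indicator (cball 0 R) y * ennreal (p y) \<partial>lborel)"
      using True by (subst e1) (auto intro!: nn_integral_cong simp: indicator_def less_le_trans[OF _ norm_ge_zero])
    also have "\<dots> = ennreal (R ^ ?m * c)" using ball R by simp
    also have "\<dots> = (\<integral>\<^sup>+r. indicator {0..R} r * ennreal (sphere_integral q p * r ^ (?m - 1)) \<partial>lborel)"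
      using seg[of 0] R zero_power[OF mpos, where 'a = real] by simp
    also have "\<dots> = emeasure ?M2 {x<..}"
      using True by (subst e2) (auto intro!: nn_integral_cong simp: indicator_def)
    finally show ?thesis .
  next
    case False
    show ?thesis
    proof (cases "x \<le> R")
      case True
      have "emeasure ?M1 {x<..} + ennreal (x ^ ?m * c) = ennreal (R ^ ?m * c)"
      proof -
        have "emeasure ?M1 {x<..} + ennreal (x ^ ?m * c) =
          (\<integral>\<^sup>+y. indicator {x<..} (norm y) * (indicator (cball 0 R) y * ennreal (p y)) + indicator (cball 0 x) y * ennreal (p y) \<partial>lborel)"
          using False by (subst e1) (auto simp: ball[symmetric] intro!: nn_integral_add[symmetric])
        also have "\<dots> = (\<integral>\<^sup>+y. indicator (cball 0 R) y * ennreal (p y) \<partial>lborel)"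
          using True by (intro nn_integral_cong) (auto simp: indicator_def)
        finally show ?thesis using ball[of R] R by simp
      qed
      then have "emeasure ?M1 {x<..} = ennreal (R ^ ?m * c) - ennreal (x ^ ?m * c)"
        by (metis ennreal_add_diff_cancel_right ennreal_neq_top)
      also have "\<dots> = ennreal (R ^ ?m * c - x ^ ?m * c)"
        using False c by (intro ennreal_minus) simp
      also have "\<dots> = (\<integral>\<^sup>+r. indicator {x..R} r * ennreal (sphere_integral q p * r ^ (?m - 1)) \<partial>lborel)"
        using seg[of x] False True by simp
      also have "\<dots> = emeasure ?M2 {x<..}"
        using False by (subst e2, simp, intro nn_integral_cong_AE, use AE_lborel_singleton[of x] in eventually_elim)
          (auto simp: indicator_def)
      finally show ?thesis .
    next
      case R': False
      have "emeasure ?M1 {x<..} = (\<integral>\<^sup>+(y::real^'n). 0 \<partial>lborel)"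
        using R' by (subst e1, simp, intro nn_integral_cong) (auto simp: indicator_def)
      moreover have "emeasure ?M2 {x<..} = (\<integral>\<^sup>+(r::real). 0 \<partial>lborel)"
        using R' by (subst e2, simp, intro nn_integral_cong) (auto simp: indicator_def)
      ultimately have "emeasure ?M1 {x<..} = 0" "emeasure ?M2 {x<..} = 0" by simp_all
      then show ?thesis by simp
    qed
  qed
  show ?thesis
  proof (rule measure_eqI_lessThan)
    show "emeasure ?M1 {x<..} < \<infinity>" for x
    proof -
      have "emeasure ?M1 {x<..} \<le> emeasure ?M1 UNIV" by (rule emeasure_mono) auto
      also have "\<dots> < \<infinity>" using fin by simp
      finally show ?thesis .
    qed
  qed (use main in auto)
qed

text \<open>Apart from the weight \<open>p\<close> the integrand depends on the norm only, so it is
  transported to the half line by the image measure just computed.\<close>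

lemma radial_integral_nonneg:
  fixes p :: "real^'n \<Rightarrow> real" and \<rho> :: "real \<Rightarrow> complex"
  assumes cont: "continuous_on UNIV p" and pos: "\<And>y. p y \<ge> 0"
    and hom: "\<And>c y. c > 0 \<Longrightarrow> p (c *\<^sub>R y) = c ^ q * p y" and R: "R > 0"
    and [measurable]: "\<rho> \<in> borel_measurable borel"
    and int: "set_integrable lborel {0..R} (\<lambda>r. r ^ (CARD('n) + q - 1) *\<^sub>R \<rho> r)"
  shows "set_integrable lborel (cball 0 R) (\<lambda>y. p y *\<^sub>R \<rho> (norm y))"
    and "(LINT y:cball 0 R|lborel. p y *\<^sub>R \<rho> (norm y)) =
      sphere_integral q p *\<^sub>R (LINT r:{0..R}|lborel. r ^ (CARD('n) + q - 1) *\<^sub>R \<rho> r)"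
proof -
  let ?m = "CARD('n) + q"
  have [measurable]: "p \<in> borel_measurable borel" using cont by (rule borel_measurable_continuous_onI)
  have S: "sphere_integral q p \<ge> 0"
    unfolding sphere_integral_def set_lebesgue_integral_def using pos
    by (intro mult_nonneg_nonneg integral_nonneg_AE) auto
  let ?g = "\<lambda>y::real^'n. indicat_real (cball 0 R) y * p y"
  let ?h = "\<lambda>r. indicat_real {0..R} r * (sphere_integral q p * r ^ (?m - 1))"
  have eq: "distr (density lborel ?g) borel norm = density lborel ?h"
    by (rule distr_norm_homogeneous[OF cont pos hom R])
  have h0: "?h r \<ge> 0" for r using S by (auto simp: indicator_def)
  have "integrable (density lborel ?h) \<rho> \<longleftrightarrow> integrable lborel (\<lambda>r. ?h r *\<^sub>R \<rho> r)"
    by (rule integrable_density) (use h0 in auto)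
  moreover have "integrable lborel (\<lambda>r. sphere_integral q p *\<^sub>R (indicator {0..R} r *\<^sub>R r ^ (?m - 1) *\<^sub>R \<rho> r))"
    using int unfolding set_integrable_def by (intro integrable_scaleR_right) simp
  then have "integrable lborel (\<lambda>r. ?h r *\<^sub>R \<rho> r)"
    by (simp add: algebra_simps)
  ultimately have "integrable (distr (density lborel ?g) borel norm) \<rho>" using eq by simp
  then have "integrable (density lborel ?g) (\<lambda>y. \<rho> (norm y))"
    by (subst (asm) integrable_distr_eq) auto
  then have "integrable lborel (\<lambda>y. ?g y *\<^sub>R \<rho> (norm y))"
    by (subst (asm) integrable_density) (auto simp: pos)
  then show "set_integrable lborel (cball 0 R) (\<lambda>y. p y *\<^sub>R \<rho> (norm y))"
    by (simp add: set_integrable_def)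
  have "(LINT y:cball 0 R|lborel. p y *\<^sub>R \<rho> (norm y)) = (LINT y|density lborel ?g. \<rho> (norm y))"
    unfolding set_lebesgue_integral_def by (subst integral_density) (auto simp: pos)
  also have "\<dots> = (LINT r|distr (density lborel ?g) borel norm. \<rho> r)"
    by (subst integral_distr) auto
  also have "\<dots> = (LINT r|lborel. ?h r *\<^sub>R \<rho> r)"
    by (subst eq, rule integral_density) (use h0 in auto)
  also have "\<dots> = (LINT r|lborel. sphere_integral q p *\<^sub>R (indicator {0..R} r *\<^sub>R r ^ (?m - 1) *\<^sub>R \<rho> r))"
    by (simp add: algebra_simps)
  finally show "(LINT y:cball 0 R|lborel. p y *\<^sub>R \<rho> (norm y)) =
      sphere_integral q p *\<^sub>R (LINT r:{0..R}|lborel. r ^ (?m - 1) *\<^sub>R \<rho> r)"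
    by (simp only: integral_scaleR_right set_lebesgue_integral_def)
qed

text \<open>Positive and negative parts of \<open>p\<close> are again homogeneous, but under
  positive scaling only, which is why \<open>hom\<close> is stated for \<open>c > 0\<close>. The
  signed case is the difference of the two nonnegative ones.\<close>

lemma radial_integral:
  fixes p :: "real^'n \<Rightarrow> real" and \<rho> :: "real \<Rightarrow> complex"
  assumes cont: "continuous_on UNIV p"
    and hom: "\<And>c y. c > 0 \<Longrightarrow> p (c *\<^sub>R y) = c ^ q * p y" and R: "R > 0"
    and \<rho>: "\<rho> \<in> borel_measurable borel"
    and int: "set_integrable lborel {0..R} (\<lambda>r. r ^ (CARD('n) + q - 1) *\<^sub>R \<rho> r)"
  shows "set_integrable lborel (cball 0 R) (\<lambda>y. p y *\<^sub>R \<rho> (norm y))"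
    and "(LINT y:cball 0 R|lborel. p y *\<^sub>R \<rho> (norm y)) =
      sphere_integral q p *\<^sub>R (LINT r:{0..R}|lborel. r ^ (CARD('n) + q - 1) *\<^sub>R \<rho> r)"
proof -
  define p1 p2 where "p1 y = max (p y) 0" and "p2 y = max (- p y) 0" for y
  have c: "continuous_on UNIV p1" "continuous_on UNIV p2"
    unfolding p1_def p2_def by (intro continuous_intros cont)+
  have pos: "p1 y \<ge> 0" "p2 y \<ge> 0" for y unfolding p1_def p2_def by auto
  have mx: "max (t * a) 0 = t * max a 0" if "t > 0" for t a :: real
    using that by (auto simp: max_def mult_le_0_iff zero_le_mult_iff)
  have h: "p1 (c *\<^sub>R y) = c ^ q * p1 y" "p2 (c *\<^sub>R y) = c ^ q * p2 y" if "c > 0" for c y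
    using mx[of "c ^ q" "p y"] mx[of "c ^ q" "- p y"] that unfolding p1_def p2_def hom[OF that] by auto
  have d: "p y = p1 y - p2 y" for y unfolding p1_def p2_def by (simp add: max_def)
  have S: "sphere_integral q p = sphere_integral q p1 - sphere_integral q p2"
    unfolding d[abs_def] by (rule sphere_integral_diff[OF c])
  note r1 = radial_integral_nonneg[OF c(1) pos(1) h(1) R \<rho> int]
  note r2 = radial_integral_nonneg[OF c(2) pos(2) h(2) R \<rho> int]
  show "set_integrable lborel (cball 0 R) (\<lambda>y. p y *\<^sub>R \<rho> (norm y))"
    unfolding d scaleR_diff_left by (rule set_integral_diff(1)[OF r1(1) r2(1)])
  show "(LINT y:cball 0 R|lborel. p y *\<^sub>R \<rho> (norm y)) =
      sphere_integral q p *\<^sub>R (LINT r:{0..R}|lborel. r ^ (CARD('n) + q - 1) *\<^sub>R \<rho> r)"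
    unfolding S d scaleR_diff_left using set_integral_diff(2)[OF r1(1) r2(1)] r1(2) r2(2) by simp
qed

section \<open>Divergence theorem and Pizzetti's formula\<close>

text \<open>Difference quotients of a compactly supported function have integral zero by translation
  invariance of Lebesgue measure, and dominated convergence passes this to the derivative. No
  iterated integrals are involved.\<close>

lemma integral_partial_eq_0:
  fixes H :: "real^'n \<Rightarrow> real"
  assumes der: "\<And>y. (H has_derivative H' y) (at y)" and cont: "continuous_on UNIV (\<lambda>y. H' y (axis i 1))"
    and supp: "\<And>y. norm y > 1 \<Longrightarrow> H y = 0"
  shows "(LINT y|lborel. H' y (axis i 1)) = 0"
proof -
  define e :: "real^'n" where "e = axis i 1"
  define g where "g y = H' y e" for y
  have e1: "norm e = 1" by (simp add: e_def norm_axis_1)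
  have g0: "g y = 0" if "norm y > 1" for y
  proof -
    have o: "open {y::real^'n. norm y > 1}" by (intro open_Collect_less continuous_intros)
    have "(H has_derivative (\<lambda>_. 0)) (at y)"
      by (rule has_derivative_transform_within_open[OF has_derivative_const[of 0] o]) (use that supp in auto)
    then have "H' y = (\<lambda>_. 0)" using der has_derivative_unique by blast
    then show ?thesis by (simp add: g_def)
  qed
  have g_cont: "continuous_on UNIV g" using cont by (simp add: g_def[abs_def] e_def)
  have "compact (g ` cball 0 1)"
    by (intro compact_continuous_image continuous_on_subset[OF g_cont]) auto
  then have "bounded (g ` cball 0 1)" by (rule compact_imp_bounded)
  then obtain B where "\<forall>z\<in>g ` cball 0 1. norm z \<le> B"
    unfolding bounded_iff by blast
  then have B: "\<bar>g y\<bar> \<le> B" if "y \<in> cball 0 1" for y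
    using that by (simp del: mem_cball)
  have B0: "B \<ge> 0" using B[of 0] by simp
  have gB: "\<bar>g y\<bar> \<le> B" for y
    using B[of y] g0[of y] B0 by (cases "norm y \<le> 1") auto
  have H_cont: "continuous_on UNIV H"
    using der has_derivative_continuous continuous_at_imp_continuous_on by blast
  have [measurable]: "H \<in> borel_measurable borel" using H_cont by (rule borel_measurable_continuous_onI)
  have H_int: "integrable lborel H"
  proof -
    have "set_integrable lborel (cball 0 1) H" by (rule integrable_cball_continuous[OF H_cont])
    moreover have "(\<lambda>y. indicat_real (cball 0 1) y *\<^sub>R H y) = H"
      using supp by (auto simp: fun_eq_iff indicator_def)
    ultimately show ?thesis by (simp add: set_integrable_def)
  qed
  define t where "t k = 1 / real (Suc k)" for k
  have t: "0 < t k" "t k \<le> 1" for k by (auto simp: t_def)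
  have tr: "integrable lborel (\<lambda>y. H (y + v))" "(LINT y|lborel. H (y + v)) = (LINT y|lborel. H y)" for v
  proof -
    have *: "lborel = distr lborel borel (\<lambda>y::real^'n. y + v)"
      using lborel_affine[of 1 v] by (simp add: density_1 add.commute)
    show "integrable lborel (\<lambda>y. H (y + v))"
      using H_int by (subst (asm) *) (simp add: integrable_distr_eq)
    show "(LINT y|lborel. H (y + v)) = (LINT y|lborel. H y)"
      by (subst (2) *) (simp add: integral_distr)
  qed
  define D where "D k y = (H (y + t k *\<^sub>R e) - H y) / t k" for k y
  have D0: "(LINT y|lborel. D k y) = 0" for k
    unfolding D_def using tr H_int by (simp add: Bochner_Integration.integral_diff)
  have line: "((\<lambda>s. H (y + s *\<^sub>R e)) has_real_derivative g (y + s *\<^sub>R e)) (at s)" for y s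
  proof -
    have "((\<lambda>s. H (y + s *\<^sub>R e)) has_derivative (\<lambda>h. H' (y + s *\<^sub>R e) (h *\<^sub>R e))) (at s)"
      by (rule has_derivative_compose[where f = "\<lambda>s. y + s *\<^sub>R e" and g = H, OF _ der])
        (auto intro!: derivative_eq_intros)
    then show ?thesis
      using linear_cmul[OF has_derivative_linear[OF der[of "y + s *\<^sub>R e"]]]
      by (simp add: has_field_derivative_def g_def mult_commute_abs)
  qed
  \<comment> \<open>\<open>H\<close> lives in the unit ball and the steps \<open>t k\<close> are at
    most 1, so all quotients vanish outside radius 2; inside, the mean value theorem bounds them by
    the bound \<open>B\<close> for the derivative.\<close>
  have Dbound: "norm (D k y) \<le> B * indicator (cball 0 2) y" for k y
  proof (cases "norm y \<le> 2")
    case True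
    have "\<exists>z>0. z < t k \<and> H (y + t k *\<^sub>R e) - H (y + 0 *\<^sub>R e) = (t k - 0) * g (y + z *\<^sub>R e)"
      by (rule MVT2) (use t line in auto)
    then obtain z where "H (y + t k *\<^sub>R e) - H y = t k * g (y + z *\<^sub>R e)" by auto
    then have "D k y = g (y + z *\<^sub>R e)" using t(1)[of k] by (simp add: D_def)
    then show ?thesis using gB True by simp
  next
    case False
    have "norm y \<le> norm (y + t k *\<^sub>R e) + norm (t k *\<^sub>R e)" by (metis add_diff_cancel_right' norm_triangle_ineq4)
    then have "norm (y + t k *\<^sub>R e) > 1" using False t[of k] by (simp add: e1)
    then show ?thesis using False supp by (simp add: D_def)
  qed
  have lim: "(\<lambda>k. D k y) \<longlonglongrightarrow> g y" for y
  proof -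
    have "((\<lambda>s. (H (y + s *\<^sub>R e) - H (y + 0 *\<^sub>R e)) / (s - 0)) \<longlongrightarrow> g (y + 0 *\<^sub>R e)) (at 0)"
      using line[of y 0] unfolding has_field_derivative_iff .
    moreover have "filterlim t (at 0) sequentially"
      unfolding filterlim_at t_def using LIMSEQ_inverse_real_of_nat by (auto simp: inverse_eq_divide)
    ultimately have "(\<lambda>k. (H (y + t k *\<^sub>R e) - H (y + 0 *\<^sub>R e)) / (t k - 0)) \<longlonglongrightarrow> g (y + 0 *\<^sub>R e)"
      by (rule filterlim_compose)
    then show ?thesis by (simp add: D_def)
  qed
  have "(\<lambda>k. LINT y|lborel. D k y) \<longlonglongrightarrow> (LINT y|lborel. g y)"
  proof (rule integral_dominated_convergence[where w = "\<lambda>y. B * indicator (cball 0 2) y"])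
    show "g \<in> borel_measurable lborel"
      using borel_measurable_continuous_onI[OF g_cont] by simp
    show "D k \<in> borel_measurable lborel" for k unfolding D_def by measurable
    show "integrable lborel (\<lambda>y::real^'n. B * indicator (cball 0 2) y)"
      using emeasure_lborel_cball_finite[of "0::real^'n" 2]
      by (intro integrable_mult_right, subst integrable_indicator_iff) auto
    show "AE y in lborel. (\<lambda>k. D k y) \<longlonglongrightarrow> g y" using lim by simp
    show "AE y in lborel. norm (D k y) \<le> B * indicator (cball 0 2) y" for k using Dbound by simp
  qed
  then have "(LINT y|lborel. g y) = 0" using D0 LIMSEQ_unique[OF _ tendsto_const] by simp
  then show ?thesis by (simp add: g_def e_def)
qed

lemma integral_power_unit: "(LINT r:{0..1}|lborel. r ^ k) = 1 / real (Suc k)"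
  using integral_power[of 0 1 k] by (simp add: set_lebesgue_integral_def mult.commute)

text \<open>The quotient of the two radial integrals that the cutoff
  \<open>(1 - r\<^sup>2)\<^sup>2\<close> and its derivative leave behind in the divergence theorem.
  Its value is \<open>1 / (n + q)\<close>, but it is kept unevaluated because all that matters is
  that it depends on \<open>n\<close> and \<open>q\<close> alone.\<close>

definition pizzetti_ratio :: "nat \<Rightarrow> nat \<Rightarrow> real" where
  "pizzetti_ratio n q = (LINT r:{0..1}|lborel. r ^ (n + q - 1) * (1 - r\<^sup>2)\<^sup>2) /
     (4 * (1 / real (n + q + 2) - 1 / real (n + q + 4)))"

text \<open>The divergence theorem for \<open>h\<close> times a radial cutoff that is \<open>C\<^sup>1\<close> with compact support.\<close>

lemma sphere_integral_by_parts:
  fixes h k :: "real^'n \<Rightarrow> real"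
  assumes der: "\<And>y. (h has_derivative h' y) (at y)" and k: "\<And>y. k y = h' y (axis i 1)"
    and cont: "continuous_on UNIV k"
    and homh: "\<And>c y. c > 0 \<Longrightarrow> h (c *\<^sub>R y) = c ^ Suc q * h y"
    and homk: "\<And>c y. c > 0 \<Longrightarrow> k (c *\<^sub>R y) = c ^ q * k y"
  shows "sphere_integral (q + 2) (\<lambda>y. y $ i * h y) = pizzetti_ratio CARD('n) q * sphere_integral q k"
proof -
  define w :: "real \<Rightarrow> real" where "w s = (if s < 1 then (1 - s)\<^sup>2 else 0)" for s
  define w' :: "real \<Rightarrow> real" where "w' s = (if s < 1 then - 2 * (1 - s) else 0)" for s
  have w_der: "(w has_real_derivative w' s) (at s)" for s
  proof -
    consider "s < 1" | "s > 1" | "s = 1" by linarith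
    then show ?thesis
    proof cases
      case 1
      have "((\<lambda>s. (1 - s)\<^sup>2) has_real_derivative - 2 * (1 - s)) (at s)"
        by (auto intro!: derivative_eq_intros)
      then have "((\<lambda>s. (1 - s)\<^sup>2) has_real_derivative w' s) (at s)" using 1 by (simp add: w'_def)
      then show ?thesis
        by (rule has_field_derivative_transform_within_open[where S = "{..<1}"]) (use 1 in \<open>auto simp: w_def\<close>)
    next
      case 2
      have "((\<lambda>s. 0) has_real_derivative w' s) (at s)" using 2 by (simp add: w'_def)
      then show ?thesis
        by (rule has_field_derivative_transform_within_open[where S = "{1<..}"]) (use 2 in \<open>auto simp: w_def\<close>)
    next
      case 3
      \<comment> \<open>The two branches meet at \<open>s = 1\<close> with value and derivative
        zero; the quotient there is bounded by the distance to 1.\<close>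
      have "(w has_real_derivative 0) (at 1)"
        unfolding has_field_derivative_iff
      proof (rule Lim_null_comparison)
        have "norm ((w t - w 1) / (t - 1)) \<le> \<bar>t - 1\<bar>" for t
        proof (cases "t < 1")
          case True
          have "(1 - t)\<^sup>2 = (t - 1) * (t - 1)"
            by (simp add: power2_eq_square algebra_simps)
          then have "(1 - t)\<^sup>2 / (t - 1) = t - 1"
            using True by simp
          then show ?thesis using True by (simp add: w_def)
        qed (simp add: w_def)
        then show "eventually (\<lambda>t. norm ((w t - w 1) / (t - 1)) \<le> \<bar>t - 1\<bar>) (at 1)" by simp
        show "((\<lambda>t. \<bar>t - 1\<bar>) \<longlongrightarrow> 0) (at (1::real))" by (auto intro!: tendsto_eq_intros)
      qed
      then show ?thesis using 3 by (simp add: w'_def)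
    qed
  qed
  have w'_eq: "w' s = - 2 * max 0 (1 - s)" for s by (auto simp: w'_def max_def)
  have w_eq: "w s = (max 0 (1 - s))\<^sup>2" for s by (auto simp: w_def max_def)
  define H where "H y = h y * w (y \<bullet> y)" for y
  define H' where "H' y v = h y * (2 * (y \<bullet> v) * w' (y \<bullet> y)) + h' y v * w (y \<bullet> y)" for y v
  have H_der: "(H has_derivative H' y) (at y)" for y
  proof -
    have "((\<lambda>y. w (y \<bullet> y)) has_derivative (\<lambda>v. (y \<bullet> v + v \<bullet> y) * w' (y \<bullet> y))) (at y)"
      by (rule has_derivative_compose[where f = "\<lambda>y. y \<bullet> y" and g = w])
        (use w_der in \<open>auto intro!: derivative_eq_intros simp: has_field_derivative_def mult_commute_abs\<close>)
    then have "(H has_derivative (\<lambda>v. h y * ((y \<bullet> v + v \<bullet> y) * w' (y \<bullet> y)) + h' y v * w (y \<bullet> y))) (at y)"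
      unfolding H_def[abs_def] by (rule has_derivative_mult[OF der])
    then show ?thesis unfolding H'_def by (simp add: inner_commute)
  qed
  have h_cont: "continuous_on UNIV h"
    using der has_derivative_continuous continuous_at_imp_continuous_on by blast
  \<comment> \<open>With \<open>w\<close> and \<open>w'\<close> written through \<open>max\<close>,
    the derivative becomes a visibly continuous function, and on the unit ball it is the difference
    of the two integrands to be compared.\<close>
  have H'_e: "H' y (axis i 1) = k y * (max 0 (1 - (norm y)\<^sup>2))\<^sup>2 - 4 * (y $ i * h y * max 0 (1 - (norm y)\<^sup>2))" for y
    unfolding H'_def w'_eq w_eq by (simp add: k inner_axis power2_norm_eq_inner[symmetric])
  have "(LINT y|lborel. H' y (axis i 1)) = 0"
  proof (rule integral_partial_eq_0[OF H_der])
    show "continuous_on UNIV (\<lambda>y. H' y (axis i 1))"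
      unfolding H'_e by (intro continuous_intros cont h_cont)
    show "H y = 0" if "norm y > 1" for y
    proof -
      have "y \<bullet> y \<ge> 1" using that by (simp add: power2_norm_eq_inner[symmetric] one_le_power)
      then show ?thesis by (simp add: H_def w_def)
    qed
  qed
  moreover have "H' y (axis i 1) = indicat_real (cball 0 1) y *\<^sub>R (k y * (1 - (norm y)\<^sup>2)\<^sup>2)
      - 4 * (indicat_real (cball 0 1) y *\<^sub>R (y $ i * h y * (1 - (norm y)\<^sup>2)))" for y
  proof (cases "norm y \<le> 1")
    case True
    then have "(norm y)\<^sup>2 \<le> 1" by (simp add: power_le_one)
    then show ?thesis unfolding H'_e using True by simp
  next
    case False
    then have "(norm y)\<^sup>2 \<ge> 1" by (simp add: one_le_power)
    then show ?thesis unfolding H'_e using False by simp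
  qed
  moreover have i1: "set_integrable lborel (cball 0 1) (\<lambda>y. k y * (1 - (norm y)\<^sup>2)\<^sup>2)"
    and i2: "set_integrable lborel (cball 0 1) (\<lambda>y. y $ i * h y * (1 - (norm y)\<^sup>2))"
    by (intro integrable_cball_continuous continuous_intros cont h_cont)+
  ultimately have parts: "(LINT y:cball 0 1|lborel. k y * (1 - (norm y)\<^sup>2)\<^sup>2) =
      4 * (LINT y:cball 0 1|lborel. y $ i * h y * (1 - (norm y)\<^sup>2))"
    unfolding set_lebesgue_integral_def set_integrable_def
    by (simp add: Bochner_Integration.integral_diff)
  have real_radial: "(LINT y:cball 0 1|lborel. p y * f (norm y)) =
      sphere_integral d p * (LINT r:{0..1}|lborel. r ^ (CARD('n) + d - 1) * f r)"
    if "continuous_on UNIV p" "\<And>c y. c > 0 \<Longrightarrow> p (c *\<^sub>R y) = c ^ d * p y" "continuous_on UNIV f"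
    for p :: "real^'n \<Rightarrow> real" and f :: "real \<Rightarrow> real" and d
  proof -
    have m: "(\<lambda>r. complex_of_real (f r)) \<in> borel_measurable borel"
      by (intro borel_measurable_continuous_onI continuous_intros that)
    have "set_integrable lborel {0..1} (\<lambda>r. r ^ (CARD('n) + d - 1) *\<^sub>R complex_of_real (f r))"
      by (intro borel_integrable_atLeastAtMost' continuous_intros continuous_on_subset[OF that(3)]) auto
    from radial_integral(2)[OF that(1,2) zero_less_one m this]
    have "(LINT y:cball 0 1|lborel. complex_of_real (p y * f (norm y))) =
      sphere_integral d p * (LINT r:{0..1}|lborel. complex_of_real (r ^ (CARD('n) + d - 1) * f r))"
      by (simp add: scaleR_conv_of_real)
    then show ?thesis
      unfolding set_integral_complex_of_real of_real_mult[symmetric] of_real_eq_iff .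
  qed
  have c1: "continuous_on UNIV (\<lambda>y. y $ i * h y)"
    by (intro continuous_intros h_cont)
  have "(LINT y:cball 0 1|lborel. y $ i * h y * (1 - (norm y)\<^sup>2)) =
      sphere_integral (q + 2) (\<lambda>y. y $ i * h y) * (LINT r:{0..1}|lborel. r ^ (CARD('n) + (q + 2) - 1) * (1 - r\<^sup>2))"
    by (rule real_radial[OF c1]) (auto simp: homh intro!: continuous_intros)
  moreover have "(LINT r:{0..1}|lborel. r ^ (CARD('n) + (q + 2) - 1) * (1 - r\<^sup>2)) =
      1 / real (CARD('n) + q + 2) - 1 / real (CARD('n) + q + 4)"
  proof -
    let ?k = "CARD('n) + q + 1"
    have "(LINT r:{0..1}|lborel. r ^ (CARD('n) + (q + 2) - 1) * (1 - r\<^sup>2)) = (LINT r:{0..1}|lborel. r ^ ?k - r ^ (?k + 2) :: real)"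
    proof -
      have *: "r ^ (CARD('n) + (q + 2) - 1) * (1 - r\<^sup>2) = r ^ ?k - r ^ (?k + 2)" for r :: real
        by (simp add: power_add power2_eq_square algebra_simps)
      show ?thesis by (rule arg_cong[where f = "set_lebesgue_integral lborel {0..1::real} :: (real \<Rightarrow> real) \<Rightarrow> real"], rule ext, rule *)
    qed
    also have "\<dots> = (LINT r:{0..1}|lborel. r ^ ?k) - (LINT r:{0..1}|lborel. r ^ (?k + 2))"
      by (intro set_integral_diff borel_integrable_atLeastAtMost' continuous_intros)
    also have "\<dots> = 1 / real (Suc ?k) - 1 / real (Suc (?k + 2))"
      by (simp only: integral_power_unit)
    finally show ?thesis by (simp add: algebra_simps)
  qed
  moreover have "(LINT y:cball 0 1|lborel. k y * (1 - (norm y)\<^sup>2)\<^sup>2) =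
      sphere_integral q k * (LINT r:{0..1}|lborel. r ^ (CARD('n) + q - 1) * (1 - r\<^sup>2)\<^sup>2)"
    by (rule real_radial[OF cont]) (auto simp: homk intro!: continuous_intros)
  moreover have "1 / real (CARD('n) + q + 4) < 1 / real (CARD('n) + q + 2)"
    by (intro divide_strict_left_mono) auto
  then have "1 / real (CARD('n) + q + 2) - 1 / real (CARD('n) + q + 4) \<noteq> 0" by simp
  ultimately show ?thesis using parts
    unfolding pizzetti_ratio_def by (simp add: field_simps)
qed

definition laplacian :: "(real^'n \<Rightarrow> real) \<Rightarrow> real^'n \<Rightarrow> real" where
  "laplacian E x = (\<Sum>i\<in>UNIV. partial i (partial i E) x)"

lemma smooth_on_laplacian: "open S \<Longrightarrow> smooth_on S E \<Longrightarrow> smooth_on S (laplacian E)"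
  unfolding laplacian_def[abs_def] by (intro smooth_on_sum smooth_on_partial)

text \<open>Peel one factor \<open>y $ i\<close> off the homogeneous polynomial and integrate by
  parts: \<open>y $ i\<close> turns into a derivative in direction \<open>i\<close>, the gradient
  formula contributes \<open>Suc q\<close>, and summing over \<open>i\<close> assembles the
  Laplacian of \<open>E\<close>.\<close>

lemma pizzetti_step:
  fixes E :: "real^'n \<Rightarrow> real"
  assumes "open S" "0 \<in> S" "smooth_on S E"
  shows "sphere_integral (q + 2) (dir_deriv (q + 2) E 0) =
    pizzetti_ratio CARD('n) q * real (Suc q) * sphere_integral q (dir_deriv q (laplacian E) 0)"
proof -
  have c: "continuous_on UNIV (\<lambda>y. y $ i * dir_deriv (Suc q) (partial i E) 0 y)" for i
    by (intro continuous_intros dir_deriv_continuous)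
  have parts: "sphere_integral (q + 2) (\<lambda>y. y $ i * dir_deriv (Suc q) (partial i E) 0 y) =
      pizzetti_ratio CARD('n) q * sphere_integral q (\<lambda>y. real (Suc q) * dir_deriv q (partial i (partial i E)) 0 y)" for i
    by (rule sphere_integral_by_parts[OF dir_deriv_has_derivative[OF assms(1,2) smooth_on_partial[OF assms(3)]]])
      (auto simp: axis_def if_distrib[of "\<lambda>x. x * _"] dir_deriv_scale intro!: continuous_intros dir_deriv_continuous cong: if_cong)
  have "sphere_integral (q + 2) (dir_deriv (q + 2) E 0) =
      sphere_integral (q + 2) (\<lambda>y. \<Sum>i\<in>UNIV. y $ i * dir_deriv (Suc q) (partial i E) 0 y)"
    by (simp only: add_2_eq_Suc' dir_deriv.simps(2)[abs_def])
  also have "\<dots> = (\<Sum>i\<in>UNIV. pizzetti_ratio CARD('n) q * real (Suc q) * sphere_integral q (dir_deriv q (partial i (partial i E)) 0))"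
    by (simp only: sphere_integral_sum[OF c] parts sphere_integral_cmult mult.assoc)
  also have "\<dots> = pizzetti_ratio CARD('n) q * real (Suc q) * sphere_integral q (\<lambda>y. \<Sum>i\<in>UNIV. dir_deriv q (partial i (partial i E)) 0 y)"
    by (simp add: sphere_integral_sum[OF dir_deriv_continuous] sum_distrib_left)
  also have "(\<lambda>y. \<Sum>i\<in>UNIV. dir_deriv q (partial i (partial i E)) 0 y) = dir_deriv q (laplacian E) 0"
    unfolding laplacian_def[abs_def]
    by (rule ext, rule dir_deriv_sum[OF assms(1,2), symmetric], intro smooth_on_partial assms(3))
  finally show ?thesis .
qed

text \<open>The product collects the constants of the \<open>m\<close> steps; the last factor is the
  area of the unit sphere.\<close>

definition pizzetti_const :: "'n::finite itself \<Rightarrow> nat \<Rightarrow> real" where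
  "pizzetti_const _ m = (\<Prod>l<m. pizzetti_ratio CARD('n) (2 * l) * real (Suc (2 * l))) *
     sphere_integral 0 (\<lambda>_::real^'n. 1)"

lemma pizzetti:
  fixes E :: "real^'n \<Rightarrow> real"
  assumes "open S" "0 \<in> S"
  shows "smooth_on S E \<Longrightarrow> sphere_integral (2 * m) (dir_deriv (2 * m) E 0) =
    pizzetti_const TYPE('n) m * (laplacian ^^ m) E 0"
proof (induction m arbitrary: E)
  case 0
  show ?case
    using sphere_integral_cmult[of 0 "E 0" "\<lambda>_::real^'n. 1"] by (simp add: pizzetti_const_def)
next
  case (Suc m)
  have "sphere_integral (2 * Suc m) (dir_deriv (2 * Suc m) E 0) =
      pizzetti_ratio CARD('n) (2 * m) * real (Suc (2 * m)) * sphere_integral (2 * m) (dir_deriv (2 * m) (laplacian E) 0)"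

    using pizzetti_step[OF assms Suc.prems, of "2 * m"] by (simp only: mult_Suc_right add.commute)
  also have "\<dots> = pizzetti_ratio CARD('n) (2 * m) * real (Suc (2 * m)) * (pizzetti_const TYPE('n) m * (laplacian ^^ m) (laplacian E) 0)"
    by (simp only: Suc.IH[OF smooth_on_laplacian[OF assms(1) Suc.prems]])
  also have "\<dots> = pizzetti_const TYPE('n) (Suc m) * (laplacian ^^ Suc m) E 0"
    by (simp add: pizzetti_const_def funpow_Suc_right del: funpow.simps)
  finally show ?case .
qed

lemma sphere_integral_dir_deriv_odd:
  "odd q \<Longrightarrow> sphere_integral q (dir_deriv q E 0) = 0"
  by (rule sphere_integral_odd[OF dir_deriv_continuous]) (use dir_deriv_scale[of q E 0 "-1"] in simp)

section \<open>Analytic continuation\<close>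

text \<open>The assumption is a local bound on \<open>h\<close> itself. Cauchy's inequality on
  circles of radius \<open>r / 2\<close> turns it into a bound for the derivative in
  \<open>s\<close>, hence for the difference quotients, and dominated convergence gives complex
  differentiability.\<close>

lemma holomorphic_integral:
  fixes h :: "complex \<Rightarrow> 'a \<Rightarrow> complex"
  assumes U: "open U" and meas: "\<And>s. s \<in> U \<Longrightarrow> h s \<in> borel_measurable M"
    and hol: "\<And>x. x \<in> space M \<Longrightarrow> (\<lambda>s. h s x) holomorphic_on U"
    and dom: "\<And>s0. s0 \<in> U \<Longrightarrow> \<exists>r>0. \<exists>b. cball s0 r \<subseteq> U \<and> integrable M b \<and>
       (\<forall>s\<in>cball s0 r. \<forall>x\<in>space M. norm (h s x) \<le> b x)"
  shows "(\<lambda>s. LINT x|M. h s x) holomorphic_on U"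
  unfolding holomorphic_on_def
proof
  fix s0 assume s0: "s0 \<in> U"
  obtain r b where r: "r > 0" "cball s0 r \<subseteq> U" and b: "integrable M b"
    "\<And>s x. s \<in> cball s0 r \<Longrightarrow> x \<in> space M \<Longrightarrow> norm (h s x) \<le> b x"
    using dom[OF s0] by blast
  define V where "V = ball s0 (r / 2)"
  have V: "open V" "s0 \<in> V" "V \<subseteq> U" "convex V" "V \<subseteq> cball s0 r" using r by (auto simp: V_def)
  have int: "integrable M (h s)" if "s \<in> V" for s
    by (rule Bochner_Integration.integrable_bound[OF b(1) meas])
      (use that V b(2) in \<open>auto intro!: AE_I2 order_trans[OF b(2)]\<close>)
  have lip: "norm (h s x - h s0 x) \<le> (2 * b x / r) * norm (s - s0)" if s: "s \<in> V" and x: "x \<in> space M" for s x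
  proof (rule field_differentiable_bound[OF V(4)])
    fix z assume z: "z \<in> V"
    have sub: "cball z (r / 2) \<subseteq> cball s0 r"
    proof
      fix w assume "w \<in> cball z (r / 2)"
      then show "w \<in> cball s0 r" using z dist_triangle[of s0 w z] unfolding V_def by auto
    qed
    have hz: "(\<lambda>s. h s x) holomorphic_on cball z (r / 2)"
      using holomorphic_on_subset[OF hol[OF x]] sub r by blast
    have "norm ((deriv ^^ 1) (\<lambda>s. h s x) z) \<le> fact 1 * b x / (r / 2) ^ 1"
    proof (rule Cauchy_inequality)
      show "continuous_on (cball z (r / 2)) (\<lambda>s. h s x)" using hz holomorphic_on_imp_continuous_on by blast
      show "(\<lambda>s. h s x) holomorphic_on ball z (r / 2)" using hz holomorphic_on_subset ball_subset_cball by blast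
      show "norm (h w x) \<le> b x" if "norm (z - w) = r / 2" for w
        using that sub x by (intro b(2)) (auto simp: dist_norm subset_iff)
    qed (use r in auto)
    then show "norm (deriv (\<lambda>s. h s x) z) \<le> 2 * b x / r" by (simp add: mult.commute)
    show "((\<lambda>s. h s x) has_field_derivative deriv (\<lambda>s. h s x) z) (at z within V)"
      using holomorphic_derivI[OF hol[OF x] U] z V(3) by (meson has_field_derivative_at_within subsetD)
  qed (use s V in auto)
  have "((\<lambda>s. LINT x|M. h s x) has_field_derivative (LINT x|M. deriv (\<lambda>s. h s x) s0)) (at s0 within V)"
    unfolding has_field_derivative_iff tendsto_at_iff_sequentially o_def
  proof (intro allI impI)
    fix X :: "nat \<Rightarrow> complex"
    assume X: "\<forall>i. X i \<in> V - {s0}" "X \<longlonglongrightarrow> s0"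
    define q where "q i x = (h (X i) x - h s0 x) / (X i - s0)" for i x
    have "(\<lambda>i. LINT x|M. q i x) \<longlonglongrightarrow> (LINT x|M. deriv (\<lambda>s. h s x) s0)"
    proof (rule integral_dominated_convergence[where w = "\<lambda>x. 2 * b x / r"])
      show qm: "q i \<in> borel_measurable M" for i
        unfolding q_def using meas X(1) V s0 by (intro borel_measurable_divide borel_measurable_diff) auto
      have lim: "(\<lambda>i. q i x) \<longlonglongrightarrow> deriv (\<lambda>s. h s x) s0" if x: "x \<in> space M" for x
      proof -
        have "((\<lambda>s. h s x) has_field_derivative deriv (\<lambda>s. h s x) s0) (at s0 within V)"
          using holomorphic_derivI[OF hol[OF x] U s0] by (rule has_field_derivative_at_within)
        then show ?thesis
          using X unfolding has_field_derivative_iff tendsto_at_iff_sequentially o_def q_def by blast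
      qed
      then show "AE x in M. (\<lambda>i. q i x) \<longlonglongrightarrow> deriv (\<lambda>s. h s x) s0" by simp
      \<comment> \<open>Measurability of the derivative comes for free: it is a pointwise limit of
        measurable quotients.\<close>
      show "(\<lambda>x. deriv (\<lambda>s. h s x) s0) \<in> borel_measurable M"
        by (rule borel_measurable_LIMSEQ_metric[OF qm lim])
      show "integrable M (\<lambda>x. 2 * b x / r)" using b(1) by simp
      show "AE x in M. norm (q i x) \<le> 2 * b x / r" for i
      proof (rule AE_I2)
        fix x assume x: "x \<in> space M"
        have "norm (X i - s0) > 0" using X(1) by auto
        then show "norm (q i x) \<le> 2 * b x / r"
          using lip[of "X i" x] X(1) x by (simp add: q_def norm_divide divide_le_eq)
      qed
    qed
    moreover have "(LINT x|M. q i x) = ((LINT x|M. h (X i) x) - (LINT x|M. h s0 x)) / (X i - s0)" for i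
      unfolding q_def using int X(1) V(2) by (simp add: Bochner_Integration.integral_diff)
    ultimately show "(\<lambda>i. ((LINT x|M. h (X i) x) - (LINT x|M. h s0 x)) / (X i - s0)) \<longlonglongrightarrow> (LINT x|M. deriv (\<lambda>s. h s x) s0)"
      by simp
  qed
  then show "(\<lambda>s. LINT x|M. h s x) field_differentiable at s0 within U"
    using at_within_open[OF V(2,1)] field_differentiable_def has_field_derivative_at_within by metis
qed

section \<open>Radial power integrals and the gluing of half planes\<close>

lemma of_real_powr_continuous:
  assumes "Re z > 0"
  shows "continuous_on {0..} (\<lambda>r. complex_of_real r powr z)"
  unfolding continuous_on_def
proof
  fix x :: real assume x: "x \<in> {0..}"
  show "((\<lambda>r. complex_of_real r powr z) \<longlongrightarrow> complex_of_real x powr z) (at x within {0..})"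
  proof (cases "x = 0")
    case True
    have "continuous_on {0..} (\<lambda>r::real. r powr Re z)"
      using assms by (intro continuous_on_powr' continuous_intros) auto
    then have lim: "((\<lambda>r. r powr Re z) \<longlongrightarrow> 0) (at (0::real) within {0..})"
      unfolding continuous_on_def by (auto dest!: bspec[of _ _ 0])
    have "((\<lambda>r. complex_of_real r powr z) \<longlongrightarrow> 0) (at 0 within {0..})"
      by (rule Lim_null_comparison[OF _ lim])
        (auto simp: eventually_at_filter norm_powr_real_powr intro!: always_eventually)
    then show ?thesis using True by simp
  next
    case False
    then have "complex_of_real x \<notin> \<real>\<^sub>\<le>\<^sub>0" using x by (auto simp: complex_nonpos_Reals_iff)
    then show ?thesis
      by (intro tendsto_powr_complex tendsto_of_real tendsto_ident_at tendsto_const) auto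
  qed
qed

lemma of_real_powr_has_vector_derivative:
  assumes "x > 0"
  shows "((\<lambda>r. complex_of_real r powr z) has_vector_derivative (z * complex_of_real x powr (z - 1))) (at x)"
proof -
  have "complex_of_real x \<notin> \<real>\<^sub>\<le>\<^sub>0" using assms by (auto simp: complex_nonpos_Reals_iff)
  then have "((\<lambda>w. w powr z) has_field_derivative (z * complex_of_real x powr (z - 1))) (at (complex_of_real x))"
    by (rule has_field_derivative_powr)
  then show ?thesis by (rule has_vector_derivative_real_field)
qed

lemma power_times_of_real_powr:
  "r > 0 \<Longrightarrow> r ^ m *\<^sub>R (complex_of_real r powr w) = complex_of_real r powr (w + of_nat m)"
  by (simp add: powr_add scaleR_conv_of_real powr_nat)

text \<open>The antiderivative is \<open>r powr z / z\<close> with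
  \<open>z = w + of_nat m + 1\<close>. It is continuous up to \<open>0\<close>, where it vanishes
  because \<open>Re z > 0\<close>. Its value at \<open>R\<close> has the denominator
  \<open>z\<close>, which is the source of every pole of the continuation.\<close>

lemma power_powr_integral:
  fixes w :: complex
  assumes R: "R > 0" and pos: "Re w + real m + 1 > 0"
  shows "set_integrable lborel {0..R} (\<lambda>r. r ^ m *\<^sub>R (complex_of_real r powr w))"
    and "(LINT r:{0..R}|lborel. r ^ m *\<^sub>R (complex_of_real r powr w)) =
      complex_of_real R powr (w + of_nat m + 1) / (w + of_nat m + 1)"
proof -
  define z where "z = w + of_nat m + 1"
  have z1: "Re z > 0" using pos unfolding z_def by simp
  then have z: "Re z > 0" "z \<noteq> 0" by auto
  let ?f = "\<lambda>r. r ^ m *\<^sub>R (complex_of_real r powr w)"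
  have fz: "?f r = complex_of_real r powr (z - 1)" if "r > 0" for r
    using power_times_of_real_powr[OF that] by (simp add: z_def)
  have fm: "?f \<in> borel_measurable borel" by measurable
  have "((\<lambda>r. r powr (Re z - 1)) has_integral (R powr Re z / Re z)) {0..R}"
    using has_integral_powr_from_0[of "Re z - 1" R] z R by simp
  then have ha: "(\<lambda>r. r powr (Re z - 1)) absolutely_integrable_on {0..R}"
    by (intro nonnegative_absolutely_integrable_1) auto
  have "set_integrable lborel {0..R} (\<lambda>r. r powr (Re z - 1))"
    using ha unfolding set_integrable_def
    by (subst (asm) integrable_completion) auto
  then have gi: "integrable lborel (\<lambda>r. indicat_real {0..R} r *\<^sub>R r powr (Re z - 1))"
    by (simp add: set_integrable_def)
  show si: "set_integrable lborel {0..R} ?f"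
    unfolding set_integrable_def
  proof (rule Bochner_Integration.integrable_bound[OF gi])
    show "(\<lambda>r. indicat_real {0..R} r *\<^sub>R ?f r) \<in> borel_measurable lborel" using fm by measurable
    show "AE r in lborel. norm (indicat_real {0..R} r *\<^sub>R ?f r) \<le> norm (indicat_real {0..R} r *\<^sub>R r powr (Re z - 1))"
      using AE_lborel_singleton[of "0::real"]
    proof eventually_elim
      case (elim r)
      show ?case
      proof (cases "r \<in> {0..R}")
        case True
        then have "r > 0" using elim by auto
        then have "norm (?f r) = r powr (Re z - 1)"
          unfolding fz[OF \<open>r > 0\<close>] by (simp add: norm_powr_real_powr)
        then show ?thesis using True by simp
      qed simp
    qed
  qed
  have "((\<lambda>r. complex_of_real r powr (z - 1)) has_integral
      (complex_of_real R powr z / z - complex_of_real 0 powr z / z)) {0..R}"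
  proof (rule fundamental_theorem_of_calculus_interior)
    show "continuous_on {0..R} (\<lambda>r. complex_of_real r powr z / z)"
      by (intro continuous_intros continuous_on_subset[OF of_real_powr_continuous[OF z(1)]]) (use z in auto)
    show "((\<lambda>r. complex_of_real r powr z / z) has_vector_derivative complex_of_real x powr (z - 1)) (at x)"
      if "x \<in> {0<..<R}" for x
      using has_vector_derivative_divide[OF of_real_powr_has_vector_derivative[of x z], of z] that z by simp
  qed (use R in simp)
  then have "((\<lambda>r. complex_of_real r powr (z - 1)) has_integral (complex_of_real R powr z / z)) {0..R}" by simp
  then have "(?f has_integral (complex_of_real R powr z / z)) {0..R}"
    by (rule has_integral_spike[of "{0}", rotated 2]) (use fz in auto)
  then show "(LINT r:{0..R}|lborel. ?f r) = complex_of_real R powr (w + of_nat m + 1) / (w + of_nat m + 1)"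
    using set_borel_integral_eq_integral(2)[OF si] integral_unique z_def by metis
qed

text \<open>\<open>h z\<close> may be zero, in which case the quotient has a finite limit and there
  is no pole; so the claim about the order is conditional on \<open>is_pole\<close>.\<close>

lemma simple_pole_residue:
  assumes S: "open S" "z \<in> S" and h: "h holomorphic_on S"
    and F: "\<And>w. w \<in> S \<Longrightarrow> w \<noteq> z \<Longrightarrow> F w = h w / (w - z)"
  shows "residue F z = h z" "F meromorphic_on {z}" "is_pole F z \<Longrightarrow> zorder F z = -1"
proof -
  have ev: "eventually (\<lambda>w. F w = h w / (w - z)) (at z)"
    unfolding eventually_at_topological using S F by blast
  show "residue F z = h z"
    using residue_cong[OF ev refl] residue_simple[OF S h] by simp
  have "h analytic_on {z}" using S h analytic_at by blast
  then have "(\<lambda>w. h w / (w - z)) meromorphic_on {z}"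
    by (intro meromorphic_intros analytic_on_imp_meromorphic_on) (auto intro!: analytic_intros)
  then show "F meromorphic_on {z}"
    using meromorphic_on_cong[of "{z}" F "\<lambda>w. h w / (w - z)" "{z}"] ev by simp
  assume pole: "is_pole F z"
  have "h z \<noteq> 0"
  proof
    assume h0: "h z = 0"
    have "(h has_field_derivative deriv h z) (at z)" using holomorphic_derivI[OF h S] .
    then have "((\<lambda>w. h w / (w - z)) \<longlongrightarrow> deriv h z) (at z)"
      unfolding has_field_derivative_iff h0 by simp
    then have "(F \<longlongrightarrow> deriv h z) (at z)"
      using tendsto_cong[OF ev] by simp
    then show False using pole unfolding is_pole_def
      using not_tendsto_and_filterlim_at_infinity[of "at z"] by auto
  qed
  then show "zorder F z = -1"
    by (intro zorder_eqI[OF S h]) (use F in \<open>auto simp: power_int_minus divide_inverse\<close>)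
qed

text \<open>The right-hand side of the decomposition of order \<open>K\<close> still makes sense on
  the larger half plane \<open>H K\<close>. Consecutive right-hand sides agree there by the identity
  theorem, so their values can be glued into one function, since every point lies in some
  \<open>H K\<close>. The possible poles are read off from the explicit fractions.\<close>

lemma meromorphic_continuation:
  fixes B :: "complex \<Rightarrow> complex" and E c :: "nat \<Rightarrow> complex \<Rightarrow> complex" and n :: nat and R :: real
  assumes R: "R > 0"
    and dec: "\<And>K s. Re s > - real n \<Longrightarrow>
      B s = E K s + (\<Sum>j<K. c j s * complex_of_real R powr (s + of_nat n + of_nat j) / (s + of_nat n + of_nat j))"
    and E: "\<And>K. E K holomorphic_on {s. Re s > - real n - real K}"
    and c: "\<And>j. c j holomorphic_on UNIV" and odd: "\<And>j s. odd j \<Longrightarrow> c j s = 0"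
  shows "\<exists>F. F meromorphic_on UNIV \<and> (\<forall>s. Re s > - real n \<longrightarrow> F s = B s) \<and>
     F holomorphic_on (UNIV - {- of_nat n - of_nat j |j. even j}) \<and>
     (\<forall>z. is_pole F z \<longrightarrow> zorder F z = -1) \<and>
     (\<forall>j. residue F (- of_nat n - of_nat j) = c j (- of_nat n - of_nat j))"
proof -
  define t where "t j s = c j s * complex_of_real R powr (s + of_nat n + of_nat j) / (s + of_nat n + of_nat j)" for j s
  define H where "H K = {s. Re s > - real n - real K}" for K
  have Ho: "open (H K)" "convex (H K)" for K
    unfolding H_def by (auto intro: open_halfspace_Re_gt convex_halfspace_Re_gt)
  have Hmono: "H K \<subseteq> H L" if "K \<le> L" for K L using that by (auto simp: H_def)
  have num: "(\<lambda>s. c j s * complex_of_real R powr (s + of_nat n + of_nat j)) holomorphic_on A" for j A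
    using R by (intro holomorphic_intros holomorphic_on_subset[OF c]) auto
  have th: "t j holomorphic_on A" if "- of_nat n - of_nat j \<notin> A \<or> odd j" for j A
  proof (cases "odd j")
    case True
    then have "t j = (\<lambda>_. 0)" by (simp add: t_def[abs_def] odd)
    then show ?thesis by simp
  next
    case False
    then have "- of_nat n - of_nat j \<notin> A" using that by blast
    moreover have "s = - of_nat n - of_nat j" if "s + of_nat n + of_nat j = 0" for s :: complex
      using that by algebra
    ultimately show ?thesis unfolding t_def[abs_def]
      by (intro holomorphic_on_divide num holomorphic_intros) auto
  qed
  define T where "T K s = E K s + (\<Sum>j<K. t j s)" for K s
  have BT: "B s = T K s" if "Re s > - real n" for K s
    using dec[OF that, of K] by (simp add: T_def t_def)
  have step: "T K s = T (Suc K) s" if "s \<in> H K" for K s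
  proof -
    \<comment> \<open>Comparing the \<open>E\<close> parts rather than the full sums keeps the
      identity theorem on holomorphic functions: the pole of \<open>t K\<close> lies on the boundary
      line of \<open>H K\<close>, outside of it.\<close>
    have "E K s = E (Suc K) s + t K s"
    proof (rule analytic_continuation_open[where s = "H 0" and s' = "H K" and f = "E K" and g = "\<lambda>s. E (Suc K) s + t K s"])
      show "H 0 \<noteq> {}" by (auto simp: H_def intro!: exI[of _ 0] exI[of _ 1])
      show "E K holomorphic_on H K" using E by (simp add: H_def)
      show "(\<lambda>s. E (Suc K) s + t K s) holomorphic_on H K"
        by (intro holomorphic_on_add th holomorphic_on_subset[OF E[of "Suc K"]]) (auto simp: H_def)
      show "E K z = E (Suc K) z + t K z" if "z \<in> H 0" for z
        using BT[of z K] BT[of z "Suc K"] that by (simp add: T_def H_def)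
    qed (use Ho Hmono that convex_connected[OF Ho(2)] in auto)
    then show ?thesis by (simp add: T_def)
  qed
  have steps: "T K s = T (K + m) s" if "s \<in> H K" for K m s
  proof (induction m)
    case (Suc m)
    have "s \<in> H (K + m)" using that Hmono[of K "K + m"] by auto
    then show ?case using Suc step[of s "K + m"] by simp
  qed simp
  define N where "N s = nat \<lceil>- Re s - real n\<rceil> + 1" for s
  have N: "s \<in> H (N s)" for s
  proof -
    have "- Re s - real n \<le> real (nat \<lceil>- Re s - real n\<rceil>)" by linarith
    then show ?thesis unfolding H_def N_def by simp
  qed
  define F where "F s = T (N s) s" for s
  have FT: "F s = T K s" if "s \<in> H K" for K s
    unfolding F_def using steps[OF that, of "N s"] steps[OF N, of s K] by (simp add: add.commute)
  have FB: "F s = B s" if "Re s > - real n" for s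
    using FT[of s 0] BT[OF that, of 0] that by (simp add: H_def)
  have near: "F analytic_on {z}" if z: "z \<notin> {- of_nat n - of_nat j |j. even j}" for z
  proof -
    let ?P = "(\<lambda>j. - of_nat n - of_nat j :: complex) ` {j. j < N z \<and> even j}"
    let ?V = "H (N z) - ?P"
    have "open ?V" by (intro open_Diff Ho finite_imp_closed) auto
    moreover have "z \<in> ?V" using z N[of z] by auto
    moreover have "F holomorphic_on ?V"
    proof (rule holomorphic_transform[of "T (N z)"])
      show "T (N z) holomorphic_on ?V"
        unfolding T_def[abs_def]
        by (intro holomorphic_on_add holomorphic_on_sum th holomorphic_on_subset[OF E[of "N z"]]) (auto simp: H_def)
    qed (use FT in auto)
    ultimately show ?thesis using analytic_at by blast
  qed
  have pole: "residue F p = c J p \<and> F meromorphic_on {p} \<and> (is_pole F p \<longrightarrow> zorder F p = -1)"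
    if p: "p = - of_nat n - of_nat J" for p J
  proof -
    define K where "K = Suc J"
    let ?P = "(\<lambda>j. - of_nat n - of_nat j :: complex) ` {..<J}"
    let ?V = "H K - ?P"
    \<comment> \<open>Clearing the one denominator that vanishes at \<open>p\<close> leaves a
      holomorphic numerator; at \<open>p\<close> the factor \<open>s - p\<close> removes everything
      except \<open>c J\<close>, because \<open>R\<close> to the power 0 is 1.
      \<open>K = Suc J\<close> gives the first half plane that contains \<open>p\<close>.\<close>
    define h where "h s = (E K s + (\<Sum>j<J. t j s)) * (s - p) + c J s * complex_of_real R powr (s + of_nat n + of_nat J)" for s
    have V: "open ?V" "p \<in> ?V" by (intro open_Diff Ho finite_imp_closed) (auto simp: H_def K_def p)
    have h: "h holomorphic_on ?V"
      unfolding h_def[abs_def]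
      by (intro holomorphic_on_add holomorphic_on_mult holomorphic_on_sum th num holomorphic_on_subset[OF E[of K]]
          holomorphic_intros) (auto simp: H_def)
    have eq: "F w = h w / (w - p)" if "w \<in> ?V" "w \<noteq> p" for w
    proof -
      have "t J w = c J w * complex_of_real R powr (w + of_nat n + of_nat J) / (w - p)"
        by (simp add: t_def p add.assoc)
      then show ?thesis
        using that FT[of w K] by (simp add: T_def K_def h_def add_divide_distrib)
    qed
    have "h p = c J p" using R by (simp add: h_def p)
    then show ?thesis using simple_pole_residue[OF V h eq] by auto
  qed
  show ?thesis
  proof (intro exI[of _ F] conjI allI impI)
    show "F meromorphic_on UNIV"
    proof (subst meromorphic_on_meromorphic_at, intro ballI)
      fix z :: complex
      show "F meromorphic_on {z}"
        using near[of z] pole[of z] analytic_on_imp_meromorphic_on by blast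
    qed
    show "F holomorphic_on (UNIV - {- of_nat n - of_nat j |j. even j})"
      using near by (intro analytic_imp_holomorphic) (auto simp: analytic_on_def)
    fix z assume "is_pole F z"
    then show "zorder F z = -1"
      using near[of z] pole[of z] analytic_at_imp_no_pole by blast
  qed (use FB pole in auto)
qed

text \<open>Two continuations agree near every point, except possibly at that point itself.\<close>

lemma residue_unique_continuation:
  assumes F: "F meromorphic_on UNIV" and G: "G meromorphic_on UNIV"
    and eq: "\<And>s. Re s > a \<Longrightarrow> F s = G s"
  shows "residue F z = residue G z"
proof -
  define D where "D s = F s - G s" for s
  have D: "D meromorphic_on UNIV" unfolding D_def[abs_def] by (intro meromorphic_intros F G)
  have "eventually (\<lambda>w. D w = 0) (at z)"
  proof -
    obtain w where w: "Re w > a" by (metis Re_complex_of_real gt_ex)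
    have "eventually (\<lambda>s. s \<in> {s. Re s > a}) (nhds w)"
      by (rule eventually_nhds_in_open) (use w in \<open>auto intro: open_halfspace_Re_gt\<close>)
    then have ev: "eventually (\<lambda>s. D s = 0) (nhds w)"
      by eventually_elim (simp add: D_def eq)
    then have "eventually (\<lambda>s. D s = 0) (at w)" by (simp add: eventually_nhds_conv_at)
    have near: "eventually (\<lambda>s. remove_sings D s = D s) (at v)" for v
      by (rule eventually_remove_sings_eq_at, rule meromorphic_on_isolated_singularity[OF meromorphic_on_subset[OF D]]) simp
    have "eventually (\<lambda>s. remove_sings D s = 0) (at w)"
      using near[of w] \<open>eventually (\<lambda>s. D s = 0) (at w)\<close> by eventually_elim simp
    then have "frequently (\<lambda>s. remove_sings D s = 0) (at w)" by (rule eventually_frequently[rotated]) simp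
    then have "remove_sings D v = 0" for v
      by (rule frequently_eq_meromorphic_imp_constant[OF _ remove_sings_nicely_meromorphic[OF D]]) auto
    then show ?thesis using near[of z] by simp
  qed
  then have "eventually (\<lambda>w. F w = G w) (at z)" by eventually_elim (simp add: D_def)
  then show ?thesis by (rule residue_cong) simp
qed

section \<open>The area measure\<close>

subsection \<open>Change of variables without an order on the index type\<close>

text \<open>The library's change of variables theorem is stated for \<open>real^'n\<close> with a well-ordered
  index type; it is transported along a copy of the index type that carries such an order.\<close>

typedef 'a ordered_copy = "UNIV :: 'a set" morphisms un_copy copy by simp

lemma un_copy_copy [simp]: "un_copy (copy x) = x" "copy (un_copy y) = y"
  using copy_inverse un_copy_inverse by auto

definition finite_rank :: "'a::finite \<Rightarrow> nat" where
  "finite_rank = (SOME f. inj f)"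

lemma inj_finite_rank: "inj (finite_rank :: 'a::finite \<Rightarrow> nat)"
proof -
  have "\<exists>f :: 'a \<Rightarrow> nat. inj f"
    using finite_imp_inj_to_nat_seg[OF finite_class.finite_UNIV] by blast
  then show ?thesis unfolding finite_rank_def by (rule someI_ex)
qed

instantiation ordered_copy :: (finite) wellorder
begin

definition less_eq_ordered_copy :: "'a ordered_copy \<Rightarrow> 'a ordered_copy \<Rightarrow> bool" where
  "x \<le> y \<longleftrightarrow> finite_rank (un_copy x) \<le> finite_rank (un_copy y)"

definition less_ordered_copy :: "'a ordered_copy \<Rightarrow> 'a ordered_copy \<Rightarrow> bool" where
  "x < y \<longleftrightarrow> finite_rank (un_copy x) < finite_rank (un_copy y)"

instance
proof
  fix x y z :: "'a ordered_copy"
  show "(x < y) = (x \<le> y \<and> \<not> y \<le> x)" "x \<le> x" "x \<le> y \<or> y \<le> x"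
    "x \<le> y \<Longrightarrow> y \<le> z \<Longrightarrow> x \<le> z"
    unfolding less_eq_ordered_copy_def less_ordered_copy_def by auto
  show "x = y" if "x \<le> y" "y \<le> x"
  proof -
    have "finite_rank (un_copy x) = finite_rank (un_copy y)"
      using that unfolding less_eq_ordered_copy_def by simp
    then show ?thesis by (simp add: inj_eq[OF inj_finite_rank] un_copy_inject)
  qed
next
  fix P :: "'a ordered_copy \<Rightarrow> bool" and a :: "'a ordered_copy"
  assume step: "\<And>x. (\<And>y. y < x \<Longrightarrow> P y) \<Longrightarrow> P x"
  show "P a"
  proof (induction a rule: measure_induct_rule[of "\<lambda>x. finite_rank (un_copy x)"])
    case (less x)
    show ?case
      by (rule step, rule less) (unfold less_ordered_copy_def)
  qed
qed

end

instance ordered_copy :: (finite) finite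
proof
  have "(UNIV :: 'a ordered_copy set) = range copy"
    by (metis surj_def un_copy_copy(2))
  moreover have "finite (range (copy :: 'a \<Rightarrow> _))" by (rule finite_imageI) simp
  ultimately show "finite (UNIV :: 'a ordered_copy set)" by (simp only:)
qed

lemma bij_copy: "bij copy" "bij un_copy"
  by (metis bijI' un_copy_copy(1) un_copy_copy(2))+

definition to_copy :: "real^'n \<Rightarrow> real^('n::finite ordered_copy)" where
  "to_copy x = (\<chi> i. x $ un_copy i)"

definition of_copy :: "real^('n::finite ordered_copy) \<Rightarrow> real^'n" where
  "of_copy y = (\<chi> i. y $ copy i)"

lemma to_copy_inverse [simp]: "of_copy (to_copy x) = x" "to_copy (of_copy y) = y"
  by (simp_all add: to_copy_def of_copy_def)

lemma linear_copy: "bounded_linear to_copy" "bounded_linear of_copy"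
  by (auto intro!: linear_conv_bounded_linear[THEN iffD1] linearI simp: to_copy_def of_copy_def vec_eq_iff)

lemma prod_Basis_cart: "(\<Prod>b\<in>Basis. x \<bullet> b) = (\<Prod>i\<in>UNIV. (x::real^'m) $ i)"
proof -
  have B: "(Basis :: (real^'m) set) = range (\<lambda>i. axis i 1)" by (auto simp: Basis_vec_def)
  have inj: "inj (\<lambda>i::'m. axis i (1::real))" by (auto simp: inj_on_def axis_eq_axis)
  show ?thesis unfolding B by (subst prod.reindex[OF inj]) (simp add: inner_axis)
qed

lemma measurable_copy [measurable]: "to_copy \<in> borel_measurable borel" "of_copy \<in> borel_measurable borel"
  using linear_copy by (auto intro!: borel_measurable_continuous_onI linear_continuous_on)

lemma distr_lborel_to_copy: "distr lborel borel (to_copy :: real^'n \<Rightarrow> _) = lborel"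
proof (rule lborel_eqI[symmetric])
  fix l u :: "real^('n ordered_copy)"
  assume le: "\<And>b. b \<in> Basis \<Longrightarrow> l \<bullet> b \<le> u \<bullet> b"
  have le': "l $ i \<le> u $ i" for i using le[of "axis i 1"] by (simp add: inner_axis)
  have "to_copy -` box l u = box (of_copy l) (of_copy u)"
    by (intro set_eqI) (simp add: mem_box_cart to_copy_def of_copy_def, metis un_copy_copy)
  then have "emeasure (distr lborel borel to_copy) (box l u) = emeasure lborel (box (of_copy l) (of_copy u))"
    by (subst emeasure_distr) auto
  also have "\<dots> = ennreal (\<Prod>b\<in>Basis. (of_copy u - of_copy l) \<bullet> b)"
  proof (rule emeasure_lborel_box)
    fix b :: "real^'n" assume "b \<in> Basis"
    then obtain i where "b = axis i 1" by (auto simp: Basis_vec_def)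
    then show "of_copy l \<bullet> b \<le> of_copy u \<bullet> b" using le' by (simp add: inner_axis of_copy_def)
  qed
  also have "(\<Prod>b\<in>Basis. (of_copy u - of_copy l) \<bullet> b) = (\<Prod>i\<in>UNIV. u $ copy i - l $ copy i)"
    by (simp add: prod_Basis_cart of_copy_def)
  also have "\<dots> = (\<Prod>i\<in>UNIV. u $ i - l $ i)"
    by (rule prod.reindex_bij_betw[OF bij_copy(1)])
  also have "\<dots> = (\<Prod>b\<in>Basis. (u - l) \<bullet> b)" by (simp add: prod_Basis_cart)
  finally show "emeasure (distr lborel borel to_copy) (box l u) = (\<Prod>b\<in>Basis. (u - l) \<bullet> b)" .
qed simp

text \<open>Permutations of the two index types correspond by conjugation with \<open>copy\<close>,
  and conjugation preserves the sign.\<close>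

lemma det_to_copy:
  fixes A :: "real^'n^'n"
  shows "det (\<chi> i j. A $ un_copy i $ un_copy j) = det A"
proof -
  have s: "sign (copy \<circ> p \<circ> un_copy) = sign p" if "p permutes (UNIV :: 'n set)" for p
  proof -
    have "inv copy = (un_copy :: 'n ordered_copy \<Rightarrow> 'n)" by (rule inv_equality) auto
    moreover have "range (copy :: 'n \<Rightarrow> 'n ordered_copy) = UNIV" by (rule bij_is_surj[OF bij_copy(1)])
    ultimately have "map_permutation UNIV copy p = copy \<circ> p \<circ> un_copy"
      by (simp add: map_permutation_def restrict_id_def fun_eq_iff)
    then show ?thesis
      using sign_map_permutation[OF bij_is_inj[OF bij_copy(1)] that finite_class.finite_UNIV] by simp
  qed
  have "det A = (\<Sum>p | p permutes UNIV. of_int (sign p) * (\<Prod>i\<in>UNIV. A $ i $ p i))"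
    by (simp add: det_def)
  also have "\<dots> = (\<Sum>p | p permutes UNIV. of_int (sign p) * (\<Prod>i\<in>UNIV. A $ un_copy i $ un_copy (p i)))"
  proof (rule sum.reindex_bij_witness[of _ "\<lambda>p. un_copy \<circ> p \<circ> copy" "\<lambda>p. copy \<circ> p \<circ> un_copy"])
    fix p :: "'n \<Rightarrow> 'n" assume "p \<in> {p. p permutes UNIV}"
    then have p: "p permutes UNIV" by simp
    have "bij (copy \<circ> p \<circ> un_copy)"
      using p bij_copy by (auto intro!: bij_comp simp: permutes_bij o_assoc)
    then show "copy \<circ> p \<circ> un_copy \<in> {p. p permutes UNIV}" by (auto intro: bij_imp_permutes)
    have "(\<Prod>i\<in>UNIV. A $ un_copy i $ un_copy ((copy \<circ> p \<circ> un_copy) i)) = (\<Prod>i\<in>UNIV. A $ un_copy i $ p (un_copy i))"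
      by simp
    also have "\<dots> = (\<Prod>i\<in>UNIV. A $ i $ p i)"
      by (rule prod.reindex_bij_betw[OF bij_copy(2)])
    finally show "of_int (sign (copy \<circ> p \<circ> un_copy)) * (\<Prod>i\<in>UNIV. A $ un_copy i $ un_copy ((copy \<circ> p \<circ> un_copy) i)) =
        of_int (sign p) * (\<Prod>i\<in>UNIV. A $ i $ p i)"
      using s[OF p] by simp
  next
    fix p :: "'n ordered_copy \<Rightarrow> _" assume "p \<in> {p. p permutes UNIV}"
    then have "bij (un_copy \<circ> p \<circ> copy)"
      using bij_copy by (auto intro!: bij_comp simp: permutes_bij)
    then show "un_copy \<circ> p \<circ> copy \<in> {p. p permutes UNIV}" by (auto intro: bij_imp_permutes)
  qed (auto simp: fun_eq_iff)
  finally show ?thesis by (simp add: det_def)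
qed

text \<open>\<open>d\<close> represents the Jacobian by a function that is Borel on the whole space,
  so that the integral can be taken without knowing how \<open>f'\<close> depends on the point. The
  image has finite measure because the underlying change of variables formula is stated for sets of
  finite Lebesgue measure.\<close>

lemma has_measure_image_det:
  fixes f :: "real^'n \<Rightarrow> real^'n"
  assumes S: "S \<in> sets borel" and der: "\<And>x. x \<in> S \<Longrightarrow> (f has_derivative f' x) (at x within S)"
    and inj: "inj_on f S" and im: "f ` S \<in> sets borel" "emeasure lborel (f ` S) < \<infinity>"
    and d: "d \<in> borel_measurable borel" "\<And>x. d x \<ge> 0" "\<And>x. x \<in> S \<Longrightarrow> \<bar>det (matrix (f' x))\<bar> = d x"
  shows "(\<integral>\<^sup>+x. indicator S x * ennreal (d x) \<partial>lborel) = emeasure lborel (f ` S)"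
proof -
  let ?F = "to_copy \<circ> f \<circ> of_copy" and ?F' = "\<lambda>y. to_copy \<circ> f' (of_copy y) \<circ> of_copy"
  let ?S = "of_copy -` S"
  have SS: "?S = to_copy ` S" by (auto simp: image_iff) (metis to_copy_inverse(2))
  have S': "?S \<in> sets borel" using measurable_sets[OF measurable_copy(2) S] by simp
  have d': "d \<circ> of_copy \<in> borel_measurable borel" using d(1) by measurable
  have ems: "emeasure lborel (of_copy -` A) = emeasure lborel A" if "A \<in> sets borel" for A :: "(real^'n) set"
  proof -
    have "of_copy -` A \<in> sets borel" using measurable_sets[OF measurable_copy(2) that] by simp
    then have "emeasure (distr lborel borel to_copy) (of_copy -` A) = emeasure lborel (to_copy -` of_copy -` A)"
      by (subst emeasure_distr) auto
    moreover have "to_copy -` of_copy -` A = A" by auto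
    ultimately show ?thesis by (simp add: distr_lborel_to_copy)
  qed
  have imF: "?F ` ?S = of_copy -` (f ` S)"
    unfolding SS by (auto simp: image_image) (metis imageI to_copy_inverse(2))
  have lm: "?F ` ?S \<in> lmeasurable"
    unfolding imF using im ems[OF im(1)] measurable_sets[OF measurable_copy(2) im(1)]
    by (intro fmeasurableI) auto
  have mt: "det (matrix (?F' y)) = det (matrix (f' (of_copy y)))" for y
  proof -
    have ax: "of_copy (axis j 1) = axis (un_copy j) (1::real)" for j :: "'n ordered_copy"
      by (auto simp: of_copy_def vec_eq_iff axis_def)
    have "matrix (?F' y) = (\<chi> i j. matrix (f' (of_copy y)) $ un_copy i $ un_copy j)"
      by (simp add: matrix_def vec_eq_iff ax) (simp add: to_copy_def)
    then show ?thesis using det_to_copy by simp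
  qed
  have "((\<lambda>y. \<bar>det (matrix (?F' y))\<bar>) has_integral measure lebesgue (?F ` ?S)) ?S"
  proof (subst has_measure_differentiable_image[symmetric])
    show "?S \<in> sets lebesgue" using S' by (simp add: sets_completionI_sets)
    show "inj_on ?F ?S"
      using inj by (auto simp: inj_on_def) (metis to_copy_inverse(1) to_copy_inverse(2))
    show "(?F has_derivative ?F' y) (at y within ?S)" if "y \<in> ?S" for y
    proof -
      have "(f has_derivative f' (of_copy y)) (at (of_copy y) within of_copy ` ?S)"
      proof -
        have "of_copy ` ?S = S" by (auto simp: image_iff) (metis to_copy_inverse(1))
        then show ?thesis using der that by simp
      qed
      then have "(f \<circ> of_copy has_derivative f' (of_copy y) \<circ> of_copy) (at y within ?S)"
        by (intro diff_chain_within bounded_linear_imp_has_derivative linear_copy)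
      then show ?thesis
        unfolding comp_assoc by (intro diff_chain_within[where g = to_copy] bounded_linear_imp_has_derivative linear_copy)
    qed
  qed (use lm in auto)
  then have hi: "(d \<circ> of_copy has_integral measure lebesgue (?F ` ?S)) ?S"
    by (rule has_integral_eq[rotated]) (use d(3) mt in auto)
  have "(\<integral>\<^sup>+y. indicator ?S y * ennreal ((d \<circ> of_copy) y) \<partial>lborel) = ennreal (measure lebesgue (?F ` ?S))"
  proof -
    have "((\<lambda>y. if y \<in> ?S then d (of_copy y) else 0) has_integral measure lebesgue (?F ` ?S)) UNIV"
      using hi unfolding has_integral_restrict_UNIV o_def .
    moreover have "(\<lambda>y. if y \<in> ?S then d (of_copy y) else 0) \<in> borel_measurable borel"
      using S' d' by (intro measurable_If_set) (auto simp: o_def)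
    ultimately have "(\<integral>\<^sup>+y. ennreal (if y \<in> ?S then d (of_copy y) else 0) \<partial>lborel) = ennreal (measure lebesgue (?F ` ?S))"
      using d(2) by (intro nn_integral_has_integral_lborel) auto
    moreover have "ennreal (if y \<in> ?S then d (of_copy y) else 0) = indicator ?S y * ennreal ((d \<circ> of_copy) y)" for y
      by (simp add: indicator_def)
    ultimately show ?thesis by (simp only:)
  qed
  also have "ennreal (measure lebesgue (?F ` ?S)) = emeasure lebesgue (?F ` ?S)"
    by (rule emeasure_eq_measure2[OF lm, symmetric])
  also have "\<dots> = emeasure lborel (of_copy -` (f ` S))"
    using measurable_sets[OF measurable_copy(2) im(1)] unfolding imF by simp
  also have "\<dots> = emeasure lborel (f ` S)" by (rule ems[OF im(1)])
  also have "(\<integral>\<^sup>+y. indicator ?S y * ennreal ((d \<circ> of_copy) y) \<partial>lborel) =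
     (\<integral>\<^sup>+y. indicator ?S y * ennreal ((d \<circ> of_copy) y) \<partial>distr lborel borel to_copy)"
    by (simp add: distr_lborel_to_copy)
  also have "\<dots> = (\<integral>\<^sup>+x. indicator S x * ennreal (d x) \<partial>lborel)"
  proof -
    note [measurable] = S' d'
    show ?thesis
      by (subst nn_integral_distr, measurable) (auto simp: indicator_def intro!: nn_integral_cong)
  qed
  finally show ?thesis .
qed

text \<open>Finite measure of the image is removed by exhausting it with balls and using continuity
  of measures along the increasing preimages \<open>S' k\<close>.\<close>

lemma nn_integral_det_eq_emeasure_image:
  fixes f :: "real^'n \<Rightarrow> real^'n"
  assumes S: "S \<in> sets borel" and der: "\<And>x. x \<in> S \<Longrightarrow> (f has_derivative f' x) (at x within S)"
    and inj: "inj_on f S" and im: "f ` S \<in> sets borel"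
    and d: "d \<in> borel_measurable borel" "\<And>x. d x \<ge> 0" "\<And>x. x \<in> S \<Longrightarrow> \<bar>det (matrix (f' x))\<bar> = d x"
  shows "(\<integral>\<^sup>+x. indicator S x * ennreal (d x) \<partial>lborel) = emeasure lborel (f ` S)"
proof -
  define S' where "S' k = S \<inter> f -` cball 0 (real k)" for k
  have c: "continuous_on S f"
    using der has_derivative_continuous_on by blast
  have S'[measurable]: "S' k \<in> sets borel" for k
  proof -
    have "f \<in> borel_measurable (restrict_space borel S)"
      by (rule borel_measurable_continuous_on_restrict[OF c])
    from measurable_sets[OF this, of "cball 0 (real k)"] have "f -` cball 0 (real k) \<inter> S \<in> sets (restrict_space borel S)"
      by (simp add: space_restrict_space)
    then show ?thesis using S by (simp add: S'_def sets_restrict_space_iff Int_commute)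
  qed
  have fS': "f ` S' k = f ` S \<inter> cball 0 (real k)" for k by (auto simp: S'_def)
  have each: "(\<integral>\<^sup>+x. indicator (S' k) x * ennreal (d x) \<partial>lborel) = emeasure lborel (f ` S' k)" for k
  proof (rule has_measure_image_det[where f' = f'])
    show "(f has_derivative f' x) (at x within S' k)" if "x \<in> S' k" for x
      using der[of x] that has_derivative_subset[of f "f' x" x S "S' k"] by (auto simp: S'_def)
    show "inj_on f (S' k)" using inj by (rule inj_on_subset) (auto simp: S'_def)
    show "f ` S' k \<in> sets borel" using im by (simp add: fS')
    have "emeasure lborel (f ` S' k) \<le> emeasure lborel (cball 0 (real k) :: (real^'n) set)"
      by (rule emeasure_mono) (auto simp: fS')
    also have "\<dots> < \<infinity>" by (rule emeasure_lborel_cball_finite)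
    finally show "emeasure lborel (f ` S' k) < \<infinity>" .
  qed (use d S'[of k] in \<open>auto simp: S'_def\<close>)
  have "incseq S'" by (auto simp: incseq_def S'_def)
  have un: "(\<Union>k. S' k) = S" by (auto simp: S'_def real_arch_simple)
  have "(\<integral>\<^sup>+x. indicator S x * ennreal (d x) \<partial>lborel) = emeasure (density lborel (\<lambda>x. ennreal (d x))) S"
    using d(1) S by (subst emeasure_density) (auto simp: mult.commute)
  also have "\<dots> = (SUP k. emeasure (density lborel (\<lambda>x. ennreal (d x))) (S' k))"
    using SUP_emeasure_incseq[of S' "density lborel (\<lambda>x. ennreal (d x))"] \<open>incseq S'\<close> S' by (simp add: un image_subset_iff)
  also have "\<dots> = (SUP k. emeasure lborel (f ` S' k))"
    using d(1) by (simp add: emeasure_density each[symmetric] mult.commute)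
  also have "\<dots> = emeasure lborel (\<Union>k. f ` S' k)"
    using \<open>incseq S'\<close> im by (intro SUP_emeasure_incseq) (auto simp: incseq_def fS')
  also have "(\<Union>k. f ` S' k) = f ` S" using un by blast
  finally show ?thesis .
qed

subsection \<open>Local parametrizations\<close>

lemma local_paramD:
  assumes "local_param M W f"
  shows "open W" "smooth_on W f" "\<And>x. x \<in> W \<Longrightarrow> inj (frechet_derivative f (at x))"
    "openin (top_of_set M) (f ` W)" "inj_on f W" "f ` W \<subseteq> M"
proof -
  show "open W" "smooth_on W f" "\<And>x. x \<in> W \<Longrightarrow> inj (frechet_derivative f (at x))" and o: "openin (top_of_set M) (f ` W)"
    using assms unfolding local_param_def by auto
  show "f ` W \<subseteq> M" using openin_imp_subset[OF o] .
  obtain g where "homeomorphism W (f ` W) f g" using assms unfolding local_param_def by blast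
  then show "inj_on f W" by (metis homeomorphism_apply1 inj_on_inverseI)
qed

lemma local_param_subset:
  assumes f: "local_param M W f" and V: "open V" "V \<subseteq> W"
  shows "local_param M V f"
proof -
  note D = local_paramD[OF f]
  obtain g where g: "homeomorphism W (f ` W) f g" using f unfolding local_param_def by blast
  have "openin (top_of_set W) V" using V D(1) by (simp add: openin_open_eq)
  then have "openin (top_of_set (f ` W)) (f ` V)"
    using homeomorphism_imp_open_map[OF g] by blast
  then have "openin (top_of_set M) (f ` V)" using D(4) openin_trans by blast
  moreover have "homeomorphism V (f ` V) f g"
    using homeomorphism_of_subsets[OF g V(2)] by blast
  moreover have "smooth_on V f" by (rule smooth_on_subset[OF D(1) V D(2)])
  ultimately show ?thesis unfolding local_param_def using V D(3) by blast
qed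

lemma frechet_eq_sum_partials:
  fixes f :: "real^'n \<Rightarrow> real^'d"
  assumes "open W" "smooth_on W f" "x \<in> W"
  shows "frechet_derivative f (at x) = (\<lambda>h. \<Sum>i\<in>UNIV. h $ i *\<^sub>R partial i f x)"
  by (rule frechet_derivative_at[OF smooth_on_has_derivative_partials[OF assms], symmetric])

lemma first_form_quadratic:
  fixes f :: "real^'n \<Rightarrow> real^'d"
  shows "y \<bullet> (first_form f x *v z) = (\<Sum>i\<in>UNIV. y $ i *\<^sub>R partial i f x) \<bullet> (\<Sum>i\<in>UNIV. z $ i *\<^sub>R partial i f x)"
  by (simp add: inner_vec_def[of y] matrix_vector_mult_def first_form_def inner_sum_left inner_sum_right sum_distrib_left
      algebra_simps) (rule sum.swap)

text \<open>On the segment from the identity to \<open>A\<close> every matrix has trivial kernel, so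
  the determinant never vanishes; it starts at 1 and cannot change sign.\<close>

lemma det_positive_definite:
  fixes A :: "real^'n^'n"
  assumes "\<And>x. x \<noteq> 0 \<Longrightarrow> x \<bullet> (A *v x) > 0"
  shows "det A > 0"
proof (rule ccontr)
  assume neg: "\<not> det A > 0"
  define B where "B t = (1 - t) *\<^sub>R mat 1 + t *\<^sub>R A" for t :: real
  have nz: "det (B t) \<noteq> 0" if "0 \<le> t" "t \<le> 1" for t
  proof -
    have "x = 0" if "B t *v x = 0" for x
    proof (rule ccontr)
      assume x: "x \<noteq> 0"
      have "x \<bullet> (B t *v x) = (1 - t) * (x \<bullet> x) + t * (x \<bullet> (A *v x))"
        unfolding B_def by (simp add: matrix_vector_mult_add_rdistrib scaleR_matrix_vector_assoc[symmetric] inner_add_right)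
      moreover have "\<dots> > 0"
      proof (cases "t = 0")
        case True
        then show ?thesis using x by simp
      next
        case False
        have "(1 - t) * (x \<bullet> x) \<ge> 0" using \<open>t \<le> 1\<close> by simp
        moreover have "t * (x \<bullet> (A *v x)) > 0" using assms[OF x] False \<open>0 \<le> t\<close> by simp
        ultimately show ?thesis by linarith
      qed
      ultimately show False using that by simp
    qed
    then have "\<exists>C. C ** B t = mat 1" by (simp add: matrix_left_invertible_ker)
    then show ?thesis by (metis invertible_def invertible_det_nz matrix_left_right_inverse)
  qed
  have "continuous_on {0..1} (\<lambda>t. det (B t))"
    unfolding B_def det_def by (intro continuous_intros)
  moreover have "det (B 1) \<le> 0" "det (B 0) = 1" using neg by (simp_all add: B_def)
  ultimately have "\<exists>t\<ge>0. t \<le> 1 \<and> det (B t) = 0"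
    by (intro IVT2') auto
  then show False using nz by blast
qed

lemma first_form_det_pos:
  fixes f :: "real^'n \<Rightarrow> real^'d"
  assumes "local_param M W f" "x \<in> W"
  shows "det (first_form f x) > 0"
proof (rule det_positive_definite)
  note D = local_paramD[OF assms(1)]
  fix y :: "real^'n" assume "y \<noteq> 0"
  have eq: "frechet_derivative f (at x) = (\<lambda>h. \<Sum>i\<in>UNIV. h $ i *\<^sub>R partial i f x)"
    by (rule frechet_eq_sum_partials[OF D(1,2) assms(2)])
  have "frechet_derivative f (at x) y \<noteq> frechet_derivative f (at x) 0"
    using D(3)[OF assms(2)] \<open>y \<noteq> 0\<close> by (meson injD)
  then have "(\<Sum>i\<in>UNIV. y $ i *\<^sub>R partial i f x) \<noteq> 0" unfolding eq by simp
  then show "y \<bullet> (first_form f x *v y) > 0" unfolding first_form_quadratic by simp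
qed

lemma smooth_on_first_form:
  fixes f :: "real^'n \<Rightarrow> real^'d"
  assumes "open W" "smooth_on W f"
  shows "smooth_on W (\<lambda>x. first_form f x $ i $ j)"
  unfolding first_form_def by (simp, intro smooth_on_inner smooth_on_partial assms)

text \<open>The indicator of \<open>W\<close> removes the meaningless values outside of the chart
  and makes the density Borel on the whole space.\<close>

definition area_density :: "(real^'n) set \<Rightarrow> (real^'n \<Rightarrow> real^'d) \<Rightarrow> real^'n \<Rightarrow> real" where
  "area_density W f x = indicator W x * sqrt (det (first_form f x))"

lemma smooth_on_sqrt_det_first_form:
  assumes "local_param M W f"
  shows "smooth_on W (\<lambda>x. sqrt (det (first_form f x)))"
  using local_paramD(1,2)[OF assms] first_form_det_pos[OF assms]
  by (intro smooth_on_sqrt smooth_on_det smooth_on_first_form)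

lemma area_density:
  assumes "local_param M W f"
  shows "area_density W f \<in> borel_measurable borel" "area_density W f x \<ge> 0"
proof -
  note D = local_paramD[OF assms]
  have "(\<lambda>x. indicator W x *\<^sub>R sqrt (det (first_form f x))) \<in> borel_measurable borel"
    by (rule borel_measurable_continuous_on_indicator)
      (use D smooth_on_continuous[OF smooth_on_sqrt_det_first_form[OF assms]] in auto)
  then show "area_density W f \<in> borel_measurable borel" unfolding area_density_def[abs_def] by simp
  show "area_density W f x \<ge> 0"
    using first_form_det_pos[OF assms] by (auto simp: area_density_def indicator_def less_imp_le)
qed

section \<open>Chart measures and transition maps\<close>

lemma continuous_vimage_borel:
  fixes f :: "'a::topological_space \<Rightarrow> 'b::topological_space"
  assumes "continuous_on W f" "W \<in> sets borel" "A \<in> sets borel"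
  shows "W \<inter> f -` A \<in> sets borel"
proof -
  have "f -` A \<inter> space (restrict_space borel W) \<in> sets (restrict_space borel W)"
    by (rule measurable_sets[OF borel_measurable_continuous_on_restrict[OF assms(1)] assms(3)])
  then show ?thesis using assms(2) by (simp add: sets_restrict_space_iff space_restrict_space Int_commute)
qed

text \<open>The area of one chart as a measure on all of the ambient space. The value
  \<open>0\<close> of the map outside \<open>W\<close> serves measurability; the density vanishes
  there.\<close>

definition chart_measure :: "(real^'n) set \<Rightarrow> (real^'n \<Rightarrow> real^'d) \<Rightarrow> (real^'d) measure" where
  "chart_measure W f = distr (density lborel (\<lambda>x. ennreal (area_density W f x))) borel (\<lambda>x. if x \<in> W then f x else 0)"

lemma chart_map_measurable:
  assumes "local_param M W f"
  shows "(\<lambda>x. if x \<in> W then f x else 0) \<in> borel_measurable borel"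
proof -
  note D = local_paramD[OF assms]
  have "(\<lambda>x. indicator W x *\<^sub>R f x) \<in> borel_measurable borel"
    by (rule borel_measurable_continuous_on_indicator) (use D smooth_on_continuous in auto)
  moreover have "(\<lambda>x. indicator W x *\<^sub>R f x) = (\<lambda>x. if x \<in> W then f x else 0)" by (auto simp: fun_eq_iff)
  ultimately show ?thesis by simp
qed

lemma sets_chart_measure [simp, measurable_cong]: "sets (chart_measure W f) = sets borel"
  by (simp add: chart_measure_def)

lemma nn_integral_chart_measure:
  assumes f: "local_param M W f" and [measurable]: "h \<in> borel_measurable borel"
  shows "(\<integral>\<^sup>+v. h v \<partial>chart_measure W f) = (\<integral>\<^sup>+x. ennreal (area_density W f x) * h (f x) \<partial>lborel)"
proof -
  note [measurable] = area_density(1)[OF f] chart_map_measurable[OF f]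
  have "(\<integral>\<^sup>+v. h v \<partial>chart_measure W f) =
      (\<integral>\<^sup>+x. ennreal (area_density W f x) * h (if x \<in> W then f x else 0) \<partial>lborel)"
    unfolding chart_measure_def by (subst nn_integral_distr, measurable, subst nn_integral_density) measurable
  also have "\<dots> = (\<integral>\<^sup>+x. ennreal (area_density W f x) * h (f x) \<partial>lborel)"
    by (rule nn_integral_cong) (simp add: area_density_def)
  finally show ?thesis .
qed

lemma emeasure_chart_measure:
  assumes f: "local_param M W f" and A: "A \<in> sets borel"
  shows "emeasure (chart_measure W f) A =
    (\<integral>\<^sup>+x\<in>W \<inter> f -` A. ennreal (sqrt (det (first_form f x))) \<partial>lborel)"
proof -
  have "emeasure (chart_measure W f) A = (\<integral>\<^sup>+v. indicator A v \<partial>chart_measure W f)" using A by simp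
  also have "\<dots> = (\<integral>\<^sup>+x. ennreal (area_density W f x) * indicator A (f x) \<partial>lborel)"
    by (rule nn_integral_chart_measure[OF f]) (use A in measurable)
  also have "\<dots> = (\<integral>\<^sup>+x\<in>W \<inter> f -` A. ennreal (sqrt (det (first_form f x))) \<partial>lborel)"
    by (rule nn_integral_cong) (auto simp: area_density_def indicator_def)
  finally show ?thesis .
qed

text \<open>A left inverse \<open>L\<close> of the derivative of \<open>f\<close> solves the
  linearized equation for a continuous lift \<open>\<phi>\<close> of \<open>k\<close> through
  \<open>f\<close>. This is meant for transition maps between charts, where \<open>f\<close> maps
  into a space of possibly higher dimension and the inverse function theorem does not apply to it
  directly.\<close>

lemma lift_has_derivative:
  fixes f :: "'b::real_normed_vector \<Rightarrow> 'c::real_normed_vector" and \<phi> :: "'a::real_normed_vector \<Rightarrow> 'b"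
  assumes k: "(k has_derivative A) (at x)" and f: "(f has_derivative B) (at (\<phi> x))"
    and L: "bounded_linear L" "\<And>v. L (B v) = v" and c: "isCont \<phi> x"
    and S: "open S" "x \<in> S" "\<And>z. z \<in> S \<Longrightarrow> f (\<phi> z) = k z"
  shows "(\<phi> has_derivative (\<lambda>v. L (A v))) (at x)"
  unfolding has_derivative_at_alt
proof (intro conjI allI impI)
  have LA: "bounded_linear (\<lambda>v. L (A v))"
    using bounded_linear_compose[OF L(1) has_derivative_bounded_linear[OF k]] .
  then show "bounded_linear (\<lambda>v. L (A v))" .
  obtain K where K: "K > 0" "\<And>v. norm (L v) \<le> norm v * K" using bounded_linear.pos_bounded[OF L(1)] by blast
  obtain b where b: "b > 0" "\<And>v. norm (L (A v)) \<le> norm v * b" using bounded_linear.pos_bounded[OF LA] by blast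
  fix e :: real assume "e > 0"
  \<comment> \<open>The first bound lets half of \<open>norm (\<phi> z - \<phi> x)\<close> be
    absorbed into the left-hand side, giving a Lipschitz estimate with constant
    \<open>2 * b + 1\<close>; the second makes the final error at most \<open>e\<close> times the
    increment.\<close>
  define \<eta> where "\<eta> = min (1 / (2 * K)) (e / (K * (2 * b + 2)))"
  have \<eta>: "\<eta> > 0" "K * \<eta> \<le> 1 / 2" "K * \<eta> * (2 * b + 2) \<le> e"
  proof -
    show "\<eta> > 0" using K b \<open>e > 0\<close> by (simp add: \<eta>_def add_pos_pos)
    have "\<eta> \<le> 1 / (2 * K)" by (simp add: \<eta>_def)
    then show "K * \<eta> \<le> 1 / 2" using K by (simp add: field_simps)
    have "\<eta> \<le> e / (K * (2 * b + 2))" by (simp add: \<eta>_def)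
    then show "K * \<eta> * (2 * b + 2) \<le> e" using K b by (simp add: pos_le_divide_eq add_pos_pos mult.commute mult.left_commute)
  qed
  obtain d1 where d1: "d1 > 0" "\<And>z. norm (z - x) < d1 \<Longrightarrow> norm (k z - k x - A (z - x)) \<le> \<eta> * norm (z - x)"
    using k \<eta>(1) unfolding has_derivative_at_alt by blast
  obtain d2 where d2: "d2 > 0" "\<And>w. norm (w - \<phi> x) < d2 \<Longrightarrow> norm (f w - f (\<phi> x) - B (w - \<phi> x)) \<le> \<eta> * norm (w - \<phi> x)"
    using f \<eta>(1) unfolding has_derivative_at_alt by blast
  obtain d3 where d3: "d3 > 0" "\<And>z. norm (z - x) < d3 \<Longrightarrow> norm (\<phi> z - \<phi> x) < d2"
    using c d2(1) unfolding continuous_at_eps_delta dist_norm by blast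
  obtain d4 where d4: "d4 > 0" "ball x d4 \<subseteq> S" using S(1,2) open_contains_ball by blast
  have "norm (\<phi> z - \<phi> x - L (A (z - x))) \<le> e * norm (z - x)" if z: "norm (z - x) < min (min d1 d3) d4" for z
  proof -
    define h p where "h = z - x" and "p = \<phi> z - \<phi> x"
    define rk rf where "rk = k z - k x - A h" and "rf = f (\<phi> z) - f (\<phi> x) - B p"
    have "z \<in> S" using z d4 by (auto simp: dist_norm norm_minus_commute)
    then have "f (\<phi> z) = k z" "f (\<phi> x) = k x" using S by auto
    then have "B p = A h + (rk - rf)" unfolding rk_def rf_def by simp
    then have "L (B p) = L (A h) + L (rk - rf)" by (simp add: bounded_linear.linear[OF L(1)] linear_add)
    then have p: "p - L (A h) = L (rk - rf)" using L(2) by simp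
    have rk: "norm rk \<le> \<eta> * norm h" using d1(2) z unfolding rk_def h_def by auto
    have rf: "norm rf \<le> \<eta> * norm p" using d2(2) d3(2) z unfolding rf_def p_def by auto
    have "norm (rk - rf) \<le> \<eta> * norm h + \<eta> * norm p" using norm_triangle_ineq4[of rk rf] rk rf by linarith
    then have "norm (rk - rf) * K \<le> (\<eta> * norm h + \<eta> * norm p) * K" using K by (intro mult_right_mono) auto
    then have main: "norm (p - L (A h)) \<le> K * \<eta> * (norm h + norm p)"
      using K(2)[of "rk - rf"] unfolding p by (simp add: algebra_simps)
    also have "\<dots> \<le> 1 / 2 * (norm h + norm p)" using \<eta> by (intro mult_right_mono) auto
    finally have "norm p \<le> (2 * b + 1) * norm h"
      using norm_triangle_ineq2[of p "L (A h)"] b(2)[of h] by (simp add: algebra_simps)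
    then have "norm h + norm p \<le> (2 * b + 2) * norm h" by (simp add: algebra_simps)
    then have "K * \<eta> * (norm h + norm p) \<le> K * \<eta> * ((2 * b + 2) * norm h)"
      using K \<eta> by (intro mult_left_mono) auto
    also have "\<dots> \<le> e * norm h" using mult_right_mono[OF \<eta>(3), of "norm h"] by (simp add: mult.assoc)
    finally show ?thesis using main unfolding h_def p_def by simp
  qed
  then show "\<exists>d>0. \<forall>z. norm (z - x) < d \<longrightarrow> norm (\<phi> z - \<phi> x - L (A (z - x))) \<le> e * norm (z - x)"
    using d1 d3 d4 by (intro exI[of _ "min (min d1 d3) d4"]) auto
qed

lemma first_form_transform:
  fixes J :: "real^'n^'n" and f1 f2 :: "real^'n \<Rightarrow> real^'d"
  assumes part: "\<And>i. partial i f1 x = (\<Sum>a\<in>UNIV. J $ a $ i *\<^sub>R partial a f2 z)"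
  shows "first_form f1 x = transpose J ** first_form f2 z ** J"
proof -
  have "first_form f1 x $ i $ j = (transpose J ** first_form f2 z ** J) $ i $ j" for i j
  proof -
    have "first_form f1 x $ i $ j = (\<Sum>a\<in>UNIV. \<Sum>b\<in>UNIV. J $ a $ i * (J $ b $ j * (partial a f2 z \<bullet> partial b f2 z)))"
      unfolding first_form_def part
      by (simp add: inner_sum_left inner_sum_right sum_distrib_left) (subst sum.swap, simp add: mult.left_commute)
    also have "\<dots> = (transpose J ** first_form f2 z ** J) $ i $ j"
      by (simp add: matrix_matrix_mult_def transpose_def first_form_def sum_distrib_left sum_distrib_right algebra_simps)
        (subst sum.swap, simp add: mult.left_commute)
    finally show ?thesis .
  qed
  then show ?thesis by (simp add: vec_eq_iff)
qed

locale transition =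
  fixes M :: "(real^'d) set" and W1 W2 :: "(real^'n) set" and f1 f2 :: "real^'n \<Rightarrow> real^'d"
  assumes f1: "local_param M W1 f1" and f2: "local_param M W2 f2"
begin

definition dom where "dom = W1 \<inter> f1 -` (f2 ` W2)"
definition tr where "tr z = inv_into W2 f2 (f1 z)"

lemma open_dom: "open dom"
proof -
  obtain T where T: "open T" "f2 ` W2 = M \<inter> T"
    using local_paramD(4)[OF f2] by (auto simp: openin_open)
  have "dom = W1 \<inter> f1 -` T"
    using T(2) local_paramD(6)[OF f1] unfolding dom_def by blast
  then show ?thesis
    using continuous_open_preimage[OF smooth_on_continuous[OF local_paramD(2)[OF f1]] local_paramD(1)[OF f1] T(1)] by simp
qed

lemma tr: "z \<in> dom \<Longrightarrow> tr z \<in> W2" "z \<in> dom \<Longrightarrow> f2 (tr z) = f1 z"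
  unfolding tr_def dom_def by (auto intro: inv_into_into f_inv_into_f)

lemma inj_tr: "inj_on tr dom"
  using tr(2) local_paramD(5)[OF f1] unfolding inj_on_def dom_def by (metis Int_iff)

lemma continuous_tr: "continuous_on dom tr"
proof -
  obtain g where g: "homeomorphism W2 (f2 ` W2) f2 g" using f2 unfolding local_param_def by blast
  have "continuous_on dom (\<lambda>z. g (f1 z))"
    by (rule continuous_on_compose2[OF homeomorphism_cont2[OF g]
          continuous_on_subset[OF smooth_on_continuous[OF local_paramD(2)[OF f1]]]]) (auto simp: dom_def)
  moreover have "tr z = g (f1 z)" if "z \<in> dom" for z
    using tr[OF that] homeomorphism_apply1[OF g] by metis
  ultimately show ?thesis by (simp cong: continuous_on_cong)
qed

text \<open>The chain rule for \<open>f1 = f2 \<circ> tr\<close> relates the two Gram matrices by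
  congruence with the Jacobian matrix, so their determinants differ by the square of the Jacobian
  determinant.\<close>

lemma tr_derivative:
  assumes x: "x \<in> dom"
  obtains \<phi>' where "(tr has_derivative \<phi>') (at x)"
    "sqrt (det (first_form f1 x)) = \<bar>det (matrix \<phi>')\<bar> * sqrt (det (first_form f2 (tr x)))"
proof -
  note D1 = local_paramD[OF f1] and D2 = local_paramD[OF f2]
  have xW: "x \<in> W1" using x by (simp add: dom_def)
  let ?A = "frechet_derivative f1 (at x)" and ?B = "frechet_derivative f2 (at (tr x))"
  have dA: "(f1 has_derivative ?A) (at x)" by (rule smooth_on_has_derivative[OF D1(1,2) xW])
  have dB: "(f2 has_derivative ?B) (at (tr x))" by (rule smooth_on_has_derivative[OF D2(1,2) tr(1)[OF x]])
  obtain L where L: "linear L" "L \<circ> ?B = id"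
    using linear_injective_left_inverse[OF has_derivative_linear[OF dB] D2(3)[OF tr(1)[OF x]]] by blast
  have LB: "L (?B v) = v" for v using L(2) by (metis comp_apply id_apply)
  have "isCont tr x" using continuous_tr open_dom x continuous_on_eq_continuous_at by blast
  then have d: "(tr has_derivative (\<lambda>v. L (?A v))) (at x)"
    by (intro lift_has_derivative[where f = f2 and k = f1 and S = dom and \<phi> = tr, OF dA dB _ LB _ open_dom x tr(2)])
      (use L(1) in \<open>auto simp: linear_conv_bounded_linear\<close>)
  let ?\<phi>' = "\<lambda>v. L (?A v)"
  have "((\<lambda>z. f2 (tr z)) has_derivative (\<lambda>v. ?B (?\<phi>' v))) (at x)"
    by (rule has_derivative_compose[where f = tr and g = f2, OF d dB])
  then have "(f1 has_derivative (\<lambda>v. ?B (?\<phi>' v))) (at x)"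
    by (rule has_derivative_transform_within_open[OF _ open_dom x]) (rule tr(2))
  then have AB: "?A = (\<lambda>v. ?B (?\<phi>' v))" using dA has_derivative_unique by blast
  define J where "J = matrix ?\<phi>'"
  have part: "partial i f1 x = (\<Sum>a\<in>UNIV. J $ a $ i *\<^sub>R partial a f2 (tr x))" for i
  proof -
    have "partial i f1 x = ?B (?\<phi>' (axis i 1))"
      unfolding partial_def by (rule fun_cong[OF AB])
    also have "\<dots> = (\<Sum>a\<in>UNIV. (?\<phi>' (axis i 1)) $ a *\<^sub>R partial a f2 (tr x))"
      by (subst frechet_eq_sum_partials[OF D2(1,2) tr(1)[OF x]]) simp
    finally show ?thesis by (simp add: J_def matrix_def)
  qed
  have "first_form f1 x = transpose J ** first_form f2 (tr x) ** J"
    by (rule first_form_transform[OF part])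
  then have "det (first_form f1 x) = (det J)\<^sup>2 * det (first_form f2 (tr x))"
    by (simp add: det_mul power2_eq_square)
  then have "sqrt (det (first_form f1 x)) = \<bar>det J\<bar> * sqrt (det (first_form f2 (tr x)))"
    by (simp add: real_sqrt_mult)
  then show thesis using that d J_def by blast
qed

text \<open>Pushed forward by the transition map, Lebesgue measure on \<open>S1\<close> with the
  density \<open>d\<close> becomes Lebesgue measure on \<open>S2\<close>; multiplying
  \<open>d\<close> by the area density of the second chart gives that of the first.\<close>

lemma chart_measure_eq:
  assumes A: "A \<in> sets borel" "A \<subseteq> f1 ` W1" "A \<subseteq> f2 ` W2"
  shows "emeasure (chart_measure W1 f1) A = emeasure (chart_measure W2 f2) A"
proof -
  define S1 S2 where "S1 = W1 \<inter> f1 -` A" and "S2 = W2 \<inter> f2 -` A"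
  note D1 = local_paramD[OF f1] and D2 = local_paramD[OF f2]
  have [measurable]: "S1 \<in> sets borel" "S2 \<in> sets borel" "dom \<in> sets borel"
    unfolding S1_def S2_def using D1(1,2) D2(1,2) open_dom A(1)
    by (auto intro!: continuous_vimage_borel smooth_on_continuous)
  have S1d: "S1 \<subseteq> dom" using A by (auto simp: S1_def dom_def)
  have trS: "tr ` S1 = S2"
  proof
    show "tr ` S1 \<subseteq> S2" using tr S1d by (auto simp: S1_def S2_def)
    show "S2 \<subseteq> tr ` S1"
    proof
      fix y assume y: "y \<in> S2"
      then obtain x where x: "x \<in> W1" "f1 x = f2 y" using A(2) unfolding S2_def by (metis IntD2 imageE subsetD vimageD)
      then have xS: "x \<in> S1" using y by (simp add: S1_def S2_def)
      then have "f2 (tr x) = f2 y" using tr(2) S1d x(2) by auto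
      then have "tr x = y" using D2(5) tr(1) xS S1d y unfolding inj_on_def S2_def by blast
      then show "y \<in> tr ` S1" using xS by blast
    qed
  qed
  \<comment> \<open>\<open>d\<close> equals the absolute Jacobian determinant of \<open>tr\<close>
    on \<open>dom\<close>. As a quotient of area densities it is continuous there, while the
    derivative of \<open>tr\<close> has only been shown to exist.\<close>
  define d where "d x = indicator dom x *\<^sub>R (sqrt (det (first_form f1 x)) / sqrt (det (first_form f2 (tr x))))" for x
  have d_meas [measurable]: "d \<in> borel_measurable borel"
    unfolding d_def[abs_def]
  proof (rule borel_measurable_continuous_on_indicator)
    have "continuous_on dom (\<lambda>x. sqrt (det (first_form f2 (tr x))))"
      by (rule continuous_on_compose2[OF smooth_on_continuous[OF smooth_on_sqrt_det_first_form[OF f2]] continuous_tr]) (use tr in auto)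
    moreover have "continuous_on dom (\<lambda>x. sqrt (det (first_form f1 x)))"
      by (rule continuous_on_subset[OF smooth_on_continuous[OF smooth_on_sqrt_det_first_form[OF f1]]]) (auto simp: dom_def)
    ultimately show "continuous_on dom (\<lambda>x. sqrt (det (first_form f1 x)) / sqrt (det (first_form f2 (tr x))))"
      using first_form_det_pos[OF f2 tr(1)] by (intro continuous_on_divide) (auto simp: less_imp_neq[THEN not_sym])
  qed simp
  have d0: "d x \<ge> 0" for x
    using first_form_det_pos[OF f1, of x] first_form_det_pos[OF f2 tr(1), of x] unfolding d_def
    by (auto simp: indicator_def dom_def less_imp_le)
  obtain \<phi>' where \<phi>': "\<And>x. x \<in> dom \<Longrightarrow> (tr has_derivative \<phi>' x) (at x)"
    "\<And>x. x \<in> dom \<Longrightarrow> sqrt (det (first_form f1 x)) = \<bar>det (matrix (\<phi>' x))\<bar> * sqrt (det (first_form f2 (tr x)))"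
  proof -
    have "\<forall>x. \<exists>\<phi>'. x \<in> dom \<longrightarrow> (tr has_derivative \<phi>') (at x) \<and>
        sqrt (det (first_form f1 x)) = \<bar>det (matrix \<phi>')\<bar> * sqrt (det (first_form f2 (tr x)))"
      using tr_derivative by blast
    then show thesis using that by metis
  qed
  define t where "t x = (if x \<in> dom then tr x else 0)" for x
  have t_meas [measurable]: "t \<in> borel_measurable borel"
  proof -
    have "(\<lambda>x. indicator dom x *\<^sub>R tr x) \<in> borel_measurable borel"
      by (rule borel_measurable_continuous_on_indicator[OF _ continuous_tr]) simp
    moreover have "(\<lambda>x. indicator dom x *\<^sub>R tr x) = t" by (auto simp: fun_eq_iff t_def)
    ultimately show ?thesis by simp
  qed
  have eq: "distr (density lborel (\<lambda>x. indicator S1 x * ennreal (d x))) borel t = density lborel (indicator S2)"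
  proof (rule measure_eqI)
    fix X assume "X \<in> sets (distr (density lborel (\<lambda>x. indicator S1 x * ennreal (d x))) borel t)"
    then have X[measurable]: "X \<in> sets borel" by simp
    define S where "S = S1 \<inter> t -` X"
    have tX[measurable]: "t -` X \<in> sets borel" using measurable_sets[OF t_meas X] by simp
    have S[measurable]: "S \<in> sets borel" by (simp add: S_def)
    have Sd: "S \<subseteq> dom" using S1d by (auto simp: S_def)
    have "t x = tr x" if "x \<in> S1" for x using S1d that by (auto simp: t_def)
    then have trSX: "tr ` S = S2 \<inter> X" unfolding trS[symmetric] S_def by force
    have "emeasure (distr (density lborel (\<lambda>x. indicator S1 x * ennreal (d x))) borel t) X =
        (\<integral>\<^sup>+x. indicator S x * ennreal (d x) \<partial>lborel)"
      by (subst emeasure_distr, measurable, subst emeasure_density, measurable)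
        (auto intro!: nn_integral_cong simp: S_def indicator_def)
    also have "\<dots> = emeasure lborel (tr ` S)"
    proof (rule nn_integral_det_eq_emeasure_image[OF S])
      show "(tr has_derivative \<phi>' x) (at x within S)" if "x \<in> S" for x
        using \<phi>'(1)[of x] that Sd by (auto intro: has_derivative_at_withinI)
      show "inj_on tr S" using inj_tr Sd inj_on_subset by blast
      show "tr ` S \<in> sets borel" by (simp add: trSX)
      show "\<bar>det (matrix (\<phi>' x))\<bar> = d x" if "x \<in> S" for x
      proof -
        have "x \<in> dom" using that Sd by blast
        then show ?thesis
          using \<phi>'(2)[of x] first_form_det_pos[OF f2 tr(1), of x] by (simp add: d_def)
      qed
    qed (use d0 in auto)
    also have "tr ` S = S2 \<inter> X" by (rule trSX)
    also have "emeasure lborel (S2 \<inter> X) = emeasure (density lborel (indicator S2)) X"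
      by (subst emeasure_density, measurable)
        (simp add: indicator_inter_arith[symmetric] nn_integral_indicator)
    finally show "emeasure (distr (density lborel (\<lambda>x. indicator S1 x * ennreal (d x))) borel t) X =
      emeasure (density lborel (indicator S2)) X" .
  qed simp
  note m2 [measurable] = area_density(1)[OF f2]
  have "emeasure (chart_measure W2 f2) A = (\<integral>\<^sup>+x. ennreal (area_density W2 f2 x) \<partial>density lborel (indicator S2))"
    unfolding emeasure_chart_measure[OF f2 A(1)] S2_def[symmetric] using m2
    by (subst nn_integral_density, simp, simp) (auto intro!: nn_integral_cong simp: area_density_def indicator_def S2_def)
  also have "\<dots> = (\<integral>\<^sup>+x. indicator S1 x * ennreal (d x) * ennreal (area_density W2 f2 (t x)) \<partial>lborel)"
    unfolding eq[symmetric] using m2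
    by (subst nn_integral_distr, measurable, subst nn_integral_density) measurable
  also have "\<dots> = (\<integral>\<^sup>+x. indicator S1 x * ennreal (sqrt (det (first_form f1 x))) \<partial>lborel)"
  proof (rule nn_integral_cong)
    fix x
    show "indicator S1 x * ennreal (d x) * ennreal (area_density W2 f2 (t x)) = indicator S1 x * ennreal (sqrt (det (first_form f1 x)))"
    proof (cases "x \<in> S1")
      case True
      then have x: "x \<in> dom" using S1d by blast
      have "d x * area_density W2 f2 (t x) = sqrt (det (first_form f1 x))"
        using x tr(1)[OF x] first_form_det_pos[OF f2 tr(1)[OF x]] by (simp add: d_def t_def area_density_def)
      then have "ennreal (d x) * ennreal (area_density W2 f2 (t x)) = ennreal (sqrt (det (first_form f1 x)))"
        using d0 area_density(2)[OF f2] by (simp flip: ennreal_mult)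
      then show ?thesis using True by simp
    qed simp
  qed
  also have "\<dots> = emeasure (chart_measure W1 f1) A"
    unfolding emeasure_chart_measure[OF f1 A(1)] S1_def[symmetric]
    by (auto intro!: nn_integral_cong simp: mult.commute)
  finally show ?thesis ..
qed

end

section \<open>Construction of the area measure\<close>

text \<open>A chart may have infinite area; shrinking it to a ball whose closure still lies in the
  domain bounds the density.\<close>

lemma submanifold_finite_chart:
  fixes M :: "(real^'d) set"
  assumes "submanifold TYPE('n::finite) M" "p \<in> M"
  shows "\<exists>(W :: (real^'n) set) f. local_param M W f \<and> p \<in> f ` W \<and> emeasure (chart_measure W f) UNIV < \<infinity>"
proof -
  obtain W0 and f :: "real^'n \<Rightarrow> real^'d" where f: "local_param M W0 f" "p \<in> f ` W0"
    using assms unfolding submanifold_def by blast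
  obtain x where x: "x \<in> W0" "p = f x" using f(2) by blast
  obtain r where r: "r > 0" "cball x r \<subseteq> W0" using local_paramD(1)[OF f(1)] x open_contains_cball by blast
  let ?V = "ball x r"
  have V: "local_param M ?V f" using r ball_subset_cball by (intro local_param_subset[OF f(1)]) auto
  have "compact ((\<lambda>x. sqrt (det (first_form f x))) ` cball x r)"
    using continuous_on_subset[OF smooth_on_continuous[OF smooth_on_sqrt_det_first_form[OF f(1)]] r(2)]
    by (intro compact_continuous_image compact_cball)
  then have "bounded ((\<lambda>x. sqrt (det (first_form f x))) ` cball x r)" by (rule compact_imp_bounded)
  then obtain C where C: "\<forall>z\<in>(\<lambda>x. sqrt (det (first_form f x))) ` cball x r. norm z \<le> C"
    unfolding bounded_iff by blast
  have "emeasure (chart_measure ?V f) UNIV = (\<integral>\<^sup>+z\<in>?V. ennreal (sqrt (det (first_form f z))) \<partial>lborel)"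
    using emeasure_chart_measure[OF V, of UNIV] by simp
  also have "\<dots> \<le> (\<integral>\<^sup>+z. ennreal C * indicator (cball x r) z \<partial>lborel)"
  proof (rule nn_integral_mono)
    fix z
    show "ennreal (sqrt (det (first_form f z))) * indicator ?V z \<le> ennreal C * indicator (cball x r) z"
    proof (cases "z \<in> ?V")
      case True
      then have "norm (sqrt (det (first_form f z))) \<le> C" using C by (auto simp: less_imp_le)
      then show ?thesis using True by (simp add: less_imp_le ennreal_leI)
    qed simp
  qed
  also have "\<dots> = ennreal C * emeasure lborel (cball x r)" by (rule nn_integral_cmult_indicator) simp
  also have "\<dots> < \<infinity>" using emeasure_lborel_cball_finite[of x r] by (simp add: ennreal_mult_less_top)
  finally have "emeasure (chart_measure ?V f) UNIV < \<infinity>" .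
  moreover have "p \<in> f ` ?V" using x r by auto
  ultimately show ?thesis using V by blast
qed

lemma finite_atlas:
  fixes M :: "(real^'d) set"
  assumes M: "compact M" "submanifold TYPE('n::finite) M"
  shows "\<exists>m (W :: nat \<Rightarrow> (real^'n) set) f. (\<forall>i<m. local_param M (W i) (f i) \<and>
    emeasure (chart_measure (W i) (f i)) UNIV < \<infinity>) \<and> M = (\<Union>i<m. f i ` W i)"
proof -
  have "\<forall>p\<in>M. \<exists>(W :: (real^'n) set) f. local_param M W f \<and> p \<in> f ` W \<and> emeasure (chart_measure W f) UNIV < \<infinity>"
    using submanifold_finite_chart[OF M(2)] by blast
  then obtain W :: "_ \<Rightarrow> (real^'n) set" and f where Wf: "\<And>p. p \<in> M \<Longrightarrow> local_param M (W p) (f p)"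
    "\<And>p. p \<in> M \<Longrightarrow> p \<in> f p ` W p" "\<And>p. p \<in> M \<Longrightarrow> emeasure (chart_measure (W p) (f p)) UNIV < \<infinity>"
    by metis
  have "\<forall>p\<in>M. \<exists>T. open T \<and> f p ` W p = M \<inter> T"
    using local_paramD(4)[OF Wf(1)] by (auto simp: openin_open)
  then obtain T where T: "\<And>p. p \<in> M \<Longrightarrow> open (T p)" "\<And>p. p \<in> M \<Longrightarrow> f p ` W p = M \<inter> T p" by metis
  have "M \<subseteq> (\<Union>p\<in>M. T p)" using Wf(2) T(2) by blast
  then obtain P where P: "P \<subseteq> M" "finite P" "M \<subseteq> (\<Union>p\<in>P. T p)"
    using compactE_image[OF M(1), of M T] T(1) by blast
  obtain h where h: "bij_betw h {0..<card P} P" using ex_bij_betw_nat_finite[OF P(2)] by blast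
  have hP: "h i \<in> M" if "i < card P" for i using that h P(1) by (auto simp: bij_betw_def)
  have Ph: "P = h ` {..<card P}" using h by (auto simp: bij_betw_def atLeast0LessThan)
  have "M = (\<Union>p\<in>P. f p ` W p)" using P(1,3) T(2) by blast
  also have "\<dots> = (\<Union>i<card P. f (h i) ` W (h i))" by (subst Ph) simp
  finally have "M = (\<Union>i<card P. f (h i) ` W (h i))" .
  moreover have "\<forall>i<card P. local_param M (W (h i)) (f (h i)) \<and> emeasure (chart_measure (W (h i)) (f (h i))) UNIV < \<infinity>"
    using Wf(1,3) hP by simp
  ultimately show ?thesis
    by (intro exI[of _ "card P"] exI[of _ "\<lambda>i. W (h i)"] exI[of _ "\<lambda>i. f (h i)"] conjI)
qed

lemma local_param_image_borel:
  assumes "compact M" "local_param M W f"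
  shows "f ` W \<in> sets borel"
proof -
  obtain T where "open T" "f ` W = M \<inter> T" using local_paramD(4)[OF assms(2)] by (auto simp: openin_open)
  moreover have "M \<in> sets borel" using assms(1) by (auto intro: borel_closed compact_imp_closed)
  ultimately show ?thesis by simp
qed

text \<open>The defining property fixes the measure of every Borel piece of a chart image. Cutting a
  finite atlas into disjoint pieces \<open>P i\<close> therefore leaves a single candidate
  \<open>\<nu>\<close>; \<open>chart_measure_eq\<close> shows that this candidate has the property
  for all other charts as well, so the definite description in \<open>area_measure\<close> denotes
  it.\<close>

lemma area_measure_exists:
  fixes M :: "(real^'d) set"
  assumes M: "compact M" "submanifold TYPE('n::finite) M"
  shows "is_area_measure TYPE('n) M (area_measure TYPE('n) M)" "emeasure (area_measure TYPE('n) M) M < \<infinity>"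
proof -
  obtain m and W :: "nat \<Rightarrow> (real^'n) set" and f where
    Wf: "\<And>i. i < m \<Longrightarrow> local_param M (W i) (f i)"
    "\<And>i. i < m \<Longrightarrow> emeasure (chart_measure (W i) (f i)) UNIV < \<infinity>" and cov: "M = (\<Union>i<m. f i ` W i)"
    using finite_atlas[OF M] by blast
  have MB: "M \<in> sets borel" using M(1) by (auto intro: borel_closed compact_imp_closed)
  have sM: "X \<in> sets (restrict_space borel M) \<longleftrightarrow> X \<in> sets borel \<and> X \<subseteq> M" for X
    using MB by (auto simp: sets_restrict_space_iff)
  define P where "P i = f i ` W i - (\<Union>k<i. f k ` W k)" for i
  define N where "N i = chart_measure (W i) (f i)" for i
  have PB: "P i \<in> sets borel" if "i < m" for i
    unfolding P_def using that local_param_image_borel[OF M(1) Wf(1)] by (intro sets.Diff sets.finite_UN) auto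
  have Psub: "P i \<subseteq> f i ` W i" for i by (auto simp: P_def)
  have disj: "disjoint_family_on P {..<m}"
    unfolding disjoint_family_on_def P_def by (auto simp: linorder_neq_iff)
  have Pcov: "(\<Union>i<m. P i) = M"
  proof
    show "(\<Union>i<m. P i) \<subseteq> M" using Psub cov by blast
    show "M \<subseteq> (\<Union>i<m. P i)"
    proof
      fix v assume "v \<in> M"
      then have ex: "\<exists>i. i < m \<and> v \<in> f i ` W i" using cov by blast
      define i where "i = (LEAST i. i < m \<and> v \<in> f i ` W i)"
      have "i < m \<and> v \<in> f i ` W i" unfolding i_def by (rule LeastI_ex[OF ex])
      moreover have "v \<notin> f k ` W k" if "k < i" for k
        using not_less_Least[of k "\<lambda>i. i < m \<and> v \<in> f i ` W i"] that calculation unfolding i_def[symmetric] by auto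
      ultimately show "v \<in> (\<Union>i<m. P i)" unfolding P_def by blast
    qed
  qed
  define \<nu> where "\<nu> A = (\<Sum>i<m. emeasure (N i) (A \<inter> P i))" for A
  have eq: "emeasure (N i) A = emeasure (chart_measure V g) A"
    if "i < m" "local_param M V g" "A \<in> sets borel" "A \<subseteq> f i ` W i" "A \<subseteq> g ` V"
    for i g A and V :: "(real^'n) set"
    unfolding N_def by (rule transition.chart_measure_eq[OF transition.intro[OF Wf(1)[OF that(1)] that(2)] that(3-5)])
  have unique: "emeasure \<mu> A = \<nu> A" if \<mu>: "is_area_measure TYPE('n) M \<mu>" and A: "A \<in> sets \<mu>" for \<mu> A
  proof -
    have s: "sets \<mu> = sets (restrict_space borel M)" using \<mu> by (simp add: is_area_measure_def)
    have AB: "A \<in> sets borel" "A \<subseteq> M" using A by (simp_all add: s sM)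
    have "A = (\<Union>i<m. A \<inter> P i)" using AB(2) Pcov by blast
    then have "emeasure \<mu> A = emeasure \<mu> (\<Union>i<m. A \<inter> P i)" by simp
    also have "\<dots> = (\<Sum>i<m. emeasure \<mu> (A \<inter> P i))"
      using disj PB AB by (intro sum_emeasure[symmetric]) (auto simp: s sM disjoint_family_on_def)
    also have "\<dots> = \<nu> A"
      unfolding \<nu>_def
    proof (rule sum.cong)
      fix i assume "i \<in> {..<m}"
      then have i: "i < m" by simp
      have "A \<inter> P i \<in> sets borel" "A \<inter> P i \<subseteq> f i ` W i" using AB PB[OF i] Psub by auto
      then show "emeasure \<mu> (A \<inter> P i) = emeasure (N i) (A \<inter> P i)"
        unfolding N_def using emeasure_chart_measure[OF Wf(1)[OF i]] \<mu> Wf(1)[OF i] by (simp add: is_area_measure_def)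
    qed simp
    finally show ?thesis .
  qed
  define \<mu> where "\<mu> = measure_of M (sets (restrict_space borel M)) \<nu>"
  have sp: "space (restrict_space borel M) = M" by (simp add: space_restrict_space)
  have sa: "sigma_algebra M (sets (restrict_space borel M))"
    using sets.sigma_algebra_axioms[of "restrict_space borel M"] by (simp add: sp)
  have s\<mu>: "sets \<mu> = sets (restrict_space borel M)"
    unfolding \<mu>_def using sa sets.space_closed[of "restrict_space borel M"]
    by (simp add: sp sigma_algebra.sigma_sets_eq)
  have "countably_additive (sets (restrict_space borel M)) \<nu>"
  proof (rule countably_additiveI)
    fix F :: "nat \<Rightarrow> _" assume F: "range F \<subseteq> sets (restrict_space borel M)" "disjoint_family F"
    have "(\<Sum>j. \<nu> (F j)) = (\<Sum>i<m. \<Sum>j. emeasure (N i) (F j \<inter> P i))"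
      unfolding \<nu>_def by (rule suminf_sum) simp
    also have "\<dots> = (\<Sum>i<m. emeasure (N i) (\<Union>j. F j \<inter> P i))"
    proof (intro sum.cong suminf_emeasure refl)
      fix i assume "i \<in> {..<m}"
      then show "range (\<lambda>j. F j \<inter> P i) \<subseteq> sets (N i)" using F(1) PB by (auto simp: N_def sM image_subset_iff)
      show "disjoint_family (\<lambda>j. F j \<inter> P i)" using F(2) by (auto simp: disjoint_family_on_def)
    qed
    also have "\<dots> = \<nu> (\<Union>j. F j)" unfolding \<nu>_def by (intro sum.cong arg_cong2[where f = emeasure]) auto
    finally show "(\<Sum>j. \<nu> (F j)) = \<nu> (\<Union>j. F j)" .
  qed
  moreover have "positive (sets (restrict_space borel M)) \<nu>" by (simp add: positive_def \<nu>_def)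
  ultimately have e\<mu>: "emeasure \<mu> A = \<nu> A" if "A \<in> sets borel" "A \<subseteq> M" for A
    unfolding \<mu>_def using that sM by (intro emeasure_measure_of_sigma[OF sa]) auto
  have area: "is_area_measure TYPE('n) M \<mu>"
    unfolding is_area_measure_def
  proof (intro conjI allI impI s\<mu>)
    fix V :: "(real^'n) set" and g A
    assume *: "local_param M V g \<and> A \<in> sets borel \<and> A \<subseteq> g ` V"
    then have g: "local_param M V g" and A: "A \<in> sets borel" "A \<subseteq> g ` V" by auto
    have AM: "A \<subseteq> M" using A(2) local_paramD(6)[OF g] by blast
    have "emeasure \<mu> A = (\<Sum>i<m. emeasure (chart_measure V g) (A \<inter> P i))"
      unfolding e\<mu>[OF A(1) AM] \<nu>_def
    proof (rule sum.cong)
      fix i assume "i \<in> {..<m}"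
      then have i: "i < m" by simp
      show "emeasure (N i) (A \<inter> P i) = emeasure (chart_measure V g) (A \<inter> P i)"
        by (rule eq[OF i g]) (use A PB[OF i] Psub[of i] in auto)
    qed simp
    also have "\<dots> = emeasure (chart_measure V g) (\<Union>i<m. A \<inter> P i)"
      using disj PB A by (intro sum_emeasure) (auto simp: disjoint_family_on_def)
    also have "(\<Union>i<m. A \<inter> P i) = A" using AM Pcov by blast
    finally show "emeasure \<mu> A = (\<integral>\<^sup>+x\<in>V \<inter> g -` A. ennreal (sqrt (det (first_form g x))) \<partial>lborel)"
      using emeasure_chart_measure[OF g A(1)] by simp
  qed
  have "area_measure TYPE('n) M = \<mu>"
    unfolding area_measure_def
  proof (rule the_equality[of "is_area_measure TYPE('n) M", OF area])
    fix \<mu>' assume \<mu>': "is_area_measure TYPE('n) M \<mu>'"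
    show "\<mu>' = \<mu>"
    proof (rule measure_eqI)
      show "sets \<mu>' = sets \<mu>" using \<mu>' s\<mu> by (simp add: is_area_measure_def)
      then show "emeasure \<mu>' A = emeasure \<mu> A" if "A \<in> sets \<mu>'" for A
        using unique[OF \<mu>' that] unique[OF area] that by simp
    qed
  qed
  then show "is_area_measure TYPE('n) M (area_measure TYPE('n) M)" using area by simp
  have "\<nu> M \<le> (\<Sum>i<m. emeasure (N i) UNIV)"
    unfolding \<nu>_def by (intro sum_mono emeasure_mono) (auto simp: N_def)
  also have "\<dots> < \<infinity>" using Wf(2) by (simp add: N_def)
  finally show "emeasure (area_measure TYPE('n) M) M < \<infinity>"
    using \<open>area_measure TYPE('n) M = \<mu>\<close> e\<mu>[OF MB] by simp
qed

lemma
  fixes M :: "(real^'d) set" and W :: "(real^'n) set" and h :: "real^'d \<Rightarrow> complex"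
  assumes M: "compact M" "submanifold TYPE('n) M" and f: "local_param M W f" and [measurable]: "h \<in> borel_measurable borel"
  shows integrable_area_measure_chart:
      "set_integrable (area_measure TYPE('n) M) (f ` W) h \<longleftrightarrow> integrable lborel (\<lambda>x. area_density W f x *\<^sub>R h (f x))"
    and integral_area_measure_chart:
      "(LINT v:f ` W|area_measure TYPE('n) M. h v) = (LINT x|lborel. area_density W f x *\<^sub>R h (f x))"
proof -
  let ?\<mu> = "area_measure TYPE('n) M"
  note area = area_measure_exists(1)[OF M]
  have MB: "M \<in> sets borel" using M(1) by (auto intro: borel_closed compact_imp_closed)
  have fB [measurable]: "f ` W \<in> sets borel" by (rule local_param_image_borel[OF M(1) f])
  have s: "sets ?\<mu> = sets (restrict_space borel M)" using area by (simp add: is_area_measure_def)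
  have sM: "X \<in> sets ?\<mu> \<longleftrightarrow> X \<in> sets borel \<and> X \<subseteq> M" for X
    using MB by (auto simp: s sets_restrict_space_iff)
  have sp: "space ?\<mu> = M" using sets_eq_imp_space_eq[OF s] by (simp add: space_restrict_space)
  have id_meas [measurable]: "(\<lambda>v. v) \<in> measurable ?\<mu> borel"
    using s by (subst measurable_cong_sets[OF s refl]) (auto intro: measurable_restrict_space1)
  have fM: "f ` W \<in> sets ?\<mu>" using fB local_paramD(6)[OF f] by (simp add: sM)
  have hm [measurable]: "h \<in> borel_measurable ?\<mu>"
    using measurable_compose[OF id_meas \<open>h \<in> borel_measurable borel\<close>] .
  have im [measurable]: "(\<lambda>v. indicat_real (f ` W) v) \<in> borel_measurable ?\<mu>" using fM by simp
  let ?D = "density ?\<mu> (\<lambda>v. ennreal (indicat_real (f ` W) v))"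
  \<comment> \<open>Restricted to the image of the chart, the area measure is the chart measure;
    both claims then follow by transport along \<open>f\<close>.\<close>
  have eq: "distr ?D borel (\<lambda>v. v) = chart_measure W f"
  proof (rule measure_eqI)
    fix X assume "X \<in> sets (distr ?D borel (\<lambda>v. v))"
    then have X [measurable]: "X \<in> sets borel" by simp
    have XM: "X \<inter> M \<in> sets ?\<mu>" using X MB by (simp add: sM)
    have "emeasure (distr ?D borel (\<lambda>v. v)) X = emeasure ?D (X \<inter> M)"
      by (subst emeasure_distr) (auto simp: sp)
    also have "\<dots> = (\<integral>\<^sup>+v. indicator (X \<inter> f ` W) v \<partial>?\<mu>)"
      using XM subsetD[OF local_paramD(6)[OF f] imageI]
      by (subst emeasure_density) (auto intro!: nn_integral_cong simp: indicator_def sp)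
    also have "\<dots> = emeasure ?\<mu> (X \<inter> f ` W)"
      using X fB local_paramD(6)[OF f] by (intro nn_integral_indicator) (auto simp: sM)
    also have "\<dots> = (\<integral>\<^sup>+x\<in>W \<inter> f -` (X \<inter> f ` W). ennreal (sqrt (det (first_form f x))) \<partial>lborel)"
    proof -
      have "X \<inter> f ` W \<in> sets borel" "X \<inter> f ` W \<subseteq> f ` W" using X fB by auto
      then show ?thesis using area f unfolding is_area_measure_def by blast
    qed
    also have "W \<inter> f -` (X \<inter> f ` W) = W \<inter> f -` X" by auto
    also have "(\<integral>\<^sup>+x\<in>W \<inter> f -` X. ennreal (sqrt (det (first_form f x))) \<partial>lborel) = emeasure (chart_measure W f) X"
      by (rule emeasure_chart_measure[OF f X, symmetric])
    finally show "emeasure (distr ?D borel (\<lambda>v. v)) X = emeasure (chart_measure W f) X" .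
  qed simp
  note am [measurable] = area_density(1)[OF f] chart_map_measurable[OF f]
  let ?t = "\<lambda>x. if x \<in> W then f x else 0"
  have dens: "area_density W f x *\<^sub>R h (?t x) = area_density W f x *\<^sub>R h (f x)" for x
    by (simp add: area_density_def)
  have idD: "(\<lambda>v. v) \<in> measurable ?D borel" using id_meas by simp
  have htm: "(\<lambda>x. h (?t x)) \<in> borel_measurable lborel"
    using measurable_compose[OF am(2) \<open>h \<in> borel_measurable borel\<close>] by simp
  have "set_integrable ?\<mu> (f ` W) h \<longleftrightarrow> integrable ?D h"
    unfolding set_integrable_def by (rule integrable_density[symmetric]) (auto intro: hm im)
  also have "\<dots> \<longleftrightarrow> integrable (chart_measure W f) h"
    unfolding eq[symmetric] using idD by (subst integrable_distr_eq) auto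
  also have "\<dots> \<longleftrightarrow> integrable (density lborel (\<lambda>x. ennreal (area_density W f x))) (\<lambda>x. h (?t x))"
    unfolding chart_measure_def using am by (subst integrable_distr_eq) auto
  also have "\<dots> \<longleftrightarrow> integrable lborel (\<lambda>x. area_density W f x *\<^sub>R h (?t x))"
    using am htm area_density(2)[OF f] by (subst integrable_density) auto
  finally show "set_integrable ?\<mu> (f ` W) h \<longleftrightarrow> integrable lborel (\<lambda>x. area_density W f x *\<^sub>R h (f x))"
    unfolding dens .
  have "(LINT v:f ` W|?\<mu>. h v) = (LINT v|?D. h v)"
    unfolding set_lebesgue_integral_def by (rule integral_density[symmetric]) (auto intro: hm im)
  also have "\<dots> = (LINT v|chart_measure W f. h v)"
    unfolding eq[symmetric] using idD by (subst integral_distr) auto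
  also have "\<dots> = (LINT x|density lborel (\<lambda>x. ennreal (area_density W f x)). h (?t x))"
    unfolding chart_measure_def using am by (subst integral_distr) auto
  also have "\<dots> = (LINT x|lborel. area_density W f x *\<^sub>R h (?t x))"
    using am htm area_density(2)[OF f] by (subst integral_density) auto
  finally show "(LINT v:f ` W|?\<mu>. h v) = (LINT x|lborel. area_density W f x *\<^sub>R h (f x))"
    unfolding dens .
qed

section \<open>Invariance of complete contractions under reparametrization\<close>

subsection \<open>Pulling back tensor components\<close>

text \<open>Component \<open>is\<close> of a tensor pulled back by a map with Jacobian
  \<open>J a i\<close>. Recursion on the index list lets the covariance proofs peel off one index at
  a time; the explicit sum is \<open>pull_eq_sum\<close>.\<close>

primrec pull :: "('n::finite \<Rightarrow> 'n \<Rightarrow> real) \<Rightarrow> 'n list \<Rightarrow> ('n list \<Rightarrow> real) \<Rightarrow> real" where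
  "pull J [] T = T []"
| "pull J (i # is) T = (\<Sum>a\<in>UNIV. J a i * pull J is (\<lambda>as. T (a # as)))"

text \<open>The connection terms of a covariant derivative in a fixed direction, and the derivative of
  \<^const>\<open>pull\<close> with respect to \<open>J\<close> in the direction \<open>J'\<close>.\<close>

primrec connection :: "('n::finite \<Rightarrow> 'n \<Rightarrow> real) \<Rightarrow> 'n list \<Rightarrow> ('n list \<Rightarrow> real) \<Rightarrow> real" where
  "connection c [] T = 0"
| "connection c (i # is) T = (\<Sum>l\<in>UNIV. c l i * T (l # is)) + connection c is (\<lambda>as. T (i # as))"

primrec dpull :: "('n::finite \<Rightarrow> 'n \<Rightarrow> real) \<Rightarrow> ('n \<Rightarrow> 'n \<Rightarrow> real) \<Rightarrow> 'n list \<Rightarrow> ('n list \<Rightarrow> real) \<Rightarrow> real" where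
  "dpull J J' [] T = 0"
| "dpull J J' (i # is) T = (\<Sum>a\<in>UNIV. J' a i * pull J is (\<lambda>as. T (a # as)) + J a i * dpull J J' is (\<lambda>as. T (a # as)))"

lemma pull_cong:
  "(\<And>as. length as = length is \<Longrightarrow> T as = T' as) \<Longrightarrow> pull J is T = pull J is T'"
proof (induction "is" arbitrary: T T')
  case (Cons i "is")
  have "pull J is (\<lambda>as. T (a # as)) = pull J is (\<lambda>as. T' (a # as))" for a
    by (rule Cons.IH) (use Cons.prems in simp)
  then show ?case by simp
qed simp

lemma connection_cong:
  "(\<And>as. length as = length is \<Longrightarrow> T as = T' as) \<Longrightarrow> connection c is T = connection c is T'"
proof (induction "is" arbitrary: T T')
  case (Cons i "is")
  have "connection c is (\<lambda>as. T (i # as)) = connection c is (\<lambda>as. T' (i # as))"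
    by (rule Cons.IH) (use Cons.prems in simp)
  then show ?case using Cons.prems by simp
qed simp

lemma pull_add: "pull J is (\<lambda>as. S as + T as) = pull J is S + pull J is T"
  by (induction "is" arbitrary: S T) (simp_all add: sum.distrib algebra_simps)

lemma pull_cmult: "pull J is (\<lambda>as. c * T as) = c * pull J is T"
  by (induction "is" arbitrary: T) (simp_all add: sum_distrib_left algebra_simps)

lemma pull_diff: "pull J is (\<lambda>as. S as - T as) = pull J is S - pull J is T"
  using pull_add[of J "is" S "\<lambda>as. - 1 * T as"] pull_cmult[of J "is" "- 1" T] by simp

lemma pull_sum: "pull J is (\<lambda>as. \<Sum>b\<in>B. T b as) = (\<Sum>b\<in>B. pull J is (T b))"
proof (induction B rule: infinite_finite_induct)
  case (insert b B)
  then show ?case using pull_add[of J "is" "T b" "\<lambda>as. \<Sum>b\<in>B. T b as"] by simp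
qed (use pull_cmult[of J "is" 0] in simp_all)

lemma connection_add: "connection c is (\<lambda>as. S as + T as) = connection c is S + connection c is T"
  by (induction "is" arbitrary: S T) (simp_all add: sum.distrib algebra_simps)

lemma connection_cmult: "connection c is (\<lambda>as. d * T as) = d * connection c is T"
  by (induction "is" arbitrary: T) (simp_all add: sum_distrib_left algebra_simps)

lemma connection_sum: "connection c is (\<lambda>as. \<Sum>b\<in>B. T b as) = (\<Sum>b\<in>B. connection c is (T b))"
proof (induction B rule: infinite_finite_induct)
  case (insert b B)
  then show ?case using connection_add[of c "is" "T b" "\<lambda>as. \<Sum>b\<in>B. T b as"] by simp
qed (use connection_cmult[of c "is" 0] in simp_all)

lemma connection_coeff_sum:
  "connection (\<lambda>l i. \<Sum>d\<in>D. x d * c d l i) is T = (\<Sum>d\<in>D. x d * connection (c d) is T)"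
proof (induction "is" arbitrary: T)
  case (Cons i "is")
  have "(\<Sum>l\<in>UNIV. (\<Sum>d\<in>D. x d * c d l i) * T (l # is)) = (\<Sum>d\<in>D. x d * (\<Sum>l\<in>UNIV. c d l i * T (l # is)))"
    by (simp add: sum_distrib_left sum_distrib_right mult.assoc) (rule sum.swap)
  then show ?case using Cons by (simp add: sum.distrib algebra_simps)
qed simp

lemma connection_eq:
  "(\<Sum>a<length is. \<Sum>l\<in>UNIV. c l (is ! a) * T (is[a := l])) = connection c is T"
proof (induction "is" arbitrary: T)
  case (Cons i "is")
  show ?case
    using Cons[of "\<lambda>as. T (i # as)"] by (simp add: sum.lessThan_Suc_shift del: sum.lessThan_Suc)
qed simp

lemma pull_snoc: "pull J (is @ [k]) T = (\<Sum>d\<in>UNIV. J d k * pull J is (\<lambda>as. T (as @ [d])))"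
proof (induction "is" arbitrary: T)
  case (Cons i "is")
  have "pull J ((i # is) @ [k]) T = (\<Sum>a\<in>UNIV. \<Sum>d\<in>UNIV. J d k * (J a i * pull J is (\<lambda>as. T (a # as @ [d]))))"
    by (simp add: Cons sum_distrib_left algebra_simps)
  also have "\<dots> = (\<Sum>d\<in>UNIV. \<Sum>a\<in>UNIV. J d k * (J a i * pull J is (\<lambda>as. T (a # as @ [d]))))"
    by (rule sum.swap)
  finally show ?case by (simp add: sum_distrib_left)
qed simp

text \<open>The assumption is the transformation law of the Christoffel symbols in one fixed
  direction. Its inhomogeneous term \<open>J'\<close> accumulates to \<open>dpull\<close>, which is
  exactly what differentiating the Jacobian factors of a pulled back tensor produces; in
  \<open>cov_deriv_pull\<close> the two cancel.\<close>

lemma connection_pull: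
  assumes c: "\<And>a i. (\<Sum>l\<in>UNIV. c' l i * J a l) = J' a i + (\<Sum>b\<in>UNIV. c a b * J b i)"
  shows "connection c' is (\<lambda>as. pull J as T) = dpull J J' is T + pull J is (\<lambda>as. connection c as T)"
proof (induction "is" arbitrary: T)
  case (Cons i "is")
  have "(\<Sum>l\<in>UNIV. c' l i * pull J (l # is) T) = (\<Sum>a\<in>UNIV. (\<Sum>l\<in>UNIV. c' l i * J a l) * pull J is (\<lambda>as. T (a # as)))"
    by (simp add: sum_distrib_left sum_distrib_right mult.assoc) (rule sum.swap)
  also have "\<dots> = (\<Sum>a\<in>UNIV. J' a i * pull J is (\<lambda>as. T (a # as)))
      + (\<Sum>a\<in>UNIV. \<Sum>b\<in>UNIV. c a b * J b i * pull J is (\<lambda>as. T (a # as)))"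
    by (simp only: c distrib_right sum.distrib sum_distrib_right)
  also have "(\<Sum>a\<in>UNIV. \<Sum>b\<in>UNIV. c a b * J b i * pull J is (\<lambda>as. T (a # as))) =
      (\<Sum>b\<in>UNIV. J b i * (\<Sum>a\<in>UNIV. c a b * pull J is (\<lambda>as. T (a # as))))"
    by (simp add: sum_distrib_left mult.assoc mult.left_commute) (rule sum.swap)
  finally have 1: "(\<Sum>l\<in>UNIV. c' l i * pull J (l # is) T) = (\<Sum>a\<in>UNIV. J' a i * pull J is (\<lambda>as. T (a # as)))
      + (\<Sum>b\<in>UNIV. J b i * (\<Sum>a\<in>UNIV. c a b * pull J is (\<lambda>as. T (a # as))))" .
  have 2: "connection c' is (\<lambda>as. pull J (i # as) T) =
      (\<Sum>a\<in>UNIV. J a i * (dpull J J' is (\<lambda>as. T (a # as)) + pull J is (\<lambda>as. connection c as (\<lambda>as. T (a # as)))))"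
    by (simp add: connection_sum connection_cmult Cons)
  have 3: "pull J (i # is) (\<lambda>as. connection c as T) =
      (\<Sum>b\<in>UNIV. J b i * (\<Sum>l\<in>UNIV. c l b * pull J is (\<lambda>as. T (l # as))))
      + (\<Sum>b\<in>UNIV. J b i * pull J is (\<lambda>as. connection c as (\<lambda>as. T (b # as))))"
    by (simp add: pull_add pull_sum pull_cmult algebra_simps sum.distrib)
  show ?case
    unfolding connection.simps(2)[of c' i "is" "\<lambda>as. pull J as T"] 1 2 3
    by (simp add: sum.distrib algebra_simps)
qed simp

lemma pull_derivative:
  fixes J :: "'n::finite \<Rightarrow> 'n \<Rightarrow> real^'m \<Rightarrow> real"
  assumes J: "\<And>a i. J a i differentiable (at y)"
  shows "(\<And>as. length as = length is \<Longrightarrow> T as differentiable (at y)) \<Longrightarrow>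
    (\<lambda>y. pull (\<lambda>a i. J a i y) is (\<lambda>as. T as y)) differentiable (at y) \<and>
    partial k (\<lambda>y. pull (\<lambda>a i. J a i y) is (\<lambda>as. T as y)) y =
      dpull (\<lambda>a i. J a i y) (\<lambda>a i. partial k (J a i) y) is (\<lambda>as. T as y)
      + pull (\<lambda>a i. J a i y) is (\<lambda>as. partial k (T as) y)"
proof (induction "is" arbitrary: T)
  case Nil
  then show ?case by (simp add: Nil.prems[of "[]"])
next
  case (Cons i "is")
  let ?p = "\<lambda>a y. pull (\<lambda>a i. J a i y) is (\<lambda>as. T (a # as) y)"
  have T: "T (a # as) differentiable (at y)" if "length as = length is" for a as
    using Cons.prems that by simp
  have IH: "?p a differentiable (at y) \<and> partial k (?p a) y =
      dpull (\<lambda>a i. J a i y) (\<lambda>a i. partial k (J a i) y) is (\<lambda>as. T (a # as) y)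
      + pull (\<lambda>a i. J a i y) is (\<lambda>as. partial k (T (a # as)) y)" for a
    by (rule Cons.IH) (rule T)
  have d: "(\<lambda>y. J a i y * ?p a y) differentiable (at y)" for a
    using J IH[of a] by (intro differentiable_mult) auto
  have "partial k (\<lambda>y. \<Sum>a\<in>UNIV. J a i y * ?p a y) y = (\<Sum>a\<in>UNIV. partial k (\<lambda>y. J a i y * ?p a y) y)"
    by (rule partial_sum) (rule d)
  also have "\<dots> = (\<Sum>a\<in>UNIV. J a i y * partial k (?p a) y + partial k (J a i) y * ?p a y)"
    using J IH by (intro sum.cong refl partial_mult) auto
  finally show ?case
    using d IH by (auto simp: sum.distrib algebra_simps intro!: differentiable_sum)
qed

lemma pull_append:
  "pull J (is @ js) (\<lambda>as. A (take (length is) as) * B (drop (length is) as)) = pull J is A * pull J js B"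
proof (induction "is" arbitrary: A)
  case Nil
  show ?case by (simp add: pull_cmult)
next
  case (Cons i "is")
  have "pull J (is @ js) (\<lambda>as. A (a # take (length is) as) * B (drop (length is) as)) =
      pull J is (\<lambda>as. A (a # as)) * pull J js B" for a
    using Cons.IH[of "\<lambda>as. A (a # as)"] .
  then show ?case by (simp add: sum_distrib_left sum_distrib_right mult.assoc)
qed

lemma finite_lists_length [simp]: "finite {is :: 'n::finite list. length is = N}"
  using finite_lists_length_eq[of "UNIV :: 'n set" N] by simp

lemma sum_lists_Suc:
  fixes F :: "'n::finite list \<Rightarrow> 'b::comm_monoid_add"
  shows "(\<Sum>is | length is = Suc N. F is) = (\<Sum>a\<in>UNIV. \<Sum>is | length is = N. F (a # is))"
proof -
  have "(\<Sum>is | length is = Suc N. F is) = (\<Sum>(a, is)\<in>UNIV \<times> {is. length is = N}. F (a # is))"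
    by (rule sum.reindex_bij_witness[of _ "\<lambda>(a, is). a # is" "\<lambda>is. (hd is, tl is)"])
      (auto simp: length_Suc_conv)
  then show ?thesis by (simp add: sum.cartesian_product)
qed

lemma pull_eq_sum:
  fixes J :: "'n::finite \<Rightarrow> 'n \<Rightarrow> real"
  shows "pull J is T = (\<Sum>as | length as = length is. (\<Prod>q<length is. J (as ! q) (is ! q)) * T as)"
proof (induction "is" arbitrary: T)
  case (Cons i "is")
  have "(\<Sum>as | length as = Suc (length is). (\<Prod>q<Suc (length is). J (as ! q) ((i # is) ! q)) * T as)
    = (\<Sum>a\<in>UNIV. \<Sum>as | length as = length is. J a i * ((\<Prod>q<length is. J (as ! q) (is ! q)) * T (a # as)))"
    by (simp add: sum_lists_Suc prod.lessThan_Suc_shift mult.assoc del: prod.lessThan_Suc)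
  then show ?case by (simp add: Cons sum_distrib_left)
qed simp

text \<open>A perfect matching of the positions splits an index list into independent pairs, so the
  sum factors into double sums.\<close>

lemma sum_lists_matching:
  fixes k :: "nat \<Rightarrow> nat \<Rightarrow> 'n::finite \<Rightarrow> 'n \<Rightarrow> real"
  assumes d: "distinct (map fst ps @ map snd ps)" and s: "set (map fst ps @ map snd ps) = {..<N}"
  shows "(\<Sum>is | length is = N. \<Prod>(a, b)\<leftarrow>ps. k a b (is ! a) (is ! b)) =
    (\<Prod>(a, b)\<leftarrow>ps. \<Sum>i\<in>UNIV. \<Sum>j\<in>UNIV. k a b i j)"
proof -
  let ?p = "length ps"
  let ?a = "\<lambda>x. fst (ps ! x)" and ?b = "\<lambda>x. snd (ps ! x)"
  have N: "N = 2 * ?p"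
    using distinct_card[OF d] s by simp
  have prodl: "(\<Prod>(a, b)\<leftarrow>ps. F a b) = (\<Prod>x<?p. F (?a x) (?b x))" for F :: "nat \<Rightarrow> nat \<Rightarrow> real"
    by (subst prod.list_conv_set_nth) (simp add: case_prod_unfold atLeast0LessThan)
  have pos: "\<exists>x<?p. q = ?a x \<or> q = ?b x" if "q < N" for q
  proof -
    have "q \<in> set (map fst ps @ map snd ps)" using that s by simp
    then show ?thesis by (auto simp: in_set_conv_nth) (metis fst_conv in_set_conv_nth snd_conv)+
  qed
  have bound: "?a x < N" "?b x < N" if "x < ?p" for x
  proof -
    have "?a x \<in> set (map fst ps @ map snd ps)" "?b x \<in> set (map fst ps @ map snd ps)" using that by auto
    then show "?a x < N" "?b x < N" unfolding s by auto
  qed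
  let ?L = "{is :: 'n list. length is = N}" and ?G = "PiE {..<?p} (\<lambda>_. UNIV :: ('n \<times> 'n) set)"
  define g where "g is = (\<lambda>x\<in>{..<?p}. (is ! ?a x, is ! ?b x))" for "is" :: "'n list"
  have inj: "inj_on g ?L"
  proof (rule inj_onI)
    fix "is" js :: "'n list" assume l: "is \<in> ?L" "js \<in> ?L" and eq: "g is = g js"
    show "is = js"
    proof (rule nth_equalityI)
      fix q assume "q < length is"
      then have "q < N" using l by simp
      then obtain x where x: "x < ?p" "q = ?a x \<or> q = ?b x" using pos by blast
      have "g is x = g js x" using eq by simp
      then show "is ! q = js ! q" using x by (auto simp: g_def)
    qed (use l in simp)
  qed
  \<comment> \<open>Surjectivity is obtained by counting: \<open>g\<close> is injective and both
    sides have \<open>CARD('n) ^ N\<close> elements.\<close>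
  have "card (g ` ?L) = card ?L" by (rule card_image[OF inj])
  also have "\<dots> = CARD('n) ^ N" using card_lists_length_eq[of "UNIV :: 'n set" N] by simp
  also have "\<dots> = card ?G" by (simp add: card_PiE N power_mult power2_eq_square power_mult_distrib)
  finally have "card (g ` ?L) = card ?G" .
  moreover have "g ` ?L \<subseteq> ?G" by (auto simp: g_def PiE_def extensional_def restrict_def)
  moreover have "finite ?G" by (intro finite_PiE) auto
  ultimately have im: "g ` ?L = ?G" by (metis card_subset_eq)
  have two: "(\<Sum>i\<in>UNIV. \<Sum>j\<in>UNIV. F i j) = (\<Sum>z\<in>UNIV. F (fst z) (snd z))" for F :: "'n \<Rightarrow> 'n \<Rightarrow> real"
    by (simp add: sum.cartesian_product case_prod_unfold)
  have "(\<Prod>(a, b)\<leftarrow>ps. \<Sum>i\<in>UNIV. \<Sum>j\<in>UNIV. k a b i j) = (\<Prod>x<?p. \<Sum>z\<in>UNIV. k (?a x) (?b x) (fst z) (snd z))"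
    unfolding prodl two ..
  also have "\<dots> = (\<Sum>h\<in>?G. \<Prod>x<?p. k (?a x) (?b x) (fst (h x)) (snd (h x)))"
    by (rule prod_sum_PiE) auto
  also have "\<dots> = (\<Sum>is\<in>?L. \<Prod>x<?p. k (?a x) (?b x) (fst (g is x)) (snd (g is x)))"
    unfolding im[symmetric] by (rule sum.reindex[OF inj, unfolded o_def])
  also have "\<dots> = (\<Sum>is\<in>?L. \<Prod>(a, b)\<leftarrow>ps. k a b (is ! a) (is ! b))"
    unfolding prodl by (simp add: g_def)
  finally show ?thesis ..
qed

lemma prod_matching:
  fixes F :: "nat \<Rightarrow> real"
  assumes d: "distinct (map fst ps @ map snd ps)" and s: "set (map fst ps @ map snd ps) = {..<N}"
  shows "(\<Prod>q<N. F q) = (\<Prod>(a, b)\<leftarrow>ps. F a * F b)"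
proof -
  have "(\<Prod>q<N. F q) = prod_list (map F (map fst ps @ map snd ps))"
    unfolding s[symmetric] by (rule prod.distinct_set_conv_list[OF d])
  also have "\<dots> = (\<Prod>(a, b)\<leftarrow>ps. F a * F b)"
    by (induction ps) (auto simp: algebra_simps)
  finally show ?thesis .
qed

lemma prod_list_mult_distrib:
  "(\<Prod>(a, b)\<leftarrow>ps. F a b * G a b) = (\<Prod>(a, b)\<leftarrow>ps. F a b) * (\<Prod>(a, b)\<leftarrow>ps. G a b :: real)"
  by (induction ps) (auto simp: algebra_simps)

text \<open>The inverse metric transforms contravariantly, so each pairing absorbs two Jacobian factors.\<close>

lemma contraction_pull:
  fixes J :: "'n::finite \<Rightarrow> 'n \<Rightarrow> real"
  assumes d: "distinct (map fst ps @ map snd ps)" and s: "set (map fst ps @ map snd ps) = {..<N}"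
    and g: "\<And>a b. (\<Sum>i\<in>UNIV. \<Sum>j\<in>UNIV. g' i j * (J a i * J b j)) = g a b"
  shows "(\<Sum>is | length is = N. (\<Prod>(a, b)\<leftarrow>ps. g' (is ! a) (is ! b)) * pull J is T) =
    (\<Sum>as | length as = N. (\<Prod>(a, b)\<leftarrow>ps. g (as ! a) (as ! b)) * T as)"
proof -
  have "(\<Sum>is | length is = N. (\<Prod>(a, b)\<leftarrow>ps. g' (is ! a) (is ! b)) * pull J is T) =
    (\<Sum>is | length is = N. \<Sum>as | length as = N. T as * ((\<Prod>(a, b)\<leftarrow>ps. g' (is ! a) (is ! b)) * (\<Prod>q<N. J (as ! q) (is ! q))))"
    by (intro sum.cong) (auto simp: pull_eq_sum sum_distrib_left algebra_simps)
  also have "\<dots> = (\<Sum>as | length as = N. \<Sum>is | length is = N. T as * ((\<Prod>(a, b)\<leftarrow>ps. g' (is ! a) (is ! b)) * (\<Prod>q<N. J (as ! q) (is ! q))))"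
    by (rule sum.swap)
  also have "\<dots> = (\<Sum>as | length as = N. T as * (\<Sum>is | length is = N.
      \<Prod>(a, b)\<leftarrow>ps. g' (is ! a) (is ! b) * (J (as ! a) (is ! a) * J (as ! b) (is ! b))))"
    by (simp add: prod_matching[OF d s] prod_list_mult_distrib sum_distrib_left)
  also have "\<dots> = (\<Sum>as | length as = N. T as * (\<Prod>(a, b)\<leftarrow>ps. g (as ! a) (as ! b)))"
    using sum_lists_matching[OF d s, where k = "\<lambda>a b i j. g' i j * (J (as ! a) i * J (as ! b) j)" for as]
    by (simp add: g)
  finally show ?thesis by (simp add: mult.commute)
qed

subsection \<open>Christoffel symbols and covariant derivatives\<close>

lemma matrix_inv_right_left:
  fixes A :: "real^'n^'n"
  assumes "det A \<noteq> 0"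
  shows "A ** matrix_inv A = mat 1" "matrix_inv A ** A = mat 1"
proof -
  have "\<exists>B. A ** B = mat 1 \<and> B ** A = mat 1"
    using assms invertible_det_nz unfolding invertible_def by blast
  then have "A ** matrix_inv A = mat 1 \<and> matrix_inv A ** A = mat 1"
    unfolding matrix_inv_def by (rule someI_ex)
  then show "A ** matrix_inv A = mat 1" "matrix_inv A ** A = mat 1" by auto
qed

lemma matrix_ker_trivial:
  fixes A :: "real^'n^'n"
  assumes "det A \<noteq> 0" "A *v x = 0"
  shows "x = 0"
proof -
  have "x = (matrix_inv A ** A) *v x" by (simp add: matrix_inv_right_left(2)[OF assms(1)])
  also have "\<dots> = matrix_inv A *v (A *v x)" by (simp add: matrix_vector_mul_assoc)
  also have "\<dots> = 0" using assms(2) by simp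
  finally show ?thesis .
qed

lemma smooth_on_inv_form:
  fixes f :: "real^'n \<Rightarrow> real^'d"
  assumes "open W" "smooth_on W f" "\<And>x. x \<in> W \<Longrightarrow> det (first_form f x) \<noteq> 0"
  shows "smooth_on W (\<lambda>x. inv_form f x $ l $ k)"
proof -
  have "smooth_on W (\<lambda>x. \<chi> l. inv_form f x $ l $ k)"
  proof (rule smooth_on_cramer[OF assms(1) smooth_on_first_form[OF assms(1,2)]])
    show "smooth_on W (\<lambda>x. axis k 1 $ i)" for i :: 'n by (intro smooth_intros assms)
    show "first_form f x *v (\<chi> l. inv_form f x $ l $ k) = axis k 1" if "x \<in> W" for x
    proof -
      have "first_form f x *v (\<chi> l. inv_form f x $ l $ k) = (\<chi> i. (first_form f x ** inv_form f x) $ i $ k)"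
        by (simp add: matrix_vector_mult_def matrix_matrix_mult_def)
      then show ?thesis
        using matrix_inv_right_left(1)[OF assms(3)[OF that]] by (simp add: inv_form_def mat_def axis_def vec_eq_iff)
    qed
  qed (use assms in auto)
  from smooth_on_vec_nth[OF assms(1) this, of l] show ?thesis by simp
qed

lemma smooth_on_christoffel:
  fixes f :: "real^'n \<Rightarrow> real^'d"
  assumes "open W" "smooth_on W f" "\<And>x. x \<in> W \<Longrightarrow> det (first_form f x) \<noteq> 0"
  shows "smooth_on W (christoffel f l i j)"
proof -
  note ff = smooth_on_partial[OF smooth_on_first_form[OF assms(1,2)]]
  show ?thesis
    unfolding christoffel_def[abs_def]
    by (intro smooth_on_divide smooth_on_sum smooth_on_mult smooth_on_add smooth_on_diff smooth_on_const
        smooth_on_inv_form ff assms) auto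
qed

lemma smooth_on_cov_deriv:
  fixes f :: "real^'n \<Rightarrow> real^'d"
  assumes "open W" "smooth_on W f" "\<And>x. x \<in> W \<Longrightarrow> det (first_form f x) \<noteq> 0"
    and T: "\<And>as. length as = r \<Longrightarrow> smooth_on W (T as)" and "length js = Suc r"
  shows "smooth_on W (cov_deriv f T js)"
  unfolding cov_deriv_def[abs_def] Let_def
  by (intro smooth_on_diff smooth_on_sum smooth_on_mult smooth_on_christoffel smooth_on_partial T assms(1-3))
    (use assms(5) in auto)

lemma second_form_eq:
  "second_form f \<nu> [i, j] x = partial i (partial j f) x \<bullet> \<nu> x"
  by (simp add: second_form_def)

lemma length_2_cases: "length is = 2 \<Longrightarrow> \<exists>i j. is = [i, j]"
  by (cases "is"; cases "tl is") auto

lemma smooth_on_cov_second_form: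
  fixes f :: "real^'n \<Rightarrow> real^'d"
  assumes W: "open W" "smooth_on W f" "\<And>x. x \<in> W \<Longrightarrow> det (first_form f x) \<noteq> 0" and \<nu>: "smooth_on W \<nu>"
  shows "length as = m + 2 \<Longrightarrow> smooth_on W (cov_second_form f \<nu> m as)"
proof (induction m arbitrary: as)
  case 0
  then show ?case
    unfolding cov_second_form_def second_form_def[abs_def] funpow_0
    by (intro smooth_on_inner smooth_on_partial W \<nu>)
next
  case (Suc m)
  have "cov_second_form f \<nu> (Suc m) = cov_deriv f (cov_second_form f \<nu> m)"
    by (simp add: cov_second_form_def)
  then show ?case using smooth_on_cov_deriv[OF W Suc.IH] Suc.prems by simp
qed

text \<open>For an induced metric, the combination of metric derivatives in the definition collapses
  to twice one inner product of a second derivative with a tangent vector, because second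
  derivatives commute. Lowering the upper index then cancels the inverse metric.\<close>

lemma christoffel_gauss:
  fixes f :: "real^'n \<Rightarrow> real^'d"
  assumes W: "open W" "smooth_on W f" "x \<in> W" and "det (first_form f x) \<noteq> 0"
  shows "(\<Sum>l\<in>UNIV. first_form f x $ m $ l * christoffel f l i j x) = partial i (partial j f) x \<bullet> partial m f x"
proof -
  have d: "partial i f differentiable (at x)" for i
    by (rule smooth_on_differentiable[OF W(1) smooth_on_partial[OF W(2)] W(3)])
  have pf: "partial i (\<lambda>y. first_form f y $ j $ k) x =
      partial j f x \<bullet> partial i (partial k f) x + partial i (partial j f) x \<bullet> partial k f x" for i j k
    unfolding first_form_def using partial_inner[OF d d] by simp
  have br: "partial i (\<lambda>y. first_form f y $ j $ k) x + partial j (\<lambda>y. first_form f y $ i $ k) x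
      - partial k (\<lambda>y. first_form f y $ i $ j) x = 2 * (partial i (partial j f) x \<bullet> partial k f x)" for k
    unfolding pf
    by (simp add: partial_commute[OF W, of j i] partial_commute[OF W, of k i] partial_commute[OF W, of k j] inner_commute)
  have "christoffel f l i j x = (\<Sum>k\<in>UNIV. inv_form f x $ l $ k * (partial i (partial j f) x \<bullet> partial k f x))" for l
    unfolding christoffel_def br by (simp add: sum_distrib_left[symmetric] mult.left_commute)
  then have "(\<Sum>l\<in>UNIV. first_form f x $ m $ l * christoffel f l i j x) =
      (\<Sum>l\<in>UNIV. \<Sum>k\<in>UNIV. first_form f x $ m $ l * inv_form f x $ l $ k * (partial i (partial j f) x \<bullet> partial k f x))"
    by (simp add: sum_distrib_left mult.assoc)
  also have "\<dots> = (\<Sum>k\<in>UNIV. \<Sum>l\<in>UNIV. first_form f x $ m $ l * inv_form f x $ l $ k * (partial i (partial j f) x \<bullet> partial k f x))"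
    by (rule sum.swap)
  also have "\<dots> = (\<Sum>k\<in>UNIV. (first_form f x ** inv_form f x) $ m $ k * (partial i (partial j f) x \<bullet> partial k f x))"
    by (simp add: matrix_matrix_mult_def sum_distrib_right)
  also have "\<dots> = partial i (partial j f) x \<bullet> partial m f x"
    using matrix_inv_right_left(1)[OF assms(4)]
    by (simp add: inv_form_def mat_def if_distrib[of "\<lambda>z. z * _"] cong: if_cong)
  finally show ?thesis .
qed

section \<open>Covariance under a change of coordinates\<close>

locale reparametrization =
  fixes W V :: "(real^'n) set" and f :: "real^'n \<Rightarrow> real^'d" and \<psi> :: "real^'n \<Rightarrow> real^'n"
  assumes W: "open W" "smooth_on W f" "\<And>x. x \<in> W \<Longrightarrow> det (first_form f x) \<noteq> 0"
    and V: "open V" "smooth_on V \<psi>" "\<psi> ` V \<subseteq> W"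
    and det_J: "\<And>y. y \<in> V \<Longrightarrow> det (\<chi> a i. partial i \<psi> y $ a) \<noteq> 0"
begin

definition f' where "f' y = f (\<psi> y)"
definition J where "J a i y = partial i \<psi> y $ a"
definition Jm where "Jm y = (\<chi> a i. J a i y)"

lemma smooth: "smooth_on V f'" "smooth_on V (J a i)"
  unfolding f'_def[abs_def] J_def[abs_def]
  by (rule smooth_on_compose[OF V(1) W(1) V(2,3) W(2)]) (intro smooth_on_vec_nth smooth_on_partial V)

lemma partial_f': "y \<in> V \<Longrightarrow> partial i f' y = (\<Sum>a\<in>UNIV. J a i y *\<^sub>R partial a f (\<psi> y))"
  unfolding f'_def[abs_def] J_def
  using V(3) by (intro partial_compose smooth_on_differentiable[OF W(1,2)] smooth_on_differentiable[OF V(1,2)]) auto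

lemma partial2_f':
  assumes y: "y \<in> V"
  shows "partial k (partial i f') y = (\<Sum>a\<in>UNIV. partial k (J a i) y *\<^sub>R partial a f (\<psi> y)
    + J a i y *\<^sub>R (\<Sum>b\<in>UNIV. J b k y *\<^sub>R partial b (partial a f) (\<psi> y)))"
proof -
  have py: "\<psi> y \<in> W" using V(3) y by blast
  have dp: "(\<lambda>y. partial a f (\<psi> y)) differentiable (at y)" for a
    by (rule smooth_on_differentiable[OF V(1) smooth_on_compose[OF V(1) W(1) V(2,3) smooth_on_partial[OF W(2)]] y])
  have dJ: "J a i differentiable (at y)" for a i by (rule smooth_on_differentiable[OF V(1) smooth(2) y])
  have c: "partial k (\<lambda>y. partial a f (\<psi> y)) y = (\<Sum>b\<in>UNIV. J b k y *\<^sub>R partial b (partial a f) (\<psi> y))" for a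
    unfolding J_def
    by (intro partial_compose smooth_on_differentiable[OF W(1) smooth_on_partial[OF W(2)] py]
        smooth_on_differentiable[OF V(1,2) y])
  have "partial k (partial i f') y = partial k (\<lambda>y. \<Sum>a\<in>UNIV. J a i y *\<^sub>R partial a f (\<psi> y)) y"
    by (rule partial_cong[OF V(1) y partial_f'])
  also have "\<dots> = (\<Sum>a\<in>UNIV. partial k (\<lambda>y. J a i y *\<^sub>R partial a f (\<psi> y)) y)"
    by (rule partial_sum, rule smooth_on_differentiable[OF V(1) _ y],
        intro smooth_on_scaleR V(1) smooth(2) smooth_on_compose[OF V(1) W(1) V(2,3) smooth_on_partial[OF W(2)]])
  also have "\<dots> = (\<Sum>a\<in>UNIV. J a i y *\<^sub>R partial k (\<lambda>y. partial a f (\<psi> y)) y + partial k (J a i) y *\<^sub>R partial a f (\<psi> y))"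
    by (rule sum.cong[OF refl], rule partial_scaleR[OF dJ dp])
  finally show ?thesis unfolding c by (simp add: add.commute)
qed

lemma first_form_f': "y \<in> V \<Longrightarrow> first_form f' y = transpose (Jm y) ** first_form f (\<psi> y) ** Jm y"
  by (rule first_form_transform) (simp add: partial_f' Jm_def)

lemma det_nz: "y \<in> V \<Longrightarrow> det (Jm y) \<noteq> 0" "y \<in> V \<Longrightarrow> det (first_form f' y) \<noteq> 0"
proof -
  assume y: "y \<in> V"
  show J: "det (Jm y) \<noteq> 0" using det_J[OF y] by (simp add: Jm_def J_def)
  have "\<psi> y \<in> W" using V(3) y by blast
  then show "det (first_form f' y) \<noteq> 0"
    unfolding first_form_f'[OF y] using J W(3) by (simp add: det_mul)
qed

lemma inv_form_f':
  assumes y: "y \<in> V"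
  shows "(\<Sum>i\<in>UNIV. \<Sum>j\<in>UNIV. inv_form f' y $ i $ j * (J a i y * J b j y)) = inv_form f (\<psi> y) $ a $ b"
proof -
  let ?J = "Jm y" and ?G = "first_form f (\<psi> y)" and ?G' = "first_form f' y"
  have G: "det ?G \<noteq> 0" using V(3) y W(3) by blast
  have Jt: "det (transpose ?J) \<noteq> 0" using det_nz(1)[OF y] by simp
  define A where "A = ?J ** matrix_inv ?G' ** transpose ?J"
  have "transpose ?J ** (?G ** A) = ?G' ** matrix_inv ?G' ** transpose ?J"
    unfolding A_def first_form_f'[OF y] by (simp only: matrix_mul_assoc)
  also have "\<dots> = transpose ?J" using matrix_inv_right_left(1)[OF det_nz(2)[OF y]] by simp
  finally have "matrix_inv (transpose ?J) ** (transpose ?J ** (?G ** A)) = matrix_inv (transpose ?J) ** transpose ?J" by simp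
  then have "?G ** A = mat 1" using matrix_inv_right_left(2)[OF Jt] by (simp add: matrix_mul_assoc)
  then have "matrix_inv ?G ** (?G ** A) = matrix_inv ?G" by simp
  then have "A = matrix_inv ?G" using matrix_inv_right_left(2)[OF G] by (simp add: matrix_mul_assoc)
  moreover have "A $ a $ b = (\<Sum>j\<in>UNIV. \<Sum>i\<in>UNIV. inv_form f' y $ i $ j * (J a i y * J b j y))"
    by (simp add: A_def matrix_matrix_mult_def transpose_def Jm_def inv_form_def sum_distrib_left sum_distrib_right algebra_simps)
  ultimately show ?thesis by (simp add: inv_form_def) (subst sum.swap, simp)
qed

text \<open>Both sides are tested against the tangent vectors of \<open>f'\<close>: by
  \<open>christoffel_gauss\<close> each yields the inner product with the second derivative of
  \<open>f'\<close>. The Gram matrix and the Jacobian are invertible, so the difference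
  vanishes.\<close>

lemma christoffel_f':
  assumes y: "y \<in> V"
  shows "(\<Sum>l\<in>UNIV. christoffel f' l k i y * J a l y) =
    partial k (J a i) y + (\<Sum>b\<in>UNIV. (\<Sum>d\<in>UNIV. J d k y * christoffel f a d b (\<psi> y)) * J b i y)"
proof -
  have py: "\<psi> y \<in> W" using V(3) y by blast
  let ?G = "first_form f (\<psi> y)" and ?e = "\<lambda>a. partial a f (\<psi> y)"
  define L where "L a = (\<Sum>l\<in>UNIV. christoffel f' l k i y * J a l y)" for a
  define R where "R a = partial k (J a i) y + (\<Sum>b\<in>UNIV. (\<Sum>d\<in>UNIV. J d k y * christoffel f a d b (\<psi> y)) * J b i y)" for a
  define D where "D = (\<chi> a. L a - R a)"
  let ?X = "partial k (partial i f') y"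
  have GL: "(\<Sum>c\<in>UNIV. J c m y * (\<Sum>a\<in>UNIV. ?G $ c $ a * L a)) = ?X \<bullet> partial m f' y" for m
  proof -
    have G': "first_form f' y $ m $ l = (\<Sum>c\<in>UNIV. \<Sum>a\<in>UNIV. J c m y * (?G $ c $ a * J a l y))" for l
      unfolding first_form_f'[OF y]
      by (simp add: matrix_matrix_mult_def transpose_def Jm_def sum_distrib_left sum_distrib_right algebra_simps)
        (subst sum.swap, simp add: mult.left_commute)
    have "?X \<bullet> partial m f' y = (\<Sum>l\<in>UNIV. first_form f' y $ m $ l * christoffel f' l k i y)"
      by (rule christoffel_gauss[OF V(1) smooth(1) y det_nz(2)[OF y], symmetric])
    also have "\<dots> = (\<Sum>l\<in>UNIV. \<Sum>c\<in>UNIV. \<Sum>a\<in>UNIV. J c m y * (?G $ c $ a * (christoffel f' l k i y * J a l y)))"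
      unfolding G' by (simp add: sum_distrib_left sum_distrib_right algebra_simps)
    also have "\<dots> = (\<Sum>c\<in>UNIV. \<Sum>l\<in>UNIV. \<Sum>a\<in>UNIV. J c m y * (?G $ c $ a * (christoffel f' l k i y * J a l y)))"
      by (rule sum.swap)
    also have "\<dots> = (\<Sum>c\<in>UNIV. \<Sum>a\<in>UNIV. \<Sum>l\<in>UNIV. J c m y * (?G $ c $ a * (christoffel f' l k i y * J a l y)))"
      by (rule sum.cong[OF refl], rule sum.swap)
    finally show ?thesis unfolding L_def by (simp add: sum_distrib_left)
  qed
  have GR: "(\<Sum>a\<in>UNIV. ?G $ c $ a * R a) = ?X \<bullet> ?e c" for c
  proof -
    have "(\<Sum>a\<in>UNIV. ?G $ c $ a * (\<Sum>b\<in>UNIV. (\<Sum>d\<in>UNIV. J d k y * christoffel f a d b (\<psi> y)) * J b i y)) =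
      (\<Sum>a\<in>UNIV. \<Sum>b\<in>UNIV. \<Sum>d\<in>UNIV. J b i y * (J d k y * (?G $ c $ a * christoffel f a d b (\<psi> y))))"
      by (simp add: sum_distrib_left sum_distrib_right algebra_simps)
    also have "\<dots> = (\<Sum>b\<in>UNIV. \<Sum>a\<in>UNIV. \<Sum>d\<in>UNIV. J b i y * (J d k y * (?G $ c $ a * christoffel f a d b (\<psi> y))))"
      by (rule sum.swap)
    also have "\<dots> = (\<Sum>b\<in>UNIV. \<Sum>d\<in>UNIV. \<Sum>a\<in>UNIV. J b i y * (J d k y * (?G $ c $ a * christoffel f a d b (\<psi> y))))"
      by (rule sum.cong[OF refl], rule sum.swap)
    also have "\<dots> = (\<Sum>b\<in>UNIV. \<Sum>d\<in>UNIV. J b i y * (J d k y * (partial d (partial b f) (\<psi> y) \<bullet> ?e c)))"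
      by (simp add: sum_distrib_left[symmetric] christoffel_gauss[OF W(1,2) py W(3)[OF py]])
    finally have 1: "(\<Sum>a\<in>UNIV. ?G $ c $ a * (\<Sum>b\<in>UNIV. (\<Sum>d\<in>UNIV. J d k y * christoffel f a d b (\<psi> y)) * J b i y)) =
      (\<Sum>b\<in>UNIV. \<Sum>d\<in>UNIV. J b i y * (J d k y * (partial d (partial b f) (\<psi> y) \<bullet> ?e c)))" .
    have 2: "(\<Sum>a\<in>UNIV. ?G $ c $ a * partial k (J a i) y) = (\<Sum>a\<in>UNIV. partial k (J a i) y * (?e a \<bullet> ?e c))"
      by (simp add: first_form_def inner_commute mult.commute)
    have "(\<Sum>a\<in>UNIV. ?G $ c $ a * R a) = (\<Sum>a\<in>UNIV. partial k (J a i) y * (?e a \<bullet> ?e c))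
       + (\<Sum>b\<in>UNIV. \<Sum>d\<in>UNIV. J b i y * (J d k y * (partial d (partial b f) (\<psi> y) \<bullet> ?e c)))"
      unfolding R_def distrib_left sum.distrib 1 2 ..
    also have "\<dots> = ?X \<bullet> ?e c"
      unfolding partial2_f'[OF y] by (simp add: inner_sum_left inner_add_left sum.distrib sum_distrib_left)
    finally show ?thesis .
  qed
  have "(transpose (Jm y) ** ?G) *v D = 0"
  proof -
    have "((transpose (Jm y) ** ?G) *v D) $ m = (\<Sum>c\<in>UNIV. J c m y * (\<Sum>a\<in>UNIV. ?G $ c $ a * (L a - R a)))" for m
      unfolding matrix_vector_mul_assoc[symmetric]
      by (simp add: matrix_vector_mult_def transpose_def Jm_def D_def)
    also have "(\<Sum>c\<in>UNIV. J c m y * (\<Sum>a\<in>UNIV. ?G $ c $ a * (L a - R a))) =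
        ?X \<bullet> partial m f' y - (\<Sum>c\<in>UNIV. J c m y * (?X \<bullet> ?e c))" for m
      unfolding GL[symmetric] GR[symmetric] by (simp add: right_diff_distrib sum_subtractf)
    also have "?X \<bullet> partial m f' y - (\<Sum>c\<in>UNIV. J c m y * (?X \<bullet> ?e c)) = 0" for m
      unfolding partial_f'[OF y] by (simp add: inner_sum_right)
    finally show ?thesis by (simp add: vec_eq_iff)
  qed
  moreover have "det (transpose (Jm y) ** ?G) \<noteq> 0" using det_nz(1)[OF y] W(3)[OF py] by (simp add: det_mul)
  ultimately have "D = 0" by (rule matrix_ker_trivial[rotated])
  then have "L a = R a" by (simp add: D_def vec_eq_iff)
  then show ?thesis by (simp add: L_def R_def)
qed

text \<open>Differentiating the pulled back components leaves a \<open>dpull\<close> term from the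
  varying Jacobian, and the connection terms leave the same one by \<open>connection_pull\<close>.
  They cancel, and what remains is the pullback of the covariant derivative, with the new index
  \<open>k\<close> in the last slot.\<close>

lemma cov_deriv_pull:
  assumes T: "\<And>as. length as = r \<Longrightarrow> smooth_on W (T as)"
    and T': "\<And>is y. length is = r \<Longrightarrow> y \<in> V \<Longrightarrow> T' is y = pull (\<lambda>a i. J a i y) is (\<lambda>as. T as (\<psi> y))"
    and y: "y \<in> V" and js: "length js = Suc r"
  shows "cov_deriv f' T' js y = pull (\<lambda>a i. J a i y) js (\<lambda>as. cov_deriv f T as (\<psi> y))"
proof -
  obtain "is" k where jk: "js = is @ [k]" "length is = r"
    using js by (metis append_butlast_last_id diff_Suc_1 length_butlast length_greater_0_conv zero_less_Suc)
  have py: "\<psi> y \<in> W" using V(3) y by blast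
  let ?J = "\<lambda>a i. J a i y" and ?dJ = "\<lambda>a i. partial k (J a i) y"
  let ?c' = "\<lambda>l i. christoffel f' l k i y" and ?c = "\<lambda>d l i. christoffel f l d i (\<psi> y)"
  have dT: "(\<lambda>y. T as (\<psi> y)) differentiable (at y)" if "length as = r" for as
    by (rule smooth_on_differentiable[OF V(1) smooth_on_compose[OF V(1) W(1) V(2,3) T[OF that]] y])
  have pT: "partial k (\<lambda>y. T as (\<psi> y)) y = (\<Sum>d\<in>UNIV. J d k y * partial d (T as) (\<psi> y))" if "length as = r" for as
    using partial_compose[OF smooth_on_differentiable[OF W(1) T[OF that] py] smooth_on_differentiable[OF V(1,2) y]]
    by (simp add: J_def)
  have dJ: "J a i differentiable (at y)" for a i by (rule smooth_on_differentiable[OF V(1) smooth(2) y])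
  have "partial k (T' is) y = partial k (\<lambda>y. pull (\<lambda>a i. J a i y) is (\<lambda>as. T as (\<psi> y))) y"
    by (rule partial_cong[OF V(1) y T'[OF jk(2)]])
  also have "\<dots> = dpull ?J ?dJ is (\<lambda>as. T as (\<psi> y)) + pull ?J is (\<lambda>as. partial k (\<lambda>y. T as (\<psi> y)) y)"
    using pull_derivative[of J y "is" "\<lambda>as y. T as (\<psi> y)", OF dJ dT] jk(2) by simp
  also have "pull ?J is (\<lambda>as. partial k (\<lambda>y. T as (\<psi> y)) y) = pull ?J is (\<lambda>as. \<Sum>d\<in>UNIV. J d k y * partial d (T as) (\<psi> y))"
    by (rule pull_cong) (simp add: pT jk(2))
  finally have A: "partial k (T' is) y = dpull ?J ?dJ is (\<lambda>as. T as (\<psi> y))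
      + pull ?J is (\<lambda>as. \<Sum>d\<in>UNIV. J d k y * partial d (T as) (\<psi> y))" .
  have "(\<Sum>a<length is. \<Sum>l\<in>UNIV. christoffel f' l k (is ! a) y * T' (is[a := l]) y) = connection ?c' is (\<lambda>as. T' as y)"
    by (rule connection_eq)
  also have "\<dots> = connection ?c' is (\<lambda>as. pull ?J as (\<lambda>as. T as (\<psi> y)))"
    by (rule connection_cong) (use T' y jk(2) in auto)
  also have "\<dots> = dpull ?J ?dJ is (\<lambda>as. T as (\<psi> y))
      + pull ?J is (\<lambda>as. connection (\<lambda>a b. \<Sum>d\<in>UNIV. J d k y * ?c d a b) as (\<lambda>as. T as (\<psi> y)))"
    by (rule connection_pull) (rule christoffel_f'[OF y])
  finally have B: "(\<Sum>a<length is. \<Sum>l\<in>UNIV. christoffel f' l k (is ! a) y * T' (is[a := l]) y) = dpull ?J ?dJ is (\<lambda>as. T as (\<psi> y))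
      + pull ?J is (\<lambda>as. \<Sum>d\<in>UNIV. J d k y * connection (?c d) as (\<lambda>as. T as (\<psi> y)))"
    by (simp only: connection_coeff_sum)
  have "cov_deriv f' T' js y = pull ?J is (\<lambda>as. \<Sum>d\<in>UNIV. J d k y * partial d (T as) (\<psi> y))
      - pull ?J is (\<lambda>as. \<Sum>d\<in>UNIV. J d k y * connection (?c d) as (\<lambda>as. T as (\<psi> y)))"
    unfolding cov_deriv_def Let_def jk(1) using A B by simp
  also have "\<dots> = pull ?J is (\<lambda>as. \<Sum>d\<in>UNIV. J d k y * (partial d (T as) (\<psi> y) - connection (?c d) as (\<lambda>as. T as (\<psi> y))))"
    by (simp add: pull_diff[symmetric] sum_subtractf right_diff_distrib)
  also have "\<dots> = (\<Sum>d\<in>UNIV. J d k y * pull ?J is (\<lambda>as. partial d (T as) (\<psi> y) - connection (?c d) as (\<lambda>as. T as (\<psi> y))))"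
    by (simp only: pull_sum pull_cmult)
  also have "\<dots> = pull ?J js (\<lambda>as. cov_deriv f T as (\<psi> y))"
    unfolding jk(1) pull_snoc cov_deriv_def Let_def by (simp add: connection_eq[symmetric])
  finally show ?thesis .
qed

text \<open>At order zero the second derivatives of \<open>f'\<close> contain a non-tensorial part,
  but it is a combination of tangent vectors and disappears in the product with the normal. Higher
  orders follow from \<open>cov_deriv_pull\<close>.\<close>

lemma cov_second_form_pull:
  assumes \<nu>: "smooth_on W \<nu>" "\<And>x i. x \<in> W \<Longrightarrow> \<nu> x \<bullet> partial i f x = 0"
  shows "length is = m + 2 \<Longrightarrow> y \<in> V \<Longrightarrow>
    cov_second_form f' (\<lambda>y. \<nu> (\<psi> y)) m is y = pull (\<lambda>a i. J a i y) is (\<lambda>as. cov_second_form f \<nu> m as (\<psi> y))"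
proof (induction m arbitrary: "is" y)
  case 0
  then have "length is = 2" by simp
  then obtain i j where ij: "is = [i, j]" using length_2_cases by blast
  have py: "\<psi> y \<in> W" using V(3) 0 by blast
  have "cov_second_form f' (\<lambda>y. \<nu> (\<psi> y)) 0 is y =
      (\<Sum>a\<in>UNIV. \<Sum>b\<in>UNIV. J a j y * (J b i y * (partial b (partial a f) (\<psi> y) \<bullet> \<nu> (\<psi> y))))"
    unfolding cov_second_form_def funpow_0 ij second_form_eq partial2_f'[OF 0(2)]
    using \<nu>(2)[OF py] by (simp add: inner_sum_right inner_add_right inner_commute[of _ "\<nu> (\<psi> y)"] sum_distrib_left)
  also have "\<dots> = (\<Sum>b\<in>UNIV. \<Sum>a\<in>UNIV. J a j y * (J b i y * (partial b (partial a f) (\<psi> y) \<bullet> \<nu> (\<psi> y))))"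
    by (rule sum.swap)
  also have "\<dots> = pull (\<lambda>a i. J a i y) is (\<lambda>as. cov_second_form f \<nu> 0 as (\<psi> y))"
    by (simp add: cov_second_form_def ij second_form_eq sum_distrib_left mult.left_commute)
  finally show ?case .
next
  case (Suc m)
  have rec: "cov_second_form g \<mu> (Suc m) = cov_deriv g (cov_second_form g \<mu> m)" for g \<mu> :: "real^'n \<Rightarrow> real^'d"
    by (simp add: cov_second_form_def)
  show ?case
    unfolding rec
  proof (rule cov_deriv_pull[where r = "m + 2"])
    show "smooth_on W (cov_second_form f \<nu> m as)" if "length as = m + 2" for as
      by (rule smooth_on_cov_second_form[OF W \<nu>(1) that])
  qed (use Suc in auto)
qed

lemma tensor_prod_pull:
  assumes \<nu>: "smooth_on W \<nu>" "\<And>x i. x \<in> W \<Longrightarrow> \<nu> x \<bullet> partial i f x = 0" and y: "y \<in> V"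
  shows "length is = num_indices ms \<Longrightarrow>
    tensor_prod (cov_second_form f' (\<lambda>y. \<nu> (\<psi> y))) ms is y =
    pull (\<lambda>a i. J a i y) is (\<lambda>as. tensor_prod (cov_second_form f \<nu>) ms as (\<psi> y))"
proof (induction ms arbitrary: "is")
  case Nil
  then show ?case by (simp add: num_indices_def)
next
  case (Cons m ms)
  have l: "length is = (m + 2) + num_indices ms" using Cons.prems by (simp add: num_indices_def)
  let ?a = "take (m + 2) is" and ?b = "drop (m + 2) is"
  have "tensor_prod (cov_second_form f' (\<lambda>y. \<nu> (\<psi> y))) (m # ms) is y =
     pull (\<lambda>a i. J a i y) ?a (\<lambda>as. cov_second_form f \<nu> m as (\<psi> y)) *
     pull (\<lambda>a i. J a i y) ?b (\<lambda>as. tensor_prod (cov_second_form f \<nu>) ms as (\<psi> y))"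
    using cov_second_form_pull[OF \<nu>, of ?a m y] Cons.IH[of ?b] l y by simp
  also have "\<dots> = pull (\<lambda>a i. J a i y) (?a @ ?b) (\<lambda>as. cov_second_form f \<nu> m (take (length ?a) as) (\<psi> y) *
      tensor_prod (cov_second_form f \<nu>) ms (drop (length ?a) as) (\<psi> y))"
    by (rule pull_append[symmetric])
  finally show ?case using l by simp
qed

theorem contraction_value_invariant:
  assumes \<nu>: "smooth_on W \<nu>" "\<And>x i. x \<in> W \<Longrightarrow> \<nu> x \<bullet> partial i f x = 0" and y: "y \<in> V"
    and c: "complete_contraction c"
  shows "contraction_value f' (\<lambda>y. \<nu> (\<psi> y)) y c = contraction_value f \<nu> (\<psi> y) c"
proof -
  obtain ms ps where c': "c = (ms, ps)" by (cases c)
  have d: "distinct (map fst ps @ map snd ps)" "set (map fst ps @ map snd ps) = {..<num_indices ms}"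
    using c by (simp_all add: complete_contraction_def c')
  have "contraction_value f' (\<lambda>y. \<nu> (\<psi> y)) y c = (\<Sum>is | length is = num_indices ms.
      (\<Prod>(a, b)\<leftarrow>ps. inv_form f' y $ (is ! a) $ (is ! b)) *
       pull (\<lambda>a i. J a i y) is (\<lambda>as. tensor_prod (cov_second_form f \<nu>) ms as (\<psi> y)))"
    unfolding contraction_value_def c' prod.case
    by (rule sum.cong) (use tensor_prod_pull[OF \<nu> y] in auto)
  also have "\<dots> = contraction_value f \<nu> (\<psi> y) c"
    unfolding contraction_value_def c' prod.case
    by (rule contraction_pull[OF d inv_form_f'[OF y]])
  finally show ?thesis .
qed

end

section \<open>Contraction polynomials\<close>

text \<open>Expressions in index notation. \<open>X t is\<close> is the component \<open>is\<close> of the tensor of rank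
  \<open>length is\<close> in the family \<open>t\<close>; an environment assigns values to index variables, of which those
  in \<open>V\<close> occur free, exactly once. \<open>K\<close> bounds the pairs (family, rank) that may occur.\<close>

inductive index_expr :: "(nat \<times> nat) set \<Rightarrow> nat set \<Rightarrow>
    ((nat \<Rightarrow> 'n::finite list \<Rightarrow> real) \<Rightarrow> (nat \<Rightarrow> 'n) \<Rightarrow> real) \<Rightarrow> bool" for K where
  zero: "finite V \<Longrightarrow> index_expr K V (\<lambda>X e. 0)"
| const: "index_expr K {} (\<lambda>X e. c)"
| atom: "distinct vs \<Longrightarrow> (t, length vs) \<in> K \<Longrightarrow> index_expr K (set vs) (\<lambda>X e. X t (map e vs))"
| add: "index_expr K V A \<Longrightarrow> index_expr K V B \<Longrightarrow> index_expr K V (\<lambda>X e. A X e + B X e)"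
| mult: "index_expr K V A \<Longrightarrow> index_expr K U B \<Longrightarrow> V \<inter> U = {} \<Longrightarrow> index_expr K (V \<union> U) (\<lambda>X e. A X e * B X e)"
| contract: "index_expr K V A \<Longrightarrow> a \<in> V \<Longrightarrow> b \<in> V \<Longrightarrow> a \<noteq> b \<Longrightarrow>
    index_expr K (V - {a, b}) (\<lambda>X e. \<Sum>i\<in>UNIV. A X (e(a := i, b := i)))"

lemma index_expr_finite: "index_expr K V A \<Longrightarrow> finite V"
  by (induction rule: index_expr.induct) auto

lemma index_expr_mono: "index_expr K V A \<Longrightarrow> K \<subseteq> K' \<Longrightarrow> index_expr K' V A"
  by (induction rule: index_expr.induct) (auto intro: index_expr.intros)

lemma index_expr_cong_env: "index_expr K V A \<Longrightarrow> (\<And>v. v \<in> V \<Longrightarrow> e v = e' v) \<Longrightarrow> A X e = A X e'"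
proof (induction arbitrary: e e' rule: index_expr.induct)
  case (atom vs t)
  then have "map e vs = map e' vs" by simp
  then show ?case by (simp only:)
next
  case (add V A B)
  show ?case using add.IH(1)[of e e'] add.IH(2)[of e e'] add.prems by simp
next
  case (mult V A U B)
  show ?case using mult.IH(1)[of e e'] mult.IH(2)[of e e'] mult.prems by simp
next
  case (contract V A a b)
  have "A X (e(a := i, b := i)) = A X (e'(a := i, b := i))" for i
    by (rule contract.IH) (use contract.prems in auto)
  then show ?case by simp
qed simp_all

lemma index_expr_cmult: "index_expr K V A \<Longrightarrow> index_expr K V (\<lambda>X e. c * A X e)"
  using mult[OF const[of K c], of V A] by simp

lemma index_expr_sum:
  assumes "finite I" "finite V"
  shows "(\<And>i. i \<in> I \<Longrightarrow> index_expr K V (A i)) \<Longrightarrow> index_expr K V (\<lambda>X e. \<Sum>i\<in>I. A i X e)"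
  using assms(1)
proof (induction I rule: finite_induct)
  case empty
  show ?case using zero[OF assms(2)] by simp
next
  case (insert i I)
  have "index_expr K V (\<lambda>X e. A i X e + (\<Sum>i\<in>I. A i X e))"
    by (rule add) (use insert in auto)
  then show ?case using insert.hyps by simp
qed

lemma index_expr_rename:
  assumes "bij \<pi>"
  shows "index_expr K V A \<Longrightarrow> index_expr K (\<pi> ` V) (\<lambda>X e. A X (e \<circ> \<pi>))"
proof (induction rule: index_expr.induct)
  case (zero V)
  then show ?case by (intro index_expr.zero) simp
next
  case (const c)
  show ?case using index_expr.const by simp
next
  case (atom vs t)
  have "distinct (map \<pi> vs)" using atom assms by (simp add: distinct_map bij_is_inj inj_on_subset[OF bij_is_inj])
  then show ?case using index_expr.atom[of "map \<pi> vs" t K] atom by (simp add: comp_def)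
next
  case (add V A B)
  then show ?case by (intro index_expr.add)
next
  case (mult V A U B)
  have "\<pi> ` V \<inter> \<pi> ` U = {}" using mult.hyps(3) assms by (metis bij_is_inj image_Int image_empty)
  then show ?case using index_expr.mult[OF mult.IH] by (simp add: image_Un)
next
  case (contract V A a b)
  have inj: "\<pi> x = \<pi> y \<longleftrightarrow> x = y" for x y using assms by (simp add: bij_is_inj inj_eq)
  have "\<pi> ` (V - {a, b}) = \<pi> ` V - {\<pi> a, \<pi> b}"
    using image_set_diff[OF bij_is_inj[OF assms], of V "{a, b}"] by simp
  moreover have "(e(\<pi> a := i, \<pi> b := i)) \<circ> \<pi> = (e \<circ> \<pi>)(a := i, b := i)" for e :: "nat \<Rightarrow> 'a" and i
    by (auto simp: fun_eq_iff inj)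
  moreover have "index_expr K (\<pi> ` V - {\<pi> a, \<pi> b}) (\<lambda>X e. \<Sum>i\<in>UNIV. A X ((e(\<pi> a := i, \<pi> b := i)) \<circ> \<pi>))"
    by (rule index_expr.contract[OF contract.IH]) (use contract.hyps inj in auto)
  ultimately show ?case by (simp only:)
qed

text \<open>The expression \<open>B\<close> is fixed before \<open>p\<close>, which ranges over all
  geometric situations with property \<open>P\<close>. This order of quantifiers is how universality
  is transported from the atoms to arbitrary expressions.\<close>

lemma index_expr_substitute:
  assumes atoms: "\<And>t vs. distinct vs \<Longrightarrow> (t, length vs) \<in> K \<Longrightarrow>
      \<exists>B. index_expr K' (set vs) B \<and> (\<forall>p. P p \<longrightarrow> (\<forall>e. X p t (map e vs) = B (Y p) e))"
  shows "index_expr K V A \<Longrightarrow> \<exists>B. index_expr K' V B \<and> (\<forall>p. P p \<longrightarrow> (\<forall>e. A (X p) e = B (Y p) e))"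
proof (induction rule: index_expr.induct)
  case (zero V)
  show ?case using index_expr.zero[OF zero] by (intro exI[of _ "\<lambda>X e. 0"]) simp
next
  case (const c)
  show ?case using index_expr.const by (intro exI[of _ "\<lambda>X e. c"]) simp
next
  case (atom vs t)
  then show ?case using atoms by blast
next
  case (add V A B)
  then obtain A' B' where "index_expr K' V A'" "index_expr K' V B'"
    "\<forall>p. P p \<longrightarrow> (\<forall>e. A (X p) e = A' (Y p) e)" "\<forall>p. P p \<longrightarrow> (\<forall>e. B (X p) e = B' (Y p) e)" by blast
  then show ?case by (intro exI[of _ "\<lambda>X e. A' X e + B' X e"]) (simp add: index_expr.add)
next
  case (mult V A U B)
  then obtain A' B' where "index_expr K' V A'" "index_expr K' U B'"
    "\<forall>p. P p \<longrightarrow> (\<forall>e. A (X p) e = A' (Y p) e)" "\<forall>p. P p \<longrightarrow> (\<forall>e. B (X p) e = B' (Y p) e)" by blast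
  then show ?case using mult.hyps by (intro exI[of _ "\<lambda>X e. A' X e * B' X e"]) (simp add: index_expr.mult)
next
  case (contract V A a b)
  then obtain A' where "index_expr K' V A'" "\<forall>p. P p \<longrightarrow> (\<forall>e. A (X p) e = A' (Y p) e)" by blast
  then show ?case using contract.hyps
    by (intro exI[of _ "\<lambda>X e. \<Sum>i\<in>UNIV. A' X (e(a := i, b := i))"]) (simp add: index_expr.contract)
qed

text \<open>Differentiation in the direction of an index variable \<open>k\<close> adds
  \<open>k\<close> to the free variables, and the Leibniz rule distributes it over products.
  \<open>K'\<close> may exceed \<open>K\<close> because derivatives raise ranks.\<close>

lemma index_expr_derivative:
  fixes X :: "'p \<Rightarrow> real^'n \<Rightarrow> nat \<Rightarrow> 'n list \<Rightarrow> real" and S :: "'p \<Rightarrow> (real^'n) set"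
  assumes "K \<subseteq> K'"
    and diff: "\<And>p y t is. P p \<Longrightarrow> y \<in> S p \<Longrightarrow> (t, length is) \<in> K \<Longrightarrow> (\<lambda>y. X p y t is) differentiable (at y)"
    and atoms: "\<And>t vs k. distinct vs \<Longrightarrow> (t, length vs) \<in> K \<Longrightarrow> k \<notin> set vs \<Longrightarrow>
      \<exists>B. index_expr K' (insert k (set vs)) B \<and> (\<forall>p y e. P p \<longrightarrow> y \<in> S p \<longrightarrow>
         partial (e k) (\<lambda>y. X p y t (map e vs)) y = B (X p y) e)"
  shows "index_expr K V A \<Longrightarrow>
    (\<forall>p y e. P p \<longrightarrow> y \<in> S p \<longrightarrow> (\<lambda>y. A (X p y) e) differentiable (at y)) \<and>
    (\<forall>k. k \<notin> V \<longrightarrow> (\<exists>B. index_expr K' (insert k V) B \<and>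
      (\<forall>p y e. P p \<longrightarrow> y \<in> S p \<longrightarrow> partial (e k) (\<lambda>y. A (X p y) e) y = B (X p y) e)))"
proof (induction rule: index_expr.induct)
  case (zero V)
  have "index_expr K' (insert k V) (\<lambda>X e. 0)" for k by (rule index_expr.zero) (use zero in simp)
  then show ?case by (auto intro!: exI[of _ "\<lambda>X e. 0"])
next
  case (const c)
  have "index_expr K' {k} (\<lambda>X e. 0)" for k by (rule index_expr.zero) simp
  then show ?case by (auto intro!: exI[of _ "\<lambda>X e. 0"])
next
  case (atom vs t)
  then show ?case using diff atoms by simp
next
  case (add V A B)
  have dA: "\<And>p y e. P p \<Longrightarrow> y \<in> S p \<Longrightarrow> (\<lambda>y. A (X p y) e) differentiable (at y)"
    and dB: "\<And>p y e. P p \<Longrightarrow> y \<in> S p \<Longrightarrow> (\<lambda>y. B (X p y) e) differentiable (at y)"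
    using add.IH by blast+
  show ?case
  proof (intro conjI allI impI)
    fix k assume k: "k \<notin> V"
    obtain A' where A': "index_expr K' (insert k V) A'" "\<And>p y e. P p \<Longrightarrow> y \<in> S p \<Longrightarrow> partial (e k) (\<lambda>y. A (X p y) e) y = A' (X p y) e"
      using add.IH(1) k by blast
    obtain B' where B': "index_expr K' (insert k V) B'" "\<And>p y e. P p \<Longrightarrow> y \<in> S p \<Longrightarrow> partial (e k) (\<lambda>y. B (X p y) e) y = B' (X p y) e"
      using add.IH(2) k by blast
    show "\<exists>C. index_expr K' (insert k V) C \<and> (\<forall>p y e. P p \<longrightarrow> y \<in> S p \<longrightarrow> partial (e k) (\<lambda>y. A (X p y) e + B (X p y) e) y = C (X p y) e)"
      using index_expr.add[OF A'(1) B'(1)] A'(2) B'(2)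
      by (intro exI[of _ "\<lambda>X e. A' X e + B' X e"]) (simp add: partial_add[OF dA dB])
  qed (intro differentiable_add dA dB)
next
  case (mult V A U B)
  have dA: "\<And>p y e. P p \<Longrightarrow> y \<in> S p \<Longrightarrow> (\<lambda>y. A (X p y) e) differentiable (at y)"
    and dB: "\<And>p y e. P p \<Longrightarrow> y \<in> S p \<Longrightarrow> (\<lambda>y. B (X p y) e) differentiable (at y)"
    using mult.IH by blast+
  show ?case
  proof (intro conjI allI impI)
    fix k assume k: "k \<notin> V \<union> U"
    obtain A' where A': "index_expr K' (insert k V) A'" "\<And>p y e. P p \<Longrightarrow> y \<in> S p \<Longrightarrow> partial (e k) (\<lambda>y. A (X p y) e) y = A' (X p y) e"
      using mult.IH(1) k by blast
    obtain B' where B': "index_expr K' (insert k U) B'" "\<And>p y e. P p \<Longrightarrow> y \<in> S p \<Longrightarrow> partial (e k) (\<lambda>y. B (X p y) e) y = B' (X p y) e"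
      using mult.IH(2) k by blast
    have "index_expr K' (V \<union> insert k U) (\<lambda>X e. A X e * B' X e)"
      by (rule index_expr.mult[OF index_expr_mono[OF mult.hyps(1) assms(1)] B'(1)]) (use mult.hyps(3) k in auto)
    moreover have "index_expr K' (insert k V \<union> U) (\<lambda>X e. A' X e * B X e)"
      by (rule index_expr.mult[OF A'(1) index_expr_mono[OF mult.hyps(2) assms(1)]]) (use mult.hyps(3) k in auto)
    ultimately have "index_expr K' (insert k (V \<union> U)) (\<lambda>X e. A X e * B' X e + A' X e * B X e)"
      by (intro index_expr.add) simp_all
    then show "\<exists>C. index_expr K' (insert k (V \<union> U)) C \<and> (\<forall>p y e. P p \<longrightarrow> y \<in> S p \<longrightarrow> partial (e k) (\<lambda>y. A (X p y) e * B (X p y) e) y = C (X p y) e)"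
      using A'(2) B'(2)
      by (intro exI[of _ "\<lambda>X e. A X e * B' X e + A' X e * B X e"]) (simp add: partial_mult[OF dA dB])
  qed (intro differentiable_mult dA dB)
next
  case (contract V A a b)
  let ?C = "\<lambda>X e. \<Sum>i\<in>UNIV. A X (e(a := i, b := i))" and ?U = "V - {a, b}"
  have dA: "\<And>p y e. P p \<Longrightarrow> y \<in> S p \<Longrightarrow> (\<lambda>y. A (X p y) e) differentiable (at y)"
    using contract.IH by blast
  have finV: "finite V" by (rule index_expr_finite[OF contract.hyps(1)])
  show ?case
  proof (intro conjI allI impI)
    fix p y e assume py: "P p" "y \<in> S p"
    show "(\<lambda>y. ?C (X p y) e) differentiable (at y)"
      by (intro differentiable_sum ballI dA[OF py]) simp
  next
    fix k assume k: "k \<notin> ?U"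
    \<comment> \<open>\<open>k\<close> may coincide with one of the bound indices \<open>a\<close>,
      \<open>b\<close>. The derivative is therefore taken with a fresh variable \<open>k'\<close>
      and renamed by a transposition afterwards.\<close>
    obtain k' where k': "k' \<notin> insert k V" using finV ex_new_if_finite[OF infinite_UNIV_nat, of "insert k V"] by auto
    obtain A' where A': "index_expr K' (insert k' V) A'" "\<And>p y e. P p \<Longrightarrow> y \<in> S p \<Longrightarrow> partial (e k') (\<lambda>y. A (X p y) e) y = A' (X p y) e"
      using contract.IH k' by blast
    have nab: "k' \<noteq> a" "k' \<noteq> b" using k' contract.hyps by auto
    let ?D = "\<lambda>X e. \<Sum>i\<in>UNIV. A' X (e(a := i, b := i))"
    have "index_expr K' (insert k' V - {a, b}) ?D"
      using contract.hyps by (intro index_expr.contract A') auto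
    then have D: "index_expr K' (insert k' ?U) ?D" using nab by (simp add: insert_Diff_if)
    have pD: "partial (e k') (\<lambda>y. ?C (X p y) e) y = ?D (X p y) e" if "P p" "y \<in> S p" for p y e
    proof -
      have "partial (e k') (\<lambda>y. ?C (X p y) e) y = (\<Sum>i\<in>UNIV. partial (e k') (\<lambda>y. A (X p y) (e(a := i, b := i))) y)"
        by (rule partial_sum) (rule dA[OF that])
      also have "\<dots> = ?D (X p y) e"
        using A'(2)[OF that, of "e(a := i, b := i)" for i] nab by simp
      finally show ?thesis .
    qed
    define \<pi> where "\<pi> = Transposition.transpose k k'"
    have \<pi>: "bij \<pi>" by (simp add: \<pi>_def)
    have "\<pi> ` insert k' ?U = insert k ?U"
    proof -
      have "\<pi> ` ?U = id ` ?U"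
        using k k' by (intro image_cong) (auto simp: \<pi>_def Transposition.transpose_def)
      then show ?thesis by (simp add: \<pi>_def)
    qed
    then have 1: "index_expr K' (insert k ?U) (\<lambda>X e. ?D X (e \<circ> \<pi>))"
      using index_expr_rename[OF \<pi> D] by simp
    have C: "index_expr K ?U ?C" using contract.hyps by (intro index_expr.contract)
    have 2: "partial (e k) (\<lambda>y. ?C (X p y) e) y = ?D (X p y) (e \<circ> \<pi>)" if "P p" "y \<in> S p" for p y e
    proof -
      have "?C (X p y) (e \<circ> \<pi>) = ?C (X p y) e" for y
        by (rule index_expr_cong_env[OF C]) (use k k' in \<open>auto simp: \<pi>_def Transposition.transpose_def\<close>)
      then show ?thesis using pD[OF that, of "e \<circ> \<pi>"] by (simp add: \<pi>_def)
    qed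
    show "\<exists>B. index_expr K' (insert k ?U) B \<and> (\<forall>p y e. P p \<longrightarrow> y \<in> S p \<longrightarrow> partial (e k) (\<lambda>y. ?C (X p y) e) y = B (X p y) e)"
      using 1 2 by (intro exI[of _ "\<lambda>X e. ?D X (e \<circ> \<pi>)"]) blast
  qed
qed

subsection \<open>Normal form\<close>

primrec tprod :: "('n list \<Rightarrow> real) \<Rightarrow> nat list \<Rightarrow> 'n list \<Rightarrow> real" where
  "tprod Y [] is = 1"
| "tprod Y (m # ms) is = Y (take (m + 2) is) * tprod Y ms (drop (m + 2) is)"

text \<open>\<open>\<rho>\<close> gives the position of each free variable; the other positions are paired by \<open>ps\<close>.\<close>

definition monomial_value :: "nat list \<Rightarrow> (nat \<times> nat) list \<Rightarrow> (nat \<Rightarrow> nat) \<Rightarrow> nat set \<Rightarrow>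
    ('n::finite list \<Rightarrow> real) \<Rightarrow> (nat \<Rightarrow> 'n) \<Rightarrow> real" where
  "monomial_value ms ps \<rho> V Y e = (\<Sum>is | length is = num_indices ms.
     (\<Prod>(a, b)\<leftarrow>ps. of_bool (is ! a = is ! b)) * (\<Prod>v\<in>V. of_bool (is ! \<rho> v = e v)) * tprod Y ms is)"

definition monomial_ok :: "nat list \<Rightarrow> (nat \<times> nat) list \<Rightarrow> (nat \<Rightarrow> nat) \<Rightarrow> nat set \<Rightarrow> bool" where
  "monomial_ok ms ps \<rho> V \<longleftrightarrow> finite V \<and> distinct (map fst ps @ map snd ps) \<and>
     set (map fst ps @ map snd ps) \<subseteq> {..<num_indices ms} \<and>
     bij_betw \<rho> V ({..<num_indices ms} - set (map fst ps @ map snd ps))"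

text \<open>Monomials are built from the family \<open>X 0\<close> alone: normal forms are taken
  after all other families have been eliminated.\<close>

definition normal_form :: "nat set \<Rightarrow> ((nat \<Rightarrow> 'n::finite list \<Rightarrow> real) \<Rightarrow> (nat \<Rightarrow> 'n) \<Rightarrow> real) \<Rightarrow> bool" where
  "normal_form V A \<longleftrightarrow> (\<exists>L. (\<forall>(c, ms, ps, \<rho>)\<in>set L. monomial_ok ms ps \<rho> V) \<and>
     (\<forall>X e. A X e = (\<Sum>(c, ms, ps, \<rho>)\<leftarrow>L. c * monomial_value ms ps \<rho> V (X 0) e)))"

lemma normal_formI:
  assumes "monomial_ok ms ps \<rho> V" "\<And>X e. A X e = c * monomial_value ms ps \<rho> V (X 0) e"
  shows "normal_form V A"
  unfolding normal_form_def using assms by (intro exI[of _ "[(c, ms, ps, \<rho>)]"]) simp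

lemma normal_form_zero: "normal_form V (\<lambda>X e. 0)"
  unfolding normal_form_def by (intro exI[of _ "[]"]) simp

lemma normal_form_add:
  assumes "normal_form V A" "normal_form V B"
  shows "normal_form V (\<lambda>X e. A X e + B X e)"
proof -
  obtain L where L: "\<forall>(c, ms, ps, \<rho>)\<in>set L. monomial_ok ms ps \<rho> V"
     "\<And>X e. A X e = (\<Sum>(c, ms, ps, \<rho>)\<leftarrow>L. c * monomial_value ms ps \<rho> V (X 0) e)"
    using assms(1) unfolding normal_form_def by blast
  obtain L' where L': "\<forall>(c, ms, ps, \<rho>)\<in>set L'. monomial_ok ms ps \<rho> V"
     "\<And>X e. B X e = (\<Sum>(c, ms, ps, \<rho>)\<leftarrow>L'. c * monomial_value ms ps \<rho> V (X 0) e)"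
    using assms(2) unfolding normal_form_def by blast
  show ?thesis unfolding normal_form_def using L L' by (intro exI[of _ "L @ L'"]) auto
qed

lemma normal_form_sum_list:
  assumes "\<And>z. z \<in> set L \<Longrightarrow> normal_form V (A z)"
  shows "normal_form V (\<lambda>X e. \<Sum>z\<leftarrow>L. A z X e)"
  using assms
proof (induction L)
  case Nil
  show ?case using normal_form_zero by simp
next
  case (Cons z L)
  have "normal_form V (\<lambda>X e. A z X e + (\<Sum>z\<leftarrow>L. A z X e))"
    by (rule normal_form_add) (use Cons in auto)
  then show ?case by simp
qed

lemma sum_lists_append:
  fixes F :: "'n::finite list \<Rightarrow> real"
  shows "(\<Sum>is | length is = N + M. F is) = (\<Sum>is | length is = N. \<Sum>js | length js = M. F (is @ js))"
proof (induction N arbitrary: F)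
  case (Suc N)
  have "(\<Sum>is | length is = Suc N + M. F is) = (\<Sum>a\<in>UNIV. \<Sum>is | length is = N + M. F (a # is))"
    using sum_lists_Suc[where N = "N + M" and F = F] by simp
  then show ?case by (simp add: Suc sum_lists_Suc)
qed simp

lemma num_indices_append: "num_indices (ms @ ms') = num_indices ms + num_indices ms'"
  by (simp add: num_indices_def)

lemma tprod_append:
  "length is = num_indices ms \<Longrightarrow> tprod Y (ms @ ms') (is @ js) = tprod Y ms is * tprod Y ms' js"
  by (induction ms arbitrary: "is") (auto simp: num_indices_def)

text \<open>The lists of tensors are concatenated, and all positions in the second monomial are
  shifted by the number \<open>N\<close> of indices of the first.\<close>

lemma monomial_mult:
  assumes ok: "monomial_ok ms ps \<rho> V" "monomial_ok ms' ps' \<rho>' U" and disj: "V \<inter> U = {}"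
  defines "N \<equiv> num_indices ms"
  defines "qs \<equiv> ps @ map (\<lambda>(a, b). (N + a, N + b)) ps'"
    and "\<sigma> \<equiv> \<lambda>v. if v \<in> V then \<rho> v else N + \<rho>' v"
  shows "monomial_ok (ms @ ms') qs \<sigma> (V \<union> U)"
    and "monomial_value (ms @ ms') qs \<sigma> (V \<union> U) Y e = monomial_value ms ps \<rho> V Y e * monomial_value ms' ps' \<rho>' U Y e"
proof -
  let ?M = "num_indices ms'"
  let ?P = "set (map fst ps @ map snd ps)" and ?P' = "set (map fst ps' @ map snd ps')"
  have o1: "finite V" "distinct (map fst ps @ map snd ps)" "?P \<subseteq> {..<N}" "bij_betw \<rho> V ({..<N} - ?P)"
    and o2: "finite U" "distinct (map fst ps' @ map snd ps')" "?P' \<subseteq> {..<?M}" "bij_betw \<rho>' U ({..<?M} - ?P')"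
    using ok by (simp_all add: monomial_ok_def N_def)
  have m: "map fst qs = map fst ps @ map ((+) N) (map fst ps')" "map snd qs = map snd ps @ map ((+) N) (map snd ps')"
    by (auto simp: qs_def)
  have sq: "set (map fst qs @ map snd qs) = ?P \<union> (+) N ` ?P'"
    unfolding m by auto
  have shift: "bij_betw (\<lambda>v. N + \<rho>' v) U ((+) N ` ({..<?M} - ?P'))"
    using bij_betw_trans[OF o2(4), of "(+) N" "(+) N ` ({..<?M} - ?P')"] by (simp add: comp_def bij_betw_def)
  have "bij_betw \<sigma> V ({..<N} - ?P)" using o1(4) by (subst bij_betw_cong[of V \<sigma> \<rho>]) (auto simp: \<sigma>_def)
  moreover have "bij_betw \<sigma> U ((+) N ` ({..<?M} - ?P'))"
    using shift disj by (subst bij_betw_cong[of U \<sigma> "\<lambda>v. N + \<rho>' v"]) (auto simp: \<sigma>_def)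
  ultimately have "bij_betw \<sigma> (V \<union> U) (({..<N} - ?P) \<union> (+) N ` ({..<?M} - ?P'))"
    by (rule bij_betw_combine) auto
  moreover have "({..<N} - ?P) \<union> (+) N ` ({..<?M} - ?P') = {..<N + ?M} - (?P \<union> (+) N ` ?P')"
  proof -
    have "{..<N + ?M} = {..<N} \<union> (+) N ` {..<?M}"
    proof -
      have "x \<in> (+) N ` {..<?M}" if "N \<le> x" "x < N + ?M" for x
        using that by (intro image_eqI[of _ _ "x - N"]) auto
      then show ?thesis by (intro set_eqI iffI) (metis UnCI lessThan_iff not_less, auto)
    qed
    moreover have "(+) N ` ({..<?M} - ?P') = (+) N ` {..<?M} - (+) N ` ?P'" by (rule image_set_diff) simp
    moreover have "?P \<inter> (+) N ` {..<?M} = {}" "{..<N} \<inter> (+) N ` ?P' = {}" using o1(3) by auto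
    ultimately show ?thesis by blast
  qed
  moreover have "distinct (map fst qs @ map snd qs)"
  proof -
    have "distinct (map ((+) N) (map fst ps' @ map snd ps'))"
      using o2(2) by (subst distinct_map) simp
    then have "distinct (map ((+) N) (map fst ps') @ map ((+) N) (map snd ps'))" by (simp only: map_append)
    moreover have "?P \<inter> (+) N ` ?P' = {}" using o1(3) by auto
    then have "?P \<inter> (set (map ((+) N) (map fst ps')) \<union> set (map ((+) N) (map snd ps'))) = {}"
      by (simp only: set_append set_map image_Un)
    ultimately show ?thesis
      using o1(2) unfolding m distinct_append set_append by blast
  qed
  moreover have "set (map fst qs @ map snd qs) \<subseteq> {..<N + ?M}"
    using o1(3) o2(3) unfolding sq by (auto simp: subset_iff)
  ultimately show "monomial_ok (ms @ ms') qs \<sigma> (V \<union> U)"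
    using o1(1) o2(1) unfolding monomial_ok_def num_indices_append N_def[symmetric] sq by simp
  have main: "(\<Prod>(a, b)\<leftarrow>qs. of_bool ((is @ js) ! a = (is @ js) ! b)) * (\<Prod>v\<in>V \<union> U. of_bool ((is @ js) ! \<sigma> v = e v)) * tprod Y (ms @ ms') (is @ js)
     = ((\<Prod>(a, b)\<leftarrow>ps. of_bool (is ! a = is ! b)) * (\<Prod>v\<in>V. of_bool (is ! \<rho> v = e v)) * tprod Y ms is) *
       ((\<Prod>(a, b)\<leftarrow>ps'. of_bool (js ! a = js ! b)) * (\<Prod>v\<in>U. of_bool (js ! \<rho>' v = e v)) * tprod Y ms' js)"
    if l: "length is = N" "length js = ?M" for "is" js
  proof -
    have p1: "map (\<lambda>(a, b). of_bool ((is @ js) ! a = (is @ js) ! b) :: real) ps = map (\<lambda>(a, b). of_bool (is ! a = is ! b)) ps"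
    proof (rule map_cong[OF refl])
      fix z assume "z \<in> set ps"
      then have "fst z < N" "snd z < N" using o1(3) by auto
      then show "(\<lambda>(a, b). of_bool ((is @ js) ! a = (is @ js) ! b) :: real) z = (\<lambda>(a, b). of_bool (is ! a = is ! b)) z"
        using l by (simp add: case_prod_unfold nth_append)
    qed
    have p2: "map (\<lambda>(a, b). of_bool ((is @ js) ! a = (is @ js) ! b) :: real) (map (\<lambda>(a, b). (N + a, N + b)) ps') = map (\<lambda>(a, b). of_bool (js ! a = js ! b)) ps'"
      using l by (auto simp: nth_append)
    have v1: "(\<Prod>v\<in>V. of_bool ((is @ js) ! \<sigma> v = e v) :: real) = (\<Prod>v\<in>V. of_bool (is ! \<rho> v = e v))"
    proof (rule prod.cong[OF refl])
      fix v assume "v \<in> V"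
      moreover have "\<rho> v < N" using bij_betwE[OF o1(4)] \<open>v \<in> V\<close> by auto
      ultimately show "(of_bool ((is @ js) ! \<sigma> v = e v) :: real) = of_bool (is ! \<rho> v = e v)"
        using l by (simp add: \<sigma>_def nth_append)
    qed
    have v2: "(\<Prod>v\<in>U. of_bool ((is @ js) ! \<sigma> v = e v) :: real) = (\<Prod>v\<in>U. of_bool (js ! \<rho>' v = e v))"
      by (rule prod.cong[OF refl]) (use disj l in \<open>auto simp: \<sigma>_def nth_append\<close>)
    have "(\<Prod>(a, b)\<leftarrow>qs. of_bool ((is @ js) ! a = (is @ js) ! b) :: real) =
      (\<Prod>(a, b)\<leftarrow>ps. of_bool (is ! a = is ! b)) * (\<Prod>(a, b)\<leftarrow>ps'. of_bool (js ! a = js ! b))"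
      unfolding qs_def map_append prod_list.append p1 p2 ..
    moreover have "(\<Prod>v\<in>V \<union> U. of_bool ((is @ js) ! \<sigma> v = e v) :: real) =
      (\<Prod>v\<in>V. of_bool (is ! \<rho> v = e v)) * (\<Prod>v\<in>U. of_bool (js ! \<rho>' v = e v))"
      unfolding prod.union_disjoint[OF o1(1) o2(1) disj] v1 v2 ..
    moreover have "tprod Y (ms @ ms') (is @ js) = tprod Y ms is * tprod Y ms' js"
      by (rule tprod_append) (use l in \<open>simp add: N_def\<close>)
    ultimately show ?thesis by (simp add: algebra_simps)
  qed
  show "monomial_value (ms @ ms') qs \<sigma> (V \<union> U) Y e = monomial_value ms ps \<rho> V Y e * monomial_value ms' ps' \<rho>' U Y e"
    unfolding monomial_value_def num_indices_append N_def[symmetric] sum_lists_append sum_product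
    by (intro sum.cong refl main) auto
qed

lemma sum_list_product:
  fixes f :: "'a \<Rightarrow> real"
  shows "(\<Sum>x\<leftarrow>L. f x) * (\<Sum>y\<leftarrow>L'. g y) = (\<Sum>x\<leftarrow>L. \<Sum>y\<leftarrow>L'. f x * g y)"
  by (induction L) (simp_all add: sum_list_const_mult distrib_right)

lemma normal_form_mult:
  assumes "normal_form V A" "normal_form U B" "V \<inter> U = {}"
  shows "normal_form (V \<union> U) (\<lambda>X e. A X e * B X e)"
proof -
  obtain L where L: "\<forall>(c, ms, ps, \<rho>)\<in>set L. monomial_ok ms ps \<rho> V"
     "\<And>X e. A X e = (\<Sum>(c, ms, ps, \<rho>)\<leftarrow>L. c * monomial_value ms ps \<rho> V (X 0) e)"
    using assms(1) unfolding normal_form_def by blast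
  obtain L' where L': "\<forall>(c, ms, ps, \<rho>)\<in>set L'. monomial_ok ms ps \<rho> U"
     "\<And>X e. B X e = (\<Sum>(c, ms, ps, \<rho>)\<leftarrow>L'. c * monomial_value ms ps \<rho> U (X 0) e)"
    using assms(2) unfolding normal_form_def by blast
  let ?v = "\<lambda>V z X e. case z of (c, ms, ps, \<rho>) \<Rightarrow> c * monomial_value ms ps \<rho> V (X (0::nat)) e"
  have "normal_form (V \<union> U) (\<lambda>X e. \<Sum>z\<leftarrow>L. \<Sum>z'\<leftarrow>L'. ?v V z X e * ?v U z' X e)"
  proof (intro normal_form_sum_list)
    fix z z' assume z: "z \<in> set L" "z' \<in> set L'"
    obtain c ms ps \<rho> where z1: "z = (c, ms, ps, \<rho>)" by (cases z)
    obtain c' ms' ps' \<rho>' where z2: "z' = (c', ms', ps', \<rho>')" by (cases z')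
    have ok: "monomial_ok ms ps \<rho> V" "monomial_ok ms' ps' \<rho>' U" using z L(1) L'(1) z1 z2 by auto
    show "normal_form (V \<union> U) (\<lambda>X e. ?v V z X e * ?v U z' X e)"
      by (rule normal_formI[OF monomial_mult(1)[OF ok assms(3)], of _ "c * c'"])
        (simp add: z1 z2 monomial_mult(2)[OF ok assms(3)])
  qed
  moreover have "A X e * B X e = (\<Sum>z\<leftarrow>L. \<Sum>z'\<leftarrow>L'. ?v V z X e * ?v U z' X e)" for X e
    unfolding L(2) L'(2) by (rule sum_list_product)
  ultimately show ?thesis by (simp only:)
qed

text \<open>Contracting \<open>a\<close> with \<open>b\<close> moves their positions from the free
  part \<open>\<rho>\<close> into the list of pairs: summing the product of two Kronecker symbols
  over the common value leaves one Kronecker symbol.\<close>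

lemma normal_form_contract:
  fixes A :: "(nat \<Rightarrow> 'n::finite list \<Rightarrow> real) \<Rightarrow> (nat \<Rightarrow> 'n) \<Rightarrow> real"
  assumes "normal_form V A" "a \<in> V" "b \<in> V" "a \<noteq> b"
  shows "normal_form (V - {a, b}) (\<lambda>X e. \<Sum>i\<in>UNIV. A X (e(a := i, b := i)))"
proof -
  obtain L where L: "\<forall>(c, ms, ps, \<rho>)\<in>set L. monomial_ok ms ps \<rho> V"
     "\<And>X e. A X e = (\<Sum>(c, ms, ps, \<rho>)\<leftarrow>L. c * monomial_value ms ps \<rho> V (X 0) e)"
    using assms(1) unfolding normal_form_def by blast
  let ?v = "\<lambda>z X e. case z of (c, ms, ps, \<rho>) \<Rightarrow> c * monomial_value ms ps \<rho> V ((X :: nat \<Rightarrow> 'n list \<Rightarrow> real) 0) e"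
  have "normal_form (V - {a, b}) (\<lambda>X e. \<Sum>z\<leftarrow>L. \<Sum>i\<in>UNIV. ?v z X (e(a := i, b := i)))"
  proof (intro normal_form_sum_list)
    fix z assume z: "z \<in> set L"
    obtain c ms ps \<rho> where z1: "z = (c, ms, ps, \<rho>)" by (cases z)
    let ?P = "set (map fst ps @ map snd ps)" and ?U = "V - {a, b}" and ?qs = "(\<rho> a, \<rho> b) # ps"
    have ok: "finite V" "distinct (map fst ps @ map snd ps)" "?P \<subseteq> {..<num_indices ms}"
      "bij_betw \<rho> V ({..<num_indices ms} - ?P)"
    proof -
      have "monomial_ok ms ps \<rho> V" using z L(1) z1 by auto
      then show "finite V" "distinct (map fst ps @ map snd ps)" "?P \<subseteq> {..<num_indices ms}"
        "bij_betw \<rho> V ({..<num_indices ms} - ?P)" unfolding monomial_ok_def by blast+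
    qed
    have inj: "inj_on \<rho> V" and im: "\<rho> ` V = {..<num_indices ms} - ?P" using ok(4) by (auto simp: bij_betw_def)
    have ab: "\<rho> a \<noteq> \<rho> b" using inj assms(2-4) by (auto simp: inj_on_def)
    have ra: "\<rho> a \<in> {..<num_indices ms} - ?P" "\<rho> b \<in> {..<num_indices ms} - ?P" using im assms(2,3) by blast+
    have imU: "\<rho> ` ?U = {..<num_indices ms} - insert (\<rho> a) (insert (\<rho> b) ?P)"
      using inj_on_image_set_diff[OF inj, of V "{a, b}"] assms(2,3) im by auto
    have "monomial_ok ms ?qs \<rho> ?U"
      unfolding monomial_ok_def
    proof (intro conjI)
      show "bij_betw \<rho> ?U ({..<num_indices ms} - set (map fst ?qs @ map snd ?qs))"
        unfolding bij_betw_def using imU inj_on_subset[OF inj, of ?U] by auto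
    qed (use ok ab ra in auto)
    moreover have "(\<Sum>i\<in>UNIV. monomial_value ms ps \<rho> V Y (e(a := i, b := i))) = monomial_value ms ?qs \<rho> ?U Y e" for Y :: "'n list \<Rightarrow> real" and e
    proof -
      have V: "V = insert a (insert b ?U)" "a \<notin> insert b ?U" "b \<notin> ?U" using assms(2-4) by auto
      have pv: "(\<Prod>v\<in>V. of_bool (is ! \<rho> v = (e(a := i, b := i)) v) :: real) =
         of_bool (is ! \<rho> a = i) * (of_bool (is ! \<rho> b = i) * (\<Prod>v\<in>?U. of_bool (is ! \<rho> v = e v)))" for "is" i
      proof -
        have "(\<Prod>v\<in>?U. of_bool (is ! \<rho> v = (e(a := i, b := i)) v) :: real) = (\<Prod>v\<in>?U. of_bool (is ! \<rho> v = e v))"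
          by (rule prod.cong) auto
        moreover have "(\<Prod>v\<in>V. g v) = g a * (g b * (\<Prod>v\<in>?U. g v))" for g :: "nat \<Rightarrow> real"
          using prod.remove[OF ok(1) assms(2), of g] prod.remove[of "V - {a}" b g] ok(1) assms(3,4)
          by (simp add: Diff_insert2[of V a "{b}"])
        ultimately show ?thesis using assms(4) by simp
      qed
      have si: "(\<Sum>i\<in>UNIV. of_bool (x = i) * (of_bool (y = i) * Q)) = of_bool (x = y) * Q" for x y :: 'n and Q :: real
        by (simp add: of_bool_def if_distrib[of "\<lambda>z. z * _"] cong: if_cong)
      have "(\<Sum>i\<in>UNIV. monomial_value ms ps \<rho> V Y (e(a := i, b := i))) =
        (\<Sum>is | length is = num_indices ms. (\<Prod>(a, b)\<leftarrow>ps. of_bool (is ! a = is ! b)) * tprod Y ms is *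
          (\<Sum>i\<in>UNIV. of_bool (is ! \<rho> a = i) * (of_bool (is ! \<rho> b = i) * (\<Prod>v\<in>?U. of_bool (is ! \<rho> v = e v)))))"
        unfolding monomial_value_def pv
        by (subst sum.swap) (simp only: sum_distrib_left mult_ac)
      then show ?thesis unfolding si monomial_value_def by (simp add: algebra_simps)
    qed
    ultimately show "normal_form ?U (\<lambda>X e. \<Sum>i\<in>UNIV. ?v z X (e(a := i, b := i)))"
      by (intro normal_formI[of ms ?qs \<rho> ?U _ c]) (simp_all add: z1 sum_distrib_left[symmetric])
  qed
  moreover have "(\<Sum>i\<in>UNIV. A X (e(a := i, b := i))) = (\<Sum>z\<leftarrow>L. \<Sum>i\<in>UNIV. ?v z X (e(a := i, b := i)))" for X e
    unfolding L(2) by (induction L) (auto simp: sum.distrib)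
  ultimately show ?thesis by (simp only:)
qed

text \<open>A tensor of rank \<open>length vs\<close> is read as a covariant derivative of order
  \<open>length vs - 2\<close>, since the second fundamental form already carries two indices; hence
  the bound on the length.\<close>

lemma normal_form_atom:
  assumes "distinct vs" "length vs \<ge> 2"
  shows "normal_form (set vs) (\<lambda>X (e :: nat \<Rightarrow> 'n::finite). X 0 (map e vs))"
proof -
  let ?L = "length vs" and ?\<rho> = "the_inv_into {..<length vs} ((!) vs)"
  have b: "bij_betw ((!) vs) {..<?L} (set vs)" by (rule bij_betw_nth[OF assms(1)]) auto
  have N: "num_indices [?L - 2] = ?L" using assms(2) by (simp add: num_indices_def)
  show ?thesis
  proof (rule normal_formI[of "[?L - 2]" "[]" ?\<rho> _ _ 1])
    show "monomial_ok [?L - 2] [] ?\<rho> (set vs)"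
      unfolding monomial_ok_def N using bij_betw_the_inv_into[OF b] by simp
    fix X :: "nat \<Rightarrow> 'n list \<Rightarrow> real" and e :: "nat \<Rightarrow> 'n"
    have "(\<Prod>v\<in>set vs. of_bool (is ! ?\<rho> v = e v) :: real) = of_bool (is = map e vs)" if "length is = ?L" for "is"
    proof -
      have "(\<Prod>v\<in>set vs. of_bool (is ! ?\<rho> v = e v) :: real) = (\<Prod>q<?L. of_bool (is ! ?\<rho> (vs ! q) = e (vs ! q)))"
        by (rule prod.reindex_bij_betw[OF b, symmetric])
      also have "\<dots> = (\<Prod>q<?L. of_bool (is ! q = e (vs ! q)))"
        using the_inv_into_f_f[OF bij_betw_imp_inj_on[OF b]] by simp
      also have "\<dots> = of_bool (\<forall>q<?L. is ! q = e (vs ! q))"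
        by (auto simp: of_bool_def intro!: prod.neutral)
      also have "(\<forall>q<?L. is ! q = e (vs ! q)) \<longleftrightarrow> is = map e vs" using that by (auto simp: list_eq_iff_nth_eq)
      finally show ?thesis .
    qed
    then have "monomial_value [?L - 2] [] ?\<rho> (set vs) (X 0) e = (\<Sum>is | length is = ?L. of_bool (is = map e vs) * X 0 is)"
      unfolding monomial_value_def N using assms(2) by (intro sum.cong) auto
    also have "\<dots> = X 0 (map e vs)"
      by (subst sum.remove[of _ "map e vs"]) (auto intro!: sum.neutral)
    finally show "X 0 (map e vs) = 1 * monomial_value [?L - 2] [] ?\<rho> (set vs) (X 0) e" by simp
  qed
qed

lemma index_expr_normal_form:
  assumes K: "\<And>t l. (t, l) \<in> K \<Longrightarrow> t = 0 \<and> l \<ge> 2"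
  shows "index_expr K V A \<Longrightarrow> normal_form V A"
proof (induction rule: index_expr.induct)
  case (zero V)
  show ?case by (rule normal_form_zero)
next
  case (const c)
  have [simp]: "{is :: 'a list. is = []} = {[]}" by auto
  show ?case
    by (rule normal_formI[of "[]" "[]" id _ _ c]) (auto simp: monomial_ok_def monomial_value_def num_indices_def bij_betw_def)
next
  case (atom vs t)
  then show ?case using normal_form_atom[of vs] K by blast
next
  case (add V A B)
  show ?case by (rule normal_form_add[OF add.IH])
next
  case (mult V A U B)
  show ?case by (rule normal_form_mult[OF mult.IH mult.hyps(3)])
next
  case (contract V A a b)
  show ?case by (rule normal_form_contract[OF contract.IH contract.hyps(2-4)])
qed

text \<open>With no free variable left, the pairs of each monomial cover every position, so each
  monomial is a complete contraction and their sum is a polynomial in them. Kronecker symbols take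
  the place of the inverse metric, which is legitimate at a point where the metric is the
  identity.\<close>

lemma index_expr_eval_poly:
  fixes A :: "(nat \<Rightarrow> 'n::finite list \<Rightarrow> real) \<Rightarrow> (nat \<Rightarrow> 'n) \<Rightarrow> real"
  assumes K: "\<And>t l. (t, l) \<in> K \<Longrightarrow> t = 0 \<and> l \<ge> 2" and A: "index_expr K {} A"
  shows "\<exists>P. (\<forall>c\<in>vars P. complete_contraction c) \<and> (\<forall>X e. A X e =
    eval_poly (\<lambda>(ms, ps). \<Sum>is | length is = num_indices ms.
      (\<Prod>(a, b)\<leftarrow>ps. of_bool (is ! a = is ! b)) * tprod (X 0) ms is) P)"
proof -
  obtain L where L: "\<forall>(c, ms, ps, \<rho>)\<in>set L. monomial_ok ms ps \<rho> {}"
     "\<And>X e. A X e = (\<Sum>(c, ms, ps, \<rho>)\<leftarrow>L. c * monomial_value ms ps \<rho> {} (X 0) e)"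
    using index_expr_normal_form[OF K A] unfolding normal_form_def by blast
  have cc: "complete_contraction (ms, ps)" if "monomial_ok ms ps \<rho> {}" for ms ps \<rho>
    using that unfolding monomial_ok_def complete_contraction_def by (auto simp: bij_betw_def)
  let ?val = "\<lambda>X (ms, ps). \<Sum>is | length is = num_indices ms.
      (\<Prod>(a, b)\<leftarrow>ps. of_bool (is ! a = is ! b)) * tprod (X (0::nat)) ms (is :: 'n list)"
  define P where "P = foldr (\<lambda>(c, ms, ps, \<rho> :: nat \<Rightarrow> nat) Q. Add (Mult (Const c) (Var (ms, ps))) Q) L (Const 0)"
  have "\<forall>c\<in>vars P. complete_contraction c"
    using L(1) unfolding P_def by (induction L) (auto intro: cc)
  moreover have "eval_poly (?val X) P = (\<Sum>(c, ms, ps, \<rho>)\<leftarrow>L. c * monomial_value ms ps \<rho> {} (X 0) e)" for X e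
    unfolding P_def by (induction L) (auto simp: monomial_value_def)
  then have "A X e = eval_poly (?val X) P" for X e by (simp only: L(2))
  ultimately show ?thesis by (intro exI[of _ P] conjI allI)
qed

section \<open>Graph charts\<close>

text \<open>The inverse function theorem provides a differentiable inverse \<open>g\<close> whose
  derivative at \<open>y\<close> is the inverse of \<open>Jh (g y)\<close>. Smoothness follows by
  bootstrapping: if \<open>g\<close> has \<open>k\<close> continuous derivatives, then so has its
  derivative.\<close>

lemma smooth_local_inverse:
  fixes h :: "real^'n \<Rightarrow> real^'n"
  assumes W: "open W" "smooth_on W h" "x0 \<in> W" and inj: "inj (frechet_derivative h (at x0))"
  obtains V \<psi> where "open V" "h x0 \<in> V" "smooth_on V \<psi>" "\<psi> ` V \<subseteq> W" "\<psi> (h x0) = x0" "open (\<psi> ` V)"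
    "homeomorphism V (\<psi> ` V) \<psi> h" "\<And>y. y \<in> V \<Longrightarrow> det (\<chi> a i. partial i \<psi> y $ a) \<noteq> 0"
proof -
  let ?f' = "\<lambda>x. Blinfun (frechet_derivative h (at x))"
  define Jh where "Jh x = (\<chi> a i. partial i h x $ a)" for x
  have d: "(h has_derivative frechet_derivative h (at x)) (at x)" if "x \<in> W" for x
    by (rule smooth_on_has_derivative[OF W(1,2) that])
  have ap: "blinfun_apply (?f' x) = frechet_derivative h (at x)" if "x \<in> W" for x
    by (rule bounded_linear_Blinfun_apply[OF has_derivative_bounded_linear[OF d[OF that]]])
  have J: "frechet_derivative h (at x) v = Jh x *v v" if "x \<in> W" for x v
    unfolding fun_cong[OF frechet_eq_sum_partials[OF W(1,2) that]] Jh_def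
    by (simp add: vec_eq_iff matrix_vector_mult_def mult.commute)
  have smJ: "smooth_on W (\<lambda>x. Jh x $ a $ b)" for a b
    unfolding Jh_def by (simp add: smooth_on_vec_nth[OF W(1) smooth_on_partial[OF W(2)]])
  have contf: "continuous_on W ?f'"
  proof (rule continuous_on_blinfun_componentwise)
    fix b :: "real^'n"
    have "continuous_on W (\<lambda>x. frechet_derivative h (at x) b)"
      by (rule smooth_on_continuous[OF smooth_on_derivative[OF W(2)]])
    then show "continuous_on W (\<lambda>x. blinfun_apply (?f' x) b)"
      by (rule continuous_on_eq) (simp add: ap)
  qed
  obtain L where L: "linear L" "L \<circ> frechet_derivative h (at x0) = id"
    using linear_injective_left_inverse[OF has_derivative_linear[OF d[OF W(3)]] inj] by blast
  have invf: "Blinfun L o\<^sub>L ?f' x0 = id_blinfun"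
  proof (rule blinfun_eqI)
    fix i show "blinfun_apply (Blinfun L o\<^sub>L ?f' x0) i = blinfun_apply id_blinfun i"
      using fun_cong[OF L(2), of i] L(1)
      by (simp add: ap[OF W(3)] bounded_linear_Blinfun_apply linear_conv_bounded_linear)
  qed
  obtain U' V g g' where UV: "open U'" "U' \<subseteq> W" "x0 \<in> U'" "open V" "h x0 \<in> V" "homeomorphism U' V h g"
    "\<And>y. y \<in> V \<Longrightarrow> (g has_derivative (g' y)) (at y)"
    "\<And>y. y \<in> V \<Longrightarrow> g' y = inv (blinfun_apply (?f' (g y)))"
    "\<And>y. y \<in> V \<Longrightarrow> bij (blinfun_apply (?f' (g y)))"
    using inverse_function_theorem[OF W(1) _ contf W(3) invf] d ap by (metis (no_types, lifting))
  have img: "g ` V = U'" and hg: "\<And>y. y \<in> V \<Longrightarrow> h (g y) = y" and gh: "\<And>x. x \<in> U' \<Longrightarrow> g (h x) = x"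
    using UV(6) unfolding homeomorphism_def by auto
  have gW: "g y \<in> W" if "y \<in> V" for y using that img UV(2) by blast
  have g': "Jh (g y) *v (g' y v) = v" if "y \<in> V" for y v
  proof -
    have "blinfun_apply (?f' (g y)) (inv (blinfun_apply (?f' (g y))) v) = v"
      using UV(9)[OF that] by (meson bij_inv_eq_iff)
    then show ?thesis by (simp add: UV(8)[OF that] ap[OF gW[OF that]] J[OF gW[OF that]])
  qed
  have prod: "Jh (g y) ** (\<chi> a i. partial i g y $ a) = mat 1" if "y \<in> V" for y
  proof (rule matrix_eq[THEN iffD2], rule allI)
    fix v
    have "(\<chi> a i. partial i g y $ a) *v v = g' y v"
    proof -
      have "g' y v = g' y (\<Sum>i\<in>UNIV. v $ i *\<^sub>R axis i 1)"
        using basis_expansion[of v] by (simp add: scalar_mult_eq_scaleR)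
      also have "\<dots> = (\<Sum>i\<in>UNIV. v $ i *\<^sub>R partial i g y)"
        using has_derivative_linear[OF UV(7)[OF that]]
        by (simp add: linear_sum linear_cmul partial_eqI[OF UV(7)[OF that]])
      also have "\<dots> = (\<chi> a i. partial i g y $ a) *v v"
        by (simp add: vec_eq_iff matrix_vector_mult_def mult.commute)
      finally show ?thesis by simp
    qed
    then show "Jh (g y) ** (\<chi> a i. partial i g y $ a) *v v = mat 1 *v v"
      using g'[OF that] by (simp add: matrix_vector_mul_assoc[symmetric])
  qed
  have det2: "det (Jh (g y)) * det (\<chi> a i. partial i g y $ a) = 1" if "y \<in> V" for y
    using arg_cong[OF prod[OF that], of det] by (simp add: det_mul)
  have det: "det (\<chi> a i. partial i g y $ a) \<noteq> 0" "det (Jh (g y)) \<noteq> 0" if "y \<in> V" for y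
    using det2[OF that] by auto
  have sm_sol: "smooth_on U' (\<lambda>x. matrix_inv (Jh x) *v v)" for v
  proof (rule smooth_on_cramer[OF UV(1), where A = Jh and b = "\<lambda>_. v"])
    fix x assume "x \<in> U'"
    then have nz: "det (Jh x) \<noteq> 0" using img det(2) by (metis imageE)
    show "det (Jh x) \<noteq> 0" by (rule nz)
    show "Jh x *v (matrix_inv (Jh x) *v v) = v"
      by (simp add: matrix_vector_mul_assoc matrix_inv_right_left(1)[OF nz])
  qed (auto intro: smooth_on_subset[OF W(1) UV(1,2)] smJ smooth_on_const UV(1))
  have g'': "g' y v = matrix_inv (Jh (g y)) *v v" if "y \<in> V" for y v
  proof -
    have "matrix_inv (Jh (g y)) *v v = matrix_inv (Jh (g y)) *v (Jh (g y) *v (g' y v))"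
      by (simp only: g'[OF that])
    then show ?thesis by (simp add: matrix_vector_mul_assoc matrix_inv_right_left(2)[OF det(2)[OF that]])
  qed
  have "times_cont_diff_on k V g" for k
  proof (induction k)
    case 0
    then show ?case using UV(6) unfolding homeomorphism_def by simp
  next
    case (Suc k)
    show ?case
    proof (rule times_cont_diff_on_SucI[OF UV(4) UV(7)])
      fix v
      have "times_cont_diff_on k V (\<lambda>y. matrix_inv (Jh (g y)) *v v)"
        by (rule times_cont_diff_on_compose[OF UV(4,1) Suc.IH])
          (use img sm_sol[of v] in \<open>auto simp: smooth_on_def\<close>)
      then show "times_cont_diff_on k V (\<lambda>y. g' y v)"
        by (rule times_cont_diff_on_cong[OF UV(4), rotated]) (simp add: g'')
    qed
  qed
  then have "smooth_on V g" by (simp add: smooth_on_def)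
  moreover have "homeomorphism V (g ` V) g h" using UV(6) unfolding img homeomorphism_def by auto
  ultimately show thesis
    using UV img gh det(1) by (intro that[of V g]) auto
qed

text \<open>The frame is the image of the standard basis under a linear isometry onto the tangent
  space; polarization turns preserved norms into preserved inner products.\<close>

lemma orthonormal_frame:
  fixes f :: "real^'n \<Rightarrow> real^'d"
  assumes "local_param M W f" "x0 \<in> W"
  obtains t :: "'n \<Rightarrow> real^'d" where "\<And>i j. t i \<bullet> t j = (if i = j then 1 else 0)"
    "\<And>i. t i \<in> range (frechet_derivative f (at x0))"
    "\<And>w. w \<in> range (frechet_derivative f (at x0)) \<Longrightarrow> (\<And>i. w \<bullet> t i = 0) \<Longrightarrow> w = 0"
proof -
  note D = local_paramD[OF assms(1)]
  let ?D = "frechet_derivative f (at x0)"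
  have lin: "linear ?D"
    by (rule has_derivative_linear[OF smooth_on_has_derivative[OF D(1,2) assms(2)]])
  have sub: "subspace (range ?D)" by (rule linear_subspace_image[OF lin subspace_UNIV])
  have "dim (UNIV :: (real^'n) set) = dim (range ?D)"
    using dim_image_eq[OF lin, of UNIV] D(3)[OF assms(2)] by simp
  then obtain L :: "real^'n \<Rightarrow> real^'d" where L: "linear L" "range L = range ?D" "\<And>x. norm (L x) = norm x"
    using isometries_subspaces[OF subspace_UNIV sub] by (metis UNIV_I)
  have inner: "L x \<bullet> L y = x \<bullet> y" for x y
  proof -
    have "L x \<bullet> L y = ((norm (L (x + y)))\<^sup>2 - (norm (L x))\<^sup>2 - (norm (L y))\<^sup>2) / 2"
      unfolding linear_add[OF L(1)] power2_norm_eq_inner by (simp add: inner_add_left inner_add_right inner_commute)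
    also have "\<dots> = x \<bullet> y"
      unfolding L(3) power2_norm_eq_inner by (simp add: inner_add_left inner_add_right inner_commute)
    finally show ?thesis .
  qed
  show thesis
  proof
    show "L (axis i 1) \<bullet> L (axis j 1) = (if i = j then 1 else 0)" for i j
      by (simp add: inner inner_axis_axis)
    show "L (axis i 1) \<in> range ?D" for i using L(2) by blast
    fix w assume "w \<in> range ?D" and 0: "\<And>i. w \<bullet> L (axis i 1) = 0"
    then obtain z where z: "w = L z" using L(2) by (metis rangeE)
    have "z $ i = 0" for i using 0[of i] unfolding z inner by (simp add: inner_axis)
    then have "z = 0" by (simp add: vec_eq_iff)
    then show "w = 0" using z linear_0[OF L(1)] by simp
  qed
qed

text \<open>\<open>h\<close> records the coordinates of \<open>f x - f x0\<close> along the
  orthonormal tangent frame. Its derivative at \<open>x0\<close> is injective, so a local inverse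
  \<open>\<psi>\<close> reparametrizes \<open>M\<close> such that the tangential part is
  \<open>y\<close> itself and the rest \<open>\<Phi>\<close> is normal to the tangent space at the
  base point.\<close>

lemma graph_chart:
  fixes f :: "real^'n \<Rightarrow> real^'d"
  assumes f: "local_param M W f" "x0 \<in> W"
  obtains V \<psi> and t :: "'n \<Rightarrow> real^'d" and \<Phi> where
    "open V" "0 \<in> V" "smooth_on V \<psi>" "\<psi> ` V \<subseteq> W" "\<psi> 0 = x0"
    "\<And>y. y \<in> V \<Longrightarrow> det (\<chi> a i. partial i \<psi> y $ a) \<noteq> 0"
    "local_param M V (\<lambda>y. f (\<psi> y))"
    "\<And>i j. t i \<bullet> t j = (if i = j then 1 else 0)"
    "\<And>i. t i \<in> range (frechet_derivative f (at x0))"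
    "smooth_on V \<Phi>" "\<Phi> 0 = 0" "\<And>i. partial i \<Phi> 0 = 0"
    "\<And>y i. y \<in> V \<Longrightarrow> \<Phi> y \<bullet> t i = 0"
    "\<And>y. y \<in> V \<Longrightarrow> f (\<psi> y) = f x0 + (\<Sum>i\<in>UNIV. y $ i *\<^sub>R t i) + \<Phi> y"
proof -
  note D = local_paramD[OF f(1)]
  let ?D = "frechet_derivative f (at x0)"
  have dD: "(f has_derivative ?D) (at x0)"
    by (rule smooth_on_has_derivative[OF D(1,2) f(2)])
  note lin = has_derivative_linear[OF dD]
  obtain t :: "'n \<Rightarrow> real^'d" where t: "\<And>i j. t i \<bullet> t j = (if i = j then 1 else 0)"
    "\<And>i. t i \<in> range ?D" "\<And>w. w \<in> range ?D \<Longrightarrow> (\<And>i. w \<bullet> t i = 0) \<Longrightarrow> w = 0"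
    using orthonormal_frame[OF f] by blast
  define h :: "real^'n \<Rightarrow> real^'n" where "h x = (\<chi> i. (f x - f x0) \<bullet> t i)" for x
  have h0: "h x0 = 0" by (simp add: h_def vec_eq_iff)
  have smh: "smooth_on W h"
    unfolding h_def[abs_def] by (intro smooth_intros D(1,2))
  have dh: "(h has_derivative (\<lambda>v. \<chi> i. ?D v \<bullet> t i)) (at x0)"
    unfolding h_def[abs_def]
    by (rule has_derivative_componentwise_within[THEN iffD2])
      (auto simp: Basis_vec_def inner_axis intro!: derivative_eq_intros dD)
  have "inj (frechet_derivative h (at x0))"
    unfolding frechet_derivative_at[OF dh, symmetric]
  proof (rule injI)
    fix v w assume eq: "(\<chi> i. ?D v \<bullet> t i) = (\<chi> i. ?D w \<bullet> t i)"
    have "?D (v - w) = 0"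
    proof (rule t(3))
      show "?D (v - w) \<bullet> t i = 0" for i
        using eq by (simp add: linear_diff[OF lin] inner_diff_left vec_eq_iff)
    qed simp
    then have "?D v = ?D w" by (simp add: linear_diff[OF lin])
    then show "v = w" using D(3)[OF f(2)] by (simp add: inj_eq)
  qed
  then obtain V \<psi> where V: "open V" "0 \<in> V" "smooth_on V \<psi>" "\<psi> ` V \<subseteq> W" "\<psi> 0 = x0" "open (\<psi> ` V)"
    "homeomorphism V (\<psi> ` V) \<psi> h" "\<And>y. y \<in> V \<Longrightarrow> det (\<chi> a i. partial i \<psi> y $ a) \<noteq> 0"
    using smooth_local_inverse[OF D(1) smh f(2)] unfolding h0 by blast
  have h\<psi>: "h (\<psi> y) = y" if "y \<in> V" for y using V(7) that unfolding homeomorphism_def by auto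
  have sm: "smooth_on V (\<lambda>y. f (\<psi> y))"
    by (rule smooth_on_compose[OF V(1) D(1) V(3,4) D(2)])
  note dV = smooth_on_differentiable[OF V(1)]
  have pf: "partial i (\<lambda>y. f (\<psi> y)) y = frechet_derivative f (at (\<psi> y)) (partial i \<psi> y)" if "y \<in> V" for y i
  proof -
    have "\<psi> y \<in> W" using V(4) that by blast
    from has_derivative_compose[OF smooth_on_has_derivative[OF V(1,3) that] smooth_on_has_derivative[OF D(1,2) this]]
    show ?thesis by (subst partial_eqI) (auto simp: partial_def)
  qed
  have lp: "local_param M V (\<lambda>y. f (\<psi> y))"
    unfolding local_param_def
  proof (intro conjI ballI)
    have f': "local_param M (\<psi> ` V) f" by (rule local_param_subset[OF f(1) V(6,4)])
    show "openin (top_of_set M) ((\<lambda>y. f (\<psi> y)) ` V)"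
      using local_paramD(4)[OF f'] by (simp add: image_image)
    obtain g where "homeomorphism (\<psi> ` V) (f ` \<psi> ` V) f g" using f' unfolding local_param_def by blast
    from homeomorphism_compose[OF V(7) this]
    show "\<exists>g. homeomorphism V ((\<lambda>y. f (\<psi> y)) ` V) (\<lambda>y. f (\<psi> y)) g"
      unfolding comp_def image_image by blast
    fix y assume y: "y \<in> V"
    then have W: "\<psi> y \<in> W" using V(4) by blast
    have "frechet_derivative (\<lambda>y. f (\<psi> y)) (at y) = (\<lambda>v. frechet_derivative f (at (\<psi> y)) (frechet_derivative \<psi> (at y) v))"
      using frechet_derivative_at[OF has_derivative_compose[OF smooth_on_has_derivative[OF V(1,3) y] smooth_on_has_derivative[OF D(1,2) W]]]
      by simp
    moreover have "frechet_derivative \<psi> (at y) v = (\<chi> a i. partial i \<psi> y $ a) *v v" for v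
      unfolding fun_cong[OF frechet_eq_sum_partials[OF V(1,3) y]]
      by (simp add: vec_eq_iff matrix_vector_mult_def mult.commute)
    moreover have "inj (\<lambda>v. (\<chi> a i. partial i \<psi> y $ a) *v v)"
      using V(8)[OF y] by (metis inj_matrix_vector_mult invertible_det_nz)
    ultimately show "inj (frechet_derivative (\<lambda>y. f (\<psi> y)) (at y))"
      using D(3)[OF W] by (simp add: inj_def)
  qed (use V sm in auto)
  define \<Phi> where "\<Phi> y = f (\<psi> y) - f x0 - (\<Sum>i\<in>UNIV. y $ i *\<^sub>R t i)" for y
  have sm\<Phi>: "smooth_on V \<Phi>"
    unfolding \<Phi>_def[abs_def] by (intro smooth_intros sm V(1))
  have \<Phi>t: "\<Phi> y \<bullet> t i = 0" if "y \<in> V" for y i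
  proof -
    have "h (\<psi> y) $ i = y $ i" using h\<psi>[OF that] by simp
    then show ?thesis
      by (simp add: h_def \<Phi>_def inner_diff_left inner_sum_left t(1) if_distrib cong: if_cong)
  qed
  \<comment> \<open>The derivative of \<open>\<Phi>\<close> at the origin is a tangent vector, as a
    difference of tangent vectors, and it is orthogonal to the frame because \<open>\<Phi>\<close>
    is; hence it vanishes.\<close>
  have "partial i \<Phi> 0 = 0" for i
  proof (rule t(3))
    have "partial i \<Phi> 0 = partial i (\<lambda>y. f (\<psi> y)) 0 - (\<Sum>j\<in>UNIV. (axis i 1 :: real^'n) $ j *\<^sub>R t j)"
    proof -
      have "(\<Phi> has_derivative (\<lambda>v. frechet_derivative (\<lambda>y. f (\<psi> y)) (at 0) v - (\<Sum>j\<in>UNIV. v $ j *\<^sub>R t j))) (at 0)"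
        unfolding \<Phi>_def[abs_def]
        by (auto intro!: derivative_eq_intros smooth_on_has_derivative[OF V(1) sm V(2)]
            bounded_linear_imp_has_derivative[OF bounded_linear_vec_nth])
      from partial_eqI[OF this] show ?thesis by (simp add: partial_def)
    qed
    also have "(\<Sum>j\<in>UNIV. (axis i 1 :: real^'n) $ j *\<^sub>R t j) = t i"
      by (simp add: axis_def if_distrib[of "\<lambda>c. c *\<^sub>R _"] cong: if_cong)
    finally have eq: "partial i \<Phi> 0 = partial i (\<lambda>y. f (\<psi> y)) 0 - t i" .
    show "partial i \<Phi> 0 \<in> range ?D"
      unfolding eq pf[OF V(2)] V(5)
      by (rule subspace_diff[OF linear_subspace_image[OF lin subspace_UNIV]]) (use t(2) in auto)
    fix j
    have "partial i (\<lambda>y. \<Phi> y \<bullet> t j) 0 = partial i (\<lambda>y. 0) (0::real^'n)"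
      by (rule partial_cong[OF V(1,2) \<Phi>t])
    moreover have "partial i (\<lambda>y. \<Phi> y \<bullet> t j) 0 = partial i \<Phi> 0 \<bullet> t j"
      by (rule partial_linear[OF bounded_linear_inner_left dV[OF sm\<Phi> V(2)]])
    ultimately show "partial i \<Phi> 0 \<bullet> t j = 0" by simp
  qed
  moreover have "\<Phi> 0 = 0" by (simp add: \<Phi>_def V(5))
  moreover have "f (\<psi> y) = f x0 + (\<Sum>i\<in>UNIV. y $ i *\<^sub>R t i) + \<Phi> y" for y by (simp add: \<Phi>_def)
  ultimately show thesis
    by (intro that[OF V(1-5,8) lp t(1,2) sm\<Phi> _ _ \<Phi>t]) auto
qed

lemma norm_graph:
  fixes t :: "'n::finite \<Rightarrow> real^'d" and y :: "real^'n"
  assumes "\<And>i j. t i \<bullet> t j = (if i = j then 1 else 0)" "\<And>i. w \<bullet> t i = 0"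
  shows "(norm ((\<Sum>i\<in>UNIV. y $ i *\<^sub>R t i) + w))\<^sup>2 = (norm y)\<^sup>2 + (norm w)\<^sup>2"
proof -
  have "(\<Sum>i\<in>UNIV. y $ i *\<^sub>R t i) \<bullet> t j = y $ j" for j
    by (simp add: inner_sum_left assms(1) if_distrib cong: if_cong)
  then have "(\<Sum>i\<in>UNIV. y $ i *\<^sub>R t i) \<bullet> (\<Sum>i\<in>UNIV. y $ i *\<^sub>R t i) = y \<bullet> y"
    by (simp add: inner_sum_right inner_vec_def[of y y])
  moreover have "w \<bullet> (\<Sum>i\<in>UNIV. y $ i *\<^sub>R t i) = 0" by (simp add: inner_sum_right assms(2))
  ultimately show ?thesis
    unfolding power2_norm_eq_inner by (simp add: inner_add_left inner_add_right inner_commute)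
qed

lemma smooth_on_quadratic_bound:
  fixes E :: "real^'n \<Rightarrow> real"
  assumes "open S" "smooth_on S E" "cball 0 r \<subseteq> S" "r > 0" "E 0 = 0" "\<And>i. partial i E 0 = 0"
  shows "\<exists>C. \<forall>y\<in>cball 0 r. \<bar>E y\<bar> \<le> C * norm y ^ 2"
proof -
  have "0 \<in> S" using assms(3,4) by auto
  have 0: "dir_deriv q E 0 y = 0" if "q < 2" for q y
    using that assms(5,6) by (auto simp: less_2_cases_iff numeral_2_eq_2 less_Suc_eq)
  have "(\<Sum>q<2. dir_deriv q E 0 y / fact q) = 0" for y by (rule sum.neutral) (simp add: 0)
  then show ?thesis using taylor_bound[OF assms(1,2,3), of 2] by auto
qed

section \<open>Hypersurfaces as graphs of a function\<close>

text \<open>Rotating \<open>v\<close> onto a coordinate axis turns the matrix into a diagonal one in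
  which at most one entry differs from 1.\<close>

lemma det_mat_1_plus_outer:
  fixes v :: "real^'n"
  shows "det (\<chi> i j. of_bool (i = j) + v $ i * v $ j) = 1 + (norm v)\<^sup>2"
proof -
  obtain k :: 'n where True by simp
  let ?A = "(\<chi> i j. of_bool (i = j) + v $ i * v $ j) :: real^'n^'n"
  let ?D = "(\<chi> i j. if i = j then (if i = k then 1 + (norm v)\<^sup>2 else 1) else 0) :: real^'n^'n"
  obtain T where T: "orthogonal_transformation T" "T v = axis k (norm v)"
    using orthogonal_transformation_exists[of v "axis k (norm v)"] by (auto simp: norm_eq_sqrt_inner inner_axis_axis)
  define Q where "Q = matrix T"
  have linT: "linear T" using T(1) orthogonal_transformation_linear by blast
  have Q: "Q *v x = T x" for x unfolding Q_def by (simp add: matrix_works linT)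
  have A: "?A *v x = x + (v \<bullet> x) *\<^sub>R v" for x
    by (simp add: vec_eq_iff matrix_vector_mult_def algebra_simps sum.distrib inner_vec_def sum_distrib_left)
  have D: "?D *v x = x + ((norm v)\<^sup>2 * x $ k) *\<^sub>R axis k 1" for x
  proof -
    have "(?D *v x) $ i = (if i = k then 1 + (norm v)\<^sup>2 else 1) * x $ i" for i
      by (simp add: matrix_vector_mult_def if_distrib[of "\<lambda>c. c * _"] cong: if_cong)
    then show ?thesis by (simp add: vec_eq_iff axis_def distrib_right)
  qed
  have "Q ** ?A = ?D ** Q"
  proof (rule matrix_eq[THEN iffD2], rule allI)
    fix x
    have "v \<bullet> x = T v \<bullet> T x" using T(1) unfolding orthogonal_transformation_def by simp
    also have "\<dots> = norm v * T x $ k" by (simp add: T(2) inner_axis')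
    finally have "T (x + (v \<bullet> x) *\<^sub>R v) = T x + (norm v * T x $ k) *\<^sub>R axis k (norm v)"
      by (simp add: linear_add[OF linT] linear_cmul[OF linT] T(2))
    also have "\<dots> = T x + ((norm v)\<^sup>2 * T x $ k) *\<^sub>R axis k 1"
      by (simp add: vec_eq_iff axis_def power2_eq_square)
    finally show "Q ** ?A *v x = ?D ** Q *v x"
      by (simp only: matrix_vector_mul_assoc[symmetric] A D Q)
  qed
  from arg_cong[OF this, of det] have "det Q * det ?A = det ?D * det Q" by (simp only: det_mul)
  moreover have "det Q \<noteq> 0"
    using T(1) unfolding orthogonal_transformation_matrix Q_def
    using det_orthogonal_matrix by fastforce
  moreover have "det ?D = 1 + (norm v)\<^sup>2"
    by (subst det_diagonal) (simp_all add: prod.If_cases[where P = "\<lambda>i. i = k"])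
  ultimately show ?thesis by simp
qed

text \<open>By dimension count the frame together with \<open>\<nu>\<close> spans the whole space,
  so a vector orthogonal to the frame is its own projection to \<open>\<nu>\<close>. This is where
  codimension one enters.\<close>

lemma orthonormal_hyperplane_complement:
  fixes t :: "'n::finite \<Rightarrow> real^'d"
  assumes card: "CARD('d) = CARD('n) + 1" and t: "\<And>i j. t i \<bullet> t j = (if i = j then 1 else 0)"
    and \<nu>: "norm \<nu> = 1" "\<And>i. \<nu> \<bullet> t i = 0" and w: "\<And>i. w \<bullet> t i = 0"
  shows "w = (w \<bullet> \<nu>) *\<^sub>R \<nu>"
proof -
  let ?B = "insert \<nu> (range t)"
  have \<nu>\<nu>: "\<nu> \<bullet> \<nu> = 1" using \<nu>(1) by (simp add: norm_eq_1)
  have notin: "\<nu> \<notin> range t" using \<nu>\<nu> \<nu>(2) by (metis imageE zero_neq_one)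
  have inj: "inj t" by (rule injI) (metis t zero_neq_one)
  have c: "card ?B = CARD('d)" using notin card by (simp add: card_image[OF inj])
  have "pairwise orthogonal ?B"
    unfolding pairwise_def orthogonal_def using t \<nu>(2) by (auto simp: inner_commute)
  moreover have "0 \<notin> ?B" using t \<nu>\<nu> by (metis (no_types, lifting) imageE inner_zero_left insertE zero_neq_one)
  ultimately have "independent ?B" by (rule pairwise_orthogonal_independent)
  then have "span ?B = UNIV"
    using card_ge_dim_independent[of ?B UNIV] c by auto
  then have "w - (w \<bullet> \<nu>) *\<^sub>R \<nu> \<in> span ?B" by simp
  moreover have "orthogonal (w - (w \<bullet> \<nu>) *\<^sub>R \<nu>) b" if "b \<in> ?B" for b
    using that w \<nu>(2) \<nu>\<nu> by (auto simp: orthogonal_def inner_diff_left)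
  ultimately have "orthogonal (w - (w \<bullet> \<nu>) *\<^sub>R \<nu>) (w - (w \<bullet> \<nu>) *\<^sub>R \<nu>)"
    using orthogonal_to_span by blast
  then show ?thesis by (simp add: orthogonal_def)
qed

text \<open>The height \<open>\<phi>\<close> is measured along the prescribed normal at
  \<open>x0\<close>, so its Hessian has the sign of the given second fundamental form.
  \<open>\<omega>\<close> is the component of the moving normal along that fixed direction; it is 1
  at the origin, and shrinking to \<open>V\<close> keeps it positive.\<close>

lemma hypersurface_graph_chart:
  fixes f :: "real^'n \<Rightarrow> real^'d"
  assumes card: "CARD('d) = CARD('n) + 1"
    and f: "local_param M W f" "x0 \<in> W" and \<nu>: "unit_normal W f \<nu>"
  obtains V \<psi> and \<phi> \<omega> :: "real^'n \<Rightarrow> real" where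
    "open V" "0 \<in> V" "smooth_on V \<psi>" "\<psi> ` V \<subseteq> W" "\<psi> 0 = x0"
    "\<And>y. y \<in> V \<Longrightarrow> det (\<chi> a i. partial i \<psi> y $ a) \<noteq> 0"
    "local_param M V (\<lambda>y. f (\<psi> y))"
    "smooth_on V \<phi>" "\<phi> 0 = 0" "\<And>i. partial i \<phi> 0 = 0"
    "smooth_on V \<omega>" "\<And>y. y \<in> V \<Longrightarrow> \<omega> y > 0"
    "\<And>y. y \<in> V \<Longrightarrow> (\<omega> y)\<^sup>2 * (1 + (\<Sum>a\<in>UNIV. (partial a \<phi> y)\<^sup>2)) = 1"
    "\<And>y. y \<in> V \<Longrightarrow> (norm (f (\<psi> y) - f x0))\<^sup>2 = (norm y)\<^sup>2 + (\<phi> y)\<^sup>2"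
    "\<And>y i j. y \<in> V \<Longrightarrow> first_form (\<lambda>y. f (\<psi> y)) y $ i $ j = of_bool (i = j) + partial i \<phi> y * partial j \<phi> y"
    "\<And>y i j. y \<in> V \<Longrightarrow> second_form (\<lambda>y. f (\<psi> y)) (\<lambda>y. \<nu> (\<psi> y)) [i, j] y = \<omega> y * partial i (partial j \<phi>) y"
proof -
  note D = local_paramD[OF f(1)]
  obtain V1 \<psi> and t :: "'n \<Rightarrow> real^'d" and \<Phi> where V1:
    "open V1" "0 \<in> V1" "smooth_on V1 \<psi>" "\<psi> ` V1 \<subseteq> W" "\<psi> 0 = x0"
    "\<And>y. y \<in> V1 \<Longrightarrow> det (\<chi> a i. partial i \<psi> y $ a) \<noteq> 0"
    "local_param M V1 (\<lambda>y. f (\<psi> y))"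
    and t: "\<And>i j. t i \<bullet> t j = (if i = j then 1 else 0)"
    "\<And>i. t i \<in> range (frechet_derivative f (at x0))"
    and \<Phi>: "smooth_on V1 \<Phi>" "\<Phi> 0 = 0" "\<And>i. partial i \<Phi> 0 = 0"
    "\<And>y i. y \<in> V1 \<Longrightarrow> \<Phi> y \<bullet> t i = 0"
    "\<And>y. y \<in> V1 \<Longrightarrow> f (\<psi> y) = f x0 + (\<Sum>i\<in>UNIV. y $ i *\<^sub>R t i) + \<Phi> y"
    using graph_chart[OF f] by blast
  define \<nu>0 where "\<nu>0 = \<nu> x0"
  define g where "g y = f (\<psi> y)" for y
  define N where "N y = \<nu> (\<psi> y)" for y
  define \<phi> where "\<phi> y = \<Phi> y \<bullet> \<nu>0" for y
  define \<omega> where "\<omega> y = N y \<bullet> \<nu>0" for y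
  have \<nu>D: "smooth_on W \<nu>" "\<And>x. x \<in> W \<Longrightarrow> norm (\<nu> x) = 1" "\<And>x i. x \<in> W \<Longrightarrow> \<nu> x \<bullet> partial i f x = 0"
    using \<nu> unfolding unit_normal_def by auto
  have n0: "norm \<nu>0 = 1" unfolding \<nu>0_def by (rule \<nu>D(2)[OF f(2)])
  then have n00: "\<nu>0 \<bullet> \<nu>0 = 1" by (simp add: norm_eq_1)
  have \<nu>t: "\<nu>0 \<bullet> t i = 0" for i
  proof -
    obtain h where "t i = frechet_derivative f (at x0) h" using t(2) by blast
    then have "t i = (\<Sum>k\<in>UNIV. h $ k *\<^sub>R partial k f x0)"
      unfolding fun_cong[OF frechet_eq_sum_partials[OF D(1,2) f(2)]] .
    then show ?thesis by (simp add: inner_sum_right \<nu>0_def \<nu>D(3)[OF f(2)])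
  qed
  note compl = orthonormal_hyperplane_complement[OF card t(1) n0 \<nu>t]
  have \<Phi>\<phi>: "\<Phi> y = \<phi> y *\<^sub>R \<nu>0" if "y \<in> V1" for y
    unfolding \<phi>_def by (rule compl[OF \<Phi>(4)[OF that]])
  have sm\<phi>: "smooth_on V1 \<phi>" unfolding \<phi>_def[abs_def] by (intro smooth_intros V1(1) \<Phi>(1))
  note diff = smooth_on_differentiable[OF V1(1)]
  have p\<phi>: "partial i \<phi> 0 = 0" for i
    unfolding \<phi>_def[abs_def] using partial_linear[OF bounded_linear_inner_left[of \<nu>0] diff[OF \<Phi>(1) V1(2)], of i] \<Phi>(3) by simp
  have smN: "smooth_on V1 N"
    unfolding N_def[abs_def] by (rule smooth_on_compose[OF V1(1) D(1) V1(3,4) \<nu>D(1)])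
  have smg: "smooth_on V1 g"
    unfolding g_def[abs_def] by (rule smooth_on_compose[OF V1(1) D(1) V1(3,4) D(2)])
  have sm\<omega>: "smooth_on V1 \<omega>" unfolding \<omega>_def[abs_def] by (intro smooth_intros V1(1) smN)
  have pg: "partial i g y = t i + partial i \<phi> y *\<^sub>R \<nu>0" if "y \<in> V1" for i y
  proof -
    have "partial i g y = partial i (\<lambda>y. f x0 + (\<Sum>i\<in>UNIV. y $ i *\<^sub>R t i) + \<phi> y *\<^sub>R \<nu>0) y"
      by (rule partial_cong[OF V1(1) that]) (simp add: g_def \<Phi>(5) \<Phi>\<phi>)
    also have "\<dots> = (\<Sum>j\<in>UNIV. (axis i 1 :: real^'n) $ j *\<^sub>R t j) + partial i \<phi> y *\<^sub>R \<nu>0"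
    proof -
      have "((\<lambda>y. f x0 + (\<Sum>i\<in>UNIV. y $ i *\<^sub>R t i) + \<phi> y *\<^sub>R \<nu>0) has_derivative
          (\<lambda>v. (\<Sum>j\<in>UNIV. v $ j *\<^sub>R t j) + frechet_derivative \<phi> (at y) v *\<^sub>R \<nu>0)) (at y)"
        by (auto intro!: derivative_eq_intros smooth_on_has_derivative[OF V1(1) sm\<phi> that]
            bounded_linear_imp_has_derivative[OF bounded_linear_vec_nth])
      from partial_eqI[OF this] show ?thesis by (simp add: partial_def)
    qed
    also have "(\<Sum>j\<in>UNIV. (axis i 1 :: real^'n) $ j *\<^sub>R t j) = t i"
      by (simp add: axis_def if_distrib[of "\<lambda>c. c *\<^sub>R _"] cong: if_cong)
    finally show ?thesis .
  qed
  have Ng: "N y \<bullet> partial i g y = 0" if y: "y \<in> V1" for y i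
  proof -
    have W: "\<psi> y \<in> W" using V1(4) y by blast
    have "partial i g y = (\<Sum>a\<in>UNIV. partial i \<psi> y $ a *\<^sub>R partial a f (\<psi> y))"
      unfolding g_def by (rule partial_compose[OF smooth_on_differentiable[OF D(1,2) W] diff[OF V1(3) y]])
    then show ?thesis by (simp add: N_def inner_sum_right \<nu>D(3)[OF W])
  qed
  have Nt: "N y \<bullet> t i = - partial i \<phi> y * \<omega> y" if "y \<in> V1" for y i
    using Ng[OF that, of i] unfolding pg[OF that] by (simp add: inner_add_right \<omega>_def)
  \<comment> \<open>Decompose the unit normal \<open>N y\<close> along the frame and
    \<open>\<nu>0\<close>: orthogonality to the tangent vectors gives the frame coefficients as
    \<open>- partial i \<phi> y * \<omega> y\<close>, and length one gives the identity.\<close>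
  have \<omega>2: "(\<omega> y)\<^sup>2 * (1 + (\<Sum>a\<in>UNIV. (partial a \<phi> y)\<^sup>2)) = 1" if y: "y \<in> V1" for y
  proof -
    define w where "w = N y - (\<Sum>i\<in>UNIV. (N y \<bullet> t i) *\<^sub>R t i)"
    have wt: "w \<bullet> t i = 0" for i
      by (simp add: w_def inner_diff_left inner_sum_left t(1) if_distrib cong: if_cong)
    have "(\<Sum>i\<in>UNIV. (N y \<bullet> t i) *\<^sub>R t i) \<bullet> \<nu>0 = 0" using \<nu>t by (simp add: inner_sum_right inner_commute[of _ \<nu>0])
    then have "w \<bullet> \<nu>0 = \<omega> y" by (simp add: w_def inner_diff_left \<omega>_def)
    then have weq: "w = \<omega> y *\<^sub>R \<nu>0" using compl[OF wt] by simp
    define z :: "real^'n" where "z = (\<chi> i. N y \<bullet> t i)"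
    have "N y = (\<Sum>i\<in>UNIV. z $ i *\<^sub>R t i) + w" by (simp add: w_def z_def)
    then have "(norm (N y))\<^sup>2 = (norm z)\<^sup>2 + (norm w)\<^sup>2" using norm_graph[OF t(1) wt, of z] by simp
    moreover have "norm (N y) = 1" unfolding N_def using V1(4) y by (intro \<nu>D(2)) blast
    moreover have "(norm z)\<^sup>2 = (\<omega> y)\<^sup>2 * (\<Sum>a\<in>UNIV. (partial a \<phi> y)\<^sup>2)"
      unfolding power2_norm_eq_inner unfolding inner_vec_def[of z z]
      by (simp add: z_def Nt[OF y] sum_distrib_left power2_eq_square algebra_simps)
    moreover have "(norm w)\<^sup>2 = (\<omega> y)\<^sup>2" by (simp add: weq n0)
    ultimately show ?thesis by (simp add: algebra_simps)
  qed
  define V where "V = {y \<in> V1. \<omega> y > 0}"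
  have "open V" unfolding V_def using continuous_open_preimage[OF smooth_on_continuous[OF sm\<omega>] V1(1), of "{0<..}"]
    by (simp add: vimage_def Int_def)
  have sub: "V \<subseteq> V1" unfolding V_def by blast
  have "\<omega> 0 = 1" by (simp add: \<omega>_def N_def V1(5) \<nu>0_def[symmetric] n00)
  then have "0 \<in> V" using V1(2) by (simp add: V_def)
  show thesis
  proof (rule that[OF \<open>open V\<close> \<open>0 \<in> V\<close>])
    show "smooth_on V \<psi>" "smooth_on V \<phi>" "smooth_on V \<omega>"
      by (rule smooth_on_subset[OF V1(1) \<open>open V\<close> sub]; fact)+
    show "\<psi> ` V \<subseteq> W" "\<psi> 0 = x0" "\<And>y. y \<in> V \<Longrightarrow> det (\<chi> a i. partial i \<psi> y $ a) \<noteq> 0"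
      "\<And>y. y \<in> V \<Longrightarrow> \<omega> y > 0"
      using V1 sub unfolding V_def by auto
    show "local_param M V (\<lambda>y. f (\<psi> y))" by (rule local_param_subset[OF V1(7) \<open>open V\<close> sub])
    show "\<phi> 0 = 0" by (simp add: \<phi>_def \<Phi>(2))
    show "partial i \<phi> 0 = 0" for i by (rule p\<phi>)
    fix y assume "y \<in> V"
    then have y: "y \<in> V1" using sub by blast
    show "(\<omega> y)\<^sup>2 * (1 + (\<Sum>a\<in>UNIV. (partial a \<phi> y)\<^sup>2)) = 1" by (rule \<omega>2[OF y])
    have "f (\<psi> y) - f x0 = (\<Sum>i\<in>UNIV. y $ i *\<^sub>R t i) + \<Phi> y" using \<Phi>(5)[OF y] by simp
    then show "(norm (f (\<psi> y) - f x0))\<^sup>2 = (norm y)\<^sup>2 + (\<phi> y)\<^sup>2"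
      using norm_graph[OF t(1) \<Phi>(4)[OF y], of y] by (simp add: \<Phi>\<phi>[OF y] n0)
    show "first_form (\<lambda>y. f (\<psi> y)) y $ i $ j = of_bool (i = j) + partial i \<phi> y * partial j \<phi> y" for i j
      unfolding g_def[abs_def, symmetric] first_form_def vec_lambda_beta pg[OF y]
      using \<nu>t by (simp add: inner_add_left inner_add_right t(1) n00 inner_commute)
    show "second_form (\<lambda>y. f (\<psi> y)) (\<lambda>y. \<nu> (\<psi> y)) [i, j] y = \<omega> y * partial i (partial j \<phi>) y" for i j
    proof -
      have "partial i (partial j g) y = partial i (\<lambda>y. t j + partial j \<phi> y *\<^sub>R \<nu>0) y"
        by (rule partial_cong[OF V1(1) y pg])
      also have "\<dots> = partial i (partial j \<phi>) y *\<^sub>R \<nu>0"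
        using diff[OF smooth_on_partial[OF sm\<phi>] y]
        by (subst partial_add) (auto simp: partial_scaleR)
      finally show ?thesis
        unfolding second_form_eq g_def[abs_def, symmetric] N_def[abs_def, symmetric]
        by (simp add: \<omega>_def inner_commute)
    qed
  qed
qed

section \<open>Meromorphic continuation\<close>

text \<open>Taylor's theorem for \<open>(1 + x) powr w\<close> on the real segment from 0 to 1/2.
  There \<open>1 + x\<close> lies between 1 and 3/2, so lowering the exponent never increases the
  modulus; this makes the bound uniform over all \<open>w\<close> of modulus at most
  \<open>m\<close>, as domination in \<open>s\<close> requires.\<close>

lemma binomial_remainder:
  fixes z m :: real and w :: complex
  assumes z: "0 \<le> z" "z \<le> 1/2" and w: "norm w \<le> m"
  shows "norm (complex_of_real (1 + z) powr w - (\<Sum>l<K. (w gchoose l) * complex_of_real z ^ l))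
    \<le> (\<Prod>k<K. m + real k) * (3/2) powr m * z ^ K"
proof -
  have m: "m \<ge> 0" using w norm_ge_zero order_trans by blast
  have pb: "norm ((1 + complex_of_real x) powr (w - of_nat k)) \<le> (3/2) powr m" if "0 \<le> x" "x \<le> 1/2" for x k
  proof -
    have "norm ((1 + complex_of_real x) powr (w - of_nat k)) = (1 + x) powr (Re w - real k)"
      using norm_powr_real_powr[of "complex_of_real (1 + x)" "w - of_nat k"] that by simp
    also have "\<dots> \<le> (1 + x) powr m"
      using that w complex_Re_le_cmod[of w] by (intro powr_mono) auto
    also have "\<dots> \<le> (3/2) powr m" using that m by (intro powr_mono2) auto
    finally show ?thesis .
  qed
  have prodb: "norm (\<Prod>k<K. w - of_nat k) \<le> (\<Prod>k<K. m + real k)" for K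
    unfolding prod_norm[symmetric]
    by (rule prod_mono) (use w norm_triangle_ineq4[of w] in \<open>fastforce intro: order_trans\<close>)
  show ?thesis
  proof (cases K)
    case 0
    then show ?thesis using pb[OF z, of 0] by simp
  next
    case (Suc n)
    define f where "f i x = (\<Prod>k<i. w - of_nat k) * (1 + x) powr (w - of_nat i)" for i :: nat and x :: complex
    let ?S = "complex_of_real ` {0..1/2}"
    have conv: "convex ?S"
      by (rule convex_linear_image) (auto simp: bounded_linear.linear[OF bounded_linear_of_real])
    have "norm (f 0 (of_real z) - (\<Sum>i\<le>n. f i 0 * (of_real z - 0) ^ i / fact i))
        \<le> ((\<Prod>k<Suc n. m + real k) * (3/2) powr m) * norm (of_real z - 0 :: complex) ^ Suc n / fact n"
    proof (rule complex_Taylor[OF conv])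
      fix i x assume x: "x \<in> ?S"
      have "1 + x \<notin> \<real>\<^sub>\<le>\<^sub>0" using x by (auto simp: complex_nonpos_Reals_iff)
      then have "((\<lambda>x. (1 + x) powr (w - of_nat i)) has_field_derivative (w - of_nat i) * (1 + x) powr (w - of_nat i - 1)) (at x within ?S)"
        by (auto intro!: derivative_eq_intros)
      from DERIV_cmult[OF this, of "\<Prod>k<i. w - of_nat k"]
      show "(f i has_field_derivative f (Suc i) x) (at x within ?S)"
        unfolding f_def[abs_def] by (simp add: algebra_simps)
    next
      fix x assume "x \<in> ?S"
      then obtain y where y: "x = of_real y" "0 \<le> y" "y \<le> 1/2" by auto
      show "norm (f (Suc n) x) \<le> (\<Prod>k<Suc n. m + real k) * (3/2) powr m"
        unfolding f_def norm_mult y(1)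
        by (rule mult_mono[OF prodb pb[OF y(2,3)]]) (use m in \<open>auto intro!: mult_nonneg_nonneg prod_nonneg add_nonneg_nonneg\<close>)
    qed (use z in \<open>auto intro: rev_image_eqI[of 0]\<close>)
    also have "\<dots> \<le> ((\<Prod>k<Suc n. m + real k) * (3/2) powr m) * z ^ Suc n"
    proof -
      have "((\<Prod>k<Suc n. m + real k) * (3/2) powr m) * z ^ Suc n / fact n \<le> ((\<Prod>k<Suc n. m + real k) * (3/2) powr m) * z ^ Suc n / 1"
        by (rule divide_left_mono) (use m z in \<open>auto intro!: mult_nonneg_nonneg prod_nonneg add_nonneg_nonneg simp: fact_ge_1\<close>)
      then show ?thesis using z by simp
    qed
    also have "f 0 (of_real z) = complex_of_real (1 + z) powr w" by (simp add: f_def)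
    also have "(\<Sum>i\<le>n. f i 0 * (of_real z - 0) ^ i / fact i) = (\<Sum>l<K. (w gchoose l) * of_real z ^ l)"
      unfolding Suc lessThan_Suc_atMost
      by (rule sum.cong) (simp_all add: f_def gbinomial_prod_rev atLeast0LessThan)
    finally show ?thesis unfolding Suc .
  qed
qed

lemma of_real_sqrt_powr:
  assumes "r > 0" "z \<ge> 0"
  shows "complex_of_real (sqrt (r\<^sup>2 * (1 + z))) powr s = complex_of_real r powr s * complex_of_real (1 + z) powr (s / 2)"
proof -
  have "ln (sqrt (r\<^sup>2 * (1 + z))) = ln r + ln (1 + z) / 2"
    using assms by (simp add: ln_sqrt ln_mult ln_realpow)
  then have "complex_of_real (ln (sqrt (r\<^sup>2 * (1 + z)))) = of_real (ln r) + of_real (ln (1 + z)) / 2"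
    by simp
  moreover have X: "complex_of_real x powr t = exp (t * of_real (ln x))" if "x > 0" for x t
    using that by (simp add: powr_def Ln_of_real)
  moreover have "sqrt (r\<^sup>2 * (1 + z)) > 0" "1 + z > 0" using assms by auto
  ultimately show ?thesis
    unfolding X[OF \<open>sqrt (r\<^sup>2 * (1 + z)) > 0\<close>] X[OF \<open>1 + z > 0\<close>] X[OF assms(1)] exp_add[symmetric]
    by (simp only:) (simp add: algebra_simps)
qed

lemma norm_of_real_powr_le:
  assumes "0 \<le> r" "r \<le> 1" "\<sigma> \<le> Re s"
  shows "norm (complex_of_real r powr s) \<le> r powr \<sigma>"
proof (cases "r = 0")
  case False
  then have "norm (complex_of_real r powr s) = r powr Re s"
    using assms norm_powr_real_powr[of "complex_of_real r" s] by simp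
  also have "\<dots> \<le> r powr \<sigma>" using assms by (intro powr_mono') auto
  finally show ?thesis .
qed simp

text \<open>\<open>q\<close> is the normal contribution to the squared distance and \<open>a\<close>
  the area density. The bound by half of the squared norm keeps the binomial variable between 0 and
  1/2, and \<open>R \<le> 1\<close> makes powers of the norm decrease with the exponent.\<close>

locale radial_perturbation =
  fixes V :: "(real^'n) set" and q a :: "real^'n \<Rightarrow> real" and R C :: real
  assumes V: "open V" and sm: "smooth_on V q" "smooth_on V a" and R: "0 < R" "R \<le> 1" "cball 0 R \<subseteq> V"
    and q: "\<And>y. y \<in> cball 0 R \<Longrightarrow> 0 \<le> q y" "\<And>y. y \<in> cball 0 R \<Longrightarrow> q y \<le> C * norm y ^ 4"
      "\<And>y. y \<in> cball 0 R \<Longrightarrow> q y \<le> (norm y)\<^sup>2 / 2"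
begin

definition E where "E l y = q y ^ l * a y"
definition P where "P l p y = dir_deriv p (E l) 0 y / fact p"
definition \<rho> where "\<rho> K w z = complex_of_real (1 + z) powr w - (\<Sum>l<K. (w gchoose l) * complex_of_real z ^ l)"
text \<open>The error of the binomial series cut at \<open>K\<close> terms plus, in each retained
  term, a Taylor error. The \<open>l\<close>-th coefficient function is expanded below degree
  \<open>K + 2 * l\<close>, which compensates the exponent \<open>s - 2 * l\<close>; all errors are
  then of the order of the norm to the power \<open>Re s + K\<close>.\<close>

definition rem where "rem K s y = indicator (cball 0 R) y *\<^sub>R
  (complex_of_real (a y) * complex_of_real (norm y) powr s * \<rho> K (s / 2) (q y / (norm y)\<^sup>2)
   + (\<Sum>l<K. (s / 2 gchoose l) * (complex_of_real (norm y) powr (s - 2 * of_nat l)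
        * complex_of_real (E l y - (\<Sum>p<K + 2 * l. P l p y)))))"
text \<open>A polynomial of degree \<open>j + 2 * l\<close> against the exponent
  \<open>s - 2 * l\<close> has total degree \<open>s + j\<close> for every \<open>l\<close>, so
  these terms share the pole at \<open>-n - j\<close>. Summands with \<open>2 * l > j\<close> vanish
  by \<open>P_zero\<close>; \<open>l \<le> j\<close> is a convenient finite range.\<close>

definition coeff where "coeff j s = (\<Sum>l\<le>j. (s / 2 gchoose l) *
  complex_of_real (sphere_integral (j + 2 * l) (dir_deriv (j + 2 * l) (E l) 0) / fact (j + 2 * l)))"

lemma smooth_E: "smooth_on V (E l)"
  unfolding E_def[abs_def] by (intro smooth_intros V sm)

lemma a_bounded: "\<exists>A\<ge>0. \<forall>y\<in>cball 0 R. \<bar>a y\<bar> \<le> A"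
proof -
  have "bounded (a ` cball 0 R)"
    by (intro compact_imp_bounded compact_continuous_image compact_cball
        continuous_on_subset[OF smooth_on_continuous[OF sm(2)] R(3)])
  then obtain A where "\<forall>x\<in>a ` cball 0 R. norm x \<le> A" unfolding bounded_iff by blast
  then have A: "\<bar>a y\<bar> \<le> A" if "y \<in> cball 0 R" for y using that by (simp del: mem_cball)
  moreover have "A \<ge> 0" using A[of 0] R by simp
  ultimately show ?thesis by blast
qed

lemma P_zero: "p < 4 * l \<Longrightarrow> P l p y = 0"
proof -
  assume p: "p < 4 * l"
  obtain A where A: "\<And>y. y \<in> cball 0 R \<Longrightarrow> \<bar>a y\<bar> \<le> A" using a_bounded by blast
  have "\<bar>E l y\<bar> \<le> (C ^ l * A) * norm y ^ (4 * l)" if y: "y \<in> cball 0 R" for y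
  proof -
    have "\<bar>E l y\<bar> = q y ^ l * \<bar>a y\<bar>" using q(1)[OF y] by (simp add: E_def abs_mult)
    also have "\<dots> \<le> (C * norm y ^ 4) ^ l * A"
      by (rule mult_mono[OF power_mono[OF q(2)[OF y] q(1)[OF y]] A[OF y]])
        (use order_trans[OF q(1)[OF y] q(2)[OF y]] in auto)
    finally show ?thesis by (simp only: power_mult_distrib power_mult[symmetric]) (simp add: mult.commute mult.left_commute)
  qed
  from dir_deriv_vanishing_order[OF V smooth_E R(3,1) this p] show ?thesis unfolding P_def by simp
qed

lemma sphere_integral_P:
  "sphere_integral p (P l p) = sphere_integral p (dir_deriv p (E l) 0) / fact p"
  unfolding P_def[abs_def] using sphere_integral_cmult[of p "1 / fact p" "dir_deriv p (E l) 0"] by simp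

text \<open>The added summands vanish by \<open>P_zero\<close>, so the range of \<open>l\<close> can
  be made independent of \<open>j\<close>, as the double sum in the expansion requires.\<close>

lemma coeff_alt:
  assumes "j < K"
  shows "coeff j s = (\<Sum>l<K. (s / 2 gchoose l) * complex_of_real (sphere_integral (j + 2 * l) (P l (j + 2 * l))))"
  unfolding coeff_def sphere_integral_P[symmetric]
proof (rule sum.mono_neutral_left)
  show "\<forall>l\<in>{..<K} - {..j}. (s / 2 gchoose l) * complex_of_real (sphere_integral (j + 2 * l) (P l (j + 2 * l))) = 0"
  proof
    fix l assume "l \<in> {..<K} - {..j}"
    then have "P l (j + 2 * l) = (\<lambda>_. 0)" by (intro ext P_zero) auto
    then show "(s / 2 gchoose l) * complex_of_real (sphere_integral (j + 2 * l) (P l (j + 2 * l))) = 0"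
      by (simp add: sphere_integral_def)
  qed
qed (use assms in auto)

lemma coeff_holomorphic: "coeff j holomorphic_on UNIV"
  unfolding coeff_def[abs_def] gbinomial_prod_rev by (intro holomorphic_intros) auto

lemma coeff_odd: "odd j \<Longrightarrow> coeff j s = 0"
  unfolding coeff_def by (rule sum.neutral) (simp add: sphere_integral_dir_deriv_odd)

text \<open>With \<open>z = q y / (norm y)\<^sup>2\<close> the squared distance is the squared norm
  times \<open>1 + z\<close>, and the binomial series in \<open>z\<close> separates radial powers
  from the functions \<open>E l\<close>. At the origin both sides vanish by the convention
  \<open>0 powr s = 0\<close>.\<close>

lemma expansion:
  assumes y: "y \<in> cball 0 R"
  shows "a y *\<^sub>R complex_of_real (sqrt ((norm y)\<^sup>2 + q y)) powr s = rem K s y +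
    (\<Sum>j<K. \<Sum>l<K. (s / 2 gchoose l) * (P l (j + 2 * l) y *\<^sub>R complex_of_real (norm y) powr (s - 2 * of_nat l)))"
proof (cases "y = 0")
  case True
  have "q 0 = 0" using q(1,3)[OF y] True by simp
  then show ?thesis using True by (simp add: rem_def)
next
  case False
  define r where "r = norm y"
  define z where "z = q y / r\<^sup>2"
  have r: "r > 0" and z: "z \<ge> 0" using False q(1)[OF y] by (auto simp: r_def z_def)
  have qz: "q y = r\<^sup>2 * z" using r by (simp add: z_def)
  \<comment> \<open>Degrees below \<open>2 * l\<close> are absent since \<open>E l\<close> vanishes
    to order \<open>4 * l\<close>; reindexing by \<open>j\<close> aligns the terms that share a
    pole.\<close>
  have sp: "(\<Sum>p<K + 2 * l. P l p y) = (\<Sum>j<K. P l (j + 2 * l) y)" for l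
  proof -
    have "(\<Sum>p<K + 2 * l. P l p y) = (\<Sum>p\<in>{2 * l..<K + 2 * l}. P l p y)"
      by (rule sum.mono_neutral_right) (auto intro!: P_zero)
    also have "\<dots> = (\<Sum>j<K. P l (j + 2 * l) y)"
      using sum.shift_bounds_nat_ivl[of "\<lambda>p. P l p y" 0 "2 * l" K] by (simp add: atLeast0LessThan)
    finally show ?thesis .
  qed
  have rz: "complex_of_real (a y) * complex_of_real r powr s * complex_of_real z ^ l =
      complex_of_real r powr (s - 2 * of_nat l) * complex_of_real (E l y)" for l
  proof -
    have "complex_of_real r powr (s - 2 * of_nat l) * complex_of_real (r ^ (2 * l)) = complex_of_real r powr s"
      using power_times_of_real_powr[OF r, of "2 * l" "s - 2 * of_nat l"] by (simp add: scaleR_conv_of_real mult.commute)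
    then have "complex_of_real r powr s * complex_of_real z ^ l = complex_of_real r powr (s - 2 * of_nat l) * complex_of_real (r ^ (2 * l) * z ^ l)"
      by (simp flip: \<open>_ = complex_of_real r powr s\<close>)
    also have "r ^ (2 * l) * z ^ l = q y ^ l" by (simp add: qz power_mult power_mult_distrib)
    finally show ?thesis by (simp add: E_def)
  qed
  have "a y *\<^sub>R complex_of_real (sqrt ((norm y)\<^sup>2 + q y)) powr s
      = complex_of_real (a y) * complex_of_real r powr s * complex_of_real (1 + z) powr (s / 2)"
    using of_real_sqrt_powr[OF r z, of s] by (simp add: qz scaleR_conv_of_real algebra_simps r_def[symmetric])
  also have "\<dots> = complex_of_real (a y) * complex_of_real r powr s * \<rho> K (s / 2) z
      + (\<Sum>l<K. (s / 2 gchoose l) * (complex_of_real (a y) * complex_of_real r powr s * complex_of_real z ^ l))"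
    unfolding \<rho>_def by (simp add: algebra_simps sum_distrib_left)
  also have "\<dots> = rem K s y + (\<Sum>l<K. \<Sum>j<K. (s / 2 gchoose l) * (P l (j + 2 * l) y *\<^sub>R complex_of_real r powr (s - 2 * of_nat l)))"
    unfolding rz rem_def sp r_def[symmetric] z_def[symmetric] using y
    by (simp add: sum.distrib[symmetric] algebra_simps sum_distrib_left scaleR_conv_of_real)
  also have "(\<Sum>l<K. \<Sum>j<K. (s / 2 gchoose l) * (P l (j + 2 * l) y *\<^sub>R complex_of_real r powr (s - 2 * of_nat l)))
    = (\<Sum>j<K. \<Sum>l<K. (s / 2 gchoose l) * (P l (j + 2 * l) y *\<^sub>R complex_of_real r powr (s - 2 * of_nat l)))"
    by (rule sum.swap)
  finally show ?thesis unfolding r_def .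
qed

lemma rem_measurable: "rem K s \<in> borel_measurable borel"
proof -
  \<comment> \<open>\<open>q\<close> and \<open>a\<close> are continuous on \<open>V\<close> only,
    so they are cut off to the ball before measurability on the whole space is claimed.\<close>
  define q' a' where "q' y = indicator (cball 0 R) y *\<^sub>R q y" and "a' y = indicator (cball 0 R) y *\<^sub>R a y" for y
  have [measurable]: "q' \<in> borel_measurable borel" "a' \<in> borel_measurable borel"
    unfolding q'_def[abs_def] a'_def[abs_def]
    by (rule borel_measurable_continuous_on_indicator[OF _ continuous_on_subset[OF smooth_on_continuous R(3)]], simp, rule sm)+
  have [measurable]: "P l p \<in> borel_measurable borel" for l p
    unfolding P_def[abs_def] by (intro borel_measurable_continuous_onI continuous_intros dir_deriv_continuous) simp
  have "rem K s = (\<lambda>y. indicator (cball 0 R) y *\<^sub>R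
    (complex_of_real (a' y) * complex_of_real (norm y) powr s * \<rho> K (s / 2) (q' y / (norm y)\<^sup>2)
     + (\<Sum>l<K. (s / 2 gchoose l) * (complex_of_real (norm y) powr (s - 2 * of_nat l)
        * complex_of_real (q' y ^ l * a' y - (\<Sum>p<K + 2 * l. P l p y))))))"
    by (rule ext) (simp add: rem_def q'_def a'_def E_def indicator_def)
  also have "\<dots> \<in> borel_measurable borel" unfolding \<rho>_def by measurable
  finally show ?thesis .
qed

text \<open>The constant \<open>D\<close> is uniform over all \<open>s\<close> of modulus at most
  \<open>m\<close> with real part at least \<open>\<sigma>\<close>, so a single integrable function
  dominates near each point of the half plane, as \<open>rem_holomorphic\<close> requires.\<close>

lemma rem_bound:
  "\<exists>D\<ge>0. \<forall>s y. norm s \<le> m \<longrightarrow> \<sigma> \<le> Re s \<longrightarrow>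
     norm (rem K s y) \<le> D * (indicator (cball 0 R) y * norm y powr (\<sigma> + real K))"
proof (cases "m \<ge> 0")
  case m: True
  obtain A where A: "A \<ge> 0" "\<And>y. y \<in> cball 0 R \<Longrightarrow> \<bar>a y\<bar> \<le> A" using a_bounded by blast
  have "\<forall>l. \<exists>T\<ge>0. \<forall>y\<in>cball 0 R. \<bar>E l y - (\<Sum>p<K + 2 * l. P l p y)\<bar> \<le> T * norm y ^ (K + 2 * l)"
    unfolding P_def using taylor_bound[OF V smooth_E R(3)] by blast
  then obtain T where T: "\<And>l. T l \<ge> 0"
    "\<And>l y. y \<in> cball 0 R \<Longrightarrow> \<bar>E l y - (\<Sum>p<K + 2 * l. P l p y)\<bar> \<le> T l * norm y ^ (K + 2 * l)"
    by metis
  define D1 where "D1 = (\<Prod>k<K. m + real k) * (3/2) powr m"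
  define G where "G l = (\<Prod>k<l. m + real k)" for l :: nat
  have D1: "D1 \<ge> 0" unfolding D1_def using m by (intro mult_nonneg_nonneg prod_nonneg) auto
  have G: "G l \<ge> 0" for l unfolding G_def using m by (intro prod_nonneg) auto
  define D where "D = A * D1 * \<bar>C\<bar> ^ K + (\<Sum>l<K. G l * T l)"
  have D: "D \<ge> 0" unfolding D_def using A D1 G T
    by (intro add_nonneg_nonneg mult_nonneg_nonneg sum_nonneg) auto
  have "norm (rem K s y) \<le> D * (indicator (cball 0 R) y * norm y powr (\<sigma> + real K))"
    if s: "norm s \<le> m" "\<sigma> \<le> Re s" for s y
  proof (cases "y \<in> cball 0 R \<and> y \<noteq> 0")
    case False
    then show ?thesis by (cases "y = 0") (auto simp: rem_def)
  next
    case True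
    define r where "r = norm y"
    define z where "z = q y / r\<^sup>2"
    have y: "y \<in> cball 0 R" and r: "0 < r" "r \<le> 1" using True R by (auto simp: r_def)
    \<comment> \<open>Quartic vanishing of \<open>q\<close> makes \<open>z\<close> quadratic in
      \<open>r\<close>; since \<open>r \<le> 1\<close>, one power is given away and
      \<open>z ^ K\<close> still has the wanted order \<open>r ^ K\<close>.\<close>
    have z: "0 \<le> z" "z \<le> 1/2" "z \<le> \<bar>C\<bar> * r"
    proof -
      show "0 \<le> z" "z \<le> 1/2" using q(1,3)[OF y] r by (auto simp: z_def r_def[symmetric] field_simps)
      have "z \<le> C * r ^ 4 / r\<^sup>2" unfolding z_def using q(2)[OF y] r by (intro divide_right_mono) (auto simp: r_def)
      also have "\<dots> = C * (r * r)" using r by (simp add: power2_eq_square eval_nat_numeral)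
      also have "\<dots> \<le> \<bar>C\<bar> * (r * r)" by (intro mult_right_mono) auto
      also have "\<dots> \<le> \<bar>C\<bar> * (r * 1)" using r by (intro mult_left_mono) auto
      finally show "z \<le> \<bar>C\<bar> * r" by simp
    qed
    have s2: "norm (s / 2) \<le> m" using s(1) m by (simp add: norm_divide)
    have rK: "r powr \<sigma> * r ^ K = r powr (\<sigma> + real K)" using r by (simp add: powr_add powr_realpow)
    have 1: "norm (complex_of_real (a y) * complex_of_real r powr s * \<rho> K (s / 2) z) \<le> A * D1 * \<bar>C\<bar> ^ K * r powr (\<sigma> + real K)"
    proof -
      have "norm (\<rho> K (s / 2) z) \<le> D1 * z ^ K" unfolding \<rho>_def D1_def by (rule binomial_remainder[OF z(1,2) s2])
      also have "\<dots> \<le> D1 * (\<bar>C\<bar> * r) ^ K" using z D1 by (intro mult_left_mono power_mono) auto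
      finally have \<rho>: "norm (\<rho> K (s / 2) z) \<le> D1 * (\<bar>C\<bar> * r) ^ K" .
      have "norm (complex_of_real (a y) * complex_of_real r powr s * \<rho> K (s / 2) z) \<le> A * r powr \<sigma> * (D1 * (\<bar>C\<bar> * r) ^ K)"
        unfolding norm_mult
        by (intro mult_mono \<rho> norm_of_real_powr_le) (use A(2)[OF y] A(1) s r D1 in auto)
      also have "\<dots> = A * D1 * \<bar>C\<bar> ^ K * (r powr \<sigma> * r ^ K)" by (simp add: power_mult_distrib algebra_simps)
      finally show ?thesis unfolding rK .
    qed
    have 2: "norm ((s / 2 gchoose l) * (complex_of_real r powr (s - 2 * of_nat l) * complex_of_real (E l y - (\<Sum>p<K + 2 * l. P l p y))))
        \<le> G l * T l * r powr (\<sigma> + real K)" for l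
    proof -
      have "norm (s / 2 gchoose l) = (\<Prod>k<l. norm (s / 2 - of_nat k)) / fact l"
        unfolding gbinomial_prod_rev atLeast0LessThan by (simp add: norm_divide prod_norm)
      also have "\<dots> \<le> (\<Prod>k<l. norm (s / 2 - of_nat k)) / 1"
        by (rule divide_left_mono) (auto intro: prod_nonneg simp: fact_ge_1)
      also have "\<dots> \<le> G l" unfolding G_def div_by_1
        by (rule prod_mono) (use s2 norm_triangle_ineq4[of "s / 2"] in \<open>fastforce intro: order_trans\<close>)
      finally have g: "norm (s / 2 gchoose l) \<le> G l" .
      have "norm ((s / 2 gchoose l) * (complex_of_real r powr (s - 2 * of_nat l) * complex_of_real (E l y - (\<Sum>p<K + 2 * l. P l p y))))
        \<le> G l * (r powr (\<sigma> - 2 * real l) * (T l * r ^ (K + 2 * l)))"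
        unfolding norm_mult
        by (intro mult_mono g norm_of_real_powr_le) (use T(2)[OF y, of l] T(1)[of l] s r G[of l] in \<open>auto simp: r_def simp del: of_real_diff\<close>)
      also have "r powr (\<sigma> - 2 * real l) * (T l * r ^ (K + 2 * l)) = T l * r powr (\<sigma> + real K)"
        using r powr_realpow[of r "K + 2 * l"] by (simp flip: powr_realpow powr_add)
      finally show ?thesis by (simp add: mult.assoc)
    qed
    have "norm (rem K s y) \<le> A * D1 * \<bar>C\<bar> ^ K * r powr (\<sigma> + real K) + (\<Sum>l<K. G l * T l * r powr (\<sigma> + real K))"
      unfolding rem_def r_def[symmetric] z_def[symmetric] using y
      by (simp del: of_real_diff) (intro order_trans[OF norm_triangle_ineq] add_mono 1 order_trans[OF norm_sum] sum_mono 2)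
    also have "\<dots> = D * r powr (\<sigma> + real K)" by (simp add: D_def distrib_right sum_distrib_right)
    finally show ?thesis using y by (simp add: r_def)
  qed
  then show ?thesis using D by blast
next
  case False
  then have "\<not> norm s \<le> m" for s :: complex using norm_ge_zero[of s] by linarith
  then show ?thesis by (intro exI[of _ 0]) auto
qed

lemma integrable_norm_powr:
  assumes "t > - real CARD('n)"
  shows "integrable lborel (\<lambda>y::real^'n. indicator (cball 0 R) y * norm y powr t)"
proof -
  have "set_integrable lborel (cball 0 R) (\<lambda>y::real^'n. 1 *\<^sub>R (complex_of_real (norm y) powr of_real t))"
    by (rule radial_integral(1)[where q = 0, OF _ _ R(1) _ power_powr_integral(1)[OF R(1)]])
      (use assms in \<open>auto simp: of_nat_diff Suc_leI\<close>)
  from integrable_norm[OF this[unfolded set_integrable_def]] show ?thesis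
    by (rule Bochner_Integration.integrable_cong[THEN iffD1, rotated -1])
      (auto simp: norm_powr_real_powr indicator_def)
qed

lemma rem_integrable:
  assumes "Re s > - real CARD('n) - real K"
  shows "integrable lborel (rem K s)"
proof -
  obtain D where D: "D \<ge> 0" "norm (rem K s y) \<le> D * (indicator (cball 0 R) y * norm y powr (Re s + real K))" for y
    using rem_bound[of "norm s" "Re s" K] by auto
  show ?thesis
    by (rule Bochner_Integration.integrable_bound[OF integrable_mult_right[OF integrable_norm_powr[of "Re s + real K"], of D]])
      (use assms D in \<open>auto simp: rem_measurable intro: order_trans\<close>)
qed

lemma rem_holomorphic:
  "(\<lambda>s. LINT y|lborel. rem K s y) holomorphic_on {s. Re s > - real CARD('n) - real K}" (is "_ holomorphic_on ?U")
proof (rule holomorphic_integral)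
  show "open ?U" by (rule open_halfspace_Re_gt)
  show "rem K s \<in> borel_measurable lborel" for s using rem_measurable by simp
  show "(\<lambda>s. rem K s y) holomorphic_on ?U" for y
    unfolding rem_def \<rho>_def gbinomial_prod_rev scaleR_conv_of_real by (intro holomorphic_intros) auto
  fix s0 assume "s0 \<in> ?U"
  \<comment> \<open>Half the distance from \<open>s0\<close> to the boundary line, so that the
    closed disc stays strictly inside the half plane.\<close>
  define e where "e = (Re s0 + real CARD('n) + real K) / 2"
  have e: "e > 0" and t: "Re s0 - e + real K > - real CARD('n)"
    using \<open>s0 \<in> ?U\<close> by (auto simp: e_def field_simps)
  have c: "norm s \<le> norm s0 + e" "Re s0 - e \<le> Re s" if "s \<in> cball s0 e" for s
  proof -
    have d: "norm (s - s0) \<le> e" using that by (simp add: dist_norm norm_minus_commute)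
    show "norm s \<le> norm s0 + e" using norm_triangle_ineq[of s0 "s - s0"] d by simp
    show "Re s0 - e \<le> Re s" using abs_Re_le_cmod[of "s - s0"] d by simp
  qed
  obtain D where D: "D \<ge> 0" "\<And>s y. norm s \<le> norm s0 + e \<Longrightarrow> Re s0 - e \<le> Re s \<Longrightarrow>
      norm (rem K s y) \<le> D * (indicator (cball 0 R) y * norm y powr (Re s0 - e + real K))"
    using rem_bound[of "norm s0 + e" "Re s0 - e" K] by blast
  show "\<exists>r>0. \<exists>b. cball s0 r \<subseteq> ?U \<and> integrable lborel b \<and> (\<forall>s\<in>cball s0 r. \<forall>y\<in>space lborel. norm (rem K s y) \<le> b y)"
  proof (intro exI[of _ e] exI conjI)
    show "cball s0 e \<subseteq> ?U" using c(2) t by fastforce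
    show "integrable lborel (\<lambda>y::real^'n. D * (indicator (cball 0 R) y * norm y powr (Re s0 - e + real K)))"
      by (rule integrable_mult_right, rule integrable_norm_powr, rule t)
  qed (use e c D in auto)
qed

lemma main_term:
  assumes s: "Re s > - real CARD('n)"
  shows "set_integrable lborel (cball 0 R) (\<lambda>y. P l (j + 2 * l) y *\<^sub>R complex_of_real (norm y) powr (s - 2 * of_nat l))"
    and "(LINT y:cball 0 R|lborel. P l (j + 2 * l) y *\<^sub>R complex_of_real (norm y) powr (s - 2 * of_nat l)) =
      complex_of_real (sphere_integral (j + 2 * l) (P l (j + 2 * l))) *
        (complex_of_real R powr (s + of_nat CARD('n) + of_nat j) / (s + of_nat CARD('n) + of_nat j))"
proof -
  define m where "m = CARD('n) + (j + 2 * l) - 1"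
  have m: "Suc m = CARD('n) + (j + 2 * l)" unfolding m_def by (simp add: Suc_leI)
  have e: "real m + 1 = real CARD('n) + real j + 2 * real l"
    using arg_cong[OF m, of real] by simp
  have e': "s - 2 * of_nat l + of_nat m + 1 = s + of_nat CARD('n) + of_nat j"
  proof -
    have "(of_nat m + 1 :: complex) = of_nat (Suc m)" by simp
    then show ?thesis unfolding m by (simp add: algebra_simps)
  qed
  have c: "continuous_on UNIV (P l p)" for p
    unfolding P_def[abs_def] by (intro continuous_intros dir_deriv_continuous) simp
  have h: "P l p (c *\<^sub>R y) = c ^ p * P l p y" for c p y
    by (simp add: P_def dir_deriv_scale)
  have pos: "Re (s - 2 * of_nat l) + real m + 1 > 0" using s e by simp
  note I = power_powr_integral[OF R(1) pos]
  have meas: "(\<lambda>r. complex_of_real r powr (s - 2 * of_nat l)) \<in> borel_measurable borel" by measurable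
  note L = radial_integral[where p = "P l (j + 2 * l)" and q = "j + 2 * l", OF c h R(1) meas I(1)[unfolded m_def]]
  show "set_integrable lborel (cball 0 R) (\<lambda>y. P l (j + 2 * l) y *\<^sub>R complex_of_real (norm y) powr (s - 2 * of_nat l))"
    by (rule L(1))
  show "(LINT y:cball 0 R|lborel. P l (j + 2 * l) y *\<^sub>R complex_of_real (norm y) powr (s - 2 * of_nat l)) =
      complex_of_real (sphere_integral (j + 2 * l) (P l (j + 2 * l))) *
        (complex_of_real R powr (s + of_nat CARD('n) + of_nat j) / (s + of_nat CARD('n) + of_nat j))"
    unfolding L(2) m_def[symmetric] I(2) e' by (simp add: scaleR_conv_of_real)
qed

theorem local_integral:
  assumes s: "Re s > - real CARD('n)"
  shows "set_integrable lborel (cball 0 R) (\<lambda>y. a y *\<^sub>R complex_of_real (sqrt ((norm y)\<^sup>2 + q y)) powr s)" (is ?int)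
    and "(LINT y:cball 0 R|lborel. a y *\<^sub>R complex_of_real (sqrt ((norm y)\<^sup>2 + q y)) powr s) =
      (LINT y|lborel. rem K s y) + (\<Sum>j<K. coeff j s *
        complex_of_real R powr (s + of_nat CARD('n) + of_nat j) / (s + of_nat CARD('n) + of_nat j))" (is ?eq)
proof -
  define t where "t j l y = indicator (cball 0 R) y *\<^sub>R (P l (j + 2 * l) y *\<^sub>R complex_of_real (norm y) powr (s - 2 * of_nat l))" for j l y
  have t: "integrable lborel (t j l)" for j l
    using main_term(1)[OF s] unfolding set_integrable_def t_def[abs_def] .
  have r: "integrable lborel (rem K s)" by (rule rem_integrable) (use s in auto)
  have eq: "(\<lambda>y. indicator (cball 0 R) y *\<^sub>R (a y *\<^sub>R complex_of_real (sqrt ((norm y)\<^sup>2 + q y)) powr s)) =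
      (\<lambda>y. rem K s y + (\<Sum>j<K. \<Sum>l<K. (s / 2 gchoose l) * t j l y))"
  proof
    fix y
    show "indicator (cball 0 R) y *\<^sub>R (a y *\<^sub>R complex_of_real (sqrt ((norm y)\<^sup>2 + q y)) powr s) =
       rem K s y + (\<Sum>j<K. \<Sum>l<K. (s / 2 gchoose l) * t j l y)"
      by (cases "y \<in> cball 0 R") (simp_all add: expansion[of y s K] t_def rem_def del: mem_cball)
  qed
  have ti: "integrable lborel (\<lambda>y. \<Sum>j<K. \<Sum>l<K. (s / 2 gchoose l) * t j l y)"
    by (intro Bochner_Integration.integrable_sum integrable_mult_right t)
  show ?int unfolding set_integrable_def eq by (intro Bochner_Integration.integrable_add r ti)
  have "(LINT y|lborel. (\<Sum>j<K. \<Sum>l<K. (s / 2 gchoose l) * t j l y)) = (\<Sum>j<K. \<Sum>l<K. (s / 2 gchoose l) * (LINT y|lborel. t j l y))"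
    using t by (simp add: integrable_mult_right)
  also have "\<dots> = (\<Sum>j<K. coeff j s *
        complex_of_real R powr (s + of_nat CARD('n) + of_nat j) / (s + of_nat CARD('n) + of_nat j))"
  proof (rule sum.cong)
    fix j assume j: "j \<in> {..<K}"
    have "(LINT y|lborel. t j l y) = complex_of_real (sphere_integral (j + 2 * l) (P l (j + 2 * l))) *
        (complex_of_real R powr (s + of_nat CARD('n) + of_nat j) / (s + of_nat CARD('n) + of_nat j))" for l
      using main_term(2)[OF s] unfolding set_lebesgue_integral_def t_def .
    then show "(\<Sum>l<K. (s / 2 gchoose l) * (LINT y|lborel. t j l y)) = coeff j s *
        complex_of_real R powr (s + of_nat CARD('n) + of_nat j) / (s + of_nat CARD('n) + of_nat j)"
      using j by (simp add: coeff_alt[of j K] sum_distrib_right sum_divide_distrib mult.assoc)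
  qed simp
  finally show ?eq
    unfolding set_lebesgue_integral_def eq using r ti by simp
qed

end

section \<open>From one chart to the whole submanifold\<close>

text \<open>Both signs of the exponent occur: a negative one is moved to \<open>1 / r\<close>, which
  is at most \<open>L\<close> as well.\<close>

lemma powr_abs_bound:
  fixes r L x t :: real
  assumes "1 / L \<le> r" "r \<le> L" "L \<ge> 1" "\<bar>x\<bar> \<le> t"
  shows "r powr x \<le> L powr t"
proof -
  have r: "r > 0" using assms(1,3) by (smt (verit) divide_pos_pos)
  have "r powr x \<le> L powr \<bar>x\<bar>"
  proof (cases "x \<ge> 0")
    case True
    then show ?thesis using r assms by (auto intro: powr_mono2)
  next
    case False
    have "r powr x = (1 / r) powr (- x)" using r by (simp add: powr_divide powr_minus_divide)
    also have "\<dots> \<le> L powr (- x)" using False r assms by (intro powr_mono2) (auto simp: field_simps)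
    finally show ?thesis using False by simp
  qed
  also have "\<dots> \<le> L powr t" using assms by (intro powr_mono) auto
  finally show ?thesis .
qed

text \<open>The integral splits into the image \<open>A\<close> of a small ball and the rest of
  \<open>M\<close>. On the rest the distance to \<open>g 0\<close> stays between
  \<open>1 / L\<close> and \<open>L\<close>, so the outer part \<open>H\<close> contributes an
  entire function of \<open>s\<close>, and all poles come from the local integral over the
  ball.\<close>

theorem B_fun_continuation:
  fixes M :: "(real^'d) set" and g :: "real^'n \<Rightarrow> real^'d"
  assumes M: "compact M" "submanifold TYPE('n) M" and g: "local_param M V g" "0 \<in> V"
    and q: "smooth_on V q" "\<And>y. y \<in> V \<Longrightarrow> (norm (g y - g 0))\<^sup>2 = (norm y)\<^sup>2 + q y" "\<And>y. y \<in> V \<Longrightarrow> q y \<ge> 0"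
    and r: "r > 0" "cball 0 r \<subseteq> V" "\<And>y. y \<in> cball 0 r \<Longrightarrow> q y \<le> C * norm y ^ 4"
  shows "\<forall>s. Re s > - real CARD('n) \<longrightarrow>
      integrable (area_measure TYPE('n) M) (\<lambda>v. complex_of_real (norm (v - g 0)) powr s)" (is ?int)
    and "\<exists>F. F meromorphic_on UNIV \<and>
      (\<forall>s. Re s > - real CARD('n) \<longrightarrow> F s = B_fun TYPE('n) M (g 0) s) \<and>
      F holomorphic_on (UNIV - {- of_nat CARD('n) - of_nat j |j. even j}) \<and>
      (\<forall>z. is_pole F z \<longrightarrow> zorder F z = -1) \<and>
      (\<forall>j. residue F (- of_nat CARD('n) - of_nat j) = (\<Sum>l\<le>j. ((- of_nat CARD('n) - of_nat j) / 2 gchoose l) *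
         complex_of_real (sphere_integral (j + 2 * l)
           (dir_deriv (j + 2 * l) (\<lambda>y. q y ^ l * sqrt (det (first_form g y))) 0) / fact (j + 2 * l))))" (is ?ex)
proof -
  let ?\<mu> = "area_measure TYPE('n) M"
  note D = local_paramD[OF g(1)]
  define a where "a y = sqrt (det (first_form g y))" for y
  have sma: "smooth_on V a" unfolding a_def[abs_def]
    by (intro smooth_on_sqrt_det_first_form[OF g(1)])
  \<comment> \<open>\<open>C' * R \<le> 1 / 2\<close> and \<open>R \<le> 1\<close> turn the quartic
    bound into \<open>q y \<le> (norm y)\<^sup>2 / 2\<close>; taking \<open>C'\<close> at least 1
    makes the division safe and forces \<open>R \<le> 1\<close>.\<close>
  define C' where "C' = max 1 C"
  define R where "R = min r (1 / (2 * C'))"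
  have C': "C' \<ge> 1" "C \<le> C'" by (auto simp: C'_def)
  have R: "0 < R" "R \<le> 1" "cball 0 R \<subseteq> V" "R \<le> r" "C' * R \<le> 1 / 2"
  proof -
    show "R \<le> r" "0 < R" using r C' by (auto simp: R_def)
    then show "cball 0 R \<subseteq> V" using r(2) by (auto simp: subset_iff)
    have le: "R \<le> 1 / (2 * C')" by (simp add: R_def)
    then show "C' * R \<le> 1 / 2" using C' by (simp add: field_simps)
    have "1 / (2 * C') \<le> 1" using C' by (simp add: field_simps)
    with le show "R \<le> 1" by linarith
  qed
  interpret rp: radial_perturbation V q a R C'
  proof
    fix y :: "real^'n" assume y: "y \<in> cball 0 R"
    then have yr: "y \<in> cball 0 r" "norm y \<le> R" using R by auto
    show "0 \<le> q y" using q(3) y R by blast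
    have "q y \<le> C * norm y ^ 4" by (rule r(3)[OF yr(1)])
    also have "\<dots> \<le> C' * norm y ^ 4" using C' by (intro mult_right_mono) auto
    finally show 4: "q y \<le> C' * norm y ^ 4" .
    also have "C' * norm y ^ 4 = (C' * norm y) * norm y * (norm y)\<^sup>2" by (simp add: eval_nat_numeral)
    also have "\<dots> \<le> (1 / 2) * 1 * (norm y)\<^sup>2"
    proof (intro mult_right_mono mult_mono)
      have "C' * norm y \<le> C' * R" using yr C' by (intro mult_left_mono) auto
      then show "C' * norm y \<le> 1 / 2" using R by simp
    qed (use yr R in auto)
    finally show "q y \<le> (norm y)\<^sup>2 / 2" by simp
  qed (use D(1) q(1) sma R in auto)
  define A where "A = g ` cball 0 R"
  have AV: "A \<subseteq> g ` V" using R by (auto simp: A_def)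
  have "compact A" unfolding A_def
    by (rule compact_continuous_image[OF continuous_on_subset[OF smooth_on_continuous[OF D(2)] R(3)] compact_cball])
  then have Ab [measurable]: "A \<in> sets borel" by (auto intro: borel_closed compact_imp_closed)
  have is\<mu>: "is_area_measure TYPE('n) M ?\<mu>" and fin: "emeasure ?\<mu> M < \<infinity>"
    using area_measure_exists[OF M] by auto
  have sets: "sets ?\<mu> = sets (restrict_space borel M)" using is\<mu> unfolding is_area_measure_def by blast
  have space: "space ?\<mu> = M" using sets_eq_imp_space_eq[OF sets] by (simp add: space_restrict_space)
  have mb: "h \<in> borel_measurable ?\<mu>" if "h \<in> borel_measurable borel" for h :: "real^'d \<Rightarrow> complex"
    using measurable_restrict_space1[OF that, of M] measurable_cong_sets[OF sets refl] by blast
  interpret \<mu>: finite_measure ?\<mu> by (rule finite_measureI) (use fin space in auto)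
  define F where "F s v = complex_of_real (norm (v - g 0)) powr s" for s and v :: "real^'d"
  have Fm [measurable]: "F s \<in> borel_measurable borel" for s unfolding F_def[abs_def] by measurable
  \<comment> \<open>Embeddedness enters here: the image of the open ball is open in
    \<open>M\<close>, so no other sheet of \<open>M\<close> accumulates at \<open>g 0\<close> and
    the rest keeps a distance \<open>\<delta>\<close>.\<close>
  have "openin (top_of_set M) (g ` ball 0 R)"
    by (rule local_paramD(4)[OF local_param_subset[OF g(1) open_ball]]) (use R in auto)
  then obtain T where T: "open T" "g ` ball 0 R = M \<inter> T" unfolding openin_open by blast
  have "g 0 \<in> T" using T(2) R by force
  then obtain \<delta> where \<delta>: "\<delta> > 0" "ball (g 0) \<delta> \<subseteq> T" using T(1) open_contains_ball by blast
  obtain D0 where D0: "\<And>v. v \<in> M \<Longrightarrow> norm v \<le> D0"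
    using compact_imp_bounded[OF M(1)] unfolding bounded_iff by blast
  define L where "L = max (max 1 (1 / \<delta>)) (D0 + norm (g 0))"
  have L: "L \<ge> 1" "1 / L \<le> \<delta>" "D0 + norm (g 0) \<le> L"
  proof -
    show "L \<ge> 1" "D0 + norm (g 0) \<le> L" by (auto simp: L_def)
    moreover have "1 / \<delta> \<le> L" by (auto simp: L_def)
    ultimately show "1 / L \<le> \<delta>" using \<delta>(1) by (simp add: field_simps)
  qed
  have bd: "1 / L \<le> norm (v - g 0)" "norm (v - g 0) \<le> L" if "v \<in> M" "v \<notin> A" for v
  proof -
    have "v \<notin> g ` ball 0 R" using that(2) unfolding A_def by (auto simp: image_iff)
    then have "v \<notin> ball (g 0) \<delta>" using that(1) T(2) \<delta>(2) by blast
    then show "1 / L \<le> norm (v - g 0)" using L(2) by (simp add: dist_norm norm_minus_commute)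
    show "norm (v - g 0) \<le> L" using norm_triangle_ineq4[of v "g 0"] D0[OF that(1)] L(3) by linarith
  qed
  define H where "H s v = indicator (- A) v *\<^sub>R F s v" for s v
  have Hm: "H s \<in> borel_measurable ?\<mu>" for s unfolding H_def[abs_def] by (rule mb) measurable
  have Hb: "norm (H s v) \<le> L powr t" if "v \<in> M" "norm s \<le> t" for s v t
  proof (cases "v \<in> A")
    case False
    have "norm (v - g 0) > 0" using bd(1)[OF that(1) False] L(1) by (smt (verit) divide_pos_pos)
    then have "norm (H s v) = norm (v - g 0) powr Re s"
      using False norm_powr_real_powr[of "complex_of_real (norm (v - g 0))" s] by (simp add: H_def F_def)
    also have "\<dots> \<le> L powr t"
      by (rule powr_abs_bound[OF bd[OF that(1) False] L(1)]) (use that(2) abs_Re_le_cmod[of s] in linarith)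
    finally show ?thesis .
  qed (simp add: H_def)
  have Hint: "integrable ?\<mu> (H s)" for s
    by (rule \<mu>.integrable_const_bound[OF AE_I2 Hm]) (use Hb space in blast)
  have Hhol: "(\<lambda>s. LINT v|?\<mu>. H s v) holomorphic_on UNIV"
  proof (rule holomorphic_integral)
    show "(\<lambda>s. H s v) holomorphic_on UNIV" for v
      unfolding H_def F_def scaleR_conv_of_real by (intro holomorphic_intros)
    fix s0 :: complex
    have "norm (H s v) \<le> L powr (norm s0 + 1)" if "s \<in> cball s0 1" "v \<in> M" for s v
    proof (rule Hb[OF that(2)])
      show "norm s \<le> norm s0 + 1"
        using that(1) norm_triangle_ineq[of s0 "s - s0"] by (simp add: dist_norm norm_minus_commute)
    qed
    then show "\<exists>r>0. \<exists>b. cball s0 r \<subseteq> UNIV \<and> integrable ?\<mu> b \<and> (\<forall>s\<in>cball s0 r. \<forall>v\<in>space ?\<mu>. norm (H s v) \<le> b v)"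
      by (intro exI[where x = "1::real"], intro conjI zero_less_one exI[where x = "\<lambda>_. L powr (norm s0 + 1)"])
        (auto simp: space)
  qed (use Hm in auto)
  define G where "G s v = indicator A v *\<^sub>R F s v" for s v
  have Gm: "G s \<in> borel_measurable borel" for s unfolding G_def[abs_def] by measurable
  have GV: "indicator (g ` V) v *\<^sub>R G s v = G s v" for s v using AV by (auto simp: G_def indicator_def)
  have chart: "area_density V g x *\<^sub>R G s (g x) =
      indicator (cball 0 R) x *\<^sub>R (a x *\<^sub>R complex_of_real (sqrt ((norm x)\<^sup>2 + q x)) powr s)" for s x
  proof (cases "x \<in> V")
    case True
    have "g x \<in> A \<longleftrightarrow> x \<in> cball 0 R"
      unfolding A_def using True R(3) inj_on_image_mem_iff[OF D(5) True] by blast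
    moreover have "norm (g x - g 0) = sqrt ((norm x)\<^sup>2 + q x)"
      using q(2)[OF True] by (metis norm_ge_zero real_sqrt_unique)
    ultimately show ?thesis using True
      by (simp add: G_def F_def area_density_def a_def indicator_def)
  next
    case False
    then have "x \<notin> cball 0 R" using R(3) by blast
    then show ?thesis using False by (simp add: area_density_def)
  qed
  have Gint: "integrable ?\<mu> (G s)" if s: "Re s > - real CARD('n)" for s
    using integrable_area_measure_chart[OF M g(1) Gm[of s]] rp.local_integral(1)[OF s]
    unfolding set_integrable_def GV chart by simp
  have FGH: "F s = (\<lambda>v. G s v + H s v)" for s by (auto simp: G_def H_def indicator_def)
  have "integrable ?\<mu> (F s)" if "Re s > - real CARD('n)" for s
    unfolding FGH by (rule Bochner_Integration.integrable_add[OF Gint[OF that] Hint])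
  then show ?int unfolding F_def[abs_def] by blast
  define EE where "EE K s = (LINT v|?\<mu>. H s v) + (LINT y|lborel. rp.rem K s y)" for K s
  have "\<exists>F. F meromorphic_on UNIV \<and> (\<forall>s. Re s > - real CARD('n) \<longrightarrow> F s = B_fun TYPE('n) M (g 0) s) \<and>
     F holomorphic_on (UNIV - {- of_nat CARD('n) - of_nat j |j. even j}) \<and>
     (\<forall>z. is_pole F z \<longrightarrow> zorder F z = -1) \<and>
     (\<forall>j. residue F (- of_nat CARD('n) - of_nat j) = rp.coeff j (- of_nat CARD('n) - of_nat j))"
  proof (rule meromorphic_continuation[OF R(1), where E = EE])
    fix K s assume s: "Re s > - real CARD('n)"
    have "B_fun TYPE('n) M (g 0) s = (LINT v|?\<mu>. G s v) + (LINT v|?\<mu>. H s v)"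
      unfolding B_fun_def F_def[symmetric] FGH by (rule Bochner_Integration.integral_add[OF Gint[OF s] Hint])
    also have "(LINT v|?\<mu>. G s v) = (LINT y:cball 0 R|lborel. a y *\<^sub>R complex_of_real (sqrt ((norm y)\<^sup>2 + q y)) powr s)"
      using integral_area_measure_chart[OF M g(1) Gm[of s]] unfolding set_lebesgue_integral_def GV chart .
    also note rp.local_integral(2)[OF s, of K]
    finally show "B_fun TYPE('n) M (g 0) s = EE K s + (\<Sum>j<K. rp.coeff j s * complex_of_real R powr (s + of_nat CARD('n) + of_nat j) / (s + of_nat CARD('n) + of_nat j))"
      by (simp add: EE_def)
  next
    show "EE K holomorphic_on {s. Re s > - real CARD('n) - real K}" for K
      unfolding EE_def[abs_def] by (intro holomorphic_on_add rp.rem_holomorphic holomorphic_on_subset[OF Hhol]) auto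
  qed (use rp.coeff_holomorphic rp.coeff_odd in auto)
  then show ?ex unfolding rp.coeff_def rp.E_def[abs_def] a_def .
qed

section \<open>Derivatives of graphs as index expressions\<close>

primrec pd :: "'n::finite list \<Rightarrow> (real^'n \<Rightarrow> real) \<Rightarrow> real^'n \<Rightarrow> real" where
  "pd [] \<phi> = \<phi>"
| "pd (i # is) \<phi> = partial i (pd is \<phi>)"

text \<open>\<open>\<omega>\<close> is the component of the unit normal in the direction orthogonal to the tangent space at \<open>0\<close>.\<close>

definition graph_functions :: "(real^'n) set \<Rightarrow> (real^'n \<Rightarrow> real) \<Rightarrow> (real^'n \<Rightarrow> real) \<Rightarrow> bool" where
  "graph_functions S \<phi> \<omega> \<longleftrightarrow> open S \<and> smooth_on S \<phi> \<and> smooth_on S \<omega> \<and>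
     (\<forall>y\<in>S. \<omega> y > 0 \<and> (\<omega> y)\<^sup>2 * (1 + (\<Sum>a\<in>UNIV. (partial a \<phi> y)\<^sup>2)) = 1)"

text \<open>Family \<open>0\<close> consists of the derivatives of \<open>\<phi>\<close>, family \<open>1\<close> of the scalar \<open>\<omega>\<close>.\<close>

definition jet :: "(real^'n \<Rightarrow> real) \<Rightarrow> (real^'n \<Rightarrow> real) \<Rightarrow> real^'n \<Rightarrow> nat \<Rightarrow> 'n::finite list \<Rightarrow> real" where
  "jet \<phi> \<omega> y t is = (if t = 0 then pd is \<phi> y else \<omega> y)"

lemma jet_0 [simp]: "jet \<phi> \<omega> y 0 is = pd is \<phi> y"
  by (simp add: jet_def)

lemma smooth_on_pd: "smooth_on S \<phi> \<Longrightarrow> smooth_on S (pd is \<phi>)"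
  by (induction "is") (simp_all add: smooth_on_partial)

text \<open>\<open>pd\<close> puts the newest derivative in front, covariant differentiation appends
  its index at the end; symmetry of partial derivatives reconciles the two.\<close>

lemma pd_rotate:
  assumes "open S" "smooth_on S \<phi>"
  shows "y \<in> S \<Longrightarrow> pd (k # is) \<phi> y = pd (is @ [k]) \<phi> y"
proof (induction "is" arbitrary: y)
  case (Cons i "is")
  have "pd (k # i # is) \<phi> y = partial i (partial k (pd is \<phi>)) y"
    using partial_commute_real[OF assms(1) smooth_on_pd[OF assms(2)] Cons.prems] by simp
  also have "\<dots> = partial i (pd (is @ [k]) \<phi>) y"
    by (rule partial_cong[OF assms(1) Cons.prems]) (use Cons.IH in simp)
  finally show ?case by simp
qed simp

text \<open>Differentiate the relation \<open>\<omega> * \<omega> * s = 1\<close>; multiplying once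
  more by \<open>\<omega>\<close> allows the relation itself to eliminate \<open>s\<close>, so the
  result is polynomial.\<close>

lemma partial_normal_component:
  fixes \<phi> \<omega> :: "real^'n \<Rightarrow> real"
  assumes "graph_functions S \<phi> \<omega>" "y \<in> S"
  shows "partial i \<omega> y = - (\<omega> y ^ 3) * (\<Sum>a\<in>UNIV. pd [a] \<phi> y * pd [i, a] \<phi> y)"
proof -
  have S: "open S" "smooth_on S \<phi>" "smooth_on S \<omega>"
    and \<omega>: "\<And>y. y \<in> S \<Longrightarrow> \<omega> y * \<omega> y * (1 + (\<Sum>a\<in>UNIV. partial a \<phi> y * partial a \<phi> y)) = 1"
    using assms(1) by (auto simp: graph_functions_def power2_eq_square)
  define s where "s y = 1 + (\<Sum>a\<in>UNIV. partial a \<phi> y * partial a \<phi> y)" for y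
  have sms: "smooth_on S s" unfolding s_def[abs_def] by (intro smooth_intros S)
  have d: "f differentiable (at y)" if "smooth_on S f" for f :: "real^'n \<Rightarrow> real"
    by (rule smooth_on_differentiable[OF S(1) that assms(2)])
  have "partial i s y = partial i (\<lambda>y. \<Sum>a\<in>UNIV. partial a \<phi> y * partial a \<phi> y) y"
    unfolding s_def[abs_def] by (subst partial_add) (auto intro!: d smooth_intros S)
  also have "\<dots> = (\<Sum>a\<in>UNIV. partial i (\<lambda>y. partial a \<phi> y * partial a \<phi> y) y)"
    by (rule partial_sum) (intro d smooth_intros S)
  also have "\<dots> = 2 * (\<Sum>a\<in>UNIV. pd [a] \<phi> y * pd [i, a] \<phi> y)"
    by (simp add: partial_mult d smooth_on_partial S sum_distrib_left algebra_simps)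
  finally have s': "partial i s y = 2 * (\<Sum>a\<in>UNIV. pd [a] \<phi> y * pd [i, a] \<phi> y)" .
  have "partial i (\<lambda>y. (\<omega> y * \<omega> y) * s y) y = partial i (\<lambda>_. 1::real) y"
    by (rule partial_cong[OF S(1) assms(2)]) (simp add: \<omega> s_def)
  then have "(\<omega> y * \<omega> y) * partial i s y + 2 * \<omega> y * partial i \<omega> y * s y = 0"
    by (simp add: partial_mult d S sms smooth_on_mult algebra_simps)
  then have "\<omega> y * ((\<omega> y * \<omega> y) * partial i s y + 2 * \<omega> y * partial i \<omega> y * s y) = 0" by simp
  then have "\<omega> y ^ 3 * partial i s y + 2 * partial i \<omega> y * (\<omega> y * \<omega> y * s y) = 0"
    by (simp add: algebra_simps eval_nat_numeral)
  then show ?thesis using \<omega>[OF assms(2)] by (simp add: s' s_def)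
qed

lemma index_expr_contract_pair:
  assumes K: "(0, 1) \<in> K" "(0, Suc (length vs)) \<in> K" "distinct vs"
  shows "index_expr K (set vs) (\<lambda>X e. \<Sum>i\<in>UNIV. X 0 [i] * X 0 (map e vs @ [i]))"
proof -
  obtain a where a: "a \<notin> set vs" using ex_new_if_finite[OF infinite_UNIV_nat] by blast
  obtain b where b: "b \<notin> insert a (set vs)" using ex_new_if_finite[OF infinite_UNIV_nat] by (metis finite_insert finite_set)
  have "index_expr K (set [a] \<union> set (vs @ [b]) - {a, b})
     (\<lambda>X e. \<Sum>i\<in>UNIV. X 0 (map (e(a := i, b := i)) [a]) * X 0 (map (e(a := i, b := i)) (vs @ [b])))"
    by (rule index_expr.contract[OF index_expr.mult[OF index_expr.atom index_expr.atom]]) (use a b K in auto)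
  moreover have "set [a] \<union> set (vs @ [b]) - {a, b} = set vs" using a b by auto
  ultimately show ?thesis using b by (simp add: map_fun_upd[OF a] del: map_eq_conv)
qed

text \<open>The jets are closed under differentiation: a derivative of \<open>\<phi>\<close> gains
  one rank, and the derivative of \<open>\<omega>\<close> is a polynomial in \<open>\<omega>\<close>
  and the derivatives of \<open>\<phi>\<close> of orders 1 and 2. The assumptions on
  \<open>K'\<close> say that it contains what these rules produce.\<close>

lemma jet_derivative:
  fixes A :: "(nat \<Rightarrow> 'n::finite list \<Rightarrow> real) \<Rightarrow> (nat \<Rightarrow> 'n) \<Rightarrow> real"
  assumes K: "K \<subseteq> K'" "\<And>t l. (t, l) \<in> K \<Longrightarrow> t = 0 \<or> l = 0"
    "\<And>l. (0, l) \<in> K \<Longrightarrow> (0, Suc l) \<in> K'" "(0, 1) \<in> K'" "(0, 2) \<in> K'" "(1, 0) \<in> K'"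
    and A: "index_expr K V A"
  shows "graph_functions S \<phi> \<omega> \<Longrightarrow> y \<in> S \<Longrightarrow> (\<lambda>y. A (jet \<phi> \<omega> y) e) differentiable (at y)"
    and "k \<notin> V \<Longrightarrow> \<exists>B. index_expr K' (insert k V) B \<and>
      (\<forall>S \<phi> \<omega> y e. graph_functions S \<phi> \<omega> \<longrightarrow> y \<in> S \<longrightarrow>
         partial (e k) (\<lambda>y. A (jet \<phi> \<omega> y) e) y = B (jet \<phi> \<omega> y) e)"
proof -
  have atoms: "\<exists>B. index_expr K' (insert k (set vs)) B \<and> (\<forall>p y e. (case p of (S, \<phi>, \<omega>) \<Rightarrow> graph_functions S \<phi> \<omega>) \<longrightarrow> y \<in> fst p \<longrightarrow>
         partial (e k) (\<lambda>y. (case p of (S, \<phi>, \<omega>) \<Rightarrow> jet \<phi> \<omega>) y t (map e vs)) y = B ((case p of (S, \<phi>, \<omega>) \<Rightarrow> jet \<phi> \<omega>) y) (e :: nat \<Rightarrow> 'n))"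
    if vs: "distinct vs" "(t, length vs) \<in> K" "k \<notin> set vs" for t vs k
  proof (cases "t = 0")
    case True
    have "index_expr K' (set (k # vs)) (\<lambda>X e. X 0 (map e (k # vs)))"
      by (rule index_expr.atom) (use vs K(3) True in auto)
    then show ?thesis
      by (intro exI[of _ "\<lambda>X e. X 0 (map e (k # vs))"]) (auto simp: jet_def True)
  next
    case False
    then have [simp]: "vs = []" using K(2)[OF vs(2)] by simp
    have w: "index_expr K' {} (\<lambda>X (e :: nat \<Rightarrow> 'n). X 1 [])"
      using index_expr.atom[of "[]" 1 K'] K(6) by simp
    have "index_expr K' ({} \<union> ({} \<union> ({} \<union> ({} \<union> {k})))) (\<lambda>X (e :: nat \<Rightarrow> 'n). - 1 * (X 1 [] * (X 1 [] * (X 1 [] * (\<Sum>i\<in>UNIV. X 0 [i] * X 0 (map e [k] @ [i]))))))"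
      using index_expr_contract_pair[of K' "[k]"] K(4,5)
      by (intro index_expr.mult w index_expr.const) (auto simp: numeral_2_eq_2)
    then show ?thesis using False
      by (intro exI[of _ "\<lambda>X e. - 1 * (X 1 [] * (X 1 [] * (X 1 [] * (\<Sum>i\<in>UNIV. X 0 [i] * X 0 (map e [k] @ [i])))))"])
        (auto simp: jet_def partial_normal_component eval_nat_numeral)
  qed
  have diff: "(\<lambda>y. (case p of (S, \<phi>, \<omega>) \<Rightarrow> jet \<phi> \<omega>) y t is) differentiable (at y)"
    if "case p of (S, \<phi>, \<omega>) \<Rightarrow> graph_functions S \<phi> \<omega>" "y \<in> fst p" for p y t and "is" :: "'n list"
  proof -
    obtain S \<phi> \<omega> where p: "p = (S, \<phi>, \<omega>)" by (cases p)
    have "open S" "smooth_on S \<phi>" "smooth_on S \<omega>" using that by (auto simp: p graph_functions_def)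
    then have "smooth_on S (\<lambda>y. jet \<phi> \<omega> y t is)" unfolding jet_def by (cases "t = 0") (simp_all add: smooth_on_pd)
    from smooth_on_differentiable[OF \<open>open S\<close> this, of y] that show ?thesis by (simp add: p)
  qed
  let ?P = "\<lambda>p. case p of (S, \<phi>, \<omega>) \<Rightarrow> graph_functions S \<phi> \<omega>" and ?X = "\<lambda>p. case p of (S, \<phi>, \<omega>) \<Rightarrow> jet \<phi> \<omega>"
  have D: "(\<forall>p y e. ?P p \<longrightarrow> y \<in> fst p \<longrightarrow> (\<lambda>y. A (?X p y) e) differentiable (at y)) \<and>
    (\<forall>k. k \<notin> V \<longrightarrow> (\<exists>B. index_expr K' (insert k V) B \<and>
      (\<forall>p y e. ?P p \<longrightarrow> y \<in> fst p \<longrightarrow> partial (e k) (\<lambda>y. A (?X p y) e) y = B (?X p y) e)))"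
    by (rule index_expr_derivative[OF K(1) _ _ A], rule diff, assumption, assumption, rule atoms)
  show "(\<lambda>y. A (jet \<phi> \<omega> y) e) differentiable (at y)" if "graph_functions S \<phi> \<omega>" "y \<in> S"
    using D[THEN conjunct1, rule_format, of "(S, \<phi>, \<omega>)"] that by simp
  show "\<exists>B. index_expr K' (insert k V) B \<and> (\<forall>S \<phi> \<omega> y e. graph_functions S \<phi> \<omega> \<longrightarrow> y \<in> S \<longrightarrow>
         partial (e k) (\<lambda>y. A (jet \<phi> \<omega> y) e) y = B (jet \<phi> \<omega> y) e)" if "k \<notin> V"
    using D[THEN conjunct2, rule_format, OF that] by (simp add: split_paired_All)
qed

section \<open>The second fundamental form of a graph\<close>

text \<open>The elimination sees the embedding \<open>g\<close> and its normal \<open>N\<close> only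
  through the two fundamental forms, so these are what is recorded.\<close>

definition graph_data :: "(real^'n) set \<Rightarrow> (real^'n \<Rightarrow> real^'d) \<Rightarrow> (real^'n \<Rightarrow> real^'d) \<Rightarrow>
    (real^'n \<Rightarrow> real) \<Rightarrow> (real^'n \<Rightarrow> real) \<Rightarrow> bool" where
  "graph_data S g N \<phi> \<omega> \<longleftrightarrow> graph_functions S \<phi> \<omega> \<and>
     (\<forall>y\<in>S. \<forall>i j. first_form g y $ i $ j = of_bool (i = j) + partial i \<phi> y * partial j \<phi> y \<and>
        second_form g N [i, j] y = \<omega> y * partial i (partial j \<phi>) y)"

lemma det_first_form_graph:
  fixes g :: "real^'n \<Rightarrow> real^'d"
  assumes "graph_data S g N \<phi> \<omega>" "y \<in> S"
  shows "det (first_form g y) = 1 + (\<Sum>a\<in>UNIV. (partial a \<phi> y)\<^sup>2)"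
proof -
  define v :: "real^'n" where "v = (\<chi> i. partial i \<phi> y)"
  have "first_form g y = (\<chi> i j. of_bool (i = j) + v $ i * v $ j)"
    using assms by (simp add: vec_eq_iff graph_data_def v_def)
  then have "det (first_form g y) = 1 + (norm v)\<^sup>2" by (simp only: det_mat_1_plus_outer)
  then show ?thesis by (simp add: power2_norm_eq_inner inner_vec_def[of v v]) (simp add: v_def power2_eq_square)
qed

text \<open>The gradient of \<open>\<phi>\<close> is an eigenvector of the first fundamental form.\<close>

lemma christoffel_graph:
  fixes g :: "real^'n \<Rightarrow> real^'d"
  assumes g: "graph_data S g N \<phi> \<omega>" and y: "y \<in> S"
  shows "christoffel g l i j y = (\<omega> y)\<^sup>2 * partial l \<phi> y * partial i (partial j \<phi>) y"
proof -
  have S: "open S" "smooth_on S \<phi>" and \<omega>: "(\<omega> y)\<^sup>2 * (1 + (\<Sum>a\<in>UNIV. (partial a \<phi> y)\<^sup>2)) = 1"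
    using g y by (auto simp: graph_data_def graph_functions_def)
  have d: "partial j \<phi> differentiable (at y)" for j
    by (rule smooth_on_differentiable[OF S(1) smooth_on_partial[OF S(2)] y])
  have pf: "partial i (\<lambda>y. first_form g y $ j $ k) y =
      partial i (partial j \<phi>) y * partial k \<phi> y + partial j \<phi> y * partial i (partial k \<phi>) y" for i j k
  proof -
    have "partial i (\<lambda>y. first_form g y $ j $ k) y = partial i (\<lambda>y. of_bool (j = k) + partial j \<phi> y * partial k \<phi> y) y"
      by (rule partial_cong[OF S(1) y]) (use g in \<open>auto simp: graph_data_def\<close>)
    also have "\<dots> = partial i (\<lambda>y. partial j \<phi> y * partial k \<phi> y) y"
      by (subst partial_add) (auto intro: d differentiable_mult)
    finally show ?thesis by (simp add: partial_mult d)
  qed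
  define v :: "real^'n" where "v = (\<chi> k. partial k \<phi> y)"
  have vv: "v \<bullet> v = (\<Sum>a\<in>UNIV. (partial a \<phi> y)\<^sup>2)" by (simp add: v_def inner_vec_def power2_eq_square)
  have G: "first_form g y *v v = (1 + v \<bullet> v) *\<^sub>R v"
  proof -
    have "(\<Sum>j\<in>UNIV. (of_bool (i = j) + v $ i * v $ j) * v $ j) = (1 + v \<bullet> v) * v $ i" for i
    proof -
      have "(\<Sum>j\<in>UNIV. (of_bool (i = j) + v $ i * v $ j) * v $ j) = (\<Sum>j\<in>UNIV. if i = j then v $ j else 0) + v $ i * (v \<bullet> v)"
        unfolding inner_vec_def[of v v] sum_distrib_left sum.distrib[symmetric]
        by (rule sum.cong) (auto simp: algebra_simps)
      then show ?thesis by (simp add: algebra_simps)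
    qed
    moreover have "first_form g y $ i $ j = of_bool (i = j) + v $ i * v $ j" for i j
      using g y by (simp add: graph_data_def v_def)
    ultimately show ?thesis by (simp add: vec_eq_iff matrix_vector_mult_def)
  qed
  have "v \<bullet> v \<ge> 0" by simp
  then have "det (first_form g y) \<noteq> 0" using det_first_form_graph[OF g y] vv by linarith
  from matrix_inv_right_left(2)[OF this] have "inv_form g y *v (first_form g y *v v) = v"
    by (simp add: inv_form_def matrix_vector_mul_assoc)
  then have "(1 + v \<bullet> v) *\<^sub>R (inv_form g y *v v) = v" unfolding G by (simp add: matrix_vector_mult_scaleR)
  then have "(\<omega> y)\<^sup>2 *\<^sub>R v = ((\<omega> y)\<^sup>2 * (1 + v \<bullet> v)) *\<^sub>R (inv_form g y *v v)" by (metis scaleR_scaleR)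
  then have Gv: "inv_form g y *v v = (\<omega> y)\<^sup>2 *\<^sub>R v" using \<omega> by (simp add: vv)
  have "christoffel g l i j y = (\<Sum>k\<in>UNIV. inv_form g y $ l $ k * (2 * (partial i (partial j \<phi>) y * partial k \<phi> y))) / 2"
    unfolding christoffel_def pf using partial_commute_real[OF S y]
    by (intro arg_cong[where f = "\<lambda>x::real. x / 2"] sum.cong) (simp_all add: algebra_simps)
  also have "\<dots> = partial i (partial j \<phi>) y * (inv_form g y *v v) $ l"
    unfolding matrix_vector_mult_def by (simp add: v_def sum_distrib_left sum_divide_distrib algebra_simps)
  also have "\<dots> = (\<omega> y)\<^sup>2 * partial l \<phi> y * partial i (partial j \<phi>) y"
    unfolding Gv by (simp add: v_def)
  finally show ?thesis .
qed

definition jet_ranks :: "nat \<Rightarrow> (nat \<times> nat) set" where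
  "jet_ranks m = insert (1, 0) {(0, l) |l. l \<le> m}"

lemma fresh_index: "\<exists>c::nat. c \<notin> set vs"
  using ex_new_if_finite[OF infinite_UNIV_nat] by blast

text \<open>The derivative of \<open>\<phi>\<close> of order \<open>m + 2\<close> enters linearly
  with coefficient \<open>\<omega>\<close>. Differentiating \<open>\<omega>\<close> or the previous
  remainder never reaches the top order, and neither do the Christoffel corrections. All lists
  \<open>vs\<close> are treated at once because the corrections replace one index of the
  list.\<close>

lemma cov_second_form_graph:
  "\<forall>vs. distinct vs \<and> length vs = m + 2 \<longrightarrow> (\<exists>A. index_expr (jet_ranks (m + 1)) (set vs) A \<and>
     (\<forall>S (g :: real^'n \<Rightarrow> real^'d) N \<phi> \<omega> y e. graph_data S g N \<phi> \<omega> \<longrightarrow> y \<in> S \<longrightarrow>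
        cov_second_form g N m (map e vs) y = \<omega> y * pd (map e vs) \<phi> y + A (jet \<phi> \<omega> y) e))"
proof (induction m)
  case 0
  show ?case
  proof (intro allI impI)
    fix vs :: "nat list" assume "distinct vs \<and> length vs = 0 + 2"
    then obtain a b where vs: "vs = [a, b]" using length_2_cases[of vs] by auto
    show "\<exists>A. index_expr (jet_ranks (0 + 1)) (set vs) A \<and>
     (\<forall>S (g :: real^'n \<Rightarrow> real^'d) N \<phi> \<omega> y e. graph_data S g N \<phi> \<omega> \<longrightarrow> y \<in> S \<longrightarrow>
        cov_second_form g N 0 (map e vs) y = \<omega> y * pd (map e vs) \<phi> y + A (jet \<phi> \<omega> y) e)"
      by (rule exI[where x = "\<lambda>X e. 0"])
        (auto simp: vs cov_second_form_def graph_data_def intro!: index_expr.zero)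
  qed
next
  case (Suc m)
  show ?case
  proof (intro allI impI)
    fix vs :: "nat list" assume vs0: "distinct vs \<and> length vs = Suc m + 2"
    define us k where "us = butlast vs" and "k = last vs"
    have vs: "vs = us @ [k]" using vs0 unfolding us_def k_def by (metis append_butlast_last_id length_0_conv add_is_0 nat.simps(3))
    have us: "distinct us" "length us = m + 2" "k \<notin> set us" using vs0 by (auto simp: vs)
    let ?K = "jet_ranks (Suc m + 1)"
    have K: "jet_ranks (m + 1) \<subseteq> ?K" "(0, l) \<in> ?K \<longleftrightarrow> l \<le> m + 2" "(1, 0) \<in> ?K" for l
      by (auto simp: jet_ranks_def)
    have w: "index_expr ?K {} (\<lambda>X (e :: nat \<Rightarrow> 'n). X 1 [])"
      using index_expr.atom[of "[]" 1 ?K] K(3) by simp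
    have IH: "\<exists>A. index_expr (jet_ranks (m + 1)) (set us') A \<and>
     (\<forall>S (g :: real^'n \<Rightarrow> real^'d) N \<phi> \<omega> y e. graph_data S g N \<phi> \<omega> \<longrightarrow> y \<in> S \<longrightarrow>
        cov_second_form g N m (map e us') y = \<omega> y * pd (map e us') \<phi> y + A (jet \<phi> \<omega> y) e)"
      if "distinct us'" "length us' = m + 2" for us'
      using Suc.IH that by blast
    obtain A0 where A0: "index_expr (jet_ranks (m + 1)) (set us) A0"
      and A0': "\<And>S (g :: real^'n \<Rightarrow> real^'d) N \<phi> \<omega> y e. graph_data S g N \<phi> \<omega> \<Longrightarrow> y \<in> S \<Longrightarrow>
        cov_second_form g N m (map e us) y = \<omega> y * pd (map e us) \<phi> y + A0 (jet \<phi> \<omega> y) e"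
      using IH[OF us(1,2)] by metis
    note jd = jet_derivative[where K = "jet_ranks (m + 1)" and K' = ?K, OF K(1)]
    have jd_prems: "\<And>t l. (t, l) \<in> jet_ranks (m + 1) \<Longrightarrow> t = 0 \<or> l = 0"
      "\<And>l. (0, l) \<in> jet_ranks (m + 1) \<Longrightarrow> (0, Suc l) \<in> ?K" "(0, 1) \<in> ?K" "(0, 2) \<in> ?K" "(1, 0) \<in> ?K"
      by (auto simp: jet_ranks_def)
    obtain B1 where B1: "index_expr ?K (insert k (set us)) B1"
      and B1': "\<And>S \<phi> \<omega> y e. graph_functions S \<phi> \<omega> \<Longrightarrow> y \<in> S \<Longrightarrow> partial (e k) (\<lambda>y. A0 (jet \<phi> \<omega> y) e) y = B1 (jet \<phi> \<omega> y) e"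
      using jd(2)[OF jd_prems A0 us(3)] by metis
    have "\<exists>B2. index_expr ?K {k} B2 \<and>
      (\<forall>S \<phi> \<omega> y e. graph_functions S \<phi> \<omega> \<longrightarrow> y \<in> S \<longrightarrow>
         partial (e k) (\<lambda>y. jet \<phi> \<omega> y 1 []) y = B2 (jet \<phi> \<omega> y) (e :: nat \<Rightarrow> 'n))"
    proof -
      have "index_expr (jet_ranks (m + 1)) {} (\<lambda>X (e :: nat \<Rightarrow> 'n). X 1 [])"
        using index_expr.atom[of "[]" 1 "jet_ranks (m + 1)"] by (simp add: jet_ranks_def)
      from jd(2)[OF jd_prems this, of k] show ?thesis by simp
    qed
    then obtain B2 where B2: "index_expr ?K {k} B2"
      and B2': "\<And>S \<phi> \<omega> y (e :: nat \<Rightarrow> 'n). graph_functions S \<phi> \<omega> \<Longrightarrow> y \<in> S \<Longrightarrow> partial (e k) \<omega> y = B2 (jet \<phi> \<omega> y) e"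
      by (auto simp: jet_def)
    have "\<forall>a. \<exists>C. a < length us \<longrightarrow> index_expr ?K (set vs) C \<and>
       (\<forall>S (g :: real^'n \<Rightarrow> real^'d) N \<phi> \<omega> y e. graph_data S g N \<phi> \<omega> \<longrightarrow> y \<in> S \<longrightarrow>
          (\<Sum>l\<in>UNIV. christoffel g l (e k) (map e us ! a) y * cov_second_form g N m ((map e us)[a := l]) y) = C (jet \<phi> \<omega> y) e)"
    proof
      fix a
      show "\<exists>C. a < length us \<longrightarrow> index_expr ?K (set vs) C \<and>
       (\<forall>S (g :: real^'n \<Rightarrow> real^'d) N \<phi> \<omega> y e. graph_data S g N \<phi> \<omega> \<longrightarrow> y \<in> S \<longrightarrow>
          (\<Sum>l\<in>UNIV. christoffel g l (e k) (map e us ! a) y * cov_second_form g N m ((map e us)[a := l]) y) = C (jet \<phi> \<omega> y) e)"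
      proof (cases "a < length us")
        case a: True
        \<comment> \<open>\<open>c\<close> takes the place of the index in position
          \<open>a\<close>, and \<open>d\<close> below is the index on the gradient of
          \<open>\<phi>\<close> in the Christoffel symbol; contracting \<open>c\<close> with
          \<open>d\<close> performs the sum over \<open>l\<close>.\<close>
        obtain c where c: "c \<notin> set vs" using fresh_index by blast
        obtain d where d: "d \<notin> set (c # vs)" using fresh_index by blast
        have cd: "c \<noteq> d" "c \<noteq> k" "d \<noteq> k" "c \<notin> set us" "d \<notin> set us" "us ! a \<noteq> c" "us ! a \<noteq> d" "us ! a \<noteq> k"
          using c d a us(3) nth_mem[OF a] by (auto simp: vs)
        define us' where "us' = us[a := c]"
        have set_us': "set us' = insert c (set us - {us ! a})"
          unfolding us'_def using set_update_distinct[OF us(1) a] .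
        have us': "distinct us'" "length us' = m + 2"
          unfolding us'_def using distinct_list_update[OF us(1), of c a] us(2) cd by auto
        obtain A where A: "index_expr (jet_ranks (m + 1)) (set us') A"
          and A': "\<And>S (g :: real^'n \<Rightarrow> real^'d) N \<phi> \<omega> y e. graph_data S g N \<phi> \<omega> \<Longrightarrow> y \<in> S \<Longrightarrow>
            cov_second_form g N m (map e us') y = \<omega> y * pd (map e us') \<phi> y + A (jet \<phi> \<omega> y) e"
          using IH[OF us'] by metis
        define Q where "Q X e = (X 1 [] * (X 1 [] * X 0 (map e [d]))) * (X 0 (map e [k, us ! a]) * (X 1 [] * X 0 (map e us') + A X e))"
          for X :: "nat \<Rightarrow> 'n list \<Rightarrow> real" and e :: "nat \<Rightarrow> 'n"
        have "index_expr ?K (({} \<union> ({} \<union> set [d])) \<union> (set [k, us ! a] \<union> ({} \<union> set us'))) Q"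
          unfolding Q_def[abs_def]
        proof (intro index_expr.mult w index_expr.add index_expr.atom)
          show "index_expr ?K ({} \<union> set us') A" using index_expr_mono[OF A K(1)] by simp
        qed (use cd us' K(2) set_us' us(3) in \<open>auto simp del: One_nat_def\<close>)
        also have "({} \<union> ({} \<union> set [d])) \<union> (set [k, us ! a] \<union> ({} \<union> set us')) = set (c # d # vs)"
          using nth_mem[OF a] by (auto simp: set_us' vs)
        finally have "index_expr ?K (set (c # d # vs) - {c, d}) (\<lambda>X e. \<Sum>l\<in>UNIV. Q X (e(c := l, d := l)))"
          by (rule index_expr.contract) (use cd in auto)
        moreover have "set (c # d # vs) - {c, d} = set vs" using c d by auto
        ultimately have C: "index_expr ?K (set vs) (\<lambda>X e. \<Sum>l\<in>UNIV. Q X (e(c := l, d := l)))" by simp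
        moreover have "(\<Sum>l\<in>UNIV. christoffel g l (e k) (map e us ! a) y * cov_second_form g N m ((map e us)[a := l]) y)
            = (\<Sum>l\<in>UNIV. Q (jet \<phi> \<omega> y) (e(c := l, d := l)))"
          if g: "graph_data S g N \<phi> \<omega>" "y \<in> S" for S and g :: "real^'n \<Rightarrow> real^'d" and N \<phi> \<omega> y e
        proof (rule sum.cong)
          fix l :: 'n
          let ?e = "e(c := l, d := l)"
          have m: "(map e us)[a := l] = map ?e us'"
            unfolding us'_def map_update using cd by (simp add: map_fun_upd del: map_eq_conv)
          show "christoffel g l (e k) (map e us ! a) y * cov_second_form g N m ((map e us)[a := l]) y = Q (jet \<phi> \<omega> y) ?e"
            unfolding m A'[OF g, of ?e] christoffel_graph[OF g] Q_def
            using cd a by (simp add: jet_def power2_eq_square)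
        qed simp
        ultimately show ?thesis by (intro exI[where x = "\<lambda>X e. \<Sum>l\<in>UNIV. Q X (e(c := l, d := l))"]) blast
      qed simp
    qed
    from choice[OF this] obtain C where CC: "\<forall>a. a < length us \<longrightarrow> index_expr ?K (set vs) (C a) \<and>
       (\<forall>S (g :: real^'n \<Rightarrow> real^'d) N \<phi> \<omega> y e. graph_data S g N \<phi> \<omega> \<longrightarrow> y \<in> S \<longrightarrow>
          (\<Sum>l\<in>UNIV. christoffel g l (e k) (map e us ! a) y * cov_second_form g N m ((map e us)[a := l]) y) = C a (jet \<phi> \<omega> y) e)" ..
    then have C: "\<And>a. a < length us \<Longrightarrow> index_expr ?K (set vs) (C a)"
      and C': "\<And>a S (g :: real^'n \<Rightarrow> real^'d) N \<phi> \<omega> y e. a < length us \<Longrightarrow> graph_data S g N \<phi> \<omega> \<Longrightarrow> y \<in> S \<Longrightarrow>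
          (\<Sum>l\<in>UNIV. christoffel g l (e k) (map e us ! a) y * cov_second_form g N m ((map e us)[a := l]) y) = C a (jet \<phi> \<omega> y) e"
      by blast+
    define A where "A X e = (B2 X e * X 0 (map e us) + B1 X e) + (\<Sum>a<length us. (- 1) * C a X e)" for X e
    have iv: "set vs = {k} \<union> set us" "set vs = insert k (set us)" by (auto simp: vs)
    have "index_expr ?K (set vs) A"
      unfolding A_def[abs_def]
    proof (intro index_expr.add index_expr_sum index_expr_cmult)
      show "index_expr ?K (set vs) (\<lambda>X e. B2 X e * X 0 (map e us))"
        unfolding iv(1) by (intro index_expr.mult B2 index_expr.atom) (use us K(2) in auto)
      show "index_expr ?K (set vs) B1" unfolding iv(2) by (rule B1)
    qed (use C in auto)
    moreover have "cov_second_form g N (Suc m) (map e vs) y = \<omega> y * pd (map e vs) \<phi> y + A (jet \<phi> \<omega> y) e"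
      if g: "graph_data S g N \<phi> \<omega>" "y \<in> S" for S and g :: "real^'n \<Rightarrow> real^'d" and N \<phi> \<omega> y e
    proof -
      have gf: "graph_functions S \<phi> \<omega>" using g(1) by (simp add: graph_data_def)
      then have S: "open S" "smooth_on S \<phi>" "smooth_on S \<omega>" by (auto simp: graph_functions_def)
      note dS = smooth_on_differentiable[OF S(1) _ g(2)]
      have "partial (e k) (cov_second_form g N m (map e us)) y = partial (e k) (\<lambda>y. \<omega> y * pd (map e us) \<phi> y + A0 (jet \<phi> \<omega> y) e) y"
        by (rule partial_cong[OF S(1) g(2)]) (rule A0'[OF g(1)])
      also have "\<dots> = partial (e k) (\<lambda>y. \<omega> y * pd (map e us) \<phi> y) y + partial (e k) (\<lambda>y. A0 (jet \<phi> \<omega> y) e) y"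
        by (rule partial_add[OF dS[OF smooth_on_mult[OF S(1,3) smooth_on_pd[OF S(2)]]] jd(1)[OF jd_prems A0 gf g(2)]])
      also have "partial (e k) (\<lambda>y. \<omega> y * pd (map e us) \<phi> y) y = \<omega> y * pd (e k # map e us) \<phi> y + partial (e k) \<omega> y * pd (map e us) \<phi> y"
        using partial_mult[OF dS[OF S(3)] dS[OF smooth_on_pd[OF S(2)]]] by simp
      also have "pd (e k # map e us) \<phi> y = pd (map e vs) \<phi> y"
        using pd_rotate[OF S(1,2) g(2)] by (simp add: vs)
      finally have 1: "partial (e k) (cov_second_form g N m (map e us)) y =
          \<omega> y * pd (map e vs) \<phi> y + (B2 (jet \<phi> \<omega> y) e * jet \<phi> \<omega> y 0 (map e us) + B1 (jet \<phi> \<omega> y) e)"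
        by (simp add: B2'[OF gf g(2)] B1'[OF gf g(2)])
      have "cov_second_form g N (Suc m) (map e vs) y = cov_deriv g (cov_second_form g N m) (map e us @ [e k]) y"
        by (simp add: cov_second_form_def vs)
      also have "\<dots> = partial (e k) (cov_second_form g N m (map e us)) y
          - (\<Sum>a<length us. \<Sum>l\<in>UNIV. christoffel g l (e k) (map e us ! a) y * cov_second_form g N m ((map e us)[a := l]) y)"
        unfolding cov_deriv_def Let_def by simp
      also have "(\<Sum>a<length us. \<Sum>l\<in>UNIV. christoffel g l (e k) (map e us ! a) y * cov_second_form g N m ((map e us)[a := l]) y)
          = (\<Sum>a<length us. C a (jet \<phi> \<omega> y) e)"
        by (rule sum.cong) (use C'[OF _ g] in auto)
      finally show ?thesis unfolding 1 A_def by (simp add: sum_negf)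
    qed
    ultimately show "\<exists>A. index_expr ?K (set vs) A \<and>
     (\<forall>S (g :: real^'n \<Rightarrow> real^'d) N \<phi> \<omega> y e. graph_data S g N \<phi> \<omega> \<longrightarrow> y \<in> S \<longrightarrow>
        cov_second_form g N (Suc m) (map e vs) y = \<omega> y * pd (map e vs) \<phi> y + A (jet \<phi> \<omega> y) e)"
      by blast
  qed
qed

subsection \<open>Expressing derivatives at the origin by the curvature\<close>

definition adapted :: "(real^'n) set \<Rightarrow> (real^'n \<Rightarrow> real^'d) \<Rightarrow> (real^'n \<Rightarrow> real^'d) \<Rightarrow>
    (real^'n \<Rightarrow> real) \<Rightarrow> (real^'n \<Rightarrow> real) \<Rightarrow> bool" where
  "adapted S g N \<phi> \<omega> \<longleftrightarrow> graph_data S g N \<phi> \<omega> \<and> 0 \<in> S \<and> \<phi> 0 = 0 \<and> (\<forall>i. partial i \<phi> 0 = 0)"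

text \<open>Packaged as an environment for \<open>index_expr\<close>: the rank of the index list
  determines the order of the covariant derivative, two of the indices belonging to the second
  fundamental form itself.\<close>

definition curv :: "(real^'n \<Rightarrow> real^'d) \<Rightarrow> (real^'n \<Rightarrow> real^'d) \<Rightarrow> nat \<Rightarrow> 'n list \<Rightarrow> real" where
  "curv g N t is = cov_second_form g N (length is - 2) is 0"

definition curv_ranks :: "(nat \<times> nat) set" where
  "curv_ranks = {(0, l) |l. l \<ge> 2}"

definition all_ranks :: "(nat \<times> nat) set" where
  "all_ranks = insert (1, 0) (range (Pair 0))"

lemma adapted_normal:
  assumes "adapted S g N \<phi> \<omega>"
  shows "\<omega> 0 = 1"
proof -
  have "(\<omega> 0)\<^sup>2 = 1" "\<omega> 0 > 0"
    using assms by (auto simp: adapted_def graph_data_def graph_functions_def)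
  then show ?thesis by (simp add: power2_eq_1_iff)
qed

text \<open>At the origin the scalar \<open>\<omega>\<close> equals 1, so its atoms become constants
  and the derivatives of \<open>\<phi>\<close> are what remains to be replaced by curvature.\<close>

lemma jet_substitute:
  fixes A :: "(nat \<Rightarrow> 'n::finite list \<Rightarrow> real) \<Rightarrow> (nat \<Rightarrow> 'n) \<Rightarrow> real"
  assumes atoms: "\<And>vs. distinct vs \<Longrightarrow> (0, length vs) \<in> K \<Longrightarrow> \<exists>B. index_expr curv_ranks (set vs) B \<and>
      (\<forall>S (g :: real^'n \<Rightarrow> real^'d) N \<phi> \<omega> e. adapted S g N \<phi> \<omega> \<longrightarrow> pd (map e vs) \<phi> 0 = B (curv g N) e)"
    and K: "\<And>t l. (t, l) \<in> K \<Longrightarrow> t = 0 \<or> l = 0" and A: "index_expr K V A"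
  shows "\<exists>B. index_expr curv_ranks V B \<and>
      (\<forall>S (g :: real^'n \<Rightarrow> real^'d) N \<phi> \<omega> e. adapted S g N \<phi> \<omega> \<longrightarrow> A (jet \<phi> \<omega> 0) e = B (curv g N) e)"
proof -
  let ?P = "\<lambda>p. case p of (S, g :: real^'n \<Rightarrow> real^'d, N, \<phi>, \<omega>) \<Rightarrow> adapted S g N \<phi> \<omega>"
  let ?X = "\<lambda>p. case p of (S :: (real^'n) set, g :: real^'n \<Rightarrow> real^'d, N :: real^'n \<Rightarrow> real^'d, \<phi>, \<omega>) \<Rightarrow> jet \<phi> \<omega> 0"
  let ?Y = "\<lambda>p. case p of (S :: (real^'n) set, g :: real^'n \<Rightarrow> real^'d, N :: real^'n \<Rightarrow> real^'d,
     \<phi> :: real^'n \<Rightarrow> real, \<omega> :: real^'n \<Rightarrow> real) \<Rightarrow> curv g N"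
  have at: "\<exists>B. index_expr curv_ranks (set vs) B \<and> (\<forall>p. ?P p \<longrightarrow> (\<forall>e. ?X p t (map e vs) = B (?Y p) e))"
    if vs: "distinct vs" "(t, length vs) \<in> K" for t vs
  proof (cases "t = 0")
    case True
    then show ?thesis using atoms[of vs] vs by (simp add: split_paired_All)
  next
    case False
    then have "vs = []" using K[OF vs(2)] by simp
    then show ?thesis using False index_expr.const[of curv_ranks 1]
      by (intro exI[where x = "\<lambda>X e. 1"]) (auto simp: jet_def adapted_normal)
  qed
  have "\<exists>B. index_expr curv_ranks V B \<and> (\<forall>p. ?P p \<longrightarrow> (\<forall>e. A (?X p) e = B (?Y p) e))"
    by (rule index_expr_substitute[OF _ A]) (rule at)
  then show ?thesis by (simp add: split_paired_All)
qed

text \<open>The formula of \<open>cov_second_form_graph\<close> is solved for its top order term,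
  whose coefficient \<open>\<omega>\<close> is 1 at the origin; the remainder involves lower orders,
  which the induction has already expressed. Orders 0 and 1 vanish because the graph is tangent to
  its base plane.\<close>

lemma pd_origin:
  "\<forall>vs. distinct vs \<and> length vs = l \<longrightarrow> (\<exists>B. index_expr curv_ranks (set vs) B \<and>
     (\<forall>S (g :: real^'n \<Rightarrow> real^'d) N \<phi> \<omega> e. adapted S g N \<phi> \<omega> \<longrightarrow> pd (map e vs) \<phi> 0 = B (curv g N) e))"
proof (induction l rule: less_induct)
  case (less l)
  show ?case
  proof (intro allI impI)
    fix vs :: "nat list" assume vs: "distinct vs \<and> length vs = l"
    show "\<exists>B. index_expr curv_ranks (set vs) B \<and>
     (\<forall>S (g :: real^'n \<Rightarrow> real^'d) N \<phi> \<omega> e. adapted S g N \<phi> \<omega> \<longrightarrow> pd (map e vs) \<phi> 0 = B (curv g N) e)"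
    proof (cases "l \<ge> 2")
      case False
      then have "vs = [] \<or> (\<exists>a. vs = [a])" using vs by (cases vs; cases "tl vs") auto
      then show ?thesis
        by (intro exI[where x = "\<lambda>X e. 0"]) (auto simp: adapted_def intro!: index_expr.zero)
    next
      case True
      define m where "m = l - 2"
      have m: "l = m + 2" using True by (simp add: m_def)
      obtain A where A: "index_expr (jet_ranks (m + 1)) (set vs) A"
        and A': "\<And>S (g :: real^'n \<Rightarrow> real^'d) N \<phi> \<omega> y e. graph_data S g N \<phi> \<omega> \<Longrightarrow> y \<in> S \<Longrightarrow>
          cov_second_form g N m (map e vs) y = \<omega> y * pd (map e vs) \<phi> y + A (jet \<phi> \<omega> y) e"
        using cov_second_form_graph[of m, where ?'n = 'n and ?'d = 'd, rule_format, of vs] vs m by metis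
      have "\<exists>B. index_expr curv_ranks (set vs) B \<and>
          (\<forall>S (g :: real^'n \<Rightarrow> real^'d) N \<phi> \<omega> e. adapted S g N \<phi> \<omega> \<longrightarrow> A (jet \<phi> \<omega> 0) e = B (curv g N) e)"
      proof (rule jet_substitute[OF _ _ A])
        fix us :: "nat list" assume "distinct us" "(0, length us) \<in> jet_ranks (m + 1)"
        then show "\<exists>B. index_expr curv_ranks (set us) B \<and>
            (\<forall>S (g :: real^'n \<Rightarrow> real^'d) N \<phi> \<omega> e. adapted S g N \<phi> \<omega> \<longrightarrow> pd (map e us) \<phi> 0 = B (curv g N) e)"
          using less.IH[of "length us"] m by (auto simp: jet_ranks_def)
      qed (auto simp: jet_ranks_def)
      then obtain B where B: "index_expr curv_ranks (set vs) B"
        "\<forall>S (g :: real^'n \<Rightarrow> real^'d) N \<phi> \<omega> e. adapted S g N \<phi> \<omega> \<longrightarrow> A (jet \<phi> \<omega> 0) e = B (curv g N) e" by blast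
      have "index_expr curv_ranks (set vs) (\<lambda>X e. X 0 (map e vs) + - 1 * B X e)"
        by (intro index_expr.add index_expr.atom index_expr_cmult B(1)) (use vs True in \<open>auto simp: curv_ranks_def\<close>)
      moreover have "pd (map e vs) \<phi> 0 = curv g N 0 (map e vs) + - 1 * B (curv g N) e"
        if ad: "adapted S g N \<phi> \<omega>" for S and g :: "real^'n \<Rightarrow> real^'d" and N \<phi> \<omega> e
      proof -
        have "graph_data S g N \<phi> \<omega>" "0 \<in> S" using ad by (auto simp: adapted_def)
        from A'[OF this, of e] have "pd (map e vs) \<phi> 0 = cov_second_form g N m (map e vs) 0 - A (jet \<phi> \<omega> 0) e"
          by (simp add: adapted_normal[OF ad])
        moreover have "A (jet \<phi> \<omega> 0) e = B (curv g N) e" using B(2) ad by blast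
        ultimately show ?thesis using vs m by (simp add: curv_def)
      qed
      ultimately show ?thesis by (intro exI[where x = "\<lambda>X e. X 0 (map e vs) + - 1 * B X e"]) blast
    qed
  qed
qed

section \<open>Laplacians at the origin as polynomials in the curvature\<close>

lemma jet_laplacian:
  fixes A :: "(nat \<Rightarrow> 'n::finite list \<Rightarrow> real) \<Rightarrow> (nat \<Rightarrow> 'n) \<Rightarrow> real"
  assumes A: "index_expr all_ranks {} A"
  shows "\<exists>B. index_expr all_ranks {} B \<and> (\<forall>S \<phi> \<omega> F. graph_functions S \<phi> \<omega> \<longrightarrow>
    (\<forall>y\<in>S. \<forall>e. F y = A (jet \<phi> \<omega> y) e) \<longrightarrow> (\<forall>y\<in>S. \<forall>e. laplacian F y = B (jet \<phi> \<omega> y) e))"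
proof -
  have K: "all_ranks \<subseteq> all_ranks" "\<And>t l. (t, l) \<in> all_ranks \<Longrightarrow> t = 0 \<or> l = 0"
    "\<And>l. (0, l) \<in> all_ranks \<Longrightarrow> (0, Suc l) \<in> all_ranks" "(0, 1) \<in> all_ranks" "(0, 2) \<in> all_ranks" "(1, 0) \<in> all_ranks"
    by (auto simp: all_ranks_def)
  obtain B1 where B1: "index_expr all_ranks {0} B1"
    "\<And>S \<phi> \<omega> y e. graph_functions S \<phi> \<omega> \<Longrightarrow> y \<in> S \<Longrightarrow> partial (e 0) (\<lambda>y. A (jet \<phi> \<omega> y) e) y = B1 (jet \<phi> \<omega> y) e"
    using jet_derivative(2)[OF K A, of 0] by (metis empty_iff)
  obtain B2 where B2: "index_expr all_ranks {1, 0} B2"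
    "\<And>S \<phi> \<omega> y e. graph_functions S \<phi> \<omega> \<Longrightarrow> y \<in> S \<Longrightarrow> partial (e 1) (\<lambda>y. B1 (jet \<phi> \<omega> y) e) y = B2 (jet \<phi> \<omega> y) e"
    using jet_derivative(2)[OF K B1(1), of 1] by (metis singletonD zero_neq_one)
  have "index_expr all_ranks ({1, 0} - {0, 1}) (\<lambda>X e. \<Sum>i\<in>UNIV. B2 X (e(0 := i, 1 := i)))"
    by (rule index_expr.contract[OF B2(1)]) auto
  moreover have "{1, 0} - {0, 1} = ({} :: nat set)" by auto
  moreover have "laplacian F y = (\<Sum>i\<in>UNIV. B2 (jet \<phi> \<omega> y) (e(0 := i, 1 := i)))"
    if gf: "graph_functions S \<phi> \<omega>" and F: "\<forall>y\<in>S. \<forall>e. F y = A (jet \<phi> \<omega> y) e" and y: "y \<in> S" for S \<phi> \<omega> F y e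
    unfolding laplacian_def
  proof (rule sum.cong)
    fix i
    let ?e = "e(0 := i, 1 := i)"
    have o: "open S" using gf by (simp add: graph_functions_def)
    have 1: "partial i F y = B1 (jet \<phi> \<omega> y) ?e" if "y \<in> S" for y
    proof -
      have "partial i F y = partial i (\<lambda>y. A (jet \<phi> \<omega> y) ?e) y"
        by (rule partial_cong[OF o that]) (use F in blast)
      then show ?thesis using B1(2)[OF gf that, of ?e] by simp
    qed
    have "partial i (partial i F) y = partial i (\<lambda>y. B1 (jet \<phi> \<omega> y) ?e) y"
      by (rule partial_cong[OF o y 1])
    then show "partial i (partial i F) y = B2 (jet \<phi> \<omega> y) ?e" using B2(2)[OF gf y, of ?e] by simp
  qed simp
  ultimately show ?thesis
    by (intro exI[where x = "\<lambda>X e. \<Sum>i\<in>UNIV. B2 X (e(0 := i, 1 := i))"]) auto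
qed

lemma jet_laplacian_iterate:
  fixes A :: "(nat \<Rightarrow> 'n::finite list \<Rightarrow> real) \<Rightarrow> (nat \<Rightarrow> 'n) \<Rightarrow> real"
  assumes A: "index_expr all_ranks {} A"
  shows "\<exists>B. index_expr all_ranks {} B \<and> (\<forall>S \<phi> \<omega> F. graph_functions S \<phi> \<omega> \<longrightarrow>
    (\<forall>y\<in>S. \<forall>e. F y = A (jet \<phi> \<omega> y) e) \<longrightarrow> (\<forall>y\<in>S. \<forall>e. (laplacian ^^ m) F y = B (jet \<phi> \<omega> y) e))"
proof (induction m)
  case 0
  show ?case using A by (intro exI[where x = A]) auto
next
  case (Suc m)
  then obtain B where B: "index_expr all_ranks {} B" "\<forall>S \<phi> \<omega> F. graph_functions S \<phi> \<omega> \<longrightarrow>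
    (\<forall>y\<in>S. \<forall>e. F y = A (jet \<phi> \<omega> y) e) \<longrightarrow> (\<forall>y\<in>S. \<forall>e. (laplacian ^^ m) F y = B (jet \<phi> \<omega> y) e)" by blast
  obtain B' where B': "index_expr all_ranks {} B'" "\<forall>S \<phi> \<omega> F. graph_functions S \<phi> \<omega> \<longrightarrow>
    (\<forall>y\<in>S. \<forall>e. F y = B (jet \<phi> \<omega> y) e) \<longrightarrow> (\<forall>y\<in>S. \<forall>e. laplacian F y = B' (jet \<phi> \<omega> y) e)"
    using jet_laplacian[OF B(1)] by blast
  have "\<forall>S \<phi> \<omega> F. graph_functions S \<phi> \<omega> \<longrightarrow>
    (\<forall>y\<in>S. \<forall>e. F y = A (jet \<phi> \<omega> y) e) \<longrightarrow> (\<forall>y\<in>S. \<forall>e. (laplacian ^^ Suc m) F y = B' (jet \<phi> \<omega> y) e)"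
  proof (intro allI impI)
    fix S :: "(real^'n) set" and \<phi> \<omega> F
    assume "graph_functions S \<phi> \<omega>" "\<forall>y\<in>S. \<forall>e. F y = A (jet \<phi> \<omega> y) e"
    then have "\<forall>y\<in>S. \<forall>e. (laplacian ^^ m) F y = B (jet \<phi> \<omega> y) e" using B(2) by blast
    then show "\<forall>y\<in>S. \<forall>e. (laplacian ^^ Suc m) F y = B' (jet \<phi> \<omega> y) e"
      using B'(2) \<open>graph_functions S \<phi> \<omega>\<close> by simp
  qed
  then show ?case using B'(1) by blast
qed

lemma index_expr_power: "index_expr K {} A \<Longrightarrow> index_expr K {} (\<lambda>X e. A X e ^ k)"
proof (induction k)
  case 0
  show ?case using index_expr.const[of K 1] by simp
next
  case (Suc k)
  from index_expr.mult[OF Suc.prems Suc.IH[OF Suc.prems]] show ?case by simp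
qed

text \<open>Since \<open>\<omega>\<close> is the reciprocal root of the determinant, multiplying it
  by the determinant yields the root itself in polynomial form.\<close>

lemma sqrt_det_first_form_graph:
  fixes g :: "real^'n \<Rightarrow> real^'d"
  assumes g: "graph_data S g N \<phi> \<omega>" and y: "y \<in> S"
  shows "sqrt (det (first_form g y)) = \<omega> y * (1 + (\<Sum>i\<in>UNIV. pd [i] \<phi> y * pd [i] \<phi> y))"
proof (rule real_sqrt_unique)
  have \<omega>: "\<omega> y > 0" "(\<omega> y)\<^sup>2 * (1 + (\<Sum>a\<in>UNIV. (partial a \<phi> y)\<^sup>2)) = 1"
    using g y by (auto simp: graph_data_def graph_functions_def)
  let ?D = "1 + (\<Sum>i\<in>UNIV. pd [i] \<phi> y * pd [i] \<phi> y)"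
  have D: "?D = 1 + (\<Sum>a\<in>UNIV. (partial a \<phi> y)\<^sup>2)" by (simp add: power2_eq_square)
  have 1: "(\<omega> y)\<^sup>2 * ?D = 1" unfolding D by (rule \<omega>(2))
  have "(\<omega> y * ?D)\<^sup>2 = ((\<omega> y)\<^sup>2 * ?D) * ?D" by (simp add: power2_eq_square)
  then show "(\<omega> y * ?D)\<^sup>2 = det (first_form g y)"
    unfolding 1 det_first_form_graph[OF g y] by (simp only: D mult_1)
  show "0 \<le> \<omega> y * ?D" unfolding D using \<omega>(1) by (intro mult_nonneg_nonneg add_nonneg_nonneg sum_nonneg) auto
qed

lemma contraction_value_origin:
  fixes g :: "real^'n \<Rightarrow> real^'d"
  assumes ad: "adapted S g N \<phi> \<omega>"
  shows "contraction_value g N 0 = (\<lambda>(ms, ps). \<Sum>is | length is = num_indices ms.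
      (\<Prod>(a, b)\<leftarrow>ps. of_bool (is ! a = is ! b)) * tprod (curv g N 0) ms is)"
proof
  fix c :: contraction
  obtain ms ps where c: "c = (ms, ps)" by (cases c)
  have "first_form g 0 = mat 1"
    using ad by (auto simp: adapted_def graph_data_def vec_eq_iff mat_def)
  then have "inv_form g 0 = mat 1"
    unfolding inv_form_def using matrix_inv_right_left(1)[of "mat 1 :: real^'n^'n"] by simp
  then have i: "inv_form g 0 $ i $ j = of_bool (i = j)" for i j by (simp add: mat_def)
  have t: "length is = num_indices ms \<Longrightarrow> tensor_prod (cov_second_form g N) ms is 0 = tprod (curv g N 0) ms is" for "is"
    by (induction ms arbitrary: "is") (simp_all add: curv_def num_indices_def)
  show "contraction_value g N 0 c = (case c of (ms, ps) \<Rightarrow> \<Sum>is | length is = num_indices ms.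
      (\<Prod>(a, b)\<leftarrow>ps. of_bool (is ! a = is ! b)) * tprod (curv g N 0) ms is)"
    unfolding contraction_value_def c prod.case i by (rule sum.cong) (simp_all add: t)
qed

text \<open>For even \<open>j\<close> the degree \<open>j + 2 * l\<close> is twice
  \<open>j div 2 + l\<close>, so \<open>pizzetti\<close> converts each sphere integral into an
  iterated Laplacian of a polynomial in the jet. At the origin this is a closed index expression in
  the curvature, and its normal form is the polynomial \<open>P\<close>, obtained before any
  hypersurface is fixed.\<close>

theorem residue_polynomial:
  assumes "even j"
  shows "\<exists>P. (\<forall>c\<in>vars P. complete_contraction c) \<and>
    (\<forall>S (g :: real^'n \<Rightarrow> real^'d) N \<phi> \<omega>. adapted S g N \<phi> \<omega> \<longrightarrow>
      (\<Sum>l\<le>j. ((- of_nat CARD('n) - of_nat j) / 2 gchoose l) *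
         complex_of_real (sphere_integral (j + 2 * l)
           (dir_deriv (j + 2 * l) (\<lambda>y. ((\<phi> y)\<^sup>2) ^ l * sqrt (det (first_form g y))) 0) / fact (j + 2 * l))) =
      complex_of_real (eval_poly (contraction_value g N 0) P))"
proof -
  define A :: "nat \<Rightarrow> (nat \<Rightarrow> 'n list \<Rightarrow> real) \<Rightarrow> (nat \<Rightarrow> 'n) \<Rightarrow> real"
    where "A l X e = (X 0 [] * X 0 []) ^ l * (X 1 [] * (1 + (\<Sum>i\<in>UNIV. X 0 [i] * X 0 [i])))" for l X e
  have at: "index_expr all_ranks {} (\<lambda>X (e :: nat \<Rightarrow> 'n). X t [])" if "t = 0 \<or> t = 1" for t
    using index_expr.atom[of "[]" t all_ranks] that by (auto simp: all_ranks_def)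
  have "index_expr all_ranks (({} \<union> {}) \<union> ({} \<union> {})) (A l)" for l
    unfolding A_def[abs_def]
  proof (intro index_expr.mult index_expr_power index_expr.add at)
    show "index_expr all_ranks {} (\<lambda>X (e :: nat \<Rightarrow> 'n). \<Sum>i\<in>UNIV. X 0 [i] * X 0 [i])"
      using index_expr_contract_pair[of all_ranks "[]"] by (simp add: all_ranks_def)
    show "index_expr all_ranks {} (\<lambda>X (e :: nat \<Rightarrow> 'n). 1)" by (rule index_expr.const)
    show "index_expr all_ranks ({} \<union> {}) (\<lambda>X (e :: nat \<Rightarrow> 'n). (X 0 [] * X 0 []) ^ l)"
      using index_expr_power[where A = "\<lambda>X (e :: nat \<Rightarrow> 'n). X 0 [] * X 0 []" and K = all_ranks]
        index_expr.mult[OF at[of 0] at[of 0]] by simp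
  qed auto
  then have A: "index_expr all_ranks {} (A l)" for l by simp
  have "\<exists>B. index_expr curv_ranks {} B \<and> (\<forall>S (g :: real^'n \<Rightarrow> real^'d) N \<phi> \<omega> e. adapted S g N \<phi> \<omega> \<longrightarrow>
      (laplacian ^^ (j div 2 + l)) (\<lambda>y. ((\<phi> y)\<^sup>2) ^ l * sqrt (det (first_form g y))) 0 = B (curv g N) e)" for l
  proof -
    obtain B where B: "index_expr all_ranks {} B" "\<forall>S \<phi> \<omega> F. graph_functions S \<phi> \<omega> \<longrightarrow>
      (\<forall>y\<in>S. \<forall>e. F y = A l (jet \<phi> \<omega> y) e) \<longrightarrow> (\<forall>y\<in>S. \<forall>e. (laplacian ^^ (j div 2 + l)) F y = B (jet \<phi> \<omega> y) e)"
      using jet_laplacian_iterate[OF A] by blast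
    have "\<exists>B'. index_expr curv_ranks {} B' \<and>
      (\<forall>S (g :: real^'n \<Rightarrow> real^'d) N \<phi> \<omega> e. adapted S g N \<phi> \<omega> \<longrightarrow> B (jet \<phi> \<omega> 0) e = B' (curv g N) e)"
      by (rule jet_substitute[OF _ _ B(1)]) (use pd_origin in \<open>blast, auto simp: all_ranks_def\<close>)
    then obtain B' where B': "index_expr curv_ranks {} B'"
      "\<forall>S (g :: real^'n \<Rightarrow> real^'d) N \<phi> \<omega> e. adapted S g N \<phi> \<omega> \<longrightarrow> B (jet \<phi> \<omega> 0) e = B' (curv g N) e" by blast
    have "(laplacian ^^ (j div 2 + l)) (\<lambda>y. ((\<phi> y)\<^sup>2) ^ l * sqrt (det (first_form g y))) 0 = B' (curv g N) e"
      if ad: "adapted S g N \<phi> \<omega>" for S and g :: "real^'n \<Rightarrow> real^'d" and N \<phi> \<omega> e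
    proof -
      have g: "graph_data S g N \<phi> \<omega>" "graph_functions S \<phi> \<omega>" "0 \<in> S" using ad by (auto simp: adapted_def graph_data_def)
      have "\<forall>y\<in>S. \<forall>e. ((\<phi> y)\<^sup>2) ^ l * sqrt (det (first_form g y)) = A l (jet \<phi> \<omega> y) e"
        by (simp add: sqrt_det_first_form_graph[OF g(1)] A_def) (simp add: jet_def power2_eq_square)
      then have "(laplacian ^^ (j div 2 + l)) (\<lambda>y. ((\<phi> y)\<^sup>2) ^ l * sqrt (det (first_form g y))) 0 = B (jet \<phi> \<omega> 0) e"
        using B(2)[rule_format, OF g(2) _ g(3), of "\<lambda>y. ((\<phi> y)\<^sup>2) ^ l * sqrt (det (first_form g y))" e] by blast
      then show ?thesis using B'(2) ad by simp
    qed
    then show ?thesis using B'(1) by blast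
  qed
  then have "\<forall>l. \<exists>B. index_expr curv_ranks {} B \<and> (\<forall>S (g :: real^'n \<Rightarrow> real^'d) N \<phi> \<omega> e. adapted S g N \<phi> \<omega> \<longrightarrow>
      (laplacian ^^ (j div 2 + l)) (\<lambda>y. ((\<phi> y)\<^sup>2) ^ l * sqrt (det (first_form g y))) 0 = B (curv g N) e)" by blast
  from choice[OF this] obtain B where B: "\<forall>l. index_expr curv_ranks {} (B l) \<and> (\<forall>S (g :: real^'n \<Rightarrow> real^'d) N \<phi> \<omega> e. adapted S g N \<phi> \<omega> \<longrightarrow>
      (laplacian ^^ (j div 2 + l)) (\<lambda>y. ((\<phi> y)\<^sup>2) ^ l * sqrt (det (first_form g y))) 0 = B l (curv g N) e)" ..
  \<comment> \<open>The binomial coefficient at \<open>s = -n - j\<close>, the Pizzetti constant and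
    the Taylor factorial; the pole is a real number, so all of these are real.\<close>
  define c where "c l = ((- real CARD('n) - real j) / 2 gchoose l) * (pizzetti_const TYPE('n) (j div 2 + l) / fact (j + 2 * l))" for l
  have "index_expr curv_ranks {} (\<lambda>X e. \<Sum>l\<le>j. c l * B l X e)"
    by (intro index_expr_sum index_expr_cmult) (use B in auto)
  from index_expr_eval_poly[OF _ this] obtain P where P: "\<forall>c\<in>vars P. complete_contraction c"
    "\<And>X e. (\<Sum>l\<le>j. c l * B l X e) = eval_poly (\<lambda>(ms, ps). \<Sum>is | length is = num_indices ms.
      (\<Prod>(a, b)\<leftarrow>ps. of_bool (is ! a = is ! b)) * tprod (X 0) ms is) P"
    by (force simp: curv_ranks_def)
  show ?thesis
  proof (intro exI[where x = P] conjI P(1) allI impI)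
    fix S and g :: "real^'n \<Rightarrow> real^'d" and N \<phi> \<omega> assume ad: "adapted S g N \<phi> \<omega>"
    then have g: "graph_data S g N \<phi> \<omega>" "0 \<in> S" and S: "open S" "smooth_on S \<phi>" "smooth_on S \<omega>"
      by (auto simp: adapted_def graph_data_def graph_functions_def)
    define E where "E l y = ((\<phi> y)\<^sup>2) ^ l * sqrt (det (first_form g y))" for l y
    have smE: "smooth_on S (E l)" for l
    proof (rule smooth_on_cong[OF S(1)])
      show "smooth_on S (\<lambda>y. ((\<phi> y)\<^sup>2) ^ l * (\<omega> y * (1 + (\<Sum>i\<in>UNIV. pd [i] \<phi> y * pd [i] \<phi> y))))"
        by (intro smooth_intros smooth_on_pd S)
    qed (simp add: E_def sqrt_det_first_form_graph[OF g(1)])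
    have jl: "j + 2 * l = 2 * (j div 2 + l)" for l using assms by auto
    \<comment> \<open>A closed index expression does not depend on the environment; an arbitrary one
      is supplied for its evaluation.\<close>
    fix e :: "nat \<Rightarrow> 'n"
    have summand: "((- of_nat CARD('n) - of_nat j) / 2 gchoose l) *
         complex_of_real (sphere_integral (j + 2 * l) (dir_deriv (j + 2 * l) (E l) 0) / fact (j + 2 * l)) =
         complex_of_real (c l * B l (curv g N) e)" for l e
    proof -
      have "(laplacian ^^ (j div 2 + l)) (E l) 0 = B l (curv g N) e"
        using B ad unfolding E_def by blast
      then have "sphere_integral (j + 2 * l) (dir_deriv (j + 2 * l) (E l) 0) = pizzetti_const TYPE('n) (j div 2 + l) * B l (curv g N) e"
        unfolding jl pizzetti[OF S(1) g(2) smE] by simp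
      moreover have "((- of_nat CARD('n) - of_nat j) / 2 gchoose l) = complex_of_real ((- real CARD('n) - real j) / 2 gchoose l)"
        unfolding gbinomial_prod_rev by simp
      ultimately show ?thesis by (simp add: c_def)
    qed
    have E: "(\<lambda>y. ((\<phi> y)\<^sup>2) ^ l * sqrt (det (first_form g y))) = E l" for l
      by (rule ext) (simp add: E_def)
    show "(\<Sum>l\<le>j. ((- of_nat CARD('n) - of_nat j) / 2 gchoose l) *
         complex_of_real (sphere_integral (j + 2 * l)
           (dir_deriv (j + 2 * l) (\<lambda>y. ((\<phi> y)\<^sup>2) ^ l * sqrt (det (first_form g y))) 0) / fact (j + 2 * l))) =
      complex_of_real (eval_poly (contraction_value g N 0) P)"
      unfolding contraction_value_origin[OF ad] P(2)[of "curv g N" e, symmetric] E summand[of _ e]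
      by simp
  qed
qed

section \<open>Residues\<close>

lemma eval_poly_cong: "(\<And>v. v \<in> vars P \<Longrightarrow> \<rho> v = \<sigma> v) \<Longrightarrow> eval_poly \<rho> P = eval_poly \<sigma> P"
  by (induction P) auto

text \<open>In any codimension the squared length of the normal part \<open>\<Phi>\<close> serves as
  \<open>q\<close>; quadratic vanishing of each component of \<open>\<Phi>\<close> gives the quartic
  bound.\<close>

lemma B_fun_continuation_submanifold:
  fixes M :: "(real^'d) set"
  assumes M: "compact M" "submanifold TYPE('n::finite) M" "u \<in> M"
  shows "(\<forall>s. Re s > - real CARD('n) \<longrightarrow>
      integrable (area_measure TYPE('n) M) (\<lambda>v. complex_of_real (norm (v - u)) powr s)) \<and>
    (\<exists>F. F meromorphic_on UNIV \<and>
      (\<forall>s. Re s > - real CARD('n) \<longrightarrow> F s = B_fun TYPE('n) M u s) \<and>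
      F holomorphic_on (UNIV - {- of_nat CARD('n) - of_nat j |j. even j}) \<and>
      (\<forall>z. is_pole F z \<longrightarrow> zorder F z = -1))"
proof -
  have "\<exists>W (f :: real^'n \<Rightarrow> real^'d). local_param M W f \<and> u \<in> f ` W"
    using M(2,3) by (simp add: submanifold_def)
  then obtain W and f :: "real^'n \<Rightarrow> real^'d" where "local_param M W f \<and> u \<in> f ` W"
    by (elim exE)
  then have f: "local_param M W f" and "u \<in> f ` W" by (rule conjunct1, rule conjunct2)
  from this(2) obtain x0 where x0: "u = f x0" "x0 \<in> W" by (rule imageE)
  obtain V \<psi> and t :: "'n \<Rightarrow> real^'d" and \<Phi> where
    V: "open V" "0 \<in> V" "smooth_on V \<psi>" "\<psi> ` V \<subseteq> W" "\<psi> 0 = x0"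
    "\<And>y. y \<in> V \<Longrightarrow> det (\<chi> a i. partial i \<psi> y $ a) \<noteq> 0"
    "local_param M V (\<lambda>y. f (\<psi> y))"
    and t: "\<And>i j. t i \<bullet> t j = (if i = j then 1 else 0)"
    "\<And>i. t i \<in> range (frechet_derivative f (at x0))"
    and \<Phi>: "smooth_on V \<Phi>" "\<Phi> 0 = 0" "\<And>i. partial i \<Phi> 0 = 0"
    "\<And>y i. y \<in> V \<Longrightarrow> \<Phi> y \<bullet> t i = 0"
    "\<And>y. y \<in> V \<Longrightarrow> f (\<psi> y) = f x0 + (\<Sum>i\<in>UNIV. y $ i *\<^sub>R t i) + \<Phi> y"
  proof (rule graph_chart[OF f x0(2)], goal_cases)
    case (1 V \<psi> t \<Phi>)
    show ?case by (rule 1(1)) (fact 1(2-))+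
  qed
  obtain r where r: "r > 0" "cball 0 r \<subseteq> V" using V(1,2) open_contains_cball by blast
  have "\<exists>C. \<forall>y\<in>cball 0 r. \<bar>\<Phi> y $ b\<bar> \<le> C * norm y ^ 2" for b
  proof (rule smooth_on_quadratic_bound[OF V(1) _ r(2,1)])
    show "smooth_on V (\<lambda>y. \<Phi> y $ b)" by (rule smooth_on_vec_nth[OF V(1) \<Phi>(1)])
    show "\<Phi> 0 $ b = 0" by (simp add: \<Phi>(2))
    show "partial i (\<lambda>y. \<Phi> y $ b) 0 = 0" for i
      using partial_linear[OF bounded_linear_vec_nth smooth_on_differentiable[OF V(1) \<Phi>(1) V(2)]] \<Phi>(3) by simp
  qed
  then have "\<forall>b. \<exists>C. \<forall>y\<in>cball 0 r. \<bar>\<Phi> y $ b\<bar> \<le> C * norm y ^ 2" by blast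
  from choice[OF this] obtain C where C: "\<forall>b. \<forall>y\<in>cball 0 r. \<bar>\<Phi> y $ b\<bar> \<le> C b * norm y ^ 2" ..
  have bound: "\<Phi> y \<bullet> \<Phi> y \<le> (\<Sum>b\<in>UNIV. (C b)\<^sup>2) * norm y ^ 4" if "y \<in> cball 0 r" for y
  proof -
    have "\<Phi> y \<bullet> \<Phi> y = (\<Sum>b\<in>UNIV. \<bar>\<Phi> y $ b\<bar>\<^sup>2)"
      by (simp add: inner_vec_def[of "\<Phi> y" "\<Phi> y"] power2_eq_square)
    also have "\<dots> \<le> (\<Sum>b\<in>UNIV. (C b * norm y ^ 2)\<^sup>2)"
      by (intro sum_mono power_mono) (use C that in auto)
    finally show ?thesis by (simp add: power_mult_distrib sum_distrib_right)
  qed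
  note B = B_fun_continuation[OF M(1,2) V(7,2), where q = "\<lambda>y. \<Phi> y \<bullet> \<Phi> y" and r = r and C = "\<Sum>b\<in>UNIV. (C b)\<^sup>2"]
  have dist: "(norm (f (\<psi> y) - f (\<psi> 0)))\<^sup>2 = (norm y)\<^sup>2 + \<Phi> y \<bullet> \<Phi> y" if "y \<in> V" for y
    using norm_graph[OF t(1) \<Phi>(4)[OF that], of y] \<Phi>(5)[OF that] by (simp add: V(5) dot_square_norm add.assoc)
  have sm: "smooth_on V (\<lambda>y. \<Phi> y \<bullet> \<Phi> y)" by (intro smooth_intros V(1) \<Phi>(1))
  show ?thesis
    using B[OF sm dist _ r bound] unfolding V(5) x0(1)[symmetric] by (simp only: inner_ge_zero) blast
qed

text \<open>The residue is computed for the continuation \<open>G\<close> built from a graph chart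
  and passes to the given \<open>F\<close> by uniqueness of continuation; the contractions are
  carried from the graph chart back to the given chart \<open>f\<close> by their invariance.\<close>

lemma residue_hypersurface:
  fixes M :: "(real^'d) set" and f :: "real^'n \<Rightarrow> real^'d"
  assumes card: "CARD('d) = CARD('n) + 1" and M: "compact M" "submanifold TYPE('n) M"
    and F: "F meromorphic_on UNIV" "\<And>s. Re s > - real CARD('n) \<Longrightarrow> F s = B_fun TYPE('n) M (f x) s"
    and f: "local_param M W f" "unit_normal W f \<nu>" "x \<in> W"
    and P: "\<forall>c\<in>vars P. complete_contraction c"
    "\<And>S (g :: real^'n \<Rightarrow> real^'d) N \<phi> \<omega>. adapted S g N \<phi> \<omega> \<Longrightarrow>
      (\<Sum>l\<le>j. ((- of_nat CARD('n) - of_nat j) / 2 gchoose l) *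
         complex_of_real (sphere_integral (j + 2 * l)
           (dir_deriv (j + 2 * l) (\<lambda>y. ((\<phi> y)\<^sup>2) ^ l * sqrt (det (first_form g y))) 0) / fact (j + 2 * l))) =
      complex_of_real (eval_poly (contraction_value g N 0) P)"
  shows "residue F (- of_nat CARD('n) - of_nat j) = complex_of_real (eval_poly (contraction_value f \<nu> x) P)"
proof -
  note D = local_paramD[OF f(1)]
  obtain V \<psi> and \<phi> \<omega> :: "real^'n \<Rightarrow> real" where
    V: "open V" "0 \<in> V" "smooth_on V \<psi>" "\<psi> ` V \<subseteq> W" "\<psi> 0 = x"
      "\<And>y. y \<in> V \<Longrightarrow> det (\<chi> a i. partial i \<psi> y $ a) \<noteq> 0" "local_param M V (\<lambda>y. f (\<psi> y))"
    and \<phi>: "smooth_on V \<phi>" "\<phi> 0 = 0" "\<And>i. partial i \<phi> 0 = 0"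
    and \<omega>: "smooth_on V \<omega>" "\<And>y. y \<in> V \<Longrightarrow> \<omega> y > 0"
      "\<And>y. y \<in> V \<Longrightarrow> (\<omega> y)\<^sup>2 * (1 + (\<Sum>a\<in>UNIV. (partial a \<phi> y)\<^sup>2)) = 1"
    and g: "\<And>y. y \<in> V \<Longrightarrow> (norm (f (\<psi> y) - f x))\<^sup>2 = (norm y)\<^sup>2 + (\<phi> y)\<^sup>2"
      "\<And>y i j. y \<in> V \<Longrightarrow> first_form (\<lambda>y. f (\<psi> y)) y $ i $ j = of_bool (i = j) + partial i \<phi> y * partial j \<phi> y"
      "\<And>y i j. y \<in> V \<Longrightarrow> second_form (\<lambda>y. f (\<psi> y)) (\<lambda>y. \<nu> (\<psi> y)) [i, j] y = \<omega> y * partial i (partial j \<phi>) y"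
  proof (rule hypersurface_graph_chart[OF card f(1,3,2)], goal_cases)
    case (1 V \<psi> \<phi> \<omega>)
    show ?case by (rule 1(1)) (fact 1(2-))+
  qed
  have ad: "adapted V (\<lambda>y. f (\<psi> y)) (\<lambda>y. \<nu> (\<psi> y)) \<phi> \<omega>"
    unfolding adapted_def graph_data_def graph_functions_def
    by (intro conjI ballI allI V(1,2) \<phi> \<omega> g(2,3))
  obtain r where r: "r > 0" "cball 0 r \<subseteq> V" using V(1,2) open_contains_cball by blast
  obtain C where C: "\<forall>y\<in>cball 0 r. \<bar>\<phi> y\<bar> \<le> C * norm y ^ 2"
    using smooth_on_quadratic_bound[OF V(1) \<phi>(1) r(2,1) \<phi>(2,3)] by blast
  have bound: "(\<phi> y)\<^sup>2 \<le> C\<^sup>2 * norm y ^ 4" if "y \<in> cball 0 r" for y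
  proof -
    have "\<bar>\<phi> y\<bar>\<^sup>2 \<le> (C * norm y ^ 2)\<^sup>2" using C that by (intro power_mono) auto
    then show ?thesis by (simp add: power_mult_distrib)
  qed
  have sm: "smooth_on V (\<lambda>y. (\<phi> y)\<^sup>2)" by (intro smooth_intros V(1) \<phi>(1))
  have g1: "(norm (f (\<psi> y) - f (\<psi> 0)))\<^sup>2 = (norm y)\<^sup>2 + (\<phi> y)\<^sup>2" if "y \<in> V" for y
    using g(1)[OF that] by (simp only: V(5))
  obtain G where G: "G meromorphic_on UNIV" "\<forall>s. Re s > - real CARD('n) \<longrightarrow> G s = B_fun TYPE('n) M (f x) s"
    "\<forall>j. residue G (- of_nat CARD('n) - of_nat j) = (\<Sum>l\<le>j. ((- of_nat CARD('n) - of_nat j) / 2 gchoose l) *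
         complex_of_real (sphere_integral (j + 2 * l)
           (dir_deriv (j + 2 * l) (\<lambda>y. ((\<phi> y)\<^sup>2) ^ l * sqrt (det (first_form (\<lambda>y. f (\<psi> y)) y))) 0) / fact (j + 2 * l)))"
    using B_fun_continuation(2)[OF M V(7,2) sm g1 zero_le_power2 r bound] unfolding V(5) by blast
  have "residue F (- of_nat CARD('n) - of_nat j) = residue G (- of_nat CARD('n) - of_nat j)"
    by (rule residue_unique_continuation[OF F(1) G(1), where a = "- real CARD('n)"]) (use F(2) G(2) in simp)
  also have "\<dots> = complex_of_real (eval_poly (contraction_value (\<lambda>y. f (\<psi> y)) (\<lambda>y. \<nu> (\<psi> y)) 0) P)"
    unfolding G(3)[rule_format] by (rule P(2)[OF ad])
  also have "eval_poly (contraction_value (\<lambda>y. f (\<psi> y)) (\<lambda>y. \<nu> (\<psi> y)) 0) P = eval_poly (contraction_value f \<nu> x) P"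
  proof (rule eval_poly_cong)
    fix c assume "c \<in> vars P"
    then have c: "complete_contraction c" using P(1) by blast
    interpret rp: reparametrization W V f \<psi>
      by unfold_locales (use D V first_form_det_pos[OF f(1)] in \<open>auto simp: less_imp_neq[THEN not_sym]\<close>)
    have "contraction_value rp.f' (\<lambda>y. \<nu> (\<psi> y)) 0 c = contraction_value f \<nu> (\<psi> 0) c"
      by (rule rp.contraction_value_invariant[OF _ _ V(2) c]) (use f(2) in \<open>auto simp: unit_normal_def\<close>)
    then show "contraction_value (\<lambda>y. f (\<psi> y)) (\<lambda>y. \<nu> (\<psi> y)) 0 c = contraction_value f \<nu> x c"
      by (simp add: rp.f'_def[abs_def] V(5))
  qed
  finally show ?thesis .
qed

text \<open>Universality lies in the position of \<open>P\<close> before the submanifold, the chart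
  and the normal. The residue claim is made for every continuation \<open>F\<close>, so it does not
  hinge on the one whose existence is asserted.\<close>

theorem theorem3p3:
  shows "(\<forall>(M :: (real^'d) set) u.
            compact M \<and> submanifold TYPE('n::finite) M \<and> u \<in> M \<longrightarrow>
            (\<forall>s. Re s > - real CARD('n) \<longrightarrow>
               integrable (area_measure TYPE('n) M)
                 (\<lambda>v. complex_of_real (norm (v - u)) powr s)) \<and>
            (\<exists>F. F meromorphic_on UNIV \<and>
               (\<forall>s. Re s > - real CARD('n) \<longrightarrow> F s = B_fun TYPE('n) M u s) \<and>
               F holomorphic_on (UNIV - {- of_nat CARD('n) - of_nat j |j. even j}) \<and>
               (\<forall>z. is_pole F z \<longrightarrow> zorder F z = -1)))
       \<and>
         (CARD('d) = CARD('n) + 1 \<longrightarrow>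
            (\<forall>j. even j \<longrightarrow>
               (\<exists>P. (\<forall>c\<in>vars P. complete_contraction c) \<and>
                 (\<forall>(M :: (real^'d) set) u F W (f :: real^'n \<Rightarrow> real^'d) \<nu> x.
                    compact M \<and> submanifold TYPE('n) M \<and> u \<in> M \<and>
                    F meromorphic_on UNIV \<and>
                    (\<forall>s. Re s > - real CARD('n) \<longrightarrow> F s = B_fun TYPE('n) M u s) \<and>
                    local_param M W f \<and> unit_normal W f \<nu> \<and> x \<in> W \<and> f x = u \<longrightarrow>
                    residue F (- of_nat CARD('n) - of_nat j) =
                      complex_of_real (eval_poly (contraction_value f \<nu> x) P)))))"
proof (intro conjI impI allI)
  fix M :: "(real^'d) set" and u s
  assume "compact M \<and> submanifold TYPE('n) M \<and> u \<in> M" "Re s > - real CARD('n)"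
  then show "integrable (area_measure TYPE('n) M) (\<lambda>v. complex_of_real (norm (v - u)) powr s)"
    using B_fun_continuation_submanifold by blast
next
  fix M :: "(real^'d) set" and u
  assume "compact M \<and> submanifold TYPE('n) M \<and> u \<in> M"
  then show "\<exists>F. F meromorphic_on UNIV \<and>
      (\<forall>s. Re s > - real CARD('n) \<longrightarrow> F s = B_fun TYPE('n) M u s) \<and>
      F holomorphic_on (UNIV - {- of_nat CARD('n) - of_nat j |j. even j}) \<and>
      (\<forall>z. is_pole F z \<longrightarrow> zorder F z = -1)"
    using B_fun_continuation_submanifold by blast
next
  fix j :: nat assume card: "CARD('d) = CARD('n) + 1" and j: "even j"
  obtain P where P: "\<forall>c\<in>vars P. complete_contraction c"
    "\<And>S (g :: real^'n \<Rightarrow> real^'d) N \<phi> \<omega>. adapted S g N \<phi> \<omega> \<Longrightarrow>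
      (\<Sum>l\<le>j. ((- of_nat CARD('n) - of_nat j) / 2 gchoose l) *
         complex_of_real (sphere_integral (j + 2 * l)
           (dir_deriv (j + 2 * l) (\<lambda>y. ((\<phi> y)\<^sup>2) ^ l * sqrt (det (first_form g y))) 0) / fact (j + 2 * l))) =
      complex_of_real (eval_poly (contraction_value g N 0) P)"
    using residue_polynomial[OF j, where ?'n = 'n and ?'d = 'd] by blast
  show "\<exists>P. (\<forall>c\<in>vars P. complete_contraction c) \<and>
      (\<forall>(M :: (real^'d) set) u F W (f :: real^'n \<Rightarrow> real^'d) \<nu> x.
        compact M \<and> submanifold TYPE('n) M \<and> u \<in> M \<and> F meromorphic_on UNIV \<and>
        (\<forall>s. Re s > - real CARD('n) \<longrightarrow> F s = B_fun TYPE('n) M u s) \<and>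
        local_param M W f \<and> unit_normal W f \<nu> \<and> x \<in> W \<and> f x = u \<longrightarrow>
        residue F (- of_nat CARD('n) - of_nat j) = complex_of_real (eval_poly (contraction_value f \<nu> x) P))"
  proof (intro exI[where x = P] conjI allI impI P(1))
    fix M :: "(real^'d) set" and u F W and f :: "real^'n \<Rightarrow> real^'d" and \<nu> x
    assume h: "compact M \<and> submanifold TYPE('n) M \<and> u \<in> M \<and> F meromorphic_on UNIV \<and>
        (\<forall>s. Re s > - real CARD('n) \<longrightarrow> F s = B_fun TYPE('n) M u s) \<and>
        local_param M W f \<and> unit_normal W f \<nu> \<and> x \<in> W \<and> f x = u"
    show "residue F (- of_nat CARD('n) - of_nat j) = complex_of_real (eval_poly (contraction_value f \<nu> x) P)"
    proof (rule residue_hypersurface[OF card])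
      show "F s = B_fun TYPE('n) M (f x) s" if "Re s > - real CARD('n)" for s
        using h that by simp
      show "compact M" "submanifold TYPE('n) M" "F meromorphic_on UNIV" "local_param M W f" "unit_normal W f \<nu>" "x \<in> W"
        using h by simp_all
    qed (fact P(1), rule P(2))
  qed
qed

end
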